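(* Let $T<\infty$ be a fixed time horizon and assume: (A1) for all $0\le t\le T$, $g_t(x)>0$ for every $x\in\mathbb X$, and $\sup_{0\le t\le T}|g_t|_\infty<\infty$; (A2) $\sup_{1\le t\le T}|\vartheta_t|_\infty<\infty$ and $\sup_{0\le t\le T}|\omega_t|_\infty<\infty$; (A3) $|m|_\infty<\infty$ and $\sup_{1\le t\le T}|p_t|_\infty<\infty$. Then for any $h\in\mathcal F_b(\mathbb X^{T+1})$, $$\sqrt N\big(\phi^N_{0:T|T}(h)-\phi_{0:T|T}(h)\big)\ \longrightarrow\ \mathcal N\big(0,\Gamma_{0:T|T}[h]\big)\quad\text{in distribution as }N\to\infty,$$ with $$\Gamma_{0:T|T}[h]=\frac{\rho_0\big[\omega_0^2(\cdot)\,G_{0,T}^2(\cdot,h)\big]}{\big(\rho_0[\omega_0(\cdot)\mathcal L_{0,T}(\cdot,\mathbf 1)]\big)^2}+\sum_{t=1}^T\frac{\phi_{t-1}[\upsilon_{t,T}(\cdot,h)]\;\phi_{t-1}(\vartheta_t)}{\big(\phi_{t-1}[\mathcal L_{t-1,T}(\cdot,\mathbf 1)]\big)^2},$$ $$\upsilon_{t,T}(x,h)=\vartheta_t(x)\int P_t(x,dx')\,\omega_t^2(x,x')\,G_{t,T}^2(x',h).$$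
   Context: Model. $(\mathbb X,\mathcal B(\mathbb X))$ and $(\mathbb Y,\mathcal B(\mathbb Y))$ are Polish spaces with their Borel $\sigma$-algebras; $\mathcal F_b(\mathbb X^d)$ is the set of bounded measurable real functions on $\mathbb X^d$; $|f|_\infty$ is the supremum norm, $\mathbf 1$ is the constant function $1$, and $x_{m:n}=(x_m,\dots,x_n)$; for a measure $\mu$, $\mu[f]=\mu(f)=\int f\,d\mu$. $\chi$ is a probability measure on $\mathbb X$ (initial law), $M$ is a Markov kernel on $\mathbb X$ with transition density $m$ with respect to a $\sigma$-finite measure $\nu$: $M(x,dx')=m(x,x')\,dx'$, where $dx'$ stands for $\nu(dx')$. $g:\mathbb X\times\mathbb Y\to[0,\infty)$ is the likelihood (density of an observation given the state). The observations $y_0,\dots,y_T$ are fixed and $g_t(x)=g(x,y_t)$. The joint smoothing distribution is $$\phi_{0:T|T}(h)=\frac{\int\cdots\int\chi(dx_0)\prod_{u=1}^T g_{u-1}(x_{u-1})M(x_{u-1},dx_u)\,g_T(x_T)\,h(x_{0:T})}{\int\cdots\int\chi(dx_0)\prod_{u=1}^T g_{u-1}(x_{u-1})M(x_{u-1},dx_u)\,g_T(x_T)},$$ the denominator being assumed positive. The filter $\phi_t$ is the marginal law of $x_t$ under $\phi_{0:t|t}$ (same formula with $T$ replaced by $t$). Particle filter. $\rho_0$ is a probability measure on $\mathbb X$ with $\chi\ll\rho_0$; for $t\ge1$, $\vartheta_t:\mathbb X\to(0,\infty)$ is measurable, and $P_t$ is a Markov kernel with density $p_t$ with respect to $\nu$,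 with $p_t(x,x')>0$ whenever $m(x,x')g_t(x')>0$. Weight functions: $\omega_0(x)=\frac{d\chi}{d\rho_0}(x)g_0(x)$ and $\omega_t(x,x')=\frac{m(x,x')g_t(x')}{\vartheta_t(x)p_t(x,x')}$, $t\ge1$. For each $N\ge1$: $\xi_0^1,\dots,\xi_0^N$ are i.i.d. with law $\rho_0$ and $\omega_0^i=\omega_0(\xi_0^i)$; for $t\ge1$, conditionally on all particles and weights up to time $t-1$, the pairs $(I_t^i,\xi_t^i)$, $i=1,\dots,N$, are i.i.d. on $\{1,\dots,N\}\times\mathbb X$ with law proportional to $(j,dx)\mapsto\omega_{t-1}^j\vartheta_t(\xi_{t-1}^j)P_t(\xi_{t-1}^j,dx)$, and $\omega_t^i=\omega_t(\xi_{t-1}^{I_t^i},\xi_t^i)$. Put $\Omega_t=\sum_{i=1}^N\omega_t^i$ and $\phi_t^N(f)=\Omega_t^{-1}\sum_{i=1}^N\omega_t^if(\xi_t^i)$. FFBS estimator. For a probability measure $\eta$ on $\mathbb X$, the backward kernel is $\mathrm B_\eta(x,f)=\frac{\int\eta(dx')m(x',x)f(x')}{\int\eta(dx')m(x',x)}$. The FFBS estimator is $$\phi^N_{0:T|T}(h)=\int\cdots\int\phi_T^N(dx_T)\,\mathrm B_{\phi^N_{T-1}}(x_T,dx_{T-1})\cdots\mathrm B_{\phi_0^N}(x_1,dx_0)\,h(x_{0:T}).$$ Limiting kernels. For $0\le t<T$, $L_{t,T}(x_{0:t},h)=\int\cdots\int\big(\prod_{u=t+1}^TM(x_{u-1},dx_u)g_u(x_u)\big)h(x_{0:T})$,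 and $L_{T,T}(x_{0:T},h)=h(x_{0:T})$. Then $\mathcal L_{0,T}(x,h)=L_{0,T}(x,h)$ and, for $1\le t\le T$, $$\mathcal L_{t,T}(x_t,h)=\int\cdots\int\mathrm B_{\phi_{t-1}}(x_t,dx_{t-1})\cdots\mathrm B_{\phi_0}(x_1,dx_0)\,L_{t,T}(x_{0:t},h),$$ and, for $0\le t\le T$, $G_{t,T}(x,h)=\mathcal L_{t,T}\big(x,h-\phi_{0:T|T}(h)\big)$. *)

theory Defs
  imports "HOL-Probability.Probability"
begin

section \<open>Data of the model and of the particle filter\<close>

text \<open>
  The kernels \<open>trans_kernel\<close> and \<open>prop_kernel t\<close> are given together with their densities with
  respect to \<open>ref_measure\<close>. The field \<open>init_ratio\<close> is a version of the Radon-Nikodym derivative of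
  \<open>init_law\<close> with respect to \<open>init_proposal\<close>; it is part of the data because boundedness of the
  weights is required pointwise, which depends on the version.
\<close>

record ('x, 'y) smc_model =
  init_law :: "'x measure"                        \<comment> \<open>\<open>\<chi>\<close>\<close>
  ref_measure :: "'x measure"                     \<comment> \<open>\<open>\<nu>\<close>\<close>
  trans_kernel :: "'x \<Rightarrow> 'x measure"             \<comment> \<open>\<open>M\<close>\<close>
  trans_density :: "'x \<Rightarrow> 'x \<Rightarrow> real"            \<comment> \<open>\<open>m\<close>\<close>
  likelihood :: "'x \<Rightarrow> 'y \<Rightarrow> real"               \<comment> \<open>\<open>g\<close>\<close>
  obs :: "nat \<Rightarrow> 'y"                              \<comment> \<open>\<open>y\<close>\<close>
  init_proposal :: "'x measure"                   \<comment> \<open>\<open>\<rho>\<^sub>0\<close>\<close>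
  init_ratio :: "'x \<Rightarrow> real"                      \<comment> \<open>\<open>d\<chi> / d\<rho>\<^sub>0\<close>\<close>
  adj_mult :: "nat \<Rightarrow> 'x \<Rightarrow> real"                \<comment> \<open>\<open>\<vartheta>\<close>\<close>
  prop_kernel :: "nat \<Rightarrow> 'x \<Rightarrow> 'x measure"       \<comment> \<open>\<open>P\<close>\<close>
  prop_density :: "nat \<Rightarrow> 'x \<Rightarrow> 'x \<Rightarrow> real"      \<comment> \<open>\<open>p\<close>\<close>

definition lik :: "('x, 'y) smc_model \<Rightarrow> nat \<Rightarrow> 'x \<Rightarrow> real" where
  "lik S t x = likelihood S x (obs S t)"

locale smc_model =
  fixes S :: "('x::polish_space, 'y::polish_space) smc_model" and T :: nat
  assumes init_law: "init_law S \<in> space (prob_algebra borel)"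
    and ref_measure: "sigma_finite_measure (ref_measure S)" "sets (ref_measure S) = sets borel"
    and trans_kernel: "trans_kernel S \<in> borel \<rightarrow>\<^sub>M prob_algebra borel"
    and trans_density_measurable:
      "(\<lambda>(x, x'). trans_density S x x') \<in> borel_measurable (borel \<Otimes>\<^sub>M borel)"
    and trans_density_nonneg: "trans_density S x x' \<ge> 0"
    and trans_kernel_eq:
      "trans_kernel S x = density (ref_measure S) (\<lambda>x'. ennreal (trans_density S x x'))"
    and likelihood_measurable:
      "(\<lambda>(x, y). likelihood S x y) \<in> borel_measurable (borel \<Otimes>\<^sub>M borel)"
    and likelihood_nonneg: "likelihood S x y \<ge> 0"
    and init_proposal: "init_proposal S \<in> space (prob_algebra borel)"
    and init_ratio_measurable: "init_ratio S \<in> borel_measurable borel"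
    and init_ratio_nonneg: "init_ratio S x \<ge> 0"
    and init_law_eq: "init_law S = density (init_proposal S) (\<lambda>x. ennreal (init_ratio S x))"
    and adj_mult_measurable: "t \<in> {1..T} \<Longrightarrow> adj_mult S t \<in> borel_measurable borel"
    and adj_mult_pos: "t \<in> {1..T} \<Longrightarrow> adj_mult S t x > 0"
    and prop_kernel: "t \<in> {1..T} \<Longrightarrow> prop_kernel S t \<in> borel \<rightarrow>\<^sub>M prob_algebra borel"
    and prop_density_measurable:
      "t \<in> {1..T} \<Longrightarrow> (\<lambda>(x, x'). prop_density S t x x') \<in> borel_measurable (borel \<Otimes>\<^sub>M borel)"
    and prop_density_nonneg: "t \<in> {1..T} \<Longrightarrow> prop_density S t x x' \<ge> 0"
    and prop_kernel_eq:
      "t \<in> {1..T} \<Longrightarrow>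
        prop_kernel S t x = density (ref_measure S) (\<lambda>x'. ennreal (prop_density S t x x'))"
    and prop_density_pos:
      "t \<in> {1..T} \<Longrightarrow> trans_density S x x' * lik S t x' > 0 \<Longrightarrow> prop_density S t x x' > 0"


section \<open>Smoothing and filtering distributions\<close>

text \<open>
  Trajectories \<open>x\<^sub>0, \<dots>, x\<^sub>t\<close> are extensional functions on \<open>{..t}\<close>. A trajectory is lengthened at
  either end by \<open>fun_upd\<close>.
\<close>

abbreviation path_space :: "nat \<Rightarrow> (nat \<Rightarrow> 'x::topological_space) measure" where
  "path_space t \<equiv> PiM {..t} (\<lambda>_. borel)"

text \<open>
  \<open>extend_path M t k x\<close> is \<open>M(x\<^sub>t, dx\<^sub>t\<^sub>+\<^sub>1) \<dots> M(x\<^sub>t\<^sub>+\<^sub>k\<^sub>-\<^sub>1, dx\<^sub>t\<^sub>+\<^sub>k)\<close> as a law on trajectories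
  \<open>x\<^sub>0, \<dots>, x\<^sub>t\<^sub>+\<^sub>k\<close> whose first \<open>t + 1\<close> coordinates are those of \<open>x\<close>.
\<close>

primrec extend_path ::
  "('x::topological_space \<Rightarrow> 'x measure) \<Rightarrow> nat \<Rightarrow> nat \<Rightarrow> (nat \<Rightarrow> 'x) \<Rightarrow> (nat \<Rightarrow> 'x) measure"
where
  "extend_path M t 0 x = return (path_space t) x"
| "extend_path M t (Suc k) x =
    M (x t) \<bind> (\<lambda>z. extend_path M (Suc t) k (x(Suc t := z)))"

lemma measurable_path_upd:
  "(\<lambda>(x, z). x(Suc t := z)) \<in> path_space t \<Otimes>\<^sub>M borel \<rightarrow>\<^sub>M path_space (Suc t)"
proof -
  have "{..Suc t} = insert (Suc t) {..t}" by auto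
  then show ?thesis using measurable_add_dim[of "Suc t" "{..t}" "\<lambda>_. borel"] by simp
qed

lemma measurable_extend_path:
  assumes M: "M \<in> borel \<rightarrow>\<^sub>M prob_algebra borel"
  shows "extend_path M t k \<in> path_space t \<rightarrow>\<^sub>M prob_algebra (path_space (t + k))"
proof (induction k arbitrary: t)
  case 0
  have "extend_path M t 0 = return (path_space t)" by (rule ext) simp
  then show ?case using measurable_return_prob_space by simp
next
  case (Suc k)
  note [measurable] = Suc M measurable_path_upd
  have "(\<lambda>p. extend_path M (Suc t) k (case p of (x, z) \<Rightarrow> x(Suc t := z)))
      \<in> path_space t \<Otimes>\<^sub>M borel \<rightarrow>\<^sub>M prob_algebra (path_space (Suc t + k))"
    by (rule measurable_compose[OF measurable_path_upd Suc])
  then have "(\<lambda>x. M (x t) \<bind> (\<lambda>z. extend_path M (Suc t) k (x(Suc t := z))))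
      \<in> path_space t \<rightarrow>\<^sub>M prob_algebra (path_space (Suc t + k))"
    by (intro measurable_bind_prob_space2[where N=borel]) (auto simp: case_prod_beta')
  then show ?case by (simp add: fun_eq_iff)
qed

lemma integral_extend_path_Suc:
  fixes f :: "(nat \<Rightarrow> 'x::polish_space) \<Rightarrow> real"
  assumes M: "M \<in> borel \<rightarrow>\<^sub>M prob_algebra borel" and x: "x \<in> space (path_space t)"
    and f: "f \<in> borel_measurable (path_space (t + Suc k))"
      "\<And>y. y \<in> space (path_space (t + Suc k)) \<Longrightarrow> \<bar>f y\<bar> \<le> C"
  shows "(\<integral>y. f y \<partial>extend_path M t (Suc k) x) =
    (\<integral>z. (\<integral>y. f y \<partial>extend_path M (Suc t) k (x(Suc t := z))) \<partial>M (x t))"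
proof -
  have Mx: "M (x t) \<in> space (prob_algebra borel)"
    using measurable_space[OF M] by simp
  have [measurable_cong]: "sets (M (x t)) = sets borel"
    using Mx by (simp add: space_prob_algebra)
  interpret prob_space "M (x t)"
    using Mx by (simp add: space_prob_algebra)
  have "(\<lambda>z. x(Suc t := z)) \<in> borel \<rightarrow>\<^sub>M path_space (Suc t)"
    using measurable_compose[OF measurable_Pair1'[OF x] measurable_path_upd] by simp
  from measurable_compose[OF this measurable_extend_path[OF M, of _ k]]
  have K: "(\<lambda>z. extend_path M (Suc t) k (x(Suc t := z))) \<in> M (x t) \<rightarrow>\<^sub>M
      subprob_algebra (path_space (t + Suc k))"
    by (auto intro!: measurable_prob_algebraD)
  have "AE z in M (x t). emeasure (extend_path M (Suc t) k (x(Suc t := z)))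
      (space (extend_path M (Suc t) k (x(Suc t := z)))) \<le> ennreal 1"
    using measurable_space[OF K] by (auto intro!: AE_I2 subprob_space.emeasure_space_le_1 simp: space_subprob_algebra)
  then show ?thesis
    using f K by (simp, intro integral_bind[where B'=1 and B=C and K="path_space (t + Suc k)"])
      (auto simp: not_empty)
qed

text \<open>The law \<open>\<chi>(dx\<^sub>0) M(x\<^sub>0, dx\<^sub>1) \<dots> M(x\<^sub>T\<^sub>-\<^sub>1, dx\<^sub>T)\<close> of the hidden chain.\<close>

definition chain_law ::
  "('x::topological_space, 'y) smc_model \<Rightarrow> nat \<Rightarrow> (nat \<Rightarrow> 'x) measure" where
  "chain_law S T =
    init_law S \<bind> (\<lambda>x. extend_path (trans_kernel S) 0 T (\<lambda>i\<in>{0}. x))"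

lemma chain_law_prob:
  fixes S :: "('x::polish_space, 'y::polish_space) smc_model"
  assumes "smc_model S T" shows "chain_law S n \<in> space (prob_algebra (path_space n))"
proof -
  interpret smc_model S T by fact
  have "(\<lambda>x. extend_path (trans_kernel S) 0 n (\<lambda>i\<in>{0}. x)) \<in> borel \<rightarrow>\<^sub>M prob_algebra (path_space (0+n))"
    by (rule measurable_compose[OF _ measurable_extend_path[OF trans_kernel]]) auto
  then show ?thesis unfolding chain_law_def
    using measurable_bind_prob_space[OF measurable_const[OF init_law, of "count_space UNIV"]]
    by (auto simp: Pi_iff)
qed

definition smoothing_norm :: "('x::topological_space, 'y) smc_model \<Rightarrow> nat \<Rightarrow> real" where
  "smoothing_norm S T = (\<integral>x. (\<Prod>u\<le>T. lik S u (x u)) \<partial>chain_law S T)"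

definition smoothing :: "('x::topological_space, 'y) smc_model \<Rightarrow> nat \<Rightarrow> (nat \<Rightarrow> 'x) measure" where
  "smoothing S T =
    density (chain_law S T) (\<lambda>x. ennreal ((\<Prod>u\<le>T. lik S u (x u)) / smoothing_norm S T))"

definition filter_law :: "('x::topological_space, 'y) smc_model \<Rightarrow> nat \<Rightarrow> 'x measure" where
  "filter_law S t = distr (smoothing S t) borel (\<lambda>x. x t)"


section \<open>Backward kernels\<close>

definition backward ::
  "('x \<Rightarrow> 'x \<Rightarrow> real) \<Rightarrow> 'x measure \<Rightarrow> 'x \<Rightarrow> ('x \<Rightarrow> real) \<Rightarrow> real" where
  "backward m \<eta> x f = (\<integral>x'. m x' x * f x' \<partial>\<eta>) / (\<integral>x'. m x' x \<partial>\<eta>)"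

text \<open>
  \<open>backward_path m \<eta> t f x\<close> is
  \<open>\<integral>\<dots>\<integral> B\<^sub>\<eta>\<^sub>(\<^sub>t\<^sub>-\<^sub>1\<^sub>)(x\<^sub>t, dx\<^sub>t\<^sub>-\<^sub>1) \<dots> B\<^sub>\<eta>\<^sub>(\<^sub>0\<^sub>)(x\<^sub>1, dx\<^sub>0) f(x\<^sub>0, \<dots>, x\<^sub>t)\<close>;
  it is applied to a path \<open>x\<close> in which only the coordinate \<open>t\<close> is set.
\<close>

primrec backward_path ::
  "('x \<Rightarrow> 'x \<Rightarrow> real) \<Rightarrow> (nat \<Rightarrow> 'x measure) \<Rightarrow> nat \<Rightarrow> ((nat \<Rightarrow> 'x) \<Rightarrow> real) \<Rightarrow> (nat \<Rightarrow> 'x) \<Rightarrow> real"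
where
  "backward_path m \<eta> 0 f x = f x"
| "backward_path m \<eta> (Suc t) f x =
    backward m (\<eta> t) (x (Suc t)) (\<lambda>z. backward_path m \<eta> t f (x(t := z)))"


section \<open>Limiting kernels and asymptotic variance\<close>

definition forward_kernel ::  \<comment> \<open>\<open>L\<^sub>t\<^sub>,\<^sub>T(x\<^sub>0\<^sub>:\<^sub>t, h)\<close>\<close>
  "('x::topological_space, 'y) smc_model \<Rightarrow> nat \<Rightarrow> nat \<Rightarrow> (nat \<Rightarrow> 'x) \<Rightarrow> ((nat \<Rightarrow> 'x) \<Rightarrow> real) \<Rightarrow> real"
where
  "forward_kernel S t T x h =
    (\<integral>z. (\<Prod>u\<in>{t<..T}. lik S u (z u)) * h z \<partial>extend_path (trans_kernel S) t (T - t) x)"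

definition limit_kernel ::  \<comment> \<open>calligraphic \<open>L\<^sub>t\<^sub>,\<^sub>T(x\<^sub>t, h)\<close>\<close>
  "('x::topological_space, 'y) smc_model \<Rightarrow> nat \<Rightarrow> nat \<Rightarrow> 'x \<Rightarrow> ((nat \<Rightarrow> 'x) \<Rightarrow> real) \<Rightarrow> real"
where
  "limit_kernel S t T x h =
    backward_path (trans_density S) (filter_law S) t
      (\<lambda>z. forward_kernel S t T z h) (\<lambda>i\<in>{t}. x)"

definition centred_kernel ::  \<comment> \<open>\<open>G\<^sub>t\<^sub>,\<^sub>T(x, h)\<close>\<close>
  "('x::topological_space, 'y) smc_model \<Rightarrow> nat \<Rightarrow> nat \<Rightarrow> 'x \<Rightarrow> ((nat \<Rightarrow> 'x) \<Rightarrow> real) \<Rightarrow> real"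
where
  "centred_kernel S t T x h = limit_kernel S t T x (\<lambda>z. h z - (\<integral>z'. h z' \<partial>smoothing S T))"

definition init_weight :: "('x, 'y) smc_model \<Rightarrow> 'x \<Rightarrow> real" where
  "init_weight S x = init_ratio S x * lik S 0 x"

definition weight :: "('x, 'y) smc_model \<Rightarrow> nat \<Rightarrow> 'x \<Rightarrow> 'x \<Rightarrow> real" where
  "weight S t x x' = trans_density S x x' * lik S t x' / (adj_mult S t x * prop_density S t x x')"

definition upsilon ::
  "('x::topological_space, 'y) smc_model \<Rightarrow> nat \<Rightarrow> nat \<Rightarrow> 'x \<Rightarrow> ((nat \<Rightarrow> 'x) \<Rightarrow> real) \<Rightarrow> real"
where
  "upsilon S t T x h =
    adj_mult S t x * (\<integral>x'. (weight S t x x')\<^sup>2 * (centred_kernel S t T x' h)\<^sup>2 \<partial>prop_kernel S t x)"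

definition asymp_variance ::
  "('x::topological_space, 'y) smc_model \<Rightarrow> nat \<Rightarrow> ((nat \<Rightarrow> 'x) \<Rightarrow> real) \<Rightarrow> real"
where
  "asymp_variance S T h =
    (\<integral>x. (init_weight S x)\<^sup>2 * (centred_kernel S 0 T x h)\<^sup>2 \<partial>init_proposal S) /
      (\<integral>x. init_weight S x * limit_kernel S 0 T x (\<lambda>_. 1) \<partial>init_proposal S)\<^sup>2 +
    (\<Sum>t = 1..T.
      (\<integral>x. upsilon S t T x h \<partial>filter_law S (t - 1)) * (\<integral>x. adj_mult S t x \<partial>filter_law S (t - 1)) /
        (\<integral>x. limit_kernel S (t - 1) T x (\<lambda>_. 1) \<partial>filter_law S (t - 1))\<^sup>2)"

definition normal_law :: "real \<Rightarrow> real \<Rightarrow> real measure" where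
  "normal_law \<mu> v =
    (if v = 0 then return borel \<mu> else density lborel (\<lambda>x. ennreal (normal_density \<mu> (sqrt v) x)))"


section \<open>Particle filter and FFBS estimator\<close>

text \<open>
  Particles are indexed by \<open>{1..N}\<close>; \<open>\<xi> t i\<close> and \<open>I t i\<close> are the random variables for the
  \<open>i\<close>-th particle at time \<open>t\<close> and the index of its ancestor at time \<open>t - 1\<close>.
\<close>

definition particle_weight ::
  "('x, 'y) smc_model \<Rightarrow> (nat \<Rightarrow> nat \<Rightarrow> 'w \<Rightarrow> 'x) \<Rightarrow> (nat \<Rightarrow> nat \<Rightarrow> 'w \<Rightarrow> nat) \<Rightarrow>
    nat \<Rightarrow> nat \<Rightarrow> 'w \<Rightarrow> real"
where
  "particle_weight S \<xi> I t i \<omega> =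
    (if t = 0 then init_weight S (\<xi> 0 i \<omega>)
     else weight S t (\<xi> (t - 1) (I t i \<omega>) \<omega>) (\<xi> t i \<omega>))"

text \<open>The \<open>\<sigma>\<close>-algebra generated by all particles and weights up to time \<open>t\<close>.\<close>

definition particle_history ::
  "('x::topological_space, 'y) smc_model \<Rightarrow> nat \<Rightarrow> 'w measure \<Rightarrow>
    (nat \<Rightarrow> nat \<Rightarrow> 'w \<Rightarrow> 'x) \<Rightarrow> (nat \<Rightarrow> nat \<Rightarrow> 'w \<Rightarrow> nat) \<Rightarrow> nat \<Rightarrow> 'w measure"
where
  "particle_history S N \<P> \<xi> I t =
    vimage_algebra (space \<P>)
      (\<lambda>\<omega>. \<lambda>(s, i)\<in>{..t} \<times> {1..N}. (\<xi> s i \<omega>, particle_weight S \<xi> I s i \<omega>))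
      (PiM ({..t} \<times> {1..N}) (\<lambda>_. borel \<Otimes>\<^sub>M borel))"

text \<open>
  The unnormalised selection and mutation measure
  \<open>\<Sum>\<^sub>j \<omega>\<^sub>t\<^sub>-\<^sub>1\<^sup>j \<vartheta>\<^sub>t(\<xi>\<^sub>t\<^sub>-\<^sub>1\<^sup>j) (\<delta>\<^sub>j \<otimes> P\<^sub>t(\<xi>\<^sub>t\<^sub>-\<^sub>1\<^sup>j, \<cdot>))\<close> of a set \<open>A\<close> of pairs (index, position).
\<close>

definition mutation_mass ::
  "('x, 'y) smc_model \<Rightarrow> nat \<Rightarrow> (nat \<Rightarrow> nat \<Rightarrow> 'w \<Rightarrow> 'x) \<Rightarrow>
    (nat \<Rightarrow> nat \<Rightarrow> 'w \<Rightarrow> nat) \<Rightarrow> nat \<Rightarrow> 'w \<Rightarrow> (nat \<times> 'x) set \<Rightarrow> real"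
where
  "mutation_mass S N \<xi> I t \<omega> A =
    (\<Sum>j = 1..N. particle_weight S \<xi> I (t - 1) j \<omega> * adj_mult S t (\<xi> (t - 1) j \<omega>) *
      measure (prop_kernel S t (\<xi> (t - 1) j \<omega>)) (Pair j -` A))"

text \<open>
  In \<open>mutation\<close>, the joint conditional law of the pairs is given on products of measurable sets. If
  all weights at time \<open>t - 1\<close> vanish, there is no normalised selection law; nothing is
  then required of the pairs at time \<open>t\<close>.
\<close>

locale particle_filter = prob_space \<P>
  for S :: "('x::polish_space, 'y::polish_space) smc_model" and T N :: nat
    and \<P> :: "'w measure"
    and \<xi> :: "nat \<Rightarrow> nat \<Rightarrow> 'w \<Rightarrow> 'x"
    and I :: "nat \<Rightarrow> nat \<Rightarrow> 'w \<Rightarrow> nat" +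
  assumes particle_measurable: "t \<le> T \<Longrightarrow> i \<in> {1..N} \<Longrightarrow> \<xi> t i \<in> \<P> \<rightarrow>\<^sub>M borel"
    and ancestor_measurable: "t \<in> {1..T} \<Longrightarrow> i \<in> {1..N} \<Longrightarrow> I t i \<in> \<P> \<rightarrow>\<^sub>M count_space {1..N}"
    and init_indep: "indep_vars (\<lambda>_. borel) (\<xi> 0) {1..N}"
    and init_distr: "i \<in> {1..N} \<Longrightarrow> distr \<P> borel (\<xi> 0 i) = init_proposal S"
    and mutation:
      "t \<in> {1..T} \<Longrightarrow> (\<And>i. i \<in> {1..N} \<Longrightarrow> A i \<in> sets (count_space {1..N} \<Otimes>\<^sub>M borel)) \<Longrightarrow>
        AE \<omega> in \<P>. mutation_mass S N \<xi> I t \<omega> ({1..N} \<times> UNIV) > 0 \<longrightarrow>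
          real_cond_exp \<P> (particle_history S N \<P> \<xi> I (t - 1))
            (indicat_real {\<omega> \<in> space \<P>. \<forall>i\<in>{1..N}. (I t i \<omega>, \<xi> t i \<omega>) \<in> A i}) \<omega> =
          (\<Prod>i = 1..N. mutation_mass S N \<xi> I t \<omega> (A i) /
            mutation_mass S N \<xi> I t \<omega> ({1..N} \<times> UNIV))"

text \<open>The weighted empirical measure \<open>\<phi>\<^sub>t\<^sup>N\<close>, and the zero measure if all weights vanish.\<close>

definition particle_measure ::
  "('x::topological_space, 'y) smc_model \<Rightarrow> nat \<Rightarrow> (nat \<Rightarrow> nat \<Rightarrow> 'w \<Rightarrow> 'x) \<Rightarrow>
    (nat \<Rightarrow> nat \<Rightarrow> 'w \<Rightarrow> nat) \<Rightarrow> 'w \<Rightarrow> nat \<Rightarrow> 'x measure"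
where
  "particle_measure S N \<xi> I \<omega> t =
    distr
      (point_measure {1..N} (\<lambda>i. ennreal (particle_weight S \<xi> I t i \<omega> /
        (\<Sum>j = 1..N. particle_weight S \<xi> I t j \<omega>))))
      borel (\<lambda>i. \<xi> t i \<omega>)"

definition ffbs ::
  "('x::topological_space, 'y) smc_model \<Rightarrow> nat \<Rightarrow> nat \<Rightarrow> (nat \<Rightarrow> nat \<Rightarrow> 'w \<Rightarrow> 'x) \<Rightarrow>
    (nat \<Rightarrow> nat \<Rightarrow> 'w \<Rightarrow> nat) \<Rightarrow> ((nat \<Rightarrow> 'x) \<Rightarrow> real) \<Rightarrow> 'w \<Rightarrow> real"
where
  "ffbs S T N \<xi> I h \<omega> =
    (\<integral>x. backward_path (trans_density S) (particle_measure S N \<xi> I \<omega>) T h (\<lambda>i\<in>{T}. x)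
      \<partial>particle_measure S N \<xi> I \<omega> T)"

lemma integral_particle_measure:
  fixes f :: "'x::topological_space \<Rightarrow> real"
  assumes "f \<in> borel_measurable borel" "\<And>i. i \<in> {1..N} \<Longrightarrow> particle_weight S \<xi> I t i \<omega> \<ge> 0"
  shows "(\<integral>x. f x \<partial>particle_measure S N \<xi> I \<omega> t) =
    (\<Sum>i = 1..N. particle_weight S \<xi> I t i \<omega> * f (\<xi> t i \<omega>)) / (\<Sum>i = 1..N. particle_weight S \<xi> I t i \<omega>)"
proof -
  let ?w = "\<lambda>i. particle_weight S \<xi> I t i \<omega>"
  have "(\<integral>x. f x \<partial>particle_measure S N \<xi> I \<omega> t) =
      (\<integral>i. f (\<xi> t i \<omega>) \<partial>point_measure {1..N} (\<lambda>i. ennreal (?w i / (\<Sum>j = 1..N. ?w j))))"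
    unfolding particle_measure_def using assms(1) by (subst integral_distr) auto
  also have "\<dots> = (\<Sum>i = 1..N. ?w i / (\<Sum>j = 1..N. ?w j) * f (\<xi> t i \<omega>))"
    using assms(2) by (subst lebesgue_integral_point_measure_finite)
      (auto intro!: divide_nonneg_nonneg sum_nonneg)
  finally show ?thesis
    by (simp add: sum_divide_distrib)
qed

end

theory Submission
  imports Defs
begin

text \<open>
  Replace the self-normalised estimators by unnormalised ones: \<open>gam t b\<close>, the weighted average of \<open>b\<close> over
  the particles at time \<open>t\<close> times the product of the earlier average selection masses. Applied to the
  particle backward kernels, \<open>gam t (bwd t f)\<close> has conditional mean \<open>gam (t - 1) (bwd (t - 1) (Q f))\<close> given
  the past, where \<open>Q\<close> is one forward step \<open>M(x\<^sub>t\<^sub>-\<^sub>1, dx\<^sub>t) g\<^sub>t(x\<^sub>t)\<close>: the backward kernel cancels exactly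
  against the mutation. So \<open>gam T (bwd T h)\<close> telescopes into martingale increments, each of which is,
  given the past, an average of \<open>N\<close> i.i.d. bounded variables. The conditional characteristic functions are
  Gaussian up to \<open>O(1 / \<surd>N)\<close>, and the conditional variances converge in mean; the latter needs that
  the particle backward kernels approach the limiting ones, which follows pointwise in \<open>x\<^sub>t\<close> from the
  law of large numbers and then, by a dominated convergence argument of Scheffe type, after integrating
  against the reference measure. For \<open>h\<close> centred under the smoothing distribution this gives the central limit
  theorem, and dividing by \<open>gam T 1\<close>, which converges to the normalising constant, gives the estimator.
\<close>

section \<open>Conditionally independent samples\<close>

text \<open>Two obstacles shape the argument. The filter prescribes nothing once all weights vanish,
  and a backward kernel may have denominator zero, where its value is \<open>0\<close> by
  convention. The product \<open>acc\<close> settles the first: it contains every earlier mass, so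
  every estimator \<open>gam\<close> is zero from the moment the weights die, and the identities
  hold on the whole space although independence is known only on the event of positive mass. The
  second is met by keeping each backward kernel multiplied by its denominator, which makes it
  linear; only the constant function needs an extra argument, since its backward image may fall
  short of 1. The backward functions are random: at time \<open>Suc t\<close> they depend on the
  particles up to time \<open>t\<close>. The limit theorems for one step therefore allow test
  functions that depend on the past, with non-asymptotic errors governed by a uniform bound alone.
  The law of large numbers comes with rate \<open>1 / sqrt N\<close> in mean, which also controls
  the scaled estimator in the final division.\<close>

lemma borel_measurable_integral_kernel:
  fixes f :: "'a \<Rightarrow> 'b \<Rightarrow> real"
  assumes f[measurable]: "(\<lambda>(x, y). f x y) \<in> borel_measurable (M \<Otimes>\<^sub>M N)"
    and L[measurable]: "L \<in> M \<rightarrow>\<^sub>M prob_algebra N"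
  shows "(\<lambda>x. \<integral>y. f x y \<partial>L x) \<in> borel_measurable M"
proof -
  \<comment> \<open>Pushing \<open>L x\<close> forward along \<open>Pair x\<close> turns the test
    function that varies with \<open>x\<close> into a fixed function on the product, integrated
    against a varying measure.\<close>
  have "(\<lambda>x. \<integral>p. (case p of (x, y) \<Rightarrow> f x y) \<partial>distr (L x) (M \<Otimes>\<^sub>M N) (Pair x)) \<in> borel_measurable M"
    by (rule measurable_compose[OF measurable_prob_algebraD[OF measurable_distr_prob_space2[OF L, of Pair]]
          integral_measurable_subprob_algebra]) auto
  moreover have "(\<integral>p. (case p of (x, y) \<Rightarrow> f x y) \<partial>distr (L x) (M \<Otimes>\<^sub>M N) (Pair x)) = (\<integral>y. f x y \<partial>L x)"
    if x: "x \<in> space M" for x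
  proof -
    have [measurable_cong]: "sets (L x) = sets N"
      using measurable_space[OF L x] by (simp add: space_prob_algebra)
    have "Pair x \<in> L x \<rightarrow>\<^sub>M M \<Otimes>\<^sub>M N" using x by measurable
    from integral_distr[OF this f] show ?thesis by simp
  qed
  ultimately show ?thesis by (simp cong: measurable_cong)
qed

text \<open>Rectangles form an intersection-stable generator, and on a rectangle the product law is
  a finite product of functions measurable in \<open>x\<close>.\<close>

lemma measurable_PiM_kernel:
  assumes I: "finite I" and L: "L \<in> M \<rightarrow>\<^sub>M prob_algebra N"
  shows "(\<lambda>x. PiM I (\<lambda>_. L x)) \<in> M \<rightarrow>\<^sub>M prob_algebra (PiM I (\<lambda>_. N))"
proof (rule measurable_prob_algebra_generated[OF sets_PiM Int_stable_prod_algebra prod_algebra_sets_into_space])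
  fix x assume x: "x \<in> space M"
  have Lx: "prob_space (L x)" and s: "sets (L x) = sets N"
    using measurable_space[OF L x] by (simp_all add: space_prob_algebra)
  show "prob_space (PiM I (\<lambda>_. L x))" by (rule prob_space_PiM) (rule Lx)
  show "sets (PiM I (\<lambda>_. L x)) = sets (PiM I (\<lambda>_. N))" by (rule sets_PiM_cong) (auto simp: s)
next
  fix A assume "A \<in> prod_algebra I (\<lambda>_. N)"
  then obtain X where X: "A = Pi\<^sub>E I X" "\<And>i. i \<in> I \<Longrightarrow> X i \<in> sets N"
    by (auto simp: prod_algebra_eq_finite[OF I])
  have "(\<lambda>x. \<Prod>i\<in>I. emeasure (L x) (X i)) \<in> borel_measurable M"
    using measurable_prob_algebraD[OF L] X(2)
    by (intro borel_measurable_prod_ennreal measurable_emeasure_kernel) auto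
  moreover have "emeasure (PiM I (\<lambda>_. L x)) A = (\<Prod>i\<in>I. emeasure (L x) (X i))" if x: "x \<in> space M" for x
  proof -
    have Lx: "prob_space (L x)" and s: "sets (L x) = sets N"
      using measurable_space[OF L x] by (simp_all add: space_prob_algebra)
    interpret prob_space "L x" by fact
    interpret product_sigma_finite "\<lambda>_. L x" ..
    show ?thesis using X I s by (simp add: emeasure_PiM)
  qed
  ultimately show "(\<lambda>x. emeasure (PiM I (\<lambda>_. L x)) A) \<in> borel_measurable M"
    by (simp cong: measurable_cong)
qed

text \<open>The first summand is the third-order Taylor remainder
  \<open>\<bar>u\<bar>^3 (2 B)^3 / 6\<close> of a centred variable bounded by \<open>2 * B\<close>.
  The second comes from replacing \<open>1 - x\<close> by \<open>exp (- x)\<close> at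
  \<open>x = u^2 v / (2 N)\<close> with \<open>v \<le> B^2\<close>. Both are multiplied by
  \<open>N\<close> when passing to \<open>N\<close>-th powers.\<close>

definition clt_err :: "real \<Rightarrow> real \<Rightarrow> nat \<Rightarrow> real" where
  "clt_err u B N = (4 / 3 * \<bar>u\<bar> ^ 3 * B ^ 3 + u ^ 4 * B ^ 4 / 8) / sqrt (real N)"

lemma exp_minus_quadratic_bound:
  fixes x :: real assumes "x \<ge> 0" shows "\<bar>exp (- x) - (1 - x)\<bar> \<le> x\<^sup>2 / 2"
proof -
  have "exp (- x) \<ge> 1 - x" using exp_ge_add_one_self[of "-x"] by simp
  moreover have "exp (- x) \<le> 1 - x + x\<^sup>2 / 2"
  proof -
    let ?f = "\<lambda>y::real. 1 - y + y\<^sup>2 / 2 - exp (- y)"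
    have "?f 0 \<le> ?f x"
    proof (rule DERIV_nonneg_imp_nondecreasing[OF assms])
      fix y :: real assume "0 \<le> y"
      have "(?f has_real_derivative (- 1 + y + exp (- y))) (at y)"
        by (auto intro!: derivative_eq_intros)
      moreover have "0 \<le> - 1 + y + exp (- y)" using exp_ge_add_one_self[of "-y"] by simp
      ultimately show "\<exists>d. (?f has_real_derivative d) (at y) \<and> 0 \<le> d" by blast
    qed
    then show ?thesis by simp
  qed
  ultimately show ?thesis by simp
qed

text \<open>The \<open>N\<close>-th power is the characteristic function of a normalised sum of
  \<open>N\<close> independent copies. It and the Gaussian factor are \<open>N\<close>-th powers of
  numbers of modulus at most 1, so their distance is at most \<open>N\<close> times that of the
  bases, which are both close to \<open>1 - u^2 v / (2 N)\<close>. The bound depends on the law only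
  through \<open>B\<close>; this is what lets it be applied under a random conditional law and then
  integrated.\<close>

lemma (in prob_space) char_power_bound:
  fixes f :: "'a \<Rightarrow> real" and u B :: real
  assumes f[measurable]: "f \<in> borel_measurable M" and B: "\<And>x. x \<in> space M \<Longrightarrow> \<bar>f x\<bar> \<le> B"
    and N: "N \<ge> 1"
  defines "v \<equiv> expectation (\<lambda>x. (f x)\<^sup>2) - (expectation f)\<^sup>2"
  shows "cmod ((\<integral>x. iexp (u / sqrt N * (f x - expectation f)) \<partial>M) ^ N - exp (- (u\<^sup>2 * v / 2)))
    \<le> clt_err u B N" "0 \<le> v" "v \<le> B\<^sup>2"
proof -
  have B0: "B \<ge> 0" using B not_empty by fastforce
  have int[simp]: "integrable M f" by (rule integrable_const_bound[where B=B]) (auto intro!: AE_I2 B)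
  have int2[simp]: "integrable M (\<lambda>x. (f x)\<^sup>2)"
    by (rule integrable_const_bound[where B="B\<^sup>2"]) (auto intro!: AE_I2 simp: abs_le_square_iff[symmetric] B0 B)
  have m: "\<bar>expectation f\<bar> \<le> B"
  proof -
    have "\<bar>expectation f\<bar> \<le> expectation (\<lambda>x. \<bar>f x\<bar>)" by (rule integral_abs_bound)
    also have "\<dots> \<le> expectation (\<lambda>x. B)" by (rule integral_mono) (auto intro: B)
    finally show ?thesis by (simp add: prob_space)
  qed
  define X where "X x = f x - expectation f" for x
  have [measurable]: "X \<in> borel_measurable M" unfolding X_def by measurable
  have XB: "\<bar>X x\<bar> \<le> 2 * B" if "x \<in> space M" for x using B[OF that] m unfolding X_def by linarith
  have Xi[simp]: "integrable M X" unfolding X_def by simp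
  have Xi2[simp]: "integrable M (\<lambda>x. (X x)\<^sup>2)"
    unfolding X_def power2_diff by simp
  have X0: "expectation X = 0" unfolding X_def by (simp add: prob_space)
  have Xv: "variance X = v"
    unfolding X0 unfolding X_def v_def power2_diff by (simp add: prob_space) (simp add: power2_eq_square)
  show v0: "0 \<le> v" unfolding Xv[symmetric] by simp
  have "expectation (\<lambda>x. (f x)\<^sup>2) \<le> expectation (\<lambda>_. B\<^sup>2)"
    by (rule integral_mono) (auto simp: abs_le_square_iff[symmetric] B0 B)
  then show vB: "v \<le> B\<^sup>2" unfolding v_def by (simp add: prob_space) (smt (verit) zero_le_power2)
  define s where "s = sqrt (real N)"
  have s: "s > 0" "s\<^sup>2 = N" "s \<ge> 1" using N by (auto simp: s_def)
  define t where "t = u / s"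
  define x where "x = u\<^sup>2 * v / (2 * N)"
  have x0: "x \<ge> 0" using v0 by (simp add: x_def)
  define c where "c = (\<integral>x. iexp (t * X x) \<partial>M)"
  have c_char: "c = char (distr M borel X) t" unfolding c_def char_def by (subst integral_distr) auto
  interpret D: real_distribution "distr M borel X" by (rule real_distribution_distr) simp
  have c1: "cmod c \<le> 1" unfolding c_char by (rule D.cmod_char_le_1)
  have tx: "1 - t\<^sup>2 * v / 2 = 1 - x" using s by (simp add: t_def x_def power_divide)
  have "cmod (c - (1 - t\<^sup>2 * v / 2)) \<le> t\<^sup>2 / 6 * expectation (\<lambda>x. min (6 * (X x)\<^sup>2) (\<bar>t\<bar> * \<bar>X x\<bar> ^ 3))"
    unfolding c_char using char_approx3'[OF _ Xi Xi2 X0 Xv refl, of t] by simp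
  also have "\<dots> \<le> t\<^sup>2 / 6 * expectation (\<lambda>x. \<bar>t\<bar> * (2 * B) ^ 3)"
  proof (intro mult_left_mono integral_mono)
    show "integrable M (\<lambda>x. min (6 * (X x)\<^sup>2) (\<bar>t\<bar> * \<bar>X x\<bar> ^ 3))"
      by (rule Bochner_Integration.integrable_bound[of _ "\<lambda>x. 6 * (X x)\<^sup>2"]) auto
    fix x assume "x \<in> space M"
    then have "\<bar>X x\<bar> ^ 3 \<le> (2 * B) ^ 3" by (intro power_mono XB) auto
    then show "min (6 * (X x)\<^sup>2) (\<bar>t\<bar> * \<bar>X x\<bar> ^ 3) \<le> \<bar>t\<bar> * (2 * B) ^ 3"
      by (meson abs_ge_zero min.coboundedI2 mult_left_mono)
  qed auto
  also have "\<dots> = 4 / 3 * \<bar>u\<bar> ^ 3 * B ^ 3 / (s * N)"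
    using s by (simp add: prob_space t_def power_mult_distrib field_simps power2_eq_square power3_eq_cube abs_mult)
  finally have 1: "cmod (c - (1 - x)) \<le> 4 / 3 * \<bar>u\<bar> ^ 3 * B ^ 3 / (s * N)" using tx by simp
  have 2: "cmod ((1 - x) - exp (- x)) \<le> u ^ 4 * B ^ 4 / 8 / (s * N)"
  proof -
    let ?y = "u ^ 4 * B ^ 4 / 8 / (s * N)"
    have NN: "real N = s * s" using s(2) by (simp add: power2_eq_square)
    have a: "\<bar>exp (- x) - (1 - x)\<bar> \<le> x\<^sup>2 / 2" by (rule exp_minus_quadratic_bound[OF x0])
    have "x \<le> u\<^sup>2 * B\<^sup>2 / (2 * N)"
      unfolding x_def using vB by (intro divide_right_mono mult_left_mono) auto
    then have b: "x\<^sup>2 / 2 \<le> (u\<^sup>2 * B\<^sup>2 / (2 * N))\<^sup>2 / 2"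
      using x0 by (intro divide_right_mono power_mono) auto
    have c: "(u\<^sup>2 * B\<^sup>2 / (2 * N))\<^sup>2 / 2 = ?y * (1 / s)"
      unfolding of_nat_mult NN by (simp add: power2_eq_square power4_eq_xxxx mult_ac)
    \<comment> \<open>The quadratic error is of order \<open>1 / N^2\<close>; a factor
      \<open>1 / s\<close> is given away so that both errors share the rate
      \<open>1 / (s * N)\<close>.\<close>
    have d: "?y * (1 / s) \<le> ?y"
      using s B0 mult_left_mono[of "1 / s" 1 ?y] by simp
    have "cmod ((1 - x) - exp (- x)) = \<bar>exp (- x) - (1 - x)\<bar>"
      unfolding norm_of_real by (rule abs_minus_commute)
    with a b c d show ?thesis by linarith
  qed
  have exx: "exp (- complex_of_real x) = complex_of_real (exp (- x))"
    by (metis exp_of_real of_real_minus)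
  have "exp (- (u\<^sup>2 * v / 2)) = exp (- x) ^ N"
    using N by (simp add: x_def exp_of_nat_mult[symmetric])
  then have ex: "complex_of_real (exp (- (u\<^sup>2 * v / 2))) = exp (- complex_of_real x) ^ N"
    unfolding exx by simp
  let ?e = "4 / 3 * \<bar>u\<bar> ^ 3 * B ^ 3 / (s * N) + u ^ 4 * B ^ 4 / 8 / (s * N)"
  have 3: "cmod (c ^ N - (exp (- complex_of_real x)) ^ N) \<le> N * cmod (c - exp (- complex_of_real x))"
    using x0 by (intro norm_power_diff c1) (simp add: norm_exp_eq_Re)
  have 4: "cmod (c - exp (- complex_of_real x)) \<le> ?e"
    using norm_triangle_ineq[of "c - complex_of_real (1 - x)" "complex_of_real ((1 - x) - exp (- x))"] 1 2
    unfolding exx by simp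
  have 5: "N * ?e = clt_err u B N"
    using s(1) N unfolding clt_err_def s_def[symmetric] by (simp add: field_simps)
  have "cmod (c ^ N - (exp (- complex_of_real x)) ^ N) \<le> clt_err u B N"
    using order_trans[OF 3 mult_left_mono[OF 4]] unfolding 5 by simp
  then show "cmod ((\<integral>x. iexp (u / sqrt N * (f x - expectation f)) \<partial>M) ^ N - exp (- (u\<^sup>2 * v / 2)))
    \<le> clt_err u B N"
    unfolding c_def t_def X_def s_def ex by simp
qed

text \<open>Conditionally on \<open>F\<close> and on the event \<open>E\<close>, the variables
  \<open>Z i\<close> are independent with the random law \<open>L \<omega>\<close>. The condition is
  put as an identity of probabilities of rectangles, the form in which it can be read off both from
  a conditional expectation (mutation) and from plain independence (initial particles). Off
  \<open>E\<close> nothing is claimed.\<close>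

locale cond_iid = prob_space P for P :: "'w measure" +
  fixes F :: "'w measure" and K :: "'z measure" and L :: "'w \<Rightarrow> 'z measure"
    and Z :: "'i \<Rightarrow> 'w \<Rightarrow> 'z" and J :: "'i set" and E :: "'w set"
  assumes subalg: "subalgebra P F"
    and kernel[measurable]: "L \<in> F \<rightarrow>\<^sub>M prob_algebra K"
    and Z: "\<And>i. i \<in> J \<Longrightarrow> Z i \<in> P \<rightarrow>\<^sub>M K"
    and E_sets[measurable]: "E \<in> sets F"
    and J: "finite J" "J \<noteq> {}"
    and cond_law: "\<And>G A. G \<in> sets F \<Longrightarrow> (\<And>i. i \<in> J \<Longrightarrow> A i \<in> sets K) \<Longrightarrow>
      prob {\<omega> \<in> E \<inter> G. \<forall>i\<in>J. Z i \<omega> \<in> A i} =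
        (\<integral>\<omega>. indicator (E \<inter> G) \<omega> * (\<Prod>i\<in>J. measure (L \<omega>) (A i)) \<partial>P)"
begin

lemma F_meas: "f \<in> F \<rightarrow>\<^sub>M M \<Longrightarrow> f \<in> P \<rightarrow>\<^sub>M M"
  by (rule measurable_from_subalg[OF subalg])

lemma space_F: "space F = space P" using subalg by (simp add: subalgebra_def)

lemma E_events[measurable]: "E \<in> events" using subalg E_sets by (auto simp: subalgebra_def)

definition "sample \<omega> = (\<lambda>i\<in>J. Z i \<omega>)"
definition "samples_law \<omega> = PiM J (\<lambda>_. L \<omega>)"

lemma measurable_sample[measurable]: "sample \<in> P \<rightarrow>\<^sub>M PiM J (\<lambda>_. K)"
  unfolding sample_def by (rule measurable_restrict) (rule Z)

lemma prob_L: assumes "\<omega> \<in> space P" shows "prob_space (L \<omega>)" "sets (L \<omega>) = sets K"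
  using measurable_space[OF kernel, of \<omega>] assms by (simp_all add: space_prob_algebra space_F)

lemma samples_law_measurable[measurable]: "samples_law \<in> F \<rightarrow>\<^sub>M prob_algebra (PiM J (\<lambda>_. K))"
  unfolding samples_law_def[abs_def] by (intro measurable_PiM_kernel kernel J(1))

lemma prob_samples_law: assumes "\<omega> \<in> space P"
  shows "prob_space (samples_law \<omega>)" "sets (samples_law \<omega>) = sets (PiM J (\<lambda>_. K))"
  using measurable_space[OF samples_law_measurable, of \<omega>] assms by (simp_all add: space_prob_algebra space_F)

text \<open>The restriction of \<open>P\<close> to \<open>E\<close> is not normalised, so
  \<open>E\<close> may be a null set and no conditional probability has to be formed.\<close>

definition "restr_law = density P (indicator E)"
definition "pair_law \<omega> = distr (samples_law \<omega>) (F \<Otimes>\<^sub>M PiM J (\<lambda>_. K)) (Pair \<omega>)"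

lemma sets_restr_law[measurable_cong, simp]: "sets restr_law = events" by (simp add: restr_law_def)
lemma space_restr_law[simp]: "space restr_law = space P" by (simp add: restr_law_def)

lemma finite_restr_law: "finite_measure restr_law"
proof
  have "emeasure restr_law (space restr_law) = emeasure P E"
    unfolding restr_law_def by (subst emeasure_density) (auto intro!: nn_integral_cong simp: nn_integral_indicator[symmetric] indicator_def dest: sets.sets_into_space[OF E_events, THEN subsetD])
  then show "emeasure restr_law (space restr_law) \<noteq> \<infinity>" by simp
qed

lemma pair_law_measurable[measurable]:
  "pair_law \<in> F \<rightarrow>\<^sub>M prob_algebra (F \<Otimes>\<^sub>M PiM J (\<lambda>_. K))"
  unfolding pair_law_def[abs_def] by (rule measurable_distr_prob_space2[OF samples_law_measurable]) simp

lemma pair_law_measurable': "pair_law \<in> restr_law \<rightarrow>\<^sub>M subprob_algebra (F \<Otimes>\<^sub>M PiM J (\<lambda>_. K))"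
  using F_meas[OF measurable_prob_algebraD[OF pair_law_measurable]]
  by (simp cong: measurable_cong_sets)

lemma measurable_Pair_sample: "(\<lambda>\<omega>. (\<omega>, sample \<omega>)) \<in> restr_law \<rightarrow>\<^sub>M F \<Otimes>\<^sub>M PiM J (\<lambda>_. K)"
proof -
  have "(\<lambda>\<omega>. \<omega>) \<in> P \<rightarrow>\<^sub>M F" by (rule F_meas) simp
  then show ?thesis by (simp cong: measurable_cong_sets)
qed

lemma restr_law_integral:
  fixes f :: "'w \<Rightarrow> real" assumes "f \<in> borel_measurable P"
  shows "(\<integral>\<omega>. f \<omega> \<partial>restr_law) = (\<integral>\<omega>. indicator E \<omega> * f \<omega> \<partial>P)"
  unfolding restr_law_def using integral_density[of f P "indicator E"] assms
  by (simp add: ennreal_indicator)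

text \<open>This is the disintegration of the law of past and sample over the past. Both sides are
  finite measures that agree on sets \<open>G \<times> Pi\<^sub>E J A\<close> by
  \<open>cond_law\<close>, and such sets generate the product sigma-algebra and are stable under
  intersection. From here on, integrating out the sample given the past is ordinary integration
  against a kernel.\<close>

lemma joint_law:
  "distr restr_law (F \<Otimes>\<^sub>M PiM J (\<lambda>_. K)) (\<lambda>\<omega>. (\<omega>, sample \<omega>)) = restr_law \<bind> pair_law" (is "?l = ?r")
proof -
  let ?FK = "F \<Otimes>\<^sub>M PiM J (\<lambda>_. K)" and ?K = "PiM J (\<lambda>_. K)"
  note [measurable] = pair_law_measurable' measurable_Pair_sample
  have r_sets: "sets ?r = sets ?FK"
    by (rule sets_bind) (auto simp: not_empty pair_law_def)
  interpret l: finite_measure ?l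
    by (rule finite_measure.finite_measure_distr[OF finite_restr_law]) measurable
  have em_r: "emeasure ?r X = (\<integral>\<^sup>+\<omega>. emeasure (pair_law \<omega>) X \<partial>restr_law)" if "X \<in> sets ?FK" for X
    by (rule emeasure_bind[OF _ pair_law_measurable' that]) (simp add: not_empty)
  have rect: "emeasure ?l (G \<times> Pi\<^sub>E J A) = emeasure ?r (G \<times> Pi\<^sub>E J A)"
    if G[measurable]: "G \<in> sets F" and A: "\<And>i. i \<in> J \<Longrightarrow> A i \<in> sets K" for G A
  proof -
    have PA[measurable]: "Pi\<^sub>E J A \<in> sets ?K" by (rule sets_PiM_I_finite[OF J(1)]) (use A in auto)
    have GP[measurable]: "G \<in> events" using G subalg by (auto simp: subalgebra_def)
    let ?B = "{\<omega> \<in> G. \<forall>i\<in>J. Z i \<omega> \<in> A i}"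
    have vim: "(\<lambda>\<omega>. (\<omega>, sample \<omega>)) -` (G \<times> Pi\<^sub>E J A) \<inter> space restr_law = ?B"
      using sets.sets_into_space[OF GP] by (auto simp: sample_def PiE_iff)
    have GA: "G \<times> Pi\<^sub>E J A \<in> sets ?FK" by measurable
    have m: "?B \<in> events"
      using measurable_sets[OF measurable_Pair_sample GA] unfolding vim by simp
    have "emeasure ?l (G \<times> Pi\<^sub>E J A) = emeasure restr_law ?B"
      unfolding vim[symmetric] by (rule emeasure_distr[OF measurable_Pair_sample GA])
    also have "\<dots> = emeasure P (E \<inter> ?B)"
      unfolding restr_law_def by (rule emeasure_restricted[OF E_events m])
    also have "E \<inter> ?B = {\<omega> \<in> E \<inter> G. \<forall>i\<in>J. Z i \<omega> \<in> A i}" by auto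
    also have "emeasure P \<dots> = ennreal (prob \<dots>)" by (rule emeasure_eq_measure)
    also have "prob {\<omega> \<in> E \<inter> G. \<forall>i\<in>J. Z i \<omega> \<in> A i} =
        (\<integral>\<omega>. indicator (E \<inter> G) \<omega> * (\<Prod>i\<in>J. measure (L \<omega>) (A i)) \<partial>P)"
      by (rule cond_law[OF G A])
    also have "\<dots> = (\<integral>\<^sup>+\<omega>. ennreal (indicator (E \<inter> G) \<omega> * (\<Prod>i\<in>J. measure (L \<omega>) (A i))) \<partial>P)"
    proof (rule nn_integral_eq_integral[symmetric])
      have "(\<lambda>\<omega>. measure (L \<omega>) (A i)) \<in> borel_measurable P" if "i \<in> J" for i
        unfolding measure_def
        by (rule F_meas[OF borel_measurable_enn2real[OF measurable_emeasure_kernel[OF measurable_prob_algebraD[OF kernel] A[OF that]]]])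
      then show "integrable P (\<lambda>\<omega>. indicator (E \<inter> G) \<omega> * (\<Prod>i\<in>J. measure (L \<omega>) (A i)))"
        by (intro integrable_const_bound[where B=1])
           (auto intro!: AE_I2 prod_le_1 prob_space.prob_le_1 prob_L simp: indicator_def abs_mult abs_prod)
    qed (auto intro!: AE_I2 prod_nonneg mult_nonneg_nonneg)
    also have "\<dots> = (\<integral>\<^sup>+\<omega>. indicator E \<omega> * emeasure (pair_law \<omega>) (G \<times> Pi\<^sub>E J A) \<partial>P)"
    proof (rule nn_integral_cong)
      fix \<omega> assume w: "\<omega> \<in> space P"
      interpret Lw: prob_space "L \<omega>" using w by (rule prob_L)
      interpret product_sigma_finite "\<lambda>_. L \<omega>" ..
      have "emeasure (pair_law \<omega>) (G \<times> Pi\<^sub>E J A) = emeasure (samples_law \<omega>) (Pair \<omega> -` (G \<times> Pi\<^sub>E J A) \<inter> space (samples_law \<omega>))"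
        unfolding pair_law_def using w prob_samples_law(2)[OF w] by (subst emeasure_distr) (auto simp: space_F)
      also have "Pair \<omega> -` (G \<times> Pi\<^sub>E J A) \<inter> space (samples_law \<omega>) = (if \<omega> \<in> G then Pi\<^sub>E J A else {})"
        using sets.sets_into_space[OF PA] sets_eq_imp_space_eq[OF prob_samples_law(2)[OF w]] by auto
      also have "emeasure (samples_law \<omega>) \<dots> = indicator G \<omega> * (\<Prod>i\<in>J. emeasure (L \<omega>) (A i))"
        using A prob_L[OF w] by (auto simp: samples_law_def emeasure_PiM J(1))
      also have "(\<Prod>i\<in>J. emeasure (L \<omega>) (A i)) = ennreal (\<Prod>i\<in>J. measure (L \<omega>) (A i))"
        by (simp add: Lw.emeasure_eq_measure prod_ennreal)
      finally show "ennreal (indicator (E \<inter> G) \<omega> * (\<Prod>i\<in>J. measure (L \<omega>) (A i))) =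
          indicator E \<omega> * emeasure (pair_law \<omega>) (G \<times> Pi\<^sub>E J A)"
        by (simp add: indicator_def)
    qed
    also have "\<dots> = emeasure ?r (G \<times> Pi\<^sub>E J A)"
    proof -
      have "(\<lambda>\<omega>. emeasure (pair_law \<omega>) (G \<times> Pi\<^sub>E J A)) \<in> borel_measurable P"
        by (rule F_meas[OF measurable_emeasure_kernel[OF measurable_prob_algebraD[OF pair_law_measurable]]]) measurable
      then show ?thesis by (subst em_r) (auto simp: restr_law_def nn_integral_density)
    qed
    finally show ?thesis .
  qed
  \<comment> \<open>The second factors range over rectangles only, not over all measurable sets of
    samples, because \<open>cond_law\<close> speaks of rectangles. The price is the verification
    that these products still generate the sigma-algebra, done by showing that both projections are
    measurable for it.\<close>
  define G where "G = {A \<times> B | A B. A \<in> sets F \<and> B \<in> prod_algebra J (\<lambda>_. K)}"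
  have GP: "G \<subseteq> Pow (space F \<times> space ?K)"
    using prod_algebra_sets_into_space[of J "\<lambda>_. K"] sets.sets_into_space[of _ F]
    unfolding G_def space_PiM by blast
  have sg: "sets ?FK = sigma_sets (space F \<times> space ?K) G"
  proof (rule antisym)
    show "sigma_sets (space F \<times> space ?K) G \<subseteq> sets ?FK"
      unfolding space_pair_measure[symmetric]
      by (rule sets.sigma_sets_subset) (auto simp: G_def sets_PiM intro!: pair_measureI sigma_sets.Basic)
    have *: "sets ?FK = sets (sigma (space F \<times> space ?K) {a \<times> b | a b. a \<in> sets F \<and> b \<in> sets ?K})"
      by (simp add: sets_pair_measure pair_measure_closed)
    let ?S = "sigma (space F \<times> space ?K) G"
    have sS: "sets ?S = sigma_sets (space F \<times> space ?K) G" "space ?S = space F \<times> space ?K" using GP by auto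
    have sp: "space ?K \<in> prod_algebra J (\<lambda>_. K)"
      unfolding space_PiM by (intro prod_algebraI_finite J(1)) auto
    have f: "fst \<in> ?S \<rightarrow>\<^sub>M F"
    proof (rule measurableI)
      fix A assume A: "A \<in> sets F"
      have "fst -` A \<inter> space ?S = A \<times> space ?K" using sets.sets_into_space[OF A] by (auto simp: sS)
      also have "\<dots> \<in> sets ?S" unfolding sS using A sp by (intro sigma_sets.Basic) (auto simp: G_def)
      finally show "fst -` A \<inter> space ?S \<in> sets ?S" .
    qed (auto simp: sS)
    have s: "snd \<in> ?S \<rightarrow>\<^sub>M ?K"
    proof (rule measurable_sigma_sets[OF sets_PiM prod_algebra_sets_into_space])
      fix B assume B: "B \<in> prod_algebra J (\<lambda>_. K)"
      have "B \<subseteq> space ?K" using B prod_algebra_sets_into_space[of "J" "\<lambda>_. K"] by (auto simp: space_PiM)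
      then have "snd -` B \<inter> space ?S = space F \<times> B" by (auto simp: sS)
      also have "\<dots> \<in> sets ?S" unfolding sS using B by (intro sigma_sets.Basic) (auto simp: G_def)
      finally show "snd -` B \<inter> space ?S \<in> sets ?S" .
    qed (auto simp: sS space_PiM[symmetric])
    show "sets ?FK \<subseteq> sigma_sets (space F \<times> space ?K) G"
      unfolding sS(1)[symmetric]
    proof (rule sets_pair_in_sets)
      fix a b assume ab: "a \<in> sets F" "b \<in> sets ?K"
      have "a \<times> b = (fst -` a \<inter> space ?S) \<inter> (snd -` b \<inter> space ?S)"
        using ab[THEN sets.sets_into_space] by (auto simp: sS)
      also have "\<dots> \<in> sets ?S" by (intro sets.Int measurable_sets[OF f] measurable_sets[OF s] ab)
      finally show "a \<times> b \<in> sets ?S" .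
    qed
  qed
  show "?l = ?r"
  proof (rule measure_eqI_generator_eq[of G "space F \<times> space ?K" _ _ "\<lambda>_. space F \<times> space ?K"])
    show "Int_stable G"
    proof (rule Int_stableI)
      fix a b assume "a \<in> G" "b \<in> G"
      then obtain A1 B1 A2 B2 where "a = A1 \<times> B1" "b = A2 \<times> B2" "A1 \<in> sets F" "A2 \<in> sets F"
        "B1 \<in> prod_algebra J (\<lambda>_. K)" "B2 \<in> prod_algebra J (\<lambda>_. K)" by (auto simp: G_def)
      moreover from this have "B1 \<inter> B2 \<in> prod_algebra J (\<lambda>_. K)"
        using Int_stableD[OF Int_stable_prod_algebra] by blast
      ultimately show "a \<inter> b \<in> G"
        unfolding G_def by (auto simp: Times_Int_Times intro!: exI[of _ "A1 \<inter> A2"] exI[of _ "B1 \<inter> B2"])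
    qed
    show "G \<subseteq> Pow (space F \<times> space ?K)"
      by (rule GP)
    show "emeasure ?l X = emeasure ?r X" if "X \<in> G" for X
    proof -
      from that obtain A C B where "X = A \<times> Pi\<^sub>E J B" "A \<in> sets F" "\<And>i. i \<in> J \<Longrightarrow> B i \<in> sets K"
        by (auto simp: G_def prod_algebra_eq_finite[OF J(1)])
      then show ?thesis using rect by simp
    qed
    show "range (\<lambda>_. space F \<times> space ?K) \<subseteq> G"
      unfolding G_def space_PiM using prod_algebraI_finite[OF J(1), of "\<lambda>_. space K" "\<lambda>_. K"] by auto
  qed (auto simp: sg[symmetric] r_sets)
qed

lemma joint_integral:
  fixes f :: "'w \<times> ('i \<Rightarrow> 'z) \<Rightarrow> real"
  assumes f[measurable]: "f \<in> borel_measurable (F \<Otimes>\<^sub>M PiM J (\<lambda>_. K))"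
    and B: "\<And>x. x \<in> space (F \<Otimes>\<^sub>M PiM J (\<lambda>_. K)) \<Longrightarrow> \<bar>f x\<bar> \<le> B"
  shows "(\<integral>\<omega>. indicator E \<omega> * f (\<omega>, sample \<omega>) \<partial>P) =
    (\<integral>\<omega>. indicator E \<omega> * (\<integral>z. f (\<omega>, z) \<partial>samples_law \<omega>) \<partial>P)"
proof -
  let ?FK = "F \<Otimes>\<^sub>M PiM J (\<lambda>_. K)"
  have "(\<integral>\<omega>. indicator E \<omega> * f (\<omega>, sample \<omega>) \<partial>P) = (\<integral>\<omega>. f (\<omega>, sample \<omega>) \<partial>restr_law)"
    using measurable_compose[OF measurable_Pair_sample f] by (subst restr_law_integral) auto
  also have "\<dots> = integral\<^sup>L (distr restr_law ?FK (\<lambda>\<omega>. (\<omega>, sample \<omega>))) f"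
    by (rule integral_distr[symmetric, OF measurable_Pair_sample f])
  also have "\<dots> = (\<integral>\<omega>. integral\<^sup>L (pair_law \<omega>) f \<partial>restr_law)"
    unfolding joint_law
  proof (rule integral_bind[OF f B pair_law_measurable' finite_restr_law])
    show "AE x in restr_law. emeasure (pair_law x) (space (pair_law x)) \<le> ennreal 1"
      using measurable_space[OF pair_law_measurable']
      by (auto intro!: AE_I2 subprob_space.emeasure_space_le_1 simp: space_subprob_algebra)
  qed
  also have "\<dots> = (\<integral>\<omega>. indicator E \<omega> * integral\<^sup>L (pair_law \<omega>) f \<partial>P)"
    by (rule restr_law_integral[OF F_meas[OF measurable_compose[OF measurable_prob_algebraD[OF pair_law_measurable]
      integral_measurable_subprob_algebra]]]) simp
  also have "\<dots> = (\<integral>\<omega>. indicator E \<omega> * (\<integral>z. f (\<omega>, z) \<partial>samples_law \<omega>) \<partial>P)"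
  proof (rule Bochner_Integration.integral_cong[OF refl])
    fix \<omega> assume w: "\<omega> \<in> space P"
    note [measurable_cong] = prob_samples_law(2)[OF w]
    show "indicator E \<omega> * integral\<^sup>L (pair_law \<omega>) f = indicator E \<omega> * (\<integral>z. f (\<omega>, z) \<partial>samples_law \<omega>)"
      unfolding pair_law_def using w by (subst integral_distr) (auto simp: space_F)
  qed
  finally show ?thesis .
qed

lemma joint_integral_complex:
  fixes f :: "'w \<times> ('i \<Rightarrow> 'z) \<Rightarrow> complex"
  assumes f[measurable]: "f \<in> borel_measurable (F \<Otimes>\<^sub>M PiM J (\<lambda>_. K))"
    and B: "\<And>x. x \<in> space (F \<Otimes>\<^sub>M PiM J (\<lambda>_. K)) \<Longrightarrow> cmod (f x) \<le> B"
  shows "(\<integral>\<omega>. indicator E \<omega> * f (\<omega>, sample \<omega>) \<partial>P) =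
    (\<integral>\<omega>. indicator E \<omega> * (\<integral>z. f (\<omega>, z) \<partial>samples_law \<omega>) \<partial>P)"
proof -
  let ?FK = "F \<Otimes>\<^sub>M PiM J (\<lambda>_. K)"
  have mP: "(\<lambda>\<omega>. f (\<omega>, sample \<omega>)) \<in> borel_measurable P"
    using measurable_compose[OF measurable_Pair_sample f] by simp
  have sp: "(\<omega>, z) \<in> space ?FK" if "\<omega> \<in> space P" "z \<in> space (samples_law \<omega>)" for \<omega> z
    using that sets_eq_imp_space_eq[OF prob_samples_law(2)[OF that(1)]] by (simp add: space_pair_measure space_F)
  have int: "integrable (samples_law \<omega>) (\<lambda>z. f (\<omega>, z))" if w: "\<omega> \<in> space P" for \<omega>
  proof -
    interpret L: prob_space "samples_law \<omega>" by (rule prob_samples_law[OF w])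
    have "Pair \<omega> \<in> samples_law \<omega> \<rightarrow>\<^sub>M ?FK"
      using w measurable_Pair1'[of \<omega> F "PiM J (\<lambda>_. K)"] measurable_cong_sets[OF prob_samples_law(2)[OF w] refl, of ?FK]
      by (auto simp: space_F)
    from measurable_compose[OF this f] show ?thesis
      by (intro L.integrable_const_bound[where B=B]) (auto intro!: AE_I2 B sp w)
  qed
  have re_m: "(\<lambda>\<omega>. \<integral>z. Re (f (\<omega>, z)) \<partial>samples_law \<omega>) \<in> borel_measurable P"
   and im_m: "(\<lambda>\<omega>. \<integral>z. Im (f (\<omega>, z)) \<partial>samples_law \<omega>) \<in> borel_measurable P"
    by (rule F_meas[OF borel_measurable_integral_kernel[OF _ samples_law_measurable]], simp add: split_beta')+
  have cm: "(\<lambda>\<omega>. \<integral>z. f (\<omega>, z) \<partial>samples_law \<omega>) \<in> borel_measurable P"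
  proof -
    have "(\<lambda>\<omega>. Complex (\<integral>z. Re (f (\<omega>, z)) \<partial>samples_law \<omega>) (\<integral>z. Im (f (\<omega>, z)) \<partial>samples_law \<omega>)) \<in> borel_measurable P"
      using re_m im_m unfolding Complex_eq by measurable
    moreover have "(\<integral>z. f (\<omega>, z) \<partial>samples_law \<omega>) = Complex (\<integral>z. Re (f (\<omega>, z)) \<partial>samples_law \<omega>) (\<integral>z. Im (f (\<omega>, z)) \<partial>samples_law \<omega>)"
      if "\<omega> \<in> space P" for \<omega>
      using int[OF that] by (intro complex_eqI) simp_all
    ultimately show ?thesis by (simp cong: measurable_cong)
  qed
  have bd: "cmod (\<integral>z. f (\<omega>, z) \<partial>samples_law \<omega>) \<le> B" if w: "\<omega> \<in> space P" for \<omega>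
  proof -
    interpret L: prob_space "samples_law \<omega>" by (rule prob_samples_law[OF w])
    have "cmod (\<integral>z. f (\<omega>, z) \<partial>samples_law \<omega>) \<le> (\<integral>z. cmod (f (\<omega>, z)) \<partial>samples_law \<omega>)"
      by (rule integral_norm_bound)
    also have "\<dots> \<le> (\<integral>z. B \<partial>samples_law \<omega>)"
      using int[OF w] by (intro integral_mono) (auto intro!: B sp w)
    finally show ?thesis by (simp add: L.prob_space)
  qed
  have B0: "B \<ge> 0"
    using not_empty bd norm_ge_zero order_trans by blast
  have i1: "integrable P (\<lambda>\<omega>. indicator E \<omega> * f (\<omega>, sample \<omega>))"
    using mP measurable_space[OF measurable_Pair_sample] B0
    by (intro integrable_const_bound[where B=B]) (auto intro!: AE_I2 B simp: norm_mult indicator_def)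
  have i2: "integrable P (\<lambda>\<omega>. indicator E \<omega> * (\<integral>z. f (\<omega>, z) \<partial>samples_law \<omega>))"
    using cm by (intro integrable_const_bound[where B=B]) (auto intro!: AE_I2 bd simp: norm_mult indicator_def B0)
  have B': "\<bar>Re (f x)\<bar> \<le> B" "\<bar>Im (f x)\<bar> \<le> B" if "x \<in> space ?FK" for x
    using B[OF that] abs_Re_le_cmod[of "f x"] abs_Im_le_cmod[of "f x"] by linarith+
  have iE: "Re (indicator E \<omega> * z) = indicator E \<omega> * Re z" "Im (indicator E \<omega> * z) = indicator E \<omega> * Im z" for \<omega> z
    by (auto simp: indicator_def)
  show ?thesis
  proof (rule complex_eqI)
    have "Re (\<integral>\<omega>. indicator E \<omega> * f (\<omega>, sample \<omega>) \<partial>P) = (\<integral>\<omega>. indicator E \<omega> * Re (f (\<omega>, sample \<omega>)) \<partial>P)"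
      unfolding integral_Re[OF i1, symmetric] iE ..
    also have "\<dots> = (\<integral>\<omega>. indicator E \<omega> * (\<integral>z. Re (f (\<omega>, z)) \<partial>samples_law \<omega>) \<partial>P)"
      using joint_integral[of "\<lambda>x. Re (f x)" B] B'(1) by simp
    also have "\<dots> = (\<integral>\<omega>. Re (indicator E \<omega> * (\<integral>z. f (\<omega>, z) \<partial>samples_law \<omega>)) \<partial>P)"
      unfolding iE using int by (intro Bochner_Integration.integral_cong) auto
    finally show "Re (\<integral>\<omega>. indicator E \<omega> * f (\<omega>, sample \<omega>) \<partial>P) = Re (\<integral>\<omega>. indicator E \<omega> * (\<integral>z. f (\<omega>, z) \<partial>samples_law \<omega>) \<partial>P)"
      unfolding integral_Re[OF i2] .
  next
    have "Im (\<integral>\<omega>. indicator E \<omega> * f (\<omega>, sample \<omega>) \<partial>P) = (\<integral>\<omega>. indicator E \<omega> * Im (f (\<omega>, sample \<omega>)) \<partial>P)"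
      unfolding integral_Im[OF i1, symmetric] iE ..
    also have "\<dots> = (\<integral>\<omega>. indicator E \<omega> * (\<integral>z. Im (f (\<omega>, z)) \<partial>samples_law \<omega>) \<partial>P)"
      using joint_integral[of "\<lambda>x. Im (f x)" B] B'(2) by simp
    also have "\<dots> = (\<integral>\<omega>. Im (indicator E \<omega> * (\<integral>z. f (\<omega>, z) \<partial>samples_law \<omega>)) \<partial>P)"
      unfolding iE using int by (intro Bochner_Integration.integral_cong) auto
    finally show "Im (\<integral>\<omega>. indicator E \<omega> * f (\<omega>, sample \<omega>) \<partial>P) = Im (\<integral>\<omega>. indicator E \<omega> * (\<integral>z. f (\<omega>, z) \<partial>samples_law \<omega>) \<partial>P)"
      unfolding integral_Im[OF i2] .
  qed
qed

section \<open>Conditional moments and limit theorems for test functions depending on the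
  past\<close>

context
  fixes f :: "'w \<Rightarrow> 'z \<Rightarrow> real" and B :: real
  assumes f[measurable]: "(\<lambda>(\<omega>, z). f \<omega> z) \<in> borel_measurable (F \<Otimes>\<^sub>M K)"
    and B: "\<And>\<omega> z. \<bar>f \<omega> z\<bar> \<le> B"
begin

definition "cmean \<omega> = (\<integral>z. f \<omega> z \<partial>L \<omega>)"
definition "cvar \<omega> = (\<integral>z. (f \<omega> z)\<^sup>2 \<partial>L \<omega>) - (cmean \<omega>)\<^sup>2"

lemma cmean_measurable[measurable]: "cmean \<in> borel_measurable F"
  unfolding cmean_def[abs_def] by (rule borel_measurable_integral_kernel) measurable

lemma cvar_measurable[measurable]: "cvar \<in> borel_measurable F"
  unfolding cvar_def[abs_def] by (intro borel_measurable_diff borel_measurable_integral_kernel[OF _ kernel]) measurable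

lemma B_nonneg: "B \<ge> 0"
  using B[of undefined undefined] by linarith

lemma f_L_measurable: assumes "\<omega> \<in> space P" shows "f \<omega> \<in> borel_measurable (L \<omega>)"
proof -
  have "f \<omega> \<in> borel_measurable K" using measurable_Pair2[OF f, of \<omega>] assms by (simp add: space_F)
  then show ?thesis using prob_L(2)[OF assms] by (simp cong: measurable_cong_sets)
qed

lemma abs_cmean_le: assumes "\<omega> \<in> space P" shows "\<bar>cmean \<omega>\<bar> \<le> B"
proof -
  interpret L: prob_space "L \<omega>" by (rule prob_L[OF assms])
  have "integrable (L \<omega>) (f \<omega>)"
    by (rule L.integrable_const_bound[where B=B]) (auto intro!: AE_I2 B f_L_measurable assms)
  then have "(\<integral>z. \<bar>f \<omega> z\<bar> \<partial>L \<omega>) \<le> (\<integral>z. B \<partial>L \<omega>)"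
    by (intro integral_mono) (auto intro: B)
  moreover have "\<bar>cmean \<omega>\<bar> \<le> (\<integral>z. \<bar>f \<omega> z\<bar> \<partial>L \<omega>)"
    unfolding cmean_def by (rule integral_abs_bound)
  ultimately show ?thesis by (simp add: L.prob_space)
qed

lemma cvar_bounds: assumes "\<omega> \<in> space P" shows "0 \<le> cvar \<omega>" "cvar \<omega> \<le> B\<^sup>2"
proof -
  interpret L: prob_space "L \<omega>" by (rule prob_L[OF assms])
  show "0 \<le> cvar \<omega>" "cvar \<omega> \<le> B\<^sup>2"
    using L.char_power_bound(2,3)[OF f_L_measurable[OF assms] B, of 1] by (simp_all add: cvar_def cmean_def)
qed

lemma conditional_mean:
  assumes i: "i \<in> J"
  shows "(\<integral>\<omega>. indicator E \<omega> * f \<omega> (Z i \<omega>) \<partial>P) = (\<integral>\<omega>. indicator E \<omega> * cmean \<omega> \<partial>P)"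
proof -
  have "(\<integral>\<omega>. indicator E \<omega> * f \<omega> (Z i \<omega>) \<partial>P) =
      (\<integral>\<omega>. indicator E \<omega> * (case (\<omega>, sample \<omega>) of (\<omega>, z) \<Rightarrow> f \<omega> (z i)) \<partial>P)"
    using i by (simp add: sample_def)
  also have "\<dots> = (\<integral>\<omega>. indicator E \<omega> * (\<integral>z. (case (\<omega>, z) of (\<omega>, z) \<Rightarrow> f \<omega> (z i)) \<partial>samples_law \<omega>) \<partial>P)"
    using i B by (intro joint_integral[where B=B]) (auto simp: split_beta' intro!: measurable_compose[OF _ f[unfolded split_beta']])
  also have "\<dots> = (\<integral>\<omega>. indicator E \<omega> * cmean \<omega> \<partial>P)"
  proof (intro Bochner_Integration.integral_cong arg_cong2[where f="(*)"] refl)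
    fix \<omega> assume w: "\<omega> \<in> space P"
    interpret L: prob_space "L \<omega>" by (rule prob_L[OF w])
    interpret product_prob_space "\<lambda>_. L \<omega>" J ..
    show "(\<integral>z. (case (\<omega>, z) of (\<omega>, z) \<Rightarrow> f \<omega> (z i)) \<partial>samples_law \<omega>) = cmean \<omega>"
      unfolding samples_law_def cmean_def
      using integral_distr[OF measurable_component_singleton[OF i, of "\<lambda>_. L \<omega>"] f_L_measurable[OF w]]
      by (simp add: PiM_component i)
  qed
  finally show ?thesis .
qed

text \<open>Centred samples are uncorrelated under the product law, so only the diagonal of the
  double sum survives.\<close>

lemma sum_square_samples_law:
  assumes w: "\<omega> \<in> space P"
  shows "(\<integral>z. (\<Sum>i\<in>J. f \<omega> (z i) - cmean \<omega>)\<^sup>2 \<partial>samples_law \<omega>) = card J * cvar \<omega>"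
proof -
  interpret L: prob_space "L \<omega>" by (rule prob_L[OF w])
  interpret product_sigma_finite "\<lambda>_. L \<omega>" ..
  define X where "X z = f \<omega> z - cmean \<omega>" for z
  have [measurable]: "X \<in> borel_measurable (L \<omega>)" unfolding X_def using f_L_measurable[OF w] by measurable
  have XB: "\<bar>X z\<bar> \<le> 2 * B" for z using B[of \<omega> z] abs_cmean_le[OF w] unfolding X_def by linarith
  have [measurable]: "f \<omega> \<in> borel_measurable (L \<omega>)" by (rule f_L_measurable[OF w])
  have fi: "integrable (L \<omega>) (f \<omega>)" "integrable (L \<omega>) (\<lambda>z. (f \<omega> z)\<^sup>2)"
    by (rule L.integrable_const_bound[where B="B"], use B in simp, simp)
       (rule L.integrable_const_bound[where B="B\<^sup>2"], use B in \<open>simp add: abs_le_square_iff[symmetric] B_nonneg\<close>, simp)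
  have X0: "(\<integral>z. X z \<partial>L \<omega>) = 0" unfolding X_def using fi by (simp add: L.prob_space cmean_def)
  have X2: "(\<integral>z. (X z)\<^sup>2 \<partial>L \<omega>) = cvar \<omega>"
    unfolding X_def power2_diff using fi by (simp add: L.prob_space cvar_def flip: cmean_def) (simp add: power2_eq_square)
  \<comment> \<open>Writing the pair as a product over all coordinates makes the integral factorise,
    with the same formula for \<open>i = j\<close> and \<open>i \<noteq> j\<close>; the coordinates
    not involved contribute the factor 1.\<close>
  have prod2: "X (z i) * X (z j) = (\<Prod>k\<in>J. (if k = i then X (z k) else 1) * (if k = j then X (z k) else 1))"
    if "i \<in> J" "j \<in> J" for i j z
    using J(1) that by (simp add: prod.distrib)
  have int1: "integrable (L \<omega>) (\<lambda>y. (if k = i then X y else 1) * (if k = j then X y else 1))" for i j k :: 'i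
  proof (rule L.integrable_const_bound[where B="(1 + 2 * B) * (1 + 2 * B)"])
    have b: "\<bar>if k = l then X y else 1\<bar> \<le> 1 + 2 * B" for l y
      using XB[of y] B_nonneg by auto
    show "AE y in L \<omega>. norm ((if k = i then X y else 1) * (if k = j then X y else 1)) \<le> (1 + 2 * B) * (1 + 2 * B)"
      unfolding real_norm_def abs_mult by (intro AE_I2 mult_mono b) (use B_nonneg in auto)
  qed measurable
  have cross: "(\<integral>z. X (z i) * X (z j) \<partial>samples_law \<omega>) = (if i = j then cvar \<omega> else 0)"
    and icross: "integrable (samples_law \<omega>) (\<lambda>z. X (z i) * X (z j))" if ij: "i \<in> J" "j \<in> J" for i j
  proof -
    have "(\<integral>z. X (z i) * X (z j) \<partial>samples_law \<omega>) =
      (\<Prod>k\<in>J. \<integral>y. (if k = i then X y else 1) * (if k = j then X y else 1) \<partial>L \<omega>)"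
      unfolding samples_law_def prod2[OF ij] by (rule product_integral_prod[OF J(1) int1])
    also have "\<dots> = (if i = j then cvar \<omega> else 0)"
    proof (cases "i = j")
      case True
      then have "(\<Prod>k\<in>J. \<integral>y. (if k = i then X y else 1) * (if k = j then X y else 1) \<partial>L \<omega>) = (\<Prod>k\<in>J. if k = i then cvar \<omega> else 1)"
        by (intro prod.cong) (auto simp: X2[symmetric] power2_eq_square L.prob_space)
      then show ?thesis using True J(1) ij by simp
    next
      case False
      have "(\<integral>y. (if i = i then X y else 1) * (if i = j then X y else 1) \<partial>L \<omega>) = 0" using False X0 by simp
      then show ?thesis using False J(1) ij by (auto intro!: prod_zero bexI[of _ i])
    qed
    finally show "(\<integral>z. X (z i) * X (z j) \<partial>samples_law \<omega>) = (if i = j then cvar \<omega> else 0)" .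
    show "integrable (samples_law \<omega>) (\<lambda>z. X (z i) * X (z j))"
      unfolding samples_law_def prod2[OF ij] by (rule product_integrable_prod[OF J(1) int1])
  qed
  have "(\<integral>z. (\<Sum>i\<in>J. f \<omega> (z i) - cmean \<omega>)\<^sup>2 \<partial>samples_law \<omega>) = (\<integral>z. (\<Sum>i\<in>J. \<Sum>j\<in>J. X (z i) * X (z j)) \<partial>samples_law \<omega>)"
    by (simp add: X_def power2_eq_square sum_product)
  also have "\<dots> = (\<Sum>i\<in>J. \<Sum>j\<in>J. \<integral>z. X (z i) * X (z j) \<partial>samples_law \<omega>)"
    by (subst Bochner_Integration.integral_sum, simp add: icross, intro sum.cong refl Bochner_Integration.integral_sum) (simp add: icross)
  also have "\<dots> = (\<Sum>i\<in>J. \<Sum>j\<in>J. if i = j then cvar \<omega> else 0)"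
    by (intro sum.cong refl cross)
  also have "\<dots> = card J * cvar \<omega>" using J(1) by simp
  finally show ?thesis .
qed

lemma f_component_measurable:
  "i \<in> J \<Longrightarrow> (\<lambda>(\<omega>, z). f \<omega> (z i)) \<in> borel_measurable (F \<Otimes>\<^sub>M PiM J (\<lambda>_. K))"
proof -
  assume i: "i \<in> J"
  have "(\<lambda>x. (fst x, snd x i)) \<in> F \<Otimes>\<^sub>M PiM J (\<lambda>_. K) \<rightarrow>\<^sub>M F \<Otimes>\<^sub>M K"
    using i by measurable
  from measurable_compose[OF this f] show ?thesis by (simp add: split_beta')
qed

lemma sum_centred_measurable[measurable]:
  "(\<lambda>(\<omega>, z). \<Sum>i\<in>J. f \<omega> (z i) - cmean \<omega>) \<in> borel_measurable (F \<Otimes>\<^sub>M PiM J (\<lambda>_. K))"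
  using f_component_measurable unfolding split_beta'
  by (intro borel_measurable_sum borel_measurable_diff) auto

lemma sum_f_Z_measurable[measurable]: "(\<lambda>\<omega>. \<Sum>i\<in>J. f \<omega> (Z i \<omega>)) \<in> borel_measurable P"
proof (rule borel_measurable_sum)
  fix i assume i: "i \<in> J"
  have "(\<lambda>\<omega>. (\<omega>, Z i \<omega>)) \<in> P \<rightarrow>\<^sub>M F \<Otimes>\<^sub>M K"
    by (rule measurable_Pair) (auto intro: F_meas Z i)
  from measurable_compose[OF this f] show "(\<lambda>\<omega>. f \<omega> (Z i \<omega>)) \<in> borel_measurable P" by simp
qed

text \<open>The second moment is the integral of the conditional one, hence at most
  \<open>card J * B^2\<close>, and the first absolute moment is at most the root of the
  second.\<close>

lemma conditional_lln:
  "(\<integral>\<omega>. indicator E \<omega> * \<bar>(\<Sum>i\<in>J. f \<omega> (Z i \<omega>)) - card J * cmean \<omega>\<bar> \<partial>P) \<le> B * sqrt (card J)"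
proof -
  define X where "X \<omega> = indicator E \<omega> * \<bar>(\<Sum>i\<in>J. f \<omega> (Z i \<omega>)) - card J * cmean \<omega>\<bar>" for \<omega>
  have [measurable]: "cmean \<in> borel_measurable P" "cvar \<in> borel_measurable P" by (rule F_meas, measurable)+
  have [measurable]: "X \<in> borel_measurable P" unfolding X_def by measurable
  have c: "(\<Sum>i\<in>J. f \<omega> (z i) - cmean \<omega>) = (\<Sum>i\<in>J. f \<omega> (z i)) - card J * cmean \<omega>" for \<omega> z
    by (simp add: sum_subtractf)
  have fb: "\<bar>(\<Sum>i\<in>J. f \<omega> (z i) - cmean \<omega>)\<bar> \<le> card J * (2 * B)" if "\<omega> \<in> space P" for \<omega> z
  proof -
    have "\<bar>(\<Sum>i\<in>J. f \<omega> (z i) - cmean \<omega>)\<bar> \<le> (\<Sum>i\<in>J. \<bar>f \<omega> (z i) - cmean \<omega>\<bar>)" by (rule sum_abs)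
    also have "\<dots> \<le> (\<Sum>i\<in>J. 2 * B)"
    proof (rule sum_mono)
      fix i show "\<bar>f \<omega> (z i) - cmean \<omega>\<bar> \<le> 2 * B" using B[of \<omega> "z i"] abs_cmean_le[OF that] by linarith
    qed
    finally show ?thesis by simp
  qed
  have Xb: "\<bar>X \<omega>\<bar> \<le> card J * (2 * B)" if "\<omega> \<in> space P" for \<omega>
    using fb[OF that, of "\<lambda>i. Z i \<omega>"] B_nonneg by (auto simp: X_def c indicator_def)
  have Xi: "integrable P X" by (rule integrable_const_bound[OF AE_I2[OF Xb[folded real_norm_def]]]) simp_all
  have X2i: "integrable P (\<lambda>\<omega>. (X \<omega>)\<^sup>2)"
    by (rule integrable_const_bound[where B="(card J * (2 * B))\<^sup>2"])
       (use Xb B_nonneg in \<open>auto simp: abs_le_square_iff[symmetric] intro!: AE_I2\<close>)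
  have "expectation (\<lambda>\<omega>. (X \<omega>)\<^sup>2) = (\<integral>\<omega>. indicator E \<omega> * (case (\<omega>, sample \<omega>) of (\<omega>, z) \<Rightarrow> (\<Sum>i\<in>J. f \<omega> (z i) - cmean \<omega>)\<^sup>2) \<partial>P)"
    by (intro Bochner_Integration.integral_cong) (auto simp: X_def indicator_def sample_def c)
  also have "\<dots> = (\<integral>\<omega>. indicator E \<omega> * (\<integral>z. (case (\<omega>, z) of (\<omega>, z) \<Rightarrow> (\<Sum>i\<in>J. f \<omega> (z i) - cmean \<omega>)\<^sup>2) \<partial>samples_law \<omega>) \<partial>P)"
  proof (rule joint_integral[where B="(card J * (2 * B))\<^sup>2"])
    show "(\<lambda>(\<omega>, z). (\<Sum>i\<in>J. f \<omega> (z i) - cmean \<omega>)\<^sup>2) \<in> borel_measurable (F \<Otimes>\<^sub>M PiM J (\<lambda>_. K))"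
      using borel_measurable_power[OF sum_centred_measurable, of 2] by (simp add: split_beta')
  qed (use fb B_nonneg in \<open>auto simp: abs_le_square_iff[symmetric] space_pair_measure space_F\<close>)
  also have "\<dots> = (\<integral>\<omega>. indicator E \<omega> * (card J * cvar \<omega>) \<partial>P)"
    by (intro Bochner_Integration.integral_cong) (simp_all add: sum_square_samples_law)
  also have "\<dots> \<le> (\<integral>\<omega>. card J * B\<^sup>2 \<partial>P)"
  proof (rule integral_mono)
    show "integrable P (\<lambda>\<omega>. indicator E \<omega> * (card J * cvar \<omega>))"
      using cvar_bounds by (intro integrable_const_bound[where B="card J * B\<^sup>2"]) (auto intro!: AE_I2 simp: abs_mult indicator_def mult_left_mono)
  qed (use cvar_bounds in \<open>auto simp: indicator_def intro: mult_left_mono\<close>)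
  finally have 1: "expectation (\<lambda>\<omega>. (X \<omega>)\<^sup>2) \<le> card J * B\<^sup>2" by (simp add: prob_space)
  \<comment> \<open>Nonnegativity of the variance stands in for the Cauchy-Schwarz
    inequality.\<close>
  have "0 \<le> variance X" by (rule variance_positive)
  then have "(expectation X)\<^sup>2 \<le> card J * B\<^sup>2" using 1 variance_eq[OF Xi X2i] by simp
  then have "expectation X \<le> sqrt (card J * B\<^sup>2)" by (rule real_le_rsqrt)
  then show ?thesis unfolding X_def using B_nonneg by (simp add: real_sqrt_mult mult.commute)
qed

text \<open>The factor \<open>W\<close> will carry the characteristic function of all earlier
  increments, which is why it is allowed to be any \<open>F\<close>-measurable variable of modulus
  at most 1. Given the past, independence turns the exponential of the sum into the power
  \<open>c \<omega> ^ card J\<close>, and \<open>char_power_bound\<close> replaces this pointwise by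
  a Gaussian factor with random variance.\<close>

lemma conditional_clt:
  fixes W :: "'w \<Rightarrow> complex"
  assumes W[measurable]: "W \<in> borel_measurable F" and W1: "\<And>\<omega>. cmod (W \<omega>) \<le> 1"
  shows "cmod ((\<integral>\<omega>. indicator E \<omega> * (W \<omega> * iexp (u * ((\<Sum>i\<in>J. f \<omega> (Z i \<omega>)) - card J * cmean \<omega>) / sqrt (card J))) \<partial>P) -
      (\<integral>\<omega>. indicator E \<omega> * (W \<omega> * exp (- (u\<^sup>2 * cvar \<omega> / 2))) \<partial>P)) \<le> clt_err u B (card J)"
proof -
  let ?n = "card J"
  have n: "?n \<ge> 1" using J by (simp add: Suc_le_eq card_gt_0_iff)
  have [measurable]: "cmean \<in> borel_measurable P" "cvar \<in> borel_measurable P" "W \<in> borel_measurable P" by (rule F_meas, measurable)+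
  define c where "c \<omega> = (\<integral>y. iexp (u / sqrt ?n * (f \<omega> y - cmean \<omega>)) \<partial>L \<omega>)" for \<omega>
  have err: "cmod (c \<omega> ^ ?n - exp (- (u\<^sup>2 * cvar \<omega> / 2))) \<le> clt_err u B ?n" if w: "\<omega> \<in> space P" for \<omega>
  proof -
    interpret L: prob_space "L \<omega>" by (rule prob_L[OF w])
    show ?thesis
      using L.char_power_bound(1)[OF f_L_measurable[OF w] B n, of u] by (simp add: cvar_def c_def cmean_def)
  qed
  define H where "H = (\<lambda>(\<omega>, z). W \<omega> * (\<Prod>i\<in>J. iexp (u / sqrt ?n * (f \<omega> (z i) - cmean \<omega>))))"
  have Hm: "H \<in> borel_measurable (F \<Otimes>\<^sub>M PiM J (\<lambda>_. K))"
    unfolding H_def split_beta'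
  proof (intro borel_measurable_times borel_measurable_prod)
    fix i assume "i \<in> J"
    from f_component_measurable[OF this, unfolded split_beta'] have [measurable]:
      "(\<lambda>x. f (fst x) (snd x i)) \<in> borel_measurable (F \<Otimes>\<^sub>M PiM J (\<lambda>_. K))" .
    show "(\<lambda>x. iexp (u / sqrt ?n * (f (fst x) (snd x i) - cmean (fst x)))) \<in> borel_measurable (F \<Otimes>\<^sub>M PiM J (\<lambda>_. K))"
      by measurable
  qed measurable
  have H1: "cmod (H x) \<le> 1" for x
    by (cases x) (simp add: H_def norm_mult prod_norm[symmetric] W1)
  have Hi: "(\<integral>z. H (\<omega>, z) \<partial>samples_law \<omega>) = W \<omega> * c \<omega> ^ ?n" if w: "\<omega> \<in> space P" for \<omega>
  proof -
    interpret L: prob_space "L \<omega>" by (rule prob_L[OF w])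
    interpret product_sigma_finite "\<lambda>_. L \<omega>" ..
    have [measurable]: "f \<omega> \<in> borel_measurable (L \<omega>)" by (rule f_L_measurable[OF w])
    have "(\<integral>z. (\<Prod>i\<in>J. iexp (u / sqrt ?n * (f \<omega> (z i) - cmean \<omega>))) \<partial>samples_law \<omega>) = (\<Prod>i\<in>J. c \<omega>)"
      unfolding samples_law_def c_def
      by (rule product_integral_prod[OF J(1)]) (rule L.integrable_const_bound[where B=1], simp, measurable)
    then show ?thesis by (simp add: H_def)
  qed
  have Hs: "H (\<omega>, sample \<omega>) = W \<omega> * iexp (u * ((\<Sum>i\<in>J. f \<omega> (Z i \<omega>)) - ?n * cmean \<omega>) / sqrt ?n)" for \<omega>
  proof -
    have "(\<Prod>i\<in>J. iexp (u / sqrt ?n * (f \<omega> (sample \<omega> i) - cmean \<omega>))) = exp (\<Sum>i\<in>J. \<i> * complex_of_real (u / sqrt ?n * (f \<omega> (sample \<omega> i) - cmean \<omega>)))"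
      using J(1) by (simp add: exp_sum)
    also have "(\<Sum>i\<in>J. \<i> * complex_of_real (u / sqrt ?n * (f \<omega> (sample \<omega> i) - cmean \<omega>))) =
        \<i> * complex_of_real (u / sqrt ?n * (\<Sum>i\<in>J. f \<omega> (sample \<omega> i) - cmean \<omega>))"
      by (simp only: sum_distrib_left of_real_sum)
    also have "(\<Sum>i\<in>J. f \<omega> (sample \<omega> i) - cmean \<omega>) = (\<Sum>i\<in>J. f \<omega> (Z i \<omega>)) - ?n * cmean \<omega>"
      by (simp add: sum_subtractf sample_def)
    finally show ?thesis by (simp add: H_def)
  qed
  have 1: "(\<integral>\<omega>. indicator E \<omega> * (W \<omega> * iexp (u * ((\<Sum>i\<in>J. f \<omega> (Z i \<omega>)) - ?n * cmean \<omega>) / sqrt ?n)) \<partial>P) =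
      (\<integral>\<omega>. indicator E \<omega> * (W \<omega> * c \<omega> ^ ?n) \<partial>P)"
    unfolding Hs[symmetric] joint_integral_complex[OF Hm H1]
    by (intro Bochner_Integration.integral_cong refl) (simp add: Hi)
  have ex1: "cmod (exp (- (u\<^sup>2 * cvar \<omega> / 2))) \<le> 1" if "\<omega> \<in> space P" for \<omega>
    using cvar_bounds(1)[OF that] by simp
  have c1: "cmod (c \<omega>) \<le> 1" if w: "\<omega> \<in> space P" for \<omega>
  proof -
    interpret L: prob_space "L \<omega>" by (rule prob_L[OF w])
    have "cmod (c \<omega>) \<le> (\<integral>y. cmod (iexp (u / sqrt ?n * (f \<omega> y - cmean \<omega>))) \<partial>L \<omega>)"
      unfolding c_def by (rule integral_norm_bound)
    then show ?thesis by (simp add: L.prob_space)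
  qed
  have e0: "0 \<le> clt_err u B ?n" using B_nonneg by (simp add: clt_err_def)
  have i2: "integrable P (\<lambda>\<omega>. indicator E \<omega> * (W \<omega> * exp (- (u\<^sup>2 * cvar \<omega> / 2))))"
    using ex1 W1 by (intro integrable_const_bound[where B=1]) (auto intro!: AE_I2 mult_le_one simp: norm_mult indicator_def)
  have cm: "c \<in> borel_measurable P"
  proof -
    have [measurable]: "(\<lambda>x. u / sqrt ?n * (f (fst x) (snd x) - cmean (fst x))) \<in> borel_measurable (F \<Otimes>\<^sub>M K)"
      using f unfolding split_beta' by measurable
    have "(\<lambda>\<omega>. \<integral>y. cos (u / sqrt ?n * (f \<omega> y - cmean \<omega>)) \<partial>L \<omega>) \<in> borel_measurable P"
      "(\<lambda>\<omega>. \<integral>y. sin (u / sqrt ?n * (f \<omega> y - cmean \<omega>)) \<partial>L \<omega>) \<in> borel_measurable P"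
      by (rule F_meas[OF borel_measurable_integral_kernel[OF _ kernel]], unfold split_beta',
        intro measurable_compose[OF _ borel_measurable_cos] measurable_compose[OF _ borel_measurable_sin], measurable)+
    then have "(\<lambda>\<omega>. Complex (\<integral>y. cos (u / sqrt ?n * (f \<omega> y - cmean \<omega>)) \<partial>L \<omega>) (\<integral>y. sin (u / sqrt ?n * (f \<omega> y - cmean \<omega>)) \<partial>L \<omega>)) \<in> borel_measurable P"
      unfolding Complex_eq by measurable
    moreover have "c \<omega> = Complex (\<integral>y. cos (u / sqrt ?n * (f \<omega> y - cmean \<omega>)) \<partial>L \<omega>) (\<integral>y. sin (u / sqrt ?n * (f \<omega> y - cmean \<omega>)) \<partial>L \<omega>)"
      if w: "\<omega> \<in> space P" for \<omega>
    proof -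
      interpret L: prob_space "L \<omega>" by (rule prob_L[OF w])
      have [measurable]: "f \<omega> \<in> borel_measurable (L \<omega>)" by (rule f_L_measurable[OF w])
      have i: "integrable (L \<omega>) (\<lambda>y. iexp (u / sqrt ?n * (f \<omega> y - cmean \<omega>)))"
        by (rule L.integrable_const_bound[where B=1], simp, measurable)
      have "Re (iexp x) = cos x" "Im (iexp x) = sin x" for x by (simp_all add: Re_exp Im_exp)
      then show ?thesis unfolding c_def
        by (intro complex_eqI) (simp_all only: complex.sel integral_Re[OF i, symmetric] integral_Im[OF i, symmetric])
    qed
    ultimately show ?thesis by (simp cong: measurable_cong)
  qed
  have i1: "integrable P (\<lambda>\<omega>. indicator E \<omega> * (W \<omega> * c \<omega> ^ ?n))"
    using c1 W1 cm by (intro integrable_const_bound[where B=1]) (auto intro!: AE_I2 mult_le_one power_le_one simp: norm_mult norm_power indicator_def)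
  have "cmod ((\<integral>\<omega>. indicator E \<omega> * (W \<omega> * c \<omega> ^ ?n) \<partial>P) - (\<integral>\<omega>. indicator E \<omega> * (W \<omega> * exp (- (u\<^sup>2 * cvar \<omega> / 2))) \<partial>P)) =
     cmod (\<integral>\<omega>. indicator E \<omega> * (W \<omega> * (c \<omega> ^ ?n - exp (- (u\<^sup>2 * cvar \<omega> / 2)))) \<partial>P)"
    using i1 i2 by (simp add: right_diff_distrib)
  also have "\<dots> \<le> (\<integral>\<omega>. cmod (indicator E \<omega> * (W \<omega> * (c \<omega> ^ ?n - exp (- (u\<^sup>2 * cvar \<omega> / 2))))) \<partial>P)"
    by (rule integral_norm_bound)
  also have "\<dots> \<le> (\<integral>\<omega>. clt_err u B ?n \<partial>P)"
  proof (rule integral_mono)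
    show "integrable P (\<lambda>\<omega>. cmod (indicator E \<omega> * (W \<omega> * (c \<omega> ^ ?n - exp (- (u\<^sup>2 * cvar \<omega> / 2))))))"
      using i1 i2 by (intro integrable_norm) (simp add: right_diff_distrib)
    fix \<omega> assume w: "\<omega> \<in> space P"
    have "cmod (W \<omega>) * cmod (c \<omega> ^ ?n - exp (- (u\<^sup>2 * cvar \<omega> / 2))) \<le> 1 * clt_err u B ?n"
      by (intro mult_mono err[OF w] W1) auto
    then show "cmod (indicator E \<omega> * (W \<omega> * (c \<omega> ^ ?n - exp (- (u\<^sup>2 * cvar \<omega> / 2))))) \<le> clt_err u B ?n"
      using e0 by (auto simp: norm_mult indicator_def)
  qed simp
  finally show ?thesis unfolding 1 by (simp add: prob_space)
qed

end

end

section \<open>Backward and forward operators\<close>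

declare restrict_upd [simp del]

text \<open>Working with total functions instead of extensional paths on \<open>{..t}\<close> means
  that updating a coordinate never changes the space, so paths with only coordinate \<open>t\<close>
  set and paths lengthened at either end can all be handled by one measurable space.\<close>

abbreviation all_paths :: "(nat \<Rightarrow> 'x::polish_space) measure" where
  "all_paths \<equiv> PiM UNIV (\<lambda>_. borel)"

lemma space_all_paths[simp]: "space (all_paths :: (nat \<Rightarrow> 'x::polish_space) measure) = UNIV"
  by (simp add: space_PiM)

lemma measurable_path_update[measurable (raw)]:
  assumes "f \<in> M \<rightarrow>\<^sub>M all_paths" "g \<in> M \<rightarrow>\<^sub>M borel"
  shows "(\<lambda>x. (f x)(s := g x)) \<in> M \<rightarrow>\<^sub>M all_paths"
  by (rule measurable_fun_upd[where J=UNIV]) (use assms in auto)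

lemma measurable_singleton_path[measurable]: "(\<lambda>x. \<lambda>i\<in>{t}. x) \<in> borel \<rightarrow>\<^sub>M all_paths"
  unfolding restrict_def by (rule measurable_PiM_single') (auto simp: PiE_iff)

text \<open>The backward recursion sets the earlier coordinate last, whereas forward steps append
  the later one; this switches between the two views.\<close>

lemma singleton_path_update: "(\<lambda>i\<in>{Suc t}. x)(t := z) = (\<lambda>i\<in>{t}. z)(Suc t := x)"
  by (auto simp: fun_eq_iff)

text \<open>The recursion overwrites only coordinates below \<open>t\<close>, so \<open>f\<close> is
  evaluated only at paths that agree with \<open>y\<close> from \<open>t\<close> on.\<close>

lemma backward_path_cong:
  assumes "\<And>z. (\<And>i. i \<ge> t \<Longrightarrow> z i = y i) \<Longrightarrow> f z = f' z"
  shows "backward_path m \<eta> t f y = backward_path m \<eta> t f' y"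
  using assms
proof (induction t arbitrary: y)
  case (Suc t)
  have "backward_path m \<eta> t f (y(t := z)) = backward_path m \<eta> t f' (y(t := z))" for z
    by (rule Suc.IH) (use Suc.prems in auto)
  then show ?case by simp
qed simp

lemma backward_path_upd:
  "t < s \<Longrightarrow> backward_path m \<eta> t f (y(s := c)) = backward_path m \<eta> t (\<lambda>z. f (z(s := c))) y"
proof (induction t arbitrary: y)
  case (Suc t)
  have "backward_path m \<eta> t f ((y(s := c))(t := z)) = backward_path m \<eta> t (\<lambda>z. f (z(s := c))) (y(t := z))" for z
    using Suc.IH[of "y(t := z)"] Suc.prems by (simp add: fun_upd_twist del: fun_upd_apply)
  moreover have "(y(s := c)) (Suc t) = y (Suc t)" using Suc.prems by simp
  ultimately show ?case by (simp del: fun_upd_apply)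
qed simp

text \<open>A coordinate from \<open>t\<close> on is never integrated, so a factor depending on it
  comes out of every numerator; the denominators are untouched and may vanish.\<close>

lemma backward_path_mult:
  "t \<le> s \<Longrightarrow> backward_path m \<eta> t (\<lambda>z. c (z s) * f z) y = c (y s) * backward_path m \<eta> t f y"
proof (induction t arbitrary: y)
  case (Suc t)
  have "backward_path m \<eta> t (\<lambda>z. c (z s) * f z) (y(t := z)) = c (y s) * backward_path m \<eta> t f (y(t := z))" for z
    using Suc.IH[of "y(t := z)"] Suc.prems by (simp del: fun_upd_apply) simp
  then show ?case by (simp add: backward_def mult.left_commute[of _ "c (y s)"])
qed simp

text \<open>Updates at indices in \<open>A\<close> keep a path extensional. This allows a function
  given only on extensional paths to be exchanged for its extension to
  \<open>all_paths\<close>.\<close>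

lemma backward_path_extensional_cong:
  assumes "\<And>z. z \<in> extensional A \<Longrightarrow> f z = f' z" "{..t} \<subseteq> A" "y \<in> extensional A"
  shows "backward_path m \<eta> t f y = backward_path m \<eta> t f' y"
  using assms(2,3)
proof (induction t arbitrary: y)
  case (Suc t)
  have "t \<in> A" using Suc.prems by auto
  then have "y(t := z) \<in> extensional A" for z using Suc.prems by (auto simp: extensional_def)
  then show ?case using Suc by (simp add: atMost_Suc)
qed (use assms(1) in simp)

text \<open>The same calculus serves the limiting filters and the weighted empirical measures. Only
  finiteness of the measures is asked for, because an empirical measure is zero when its weights
  vanish, and only below \<open>n\<close>, because the filters are under control up to the
  horizon.\<close>

locale backward_kernels =
  fixes m :: "'x::polish_space \<Rightarrow> 'x \<Rightarrow> real" and \<eta> :: "nat \<Rightarrow> 'x measure" and n :: nat and Cm :: real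
  assumes m_measurable: "(\<lambda>(x, x'). m x x') \<in> borel_measurable (borel \<Otimes>\<^sub>M borel)"
    and m_nonneg: "m x x' \<ge> 0" and m_le: "m x x' \<le> Cm"
    and finite_eta: "s < n \<Longrightarrow> finite_measure (\<eta> s)"
    and sets_eta: "s < n \<Longrightarrow> sets (\<eta> s) = sets borel"
begin

lemma m_meas[measurable (raw)]:
  assumes "f \<in> M \<rightarrow>\<^sub>M borel" "g \<in> M \<rightarrow>\<^sub>M borel"
  shows "(\<lambda>x. m (f x) (g x)) \<in> borel_measurable M"
  using measurable_compose[OF measurable_Pair[OF assms] m_measurable] by simp

lemma backward_path_measurable[measurable]:
  assumes f[measurable]: "f \<in> borel_measurable all_paths" and "t \<le> n"
  shows "backward_path m \<eta> t f \<in> borel_measurable all_paths"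
  using assms(2)
proof (induction t)
  case 0
  have "backward_path m \<eta> 0 f = f" by (simp add: fun_eq_iff)
  then show ?case by simp
next
  case (Suc t)
  interpret e: finite_measure "\<eta> t" using Suc.prems by (intro finite_eta) simp
  have [measurable_cong]: "sets (\<eta> t) = sets borel" using Suc.prems by (intro sets_eta) simp
  have [measurable]: "backward_path m \<eta> t f \<in> borel_measurable all_paths" using Suc by simp
  have "backward_path m \<eta> (Suc t) f =
      (\<lambda>y. (\<integral>z. m z (y (Suc t)) * backward_path m \<eta> t f (y(t := z)) \<partial>\<eta> t) / (\<integral>z. m z (y (Suc t)) \<partial>\<eta> t))"
    by (simp add: fun_eq_iff backward_def)
  also have "\<dots> \<in> borel_measurable all_paths"
    by (intro borel_measurable_divide e.borel_measurable_lebesgue_integral) (unfold split_beta', measurable)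
  finally show ?case .
qed

text \<open>Each numerator is at most \<open>B\<close> times its denominator. If the denominator is
  zero, the quotient is \<open>0\<close> by convention, which is within the bound as well.\<close>

lemma backward_path_bound:
  assumes f: "f \<in> borel_measurable all_paths" and B: "\<And>y. \<bar>f y\<bar> \<le> B" and "t \<le> n"
  shows "\<bar>backward_path m \<eta> t f y\<bar> \<le> B"
  using assms(3)
proof (induction t arbitrary: y)
  case (Suc t)
  interpret e: finite_measure "\<eta> t" using Suc.prems by (intro finite_eta) simp
  have [measurable_cong]: "sets (\<eta> t) = sets borel" using Suc.prems by (intro sets_eta) simp
  have [measurable]: "backward_path m \<eta> t f \<in> borel_measurable all_paths"
    using Suc.prems by (intro backward_path_measurable f) simp
  have B0: "B \<ge> 0" using B[of undefined] by linarith
  let ?d = "\<integral>z. m z (y (Suc t)) \<partial>\<eta> t"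
  have im: "integrable (\<eta> t) (\<lambda>z. m z (y (Suc t)))"
    by (rule e.integrable_const_bound[where B=Cm]) (auto simp: m_nonneg m_le)
  have d0: "?d \<ge> 0" by (simp add: m_nonneg)
  have "\<bar>\<integral>z. m z (y (Suc t)) * backward_path m \<eta> t f (y(t := z)) \<partial>\<eta> t\<bar> \<le>
      (\<integral>z. \<bar>m z (y (Suc t)) * backward_path m \<eta> t f (y(t := z))\<bar> \<partial>\<eta> t)" by (rule integral_abs_bound)
  also have "\<dots> \<le> (\<integral>z. m z (y (Suc t)) * B \<partial>\<eta> t)"
  proof (rule integral_mono)
    show "integrable (\<eta> t) (\<lambda>z. \<bar>m z (y (Suc t)) * backward_path m \<eta> t f (y(t := z))\<bar>)"
      by (rule Bochner_Integration.integrable_bound[OF integrable_mult_left[OF im, of B]])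
         (use Suc B0 in \<open>auto simp: abs_mult m_nonneg intro!: mult_left_mono\<close>)
    show "\<bar>m z (y (Suc t)) * backward_path m \<eta> t f (y(t := z))\<bar> \<le> m z (y (Suc t)) * B" for z
      using Suc by (simp add: abs_mult m_nonneg mult_left_mono)
  qed (use im in simp)
  finally have le: "\<bar>\<integral>z. m z (y (Suc t)) * backward_path m \<eta> t f (y(t := z)) \<partial>\<eta> t\<bar> \<le> ?d * B" by simp
  show ?case
  proof (cases "?d = 0")
    case False
    then show ?thesis using le d0 by (simp add: backward_def abs_mult pos_divide_le_eq mult.commute)
  qed (simp add: backward_def B0)
qed (simp add: B)

lemma integrable_backward:
  assumes f: "f \<in> borel_measurable all_paths" and B: "\<And>y. \<bar>f y\<bar> \<le> B" and "t < n"
  shows "integrable (\<eta> t) (\<lambda>z. m z x * backward_path m \<eta> t f (y(t := z)))"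
    "integrable (\<eta> t) (\<lambda>z. m z x)"
    "integrable (\<eta> t) (\<lambda>z. backward_path m \<eta> t f (\<lambda>i\<in>{t}. z))"
proof -
  interpret e: finite_measure "\<eta> t" using assms by (intro finite_eta) simp
  have [measurable_cong]: "sets (\<eta> t) = sets borel" using assms by (intro sets_eta) simp
  have [measurable]: "backward_path m \<eta> t f \<in> borel_measurable all_paths"
    using assms by (intro backward_path_measurable f) simp
  have b: "\<bar>backward_path m \<eta> t f y\<bar> \<le> B" for y using assms by (intro backward_path_bound) auto
  have C0: "Cm \<ge> 0" using m_nonneg[of undefined undefined] m_le[of undefined undefined] by linarith
  show "integrable (\<eta> t) (\<lambda>z. m z x * backward_path m \<eta> t f (y(t := z)))"
    by (rule e.integrable_const_bound[where B="Cm * B"])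
       (auto simp: abs_mult m_nonneg intro!: AE_I2 mult_mono m_le b C0)
  show "integrable (\<eta> t) (\<lambda>z. m z x)"
    by (rule e.integrable_const_bound[where B=Cm]) (auto simp: m_nonneg m_le)
  show "integrable (\<eta> t) (\<lambda>z. backward_path m \<eta> t f (\<lambda>i\<in>{t}. z))"
    by (rule e.integrable_const_bound[where B=B]) (auto simp: b)
qed

lemma backward_path_diff:
  assumes f: "f \<in> borel_measurable all_paths" "\<And>y. \<bar>f y\<bar> \<le> B"
    and g: "g \<in> borel_measurable all_paths" "\<And>y. \<bar>g y\<bar> \<le> B'" and "t \<le> n"
  shows "backward_path m \<eta> t (\<lambda>y. f y - c * g y) y =
    backward_path m \<eta> t f y - c * backward_path m \<eta> t g y"
  using assms(5)
proof (induction t arbitrary: y)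
  case (Suc t)
  then have IH: "backward_path m \<eta> t (\<lambda>y. f y - c * g y) y = backward_path m \<eta> t f y - c * backward_path m \<eta> t g y" for y
    by simp
  have "t < n" using Suc.prems by simp
  note i = integrable_backward(1)[OF f this] integrable_backward(1)[OF g this]
  have "(\<integral>z. m z (y (Suc t)) * (backward_path m \<eta> t f (y(t := z)) - c * backward_path m \<eta> t g (y(t := z))) \<partial>\<eta> t) =
    (\<integral>z. m z (y (Suc t)) * backward_path m \<eta> t f (y(t := z)) \<partial>\<eta> t) - c * (\<integral>z. m z (y (Suc t)) * backward_path m \<eta> t g (y(t := z)) \<partial>\<eta> t)"
    using i by (simp add: right_diff_distrib mult.left_commute[of _ c])
  then show ?case by (simp add: IH backward_def diff_divide_distrib)
qed simp

text \<open>Since \<open>t < s\<close>, no denominator of the recursion involves coordinate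
  \<open>s\<close>, so Fubini applies to the numerators alone.\<close>

lemma backward_path_integral:
  assumes f: "f \<in> borel_measurable all_paths" "\<And>y. \<bar>f y\<bar> \<le> B" and "t \<le> n" "t < s"
    and mu: "finite_measure \<mu>" "sets \<mu> = sets borel"
  shows "backward_path m \<eta> t (\<lambda>y. \<integral>x. f (y(s := x)) \<partial>\<mu>) y = (\<integral>x. backward_path m \<eta> t f (y(s := x)) \<partial>\<mu>)"
  using assms(3,4)
proof (induction t arbitrary: y)
  case (Suc t)
  interpret e: finite_measure "\<eta> t" using Suc.prems by (intro finite_eta) simp
  interpret u: finite_measure \<mu> by fact
  note [measurable_cong] = mu(2)
  have [measurable_cong]: "sets (\<eta> t) = sets borel" using Suc.prems by (intro sets_eta) simp
  have [measurable]: "backward_path m \<eta> t f \<in> borel_measurable all_paths"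
    using Suc.prems by (intro backward_path_measurable f) simp
  have b: "\<bar>backward_path m \<eta> t f y\<bar> \<le> B" for y using Suc.prems by (intro backward_path_bound f) auto
  have C0: "Cm \<ge> 0" using m_nonneg[of undefined undefined] m_le[of undefined undefined] by linarith
  interpret P: pair_sigma_finite "\<eta> t" \<mu> ..
  interpret PF: finite_measure "\<eta> t \<Otimes>\<^sub>M \<mu>" by (rule finite_measure_pair_measure) unfold_locales
  let ?x = "y (Suc t)"
  have int: "integrable (\<eta> t \<Otimes>\<^sub>M \<mu>) (\<lambda>(z, x). m z ?x * backward_path m \<eta> t f (y(t := z, s := x)))"
  proof (rule PF.integrable_const_bound[where B="Cm * B"])
    show "AE p in \<eta> t \<Otimes>\<^sub>M \<mu>. norm (case p of (z, x) \<Rightarrow> m z ?x * backward_path m \<eta> t f (y(t := z, s := x))) \<le> Cm * B"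
      by (auto simp: abs_mult m_nonneg intro!: AE_I2 mult_mono m_le b C0)
  qed (unfold split_beta', measurable)
  have "(\<integral>z. m z ?x * backward_path m \<eta> t (\<lambda>y. \<integral>x. f (y(s := x)) \<partial>\<mu>) (y(t := z)) \<partial>\<eta> t) =
      (\<integral>z. (\<integral>x. m z ?x * backward_path m \<eta> t f (y(t := z, s := x)) \<partial>\<mu>) \<partial>\<eta> t)"
    using Suc by (simp del: fun_upd_apply)
  also have "\<dots> = (\<integral>x. (\<integral>z. m z ?x * backward_path m \<eta> t f (y(t := z, s := x)) \<partial>\<eta> t) \<partial>\<mu>)"
    by (rule P.Fubini_integral[OF int, symmetric])
  finally show ?case
    using Suc.prems by (simp add: backward_def fun_upd_twist del: fun_upd_apply) simp
qed simp

end

section \<open>The model with explicit uniform bounds and its one-step operators\<close>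

locale bounded_smc = smc_model S T
  for S :: "('x::polish_space, 'y::polish_space) smc_model" and T :: nat +
  fixes Cg Cm Ca Cw :: real
  assumes lik_le: "t \<le> T \<Longrightarrow> lik S t x \<le> Cg"
    and trans_le: "trans_density S x x' \<le> Cm"
    and adj_le: "t \<in> {1..T} \<Longrightarrow> adj_mult S t x \<le> Ca"
    and init_weight_le: "init_weight S x \<le> Cw"
    and weight_le: "t \<in> {1..T} \<Longrightarrow> weight S t x x' \<le> Cw"
    and norm_pos: "smoothing_norm S T > 0"
begin

abbreviation "m \<equiv> trans_density S"
abbreviation "\<nu> \<equiv> ref_measure S"
abbreviation "g \<equiv> lik S"

lemmas sets_ref[measurable_cong] = ref_measure(2)

sublocale nu: sigma_finite_measure \<nu> by (rule ref_measure)

lemma m_meas[measurable (raw)]: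
  assumes "f \<in> M \<rightarrow>\<^sub>M borel" "h \<in> M \<rightarrow>\<^sub>M borel"
  shows "(\<lambda>x. m (f x) (h x)) \<in> borel_measurable M"
  using measurable_compose[OF measurable_Pair[OF assms] trans_density_measurable] by simp

lemma lik_measurable[measurable]: "g t \<in> borel_measurable borel"
proof -
  have "(\<lambda>x. case (x, obs S t) of (x, y) \<Rightarrow> likelihood S x y) \<in> borel_measurable borel"
    by (rule measurable_compose[OF measurable_Pair likelihood_measurable]) auto
  then show ?thesis by (simp add: lik_def[abs_def])
qed

lemma lik_nonneg: "g t x \<ge> 0" by (simp add: lik_def likelihood_nonneg)

lemma C_nonneg: "Cg \<ge> 0" "Cm \<ge> 0"
  using lik_nonneg[of 0] lik_le[of 0] trans_le trans_density_nonneg by (meson le0 order_trans)+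

lemma prob_trans: "prob_space (trans_kernel S x)" "sets (trans_kernel S x) = sets borel"
  using measurable_space[OF trans_kernel, of x] by (simp_all add: space_prob_algebra)

lemma trans_integral:
  fixes f :: "'x \<Rightarrow> real" assumes "f \<in> borel_measurable borel"
  shows "(\<integral>z. f z \<partial>trans_kernel S x) = (\<integral>z. m x z * f z \<partial>\<nu>)"
  unfolding trans_kernel_eq using assms trans_density_nonneg by (subst integral_density) auto

lemma trans_integrable:
  fixes f :: "'x \<Rightarrow> real" assumes f[measurable]: "f \<in> borel_measurable borel" and "\<And>x. \<bar>f x\<bar> \<le> B"
  shows "integrable \<nu> (\<lambda>z. m x z * f z)" "\<bar>\<integral>z. m x z * f z \<partial>\<nu>\<bar> \<le> B"
proof -
  interpret t: prob_space "trans_kernel S x" by (rule prob_trans)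
  note [measurable_cong] = prob_trans(2)
  have i: "integrable (trans_kernel S x) f"
    by (rule t.integrable_const_bound[where B=B]) (auto simp: assms)
  then show "integrable \<nu> (\<lambda>z. m x z * f z)"
    unfolding trans_kernel_eq using trans_density_nonneg by (subst (asm) integrable_density) auto
  have "\<bar>t.expectation f\<bar> \<le> t.expectation (\<lambda>x. \<bar>f x\<bar>)" by (rule integral_abs_bound)
  also have "\<dots> \<le> t.expectation (\<lambda>_. B)" using i by (intro integral_mono) (auto simp: assms)
  finally show "\<bar>\<integral>z. m x z * f z \<partial>\<nu>\<bar> \<le> B" by (simp add: trans_integral[symmetric] t.prob_space)
qed

lemma trans_total: "integrable \<nu> (\<lambda>z. m x z)" "(\<integral>z. m x z \<partial>\<nu>) = 1"
proof -
  interpret t: prob_space "trans_kernel S x" by (rule prob_trans)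
  show "integrable \<nu> (\<lambda>z. m x z)" using trans_integrable(1)[of "\<lambda>_. 1" 1 x] by simp
  show "(\<integral>z. m x z \<partial>\<nu>) = 1" using trans_integral[of "\<lambda>_. 1" x] t.prob_space by simp
qed

text \<open>The reference measure may be infinite. Integrability on the product holds because
  \<open>m z\<close> is a probability density for every \<open>z\<close>, so integrating over
  \<open>\<nu>\<close> before \<open>\<eta>\<close> yields at most \<open>B\<close> times the finite
  mass of \<open>\<eta>\<close>.\<close>

lemma trans_fubini:
  assumes \<eta>: "finite_measure \<eta>" "sets \<eta> = sets borel"
    and G[measurable]: "(\<lambda>(z, x). G z x) \<in> borel_measurable (borel \<Otimes>\<^sub>M borel)"
    and B: "\<And>z x. \<bar>G z x\<bar> \<le> B"
  shows "integrable (\<eta> \<Otimes>\<^sub>M \<nu>) (\<lambda>(z, x). m z x * G z x)"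
    "(\<integral>z. (\<integral>x. m z x * G z x \<partial>\<nu>) \<partial>\<eta>) = (\<integral>x. (\<integral>z. m z x * G z x \<partial>\<eta>) \<partial>\<nu>)"
proof -
  interpret e: finite_measure \<eta> by fact
  note [measurable_cong] = \<eta>(2)
  interpret P: pair_sigma_finite \<eta> \<nu> ..
  have B0: "B \<ge> 0" using B[of undefined undefined] by linarith
  have mm: "(\<lambda>(z, x). m z x * G z x) \<in> borel_measurable (\<eta> \<Otimes>\<^sub>M \<nu>)"
    using G unfolding split_beta' by measurable
  have Gz: "(\<lambda>x. \<bar>G z x\<bar>) \<in> borel_measurable borel" "G z \<in> borel_measurable borel" for z
    using measurable_Pair2[OF G, of z] by auto
  show int: "integrable (\<eta> \<Otimes>\<^sub>M \<nu>) (\<lambda>(z, x). m z x * G z x)"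
  proof (rule P.Fubini_integrable[OF mm])
    have "(\<lambda>z. \<integral>x. m z x * \<bar>G z x\<bar> \<partial>\<nu>) \<in> borel_measurable \<eta>"
      using G by (intro nu.borel_measurable_lebesgue_integral) (unfold split_beta', measurable)
    then have "integrable \<eta> (\<lambda>z. \<integral>x. m z x * \<bar>G z x\<bar> \<partial>\<nu>)"
      using trans_integrable(2)[OF Gz(1), where B=B] B by (intro e.integrable_const_bound[where B=B]) auto
    then show "integrable \<eta> (\<lambda>z. \<integral>x. norm (case (z, x) of (z, x) \<Rightarrow> m z x * G z x) \<partial>\<nu>)"
      by (simp add: abs_mult trans_density_nonneg)
    show "AE z in \<eta>. integrable \<nu> (\<lambda>x. case (z, x) of (z, x) \<Rightarrow> m z x * G z x)"
      using trans_integrable(1)[OF Gz(2) B] by simp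
  qed
  show "(\<integral>z. (\<integral>x. m z x * G z x \<partial>\<nu>) \<partial>\<eta>) = (\<integral>x. (\<integral>z. m z x * G z x \<partial>\<eta>) \<partial>\<nu>)"
    by (rule P.Fubini_integral[OF int, symmetric])
qed

text \<open>The operator \<open>Q\<close> on functions of a whole path: coordinate
  \<open>Suc t\<close> is drawn from the transition kernel, weighted by its likelihood and
  integrated out. Its restriction to functions of the newest coordinate alone is
  \<open>predict\<close>, which acts on functions of one state.\<close>

definition forward_step :: "nat \<Rightarrow> ((nat \<Rightarrow> 'x) \<Rightarrow> real) \<Rightarrow> (nat \<Rightarrow> 'x) \<Rightarrow> real" where
  "forward_step t f y = (\<integral>x. m (y t) x * (g (Suc t) x * f (y(Suc t := x))) \<partial>\<nu>)"

definition predict :: "nat \<Rightarrow> ('x \<Rightarrow> real) \<Rightarrow> 'x \<Rightarrow> real" where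
  "predict t b z = (\<integral>x. m z x * (g (Suc t) x * b x) \<partial>\<nu>)"

lemma forward_step_measurable[measurable]:
  assumes [measurable]: "f \<in> borel_measurable all_paths"
  shows "forward_step t f \<in> borel_measurable all_paths"
  unfolding forward_step_def[abs_def]
  by (intro nu.borel_measurable_lebesgue_integral) (unfold split_beta', measurable)

lemma predict_measurable[measurable]:
  assumes [measurable]: "b \<in> borel_measurable borel"
  shows "predict t b \<in> borel_measurable borel"
  unfolding predict_def[abs_def]
  by (intro nu.borel_measurable_lebesgue_integral) (unfold split_beta', measurable)

lemma lik_mult_bound: "t \<le> T \<Longrightarrow> \<bar>a\<bar> \<le> B \<Longrightarrow> \<bar>g t x * a\<bar> \<le> Cg * B"
  using lik_le[of t x] lik_nonneg[of t x] by (auto simp: abs_mult intro: mult_mono C_nonneg)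

lemma forward_step_bound:
  assumes [measurable]: "f \<in> borel_measurable all_paths" and "\<And>y. \<bar>f y\<bar> \<le> B" and "Suc t \<le> T"
  shows "\<bar>forward_step t f y\<bar> \<le> Cg * B"
  unfolding forward_step_def by (rule trans_integrable(2)) (auto intro: lik_mult_bound assms)

lemma predict_bound:
  assumes [measurable]: "b \<in> borel_measurable borel" and "\<And>y. \<bar>b y\<bar> \<le> B" and "Suc t \<le> T"
  shows "\<bar>predict t b z\<bar> \<le> Cg * B"
  unfolding predict_def by (rule trans_integrable(2)) (auto intro: lik_mult_bound assms)

lemma forward_step_last: "forward_step t (\<lambda>y. b (y (Suc t))) y = predict t b (y t)"
  by (simp add: forward_step_def predict_def)

text \<open>Multiplying by the normalisation of the backward kernel also covers the case where it vanishes.\<close>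

lemma backward_path_normalised:
  assumes bk: "backward_kernels m \<eta> n Cm" and t: "t < n"
    and f: "f \<in> borel_measurable all_paths" "\<And>y. \<bar>f y\<bar> \<le> B"
  shows "(\<integral>z. m z x \<partial>\<eta> t) * backward_path m \<eta> (Suc t) f (\<lambda>i\<in>{Suc t}. x) =
    (\<integral>z. m z x * backward_path m \<eta> t f ((\<lambda>i\<in>{t}. z)(Suc t := x)) \<partial>\<eta> t)"
    "(\<integral>z. m z x \<partial>\<eta> t) * backward_path m \<eta> (Suc t) f (\<lambda>i\<in>{Suc t}. x) =
    (\<integral>z. backward_path m \<eta> t (\<lambda>y. m (y t) x * f (y(Suc t := x))) (\<lambda>i\<in>{t}. z) \<partial>\<eta> t)"
proof -
  interpret backward_kernels m \<eta> n Cm by fact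
  interpret e: finite_measure "\<eta> t" using t by (rule finite_eta)
  let ?d = "\<integral>z. m z x \<partial>\<eta> t" and ?n = "\<integral>z. m z x * backward_path m \<eta> t f ((\<lambda>i\<in>{t}. z)(Suc t := x)) \<partial>\<eta> t"
  have eq: "backward_path m \<eta> (Suc t) f (\<lambda>i\<in>{Suc t}. x) = ?n / ?d"
    by (simp add: backward_def singleton_path_update del: fun_upd_apply)
  show 1: "?d * backward_path m \<eta> (Suc t) f (\<lambda>i\<in>{Suc t}. x) = ?n"
  proof (cases "?d = 0")
    case True
    \<comment> \<open>A vanishing denominator forces \<open>m z x = 0\<close> for almost every
      \<open>z\<close>, so the numerator vanishes with it and the product form survives.\<close>
    have "AE z in \<eta> t. m z x = 0"
      using True integral_nonneg_eq_0_iff_AE[OF integrable_backward(2)[OF f t, of x]] by (simp add: trans_density_nonneg)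
    then have "?n = (\<integral>z. 0 \<partial>\<eta> t)"
      using borel_measurable_integrable[OF integrable_backward(1)[OF f t, of x "\<lambda>i\<in>{Suc t}. x"]]
      unfolding singleton_path_update by (intro integral_cong_AE) auto
    then show ?thesis using True by simp
  qed (simp add: eq del: backward_path.simps)
  have "backward_path m \<eta> t (\<lambda>y. m (y t) x * f (y(Suc t := x))) (\<lambda>i\<in>{t}. z) =
      m z x * backward_path m \<eta> t f ((\<lambda>i\<in>{t}. z)(Suc t := x))" for z
    by (subst backward_path_mult) (simp_all add: backward_path_upd)
  then show "?d * backward_path m \<eta> (Suc t) f (\<lambda>i\<in>{Suc t}. x) =
    (\<integral>z. backward_path m \<eta> t (\<lambda>y. m (y t) x * f (y(Suc t := x))) (\<lambda>i\<in>{t}. z) \<partial>\<eta> t)"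
    using 1 by simp
qed

text \<open>Predicting forward from \<open>\<eta> t\<close> has density
  \<open>\<integral>z. m z x \<partial>\<eta> t\<close> at \<open>x\<close>, and this is exactly the
  denominator of the last backward kernel at \<open>x\<close>. What remains is a double integral
  that can also be read as a forward step followed by the first \<open>t\<close> backward kernels.
  Nothing about \<open>\<eta>\<close> beyond finiteness enters, so the identity holds both for each
  realisation of the particles and for the filters.\<close>

lemma backward_forward_step:
  assumes bk: "backward_kernels m \<eta> n Cm" and t: "t < n" "Suc t \<le> T"
    and f: "f \<in> borel_measurable all_paths" "\<And>y. \<bar>f y\<bar> \<le> B"
  shows "(\<integral>z. predict t (\<lambda>x. backward_path m \<eta> (Suc t) f (\<lambda>i\<in>{Suc t}. x)) z \<partial>\<eta> t) =
    (\<integral>z. backward_path m \<eta> t (forward_step t f) (\<lambda>i\<in>{t}. z) \<partial>\<eta> t)"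
proof -
  interpret backward_kernels m \<eta> n Cm by fact
  have e: "finite_measure (\<eta> t)" "sets (\<eta> t) = sets borel" using t finite_eta sets_eta by auto
  define G where "G = (\<lambda>z x. g (Suc t) x * backward_path m \<eta> t f ((\<lambda>i\<in>{t}. z)(Suc t := x)))"
  define b where "b x = backward_path m \<eta> (Suc t) f (\<lambda>i\<in>{Suc t}. x)" for x
  have [measurable]: "backward_path m \<eta> t f \<in> borel_measurable all_paths" "backward_path m \<eta> (Suc t) f \<in> borel_measurable all_paths"
    using t by (auto intro!: backward_path_measurable f)
  have [measurable]: "b \<in> borel_measurable borel" unfolding b_def by measurable
  have bb: "\<bar>b x\<bar> \<le> B" for x unfolding b_def using t by (intro backward_path_bound f) auto
  have Gm: "(\<lambda>(z, x). G z x) \<in> borel_measurable (borel \<Otimes>\<^sub>M borel)" unfolding G_def split_beta' by measurable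
  have GB: "\<bar>G z x\<bar> \<le> Cg * B" for z x
    unfolding G_def using t by (intro lik_mult_bound backward_path_bound f) auto
  \<comment> \<open>Coordinate \<open>t\<close> stays equal to \<open>z\<close> throughout the
    recursion, so the kernel of the forward step can be fixed at \<open>z\<close>; its integration
    variable is a later coordinate and commutes with the backward integrals.\<close>
  have Qf: "backward_path m \<eta> t (forward_step t f) (\<lambda>i\<in>{t}. z) = (\<integral>x. m z x * G z x \<partial>\<nu>)" for z
  proof -
    interpret tr: prob_space "trans_kernel S z" by (rule prob_trans)
    have gf: "(\<lambda>y. g (Suc t) (y (Suc t)) * f y) \<in> borel_measurable all_paths" using f(1) by measurable
    have "backward_path m \<eta> t (forward_step t f) (\<lambda>i\<in>{t}. z) =
        backward_path m \<eta> t (\<lambda>y. \<integral>x. g (Suc t) ((y(Suc t := x)) (Suc t)) * f (y(Suc t := x)) \<partial>trans_kernel S z) (\<lambda>i\<in>{t}. z)"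
    proof (rule backward_path_cong)
      fix y :: "nat \<Rightarrow> 'x" assume "\<And>i. t \<le> i \<Longrightarrow> y i = (\<lambda>i\<in>{t}. z) i"
      then have "y t = z" by simp
      then show "forward_step t f y = (\<integral>x. g (Suc t) ((y(Suc t := x)) (Suc t)) * f (y(Suc t := x)) \<partial>trans_kernel S z)"
        using f(1) by (subst trans_integral) (simp_all add: forward_step_def)
    qed
    also have "\<dots> = (\<integral>x. backward_path m \<eta> t (\<lambda>y. g (Suc t) (y (Suc t)) * f y) ((\<lambda>i\<in>{t}. z)(Suc t := x)) \<partial>trans_kernel S z)"
      using t by (intro backward_path_integral[OF gf lik_mult_bound[OF t(2) f(2)]] prob_trans tr.finite_measure) auto
    also have "\<dots> = (\<integral>x. G z x \<partial>trans_kernel S z)"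
      unfolding G_def by (subst backward_path_mult) simp_all
    also have "\<dots> = (\<integral>x. m z x * G z x \<partial>\<nu>)"
      using measurable_Pair2[OF Gm, of z] by (subst trans_integral) auto
    finally show ?thesis .
  qed
  have "(\<integral>z. backward_path m \<eta> t (forward_step t f) (\<lambda>i\<in>{t}. z) \<partial>\<eta> t) = (\<integral>x. (\<integral>z. m z x * G z x \<partial>\<eta> t) \<partial>\<nu>)"
    unfolding Qf by (rule trans_fubini(2)[OF e Gm GB])
  \<comment> \<open>The inner integral is the numerator of the last backward kernel. The product
    form trades it for denominator times value without distinguishing whether the denominator
    vanishes.\<close>
  also have "\<dots> = (\<integral>x. g (Suc t) x * ((\<integral>z. m z x \<partial>\<eta> t) * b x) \<partial>\<nu>)"
    unfolding b_def backward_path_normalised(1)[OF bk t(1) f] G_def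
    by (simp add: mult.left_commute[of _ "g (Suc t) _"])
  also have "\<dots> = (\<integral>x. (\<integral>z. m z x * (g (Suc t) x * b x) \<partial>\<eta> t) \<partial>\<nu>)"
    by (simp add: ac_simps)
  also have "\<dots> = (\<integral>z. (\<integral>x. m z x * (g (Suc t) x * b x) \<partial>\<nu>) \<partial>\<eta> t)"
    by (rule trans_fubini(2)[OF e, symmetric, where B="Cg * B"]) (unfold split_beta', auto intro: lik_mult_bound[OF t(2) bb])
  finally show ?thesis unfolding predict_def b_def by simp
qed

section \<open>The hidden chain and the unnormalised smoothing measures\<close>

lemma lik_prod_bounds:
  assumes "t \<le> T" shows "0 \<le> (\<Prod>u\<le>t. g u (y u))" "(\<Prod>u\<le>t. g u (y u)) \<le> Cg ^ Suc t"
proof -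
  show "0 \<le> (\<Prod>u\<le>t. g u (y u))" by (simp add: prod_nonneg lik_nonneg)
  have "(\<Prod>u\<le>t. g u (y u)) \<le> (\<Prod>u\<le>t. Cg)"
    using assms by (intro prod_mono) (auto simp: lik_nonneg intro: lik_le)
  then show "(\<Prod>u\<le>t. g u (y u)) \<le> Cg ^ Suc t" by simp
qed

lemma lik_prod_measurable[measurable]: "(\<lambda>y. \<Prod>u\<le>t. g u (y u)) \<in> borel_measurable all_paths"
  by (intro borel_measurable_prod) measurable

text \<open>On extensional paths the coordinates beyond \<open>t\<close> are constantly
  \<open>undefined\<close>, hence measurable.\<close>

lemma path_space_inclusion: "(\<lambda>x. x) \<in> path_space t \<rightarrow>\<^sub>M (all_paths :: (nat \<Rightarrow> 'x) measure)"
proof (rule measurable_PiM_single')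
  fix i
  show "(\<lambda>x. x i) \<in> path_space t \<rightarrow>\<^sub>M (borel :: 'x measure)"
  proof (cases "i \<le> t")
    case False
    then have "x i = undefined" if "x \<in> space (path_space t :: (nat \<Rightarrow> 'x) measure)" for x
      using that by (auto simp: space_PiM PiE_iff extensional_def)
    then show ?thesis by (subst measurable_cong[where g="\<lambda>_. undefined"]) auto
  qed simp
qed auto

lemma path_space_measurable:
  fixes f :: "(nat \<Rightarrow> 'x) \<Rightarrow> 'b"
  shows "f \<in> all_paths \<rightarrow>\<^sub>M N \<Longrightarrow> f \<in> path_space t \<rightarrow>\<^sub>M N"
  by (rule measurable_compose[OF path_space_inclusion])

lemma path_space_upd: "x \<in> space (path_space t) \<Longrightarrow> x(Suc t := z) \<in> space (path_space (Suc t))"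
  by (auto simp: space_PiM PiE_iff extensional_def)

lemma singleton_in_path_space: "(\<lambda>i\<in>{0}. x) \<in> space (path_space 0)"
  by (auto simp: space_PiM PiE_iff)

lemma prob_extend_path:
  assumes "x \<in> space (path_space t)"
  shows "prob_space (extend_path (trans_kernel S) t k x)"
    "sets (extend_path (trans_kernel S) t k x) = sets (path_space (t + k))"
  using measurable_space[OF measurable_extend_path[OF trans_kernel] assms, of k]
  by (simp_all add: space_prob_algebra)

text \<open>\<open>extend_path\<close> peels transitions off at the front, while the recursions in
  time need the last one; hence the induction on \<open>k\<close> with the starting time and path
  generalised.\<close>

lemma integral_extend_path_append:
  assumes f[measurable]: "f \<in> borel_measurable all_paths" and B: "\<And>y. \<bar>f y\<bar> \<le> B"
    and x: "x \<in> space (path_space t)"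
  shows "(\<integral>y. f y \<partial>extend_path (trans_kernel S) t (Suc k) x) =
    (\<integral>y. (\<integral>z. m (y (t + k)) z * f (y(Suc (t + k) := z)) \<partial>\<nu>) \<partial>extend_path (trans_kernel S) t k x)"
  using x
proof (induction k arbitrary: t x)
  case 0
  have fm: "(\<lambda>y. \<integral>z. m (y t) z * f (y(Suc t := z)) \<partial>\<nu>) \<in> borel_measurable all_paths"
    by (intro nu.borel_measurable_lebesgue_integral) (unfold split_beta', measurable)
  have "(\<integral>y. f y \<partial>extend_path (trans_kernel S) t (Suc 0) x) =
      (\<integral>z. (\<integral>y. f y \<partial>return (path_space (Suc t)) (x(Suc t := z))) \<partial>trans_kernel S (x t))"
    using 0 by (subst integral_extend_path_Suc[OF trans_kernel, where C=B]) (auto intro: path_space_measurable f B)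
  also have "\<dots> = (\<integral>z. f (x(Suc t := z)) \<partial>trans_kernel S (x t))"
    using 0 by (subst integral_return) (auto intro: path_space_upd path_space_measurable f)
  also have "\<dots> = (\<integral>z. m (x t) z * f (x(Suc t := z)) \<partial>\<nu>)"
    by (rule trans_integral) measurable
  finally show ?case using 0 path_space_measurable[OF fm] by (simp add: integral_return del: fun_upd_apply)
next
  case (Suc k)
  let ?G = "\<lambda>y. \<integral>z. m (y (t + Suc k)) z * f (y(Suc (t + Suc k) := z)) \<partial>\<nu>"
  have Gm: "?G \<in> borel_measurable all_paths"
    by (intro nu.borel_measurable_lebesgue_integral) (unfold split_beta', measurable)
  have GB: "\<bar>?G y\<bar> \<le> B" for y by (rule trans_integrable(2)) (auto simp: B)
  have "(\<integral>y. f y \<partial>extend_path (trans_kernel S) t (Suc (Suc k)) x) =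
      (\<integral>z. (\<integral>y. f y \<partial>extend_path (trans_kernel S) (Suc t) (Suc k) (x(Suc t := z))) \<partial>trans_kernel S (x t))"
    by (rule integral_extend_path_Suc[OF trans_kernel Suc.prems, where C=B]) (auto intro: path_space_measurable f B)
  also have "\<dots> = (\<integral>z. (\<integral>y. ?G y \<partial>extend_path (trans_kernel S) (Suc t) k (x(Suc t := z))) \<partial>trans_kernel S (x t))"
    by (simp only: Suc.IH[OF path_space_upd[OF Suc.prems]] add_Suc add_Suc_right)
  also have "\<dots> = (\<integral>y. ?G y \<partial>extend_path (trans_kernel S) t (Suc k) x)"
    by (rule integral_extend_path_Suc[OF trans_kernel Suc.prems, where C=B, symmetric])
       (auto intro: path_space_measurable Gm GB simp del: add_Suc_right)
  finally show ?case .
qed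

lemma prob_init: "prob_space (init_law S)" "sets (init_law S) = sets borel"
  "prob_space (init_proposal S)" "sets (init_proposal S) = sets borel"
  using init_law init_proposal by (simp_all add: space_prob_algebra)

lemma prob_chain: "prob_space (chain_law S n)" "sets (chain_law S n) = sets (path_space n)"
  using chain_law_prob[OF smc_model_axioms, of n] by (simp_all add: space_prob_algebra)

lemma chain_law_integral:
  fixes f :: "(nat \<Rightarrow> 'x) \<Rightarrow> real"
  assumes f: "f \<in> borel_measurable all_paths" and B: "\<And>y. \<bar>f y\<bar> \<le> B"
  shows "(\<integral>y. f y \<partial>chain_law S n) = (\<integral>x. (\<integral>y. f y \<partial>extend_path (trans_kernel S) 0 n (\<lambda>i\<in>{0}. x)) \<partial>init_law S)"
proof -
  interpret i: prob_space "init_law S" by (rule prob_init)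
  have K: "(\<lambda>x. extend_path (trans_kernel S) 0 n (\<lambda>i\<in>{0}. x)) \<in> borel \<rightarrow>\<^sub>M prob_algebra (path_space (0 + n))"
    by (rule measurable_compose[OF _ measurable_extend_path[OF trans_kernel]]) auto
  then have K': "(\<lambda>x. extend_path (trans_kernel S) 0 n (\<lambda>i\<in>{0}. x)) \<in> init_law S \<rightarrow>\<^sub>M subprob_algebra (path_space n)"
    using measurable_prob_algebraD prob_init(2) by (simp cong: measurable_cong_sets)
  show ?thesis unfolding chain_law_def
  proof (rule integral_bind[OF path_space_measurable[OF f] B K'])
    show "finite_measure (init_law S)" by unfold_locales
    show "AE x in init_law S. emeasure (extend_path (trans_kernel S) 0 n (\<lambda>i\<in>{0}. x))
        (space (extend_path (trans_kernel S) 0 n (\<lambda>i\<in>{0}. x))) \<le> ennreal 1"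
      using prob_extend_path(1)[OF singleton_in_path_space] by (auto simp: prob_space.emeasure_space_1)
  qed
qed

text \<open>The Feynman-Kac measure behind the smoothing distribution; its total mass is the
  normalising constant. It obeys a linear recursion in \<open>t\<close> without quotients and is the
  limit of the particle quantities \<open>gam\<close>.\<close>

definition unnorm :: "nat \<Rightarrow> ((nat \<Rightarrow> 'x) \<Rightarrow> real) \<Rightarrow> real" where
  "unnorm t f = (\<integral>y. (\<Prod>u\<le>t. g u (y u)) * f y \<partial>chain_law S t)"

lemma unnorm_integrable:
  assumes f: "f \<in> borel_measurable all_paths" and B: "\<And>y. \<bar>f y\<bar> \<le> B" and t: "t \<le> T"
  shows "integrable (chain_law S t) (\<lambda>y. (\<Prod>u\<le>t. g u (y u)) * f y)"
proof -
  interpret c: prob_space "chain_law S t" by (rule prob_chain)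
  have "f \<in> borel_measurable (chain_law S t)" "(\<lambda>y. \<Prod>u\<le>t. g u (y u)) \<in> borel_measurable (chain_law S t)"
    using path_space_measurable[OF f, of t] path_space_measurable[OF lik_prod_measurable, of t t]
    by (simp_all cong: measurable_cong_sets add: prob_chain(2))
  then show ?thesis
    using lik_prod_bounds[OF t] B C_nonneg
    by (intro c.integrable_const_bound[where B="Cg ^ Suc t * B"]) (auto simp: abs_mult intro!: AE_I2 mult_mono simp del: power_Suc)
qed

lemma unnorm_diff:
  assumes "f \<in> borel_measurable all_paths" "\<And>y. \<bar>f y\<bar> \<le> B" "h \<in> borel_measurable all_paths" "\<And>y. \<bar>h y\<bar> \<le> B'" "t \<le> T"
  shows "unnorm t (\<lambda>y. f y - c * h y) = unnorm t f - c * unnorm t h"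
  unfolding unnorm_def using unnorm_integrable[OF assms(1,2,5)] unnorm_integrable[OF assms(3,4,5)]
  by (simp add: right_diff_distrib mult.left_commute[of _ c])

lemma unnorm_nonneg: "t \<le> T \<Longrightarrow> (\<And>y. f y \<ge> 0) \<Longrightarrow> unnorm t f \<ge> 0"
  unfolding unnorm_def by (intro integral_nonneg_AE AE_I2 mult_nonneg_nonneg lik_prod_bounds)

lemma unnorm_abs_le:
  assumes "f \<in> borel_measurable all_paths" "\<And>y. \<bar>f y\<bar> \<le> B" "t \<le> T"
  shows "\<bar>unnorm t f\<bar> \<le> B * unnorm t (\<lambda>_. 1)"
proof -
  have "\<bar>unnorm t f\<bar> \<le> (\<integral>y. \<bar>(\<Prod>u\<le>t. g u (y u)) * f y\<bar> \<partial>chain_law S t)"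
    unfolding unnorm_def by (rule integral_abs_bound)
  also have "\<dots> \<le> (\<integral>y. B * ((\<Prod>u\<le>t. g u (y u)) * 1) \<partial>chain_law S t)"
    using unnorm_integrable[OF assms] unnorm_integrable[of "\<lambda>_. 1" 1 t] lik_prod_bounds[OF assms(3)] assms
    by (intro integral_mono integrable_abs integrable_mult_right) (auto simp: abs_mult mult.commute[of B] intro!: mult_left_mono)
  finally show ?thesis unfolding unnorm_def by simp
qed

lemma unnorm_Suc:
  assumes f[measurable]: "f \<in> borel_measurable all_paths" and B: "\<And>y. \<bar>f y\<bar> \<le> B" and t: "Suc t \<le> T"
  shows "unnorm (Suc t) f = unnorm t (forward_step t f)"
proof -
  let ?F = "\<lambda>y. (\<Prod>u\<le>Suc t. g u (y u)) * f y"
  have B0: "B \<ge> 0" using B[of undefined] by linarith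
  have Fb: "\<bar>?F y\<bar> \<le> Cg ^ Suc (Suc t) * B" for y
    unfolding abs_mult using lik_prod_bounds[OF t, of y] B C_nonneg by (intro mult_mono) auto
  have Fm: "?F \<in> borel_measurable all_paths" by measurable
  have Gb: "\<bar>(\<Prod>u\<le>t. g u (y u)) * forward_step t f y\<bar> \<le> Cg ^ Suc t * (Cg * B)" for y
    unfolding abs_mult using lik_prod_bounds[of t y] t C_nonneg forward_step_bound[OF f B t] by (intro mult_mono) auto
  have Gm: "(\<lambda>y. (\<Prod>u\<le>t. g u (y u)) * forward_step t f y) \<in> borel_measurable all_paths" by measurable
  have step: "(\<integral>z. m (y t) z * ?F (y(Suc t := z)) \<partial>\<nu>) = (\<Prod>u\<le>t. g u (y u)) * forward_step t f y" for y
  proof -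
    have P: "(\<Prod>u\<le>Suc t. g u ((y(Suc t := z)) u)) = (\<Prod>u\<le>t. g u (y u)) * g (Suc t) z" for z
      by simp
    show ?thesis
      unfolding P mult.assoc forward_step_def integral_mult_right_zero[symmetric]
      by (simp add: mult.left_commute[of _ "prod _ _"] del: fun_upd_apply)
  qed
  show ?thesis
    unfolding unnorm_def chain_law_integral[OF Fm Fb] chain_law_integral[OF Gm Gb]
    by (simp only: integral_extend_path_append[OF Fm Fb singleton_in_path_space] step add_0)
qed

lemma unnorm_0:
  assumes f[measurable]: "f \<in> borel_measurable all_paths" and B: "\<And>y. \<bar>f y\<bar> \<le> B"
  shows "unnorm 0 f = (\<integral>x. init_weight S x * f (\<lambda>i\<in>{0}. x) \<partial>init_proposal S)"
proof -
  let ?F = "\<lambda>y. (\<Prod>u\<le>0. g u (y u)) * f y"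
  have Fb: "\<bar>?F y\<bar> \<le> Cg ^ Suc 0 * B" for y
    unfolding abs_mult using lik_prod_bounds[of 0 y] B C_nonneg by (intro mult_mono) auto
  have Fm: "?F \<in> borel_measurable all_paths" by measurable
  have "unnorm 0 f = (\<integral>x. (\<integral>y. ?F y \<partial>return (path_space 0) (\<lambda>i\<in>{0}. x)) \<partial>init_law S)"
    unfolding unnorm_def chain_law_integral[OF Fm Fb] by simp
  also have "\<dots> = (\<integral>x. g 0 x * f (\<lambda>i\<in>{0}. x) \<partial>init_law S)"
    by (subst integral_return[OF singleton_in_path_space path_space_measurable[OF Fm]]) simp
  also have "\<dots> = (\<integral>x. init_weight S x * f (\<lambda>i\<in>{0}. x) \<partial>init_proposal S)"
  proof -
    note [measurable] = init_ratio_measurable and [measurable_cong] = prob_init(4)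
    show ?thesis
      unfolding init_law_eq by (subst integral_density) (auto simp: init_ratio_nonneg init_weight_def mult.assoc)
  qed
  finally show ?thesis .
qed

lemma smoothing_norm_eq: "smoothing_norm S t = unnorm t (\<lambda>_. 1)"
  by (simp add: smoothing_norm_def unnorm_def)

text \<open>Positivity is inherited downwards from the horizon: one forward step multiplies the
  total mass by at most \<open>Cg\<close>, so a zero mass at \<open>t\<close> would force a zero
  mass at \<open>Suc t\<close>.\<close>

lemma unnorm_1_pos: assumes "t \<le> T" shows "unnorm t (\<lambda>_. 1) > 0"
  using assms
proof (induction t rule: inc_induct)
  case base
  then show ?case using norm_pos by (simp add: smoothing_norm_eq)
next
  case (step t)
  have "unnorm (Suc t) (\<lambda>_. 1) = unnorm t (forward_step t (\<lambda>_. 1))"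
    using step by (intro unnorm_Suc[where B=1]) auto
  also have "\<dots> \<le> \<bar>\<dots>\<bar>" by simp
  also have "\<dots> \<le> (Cg * 1) * unnorm t (\<lambda>_. 1)"
    using step by (intro unnorm_abs_le forward_step_bound) auto
  finally have "Cg * unnorm t (\<lambda>_. 1) > 0" using step.IH by simp
  then show ?case using C_nonneg(1) by (simp add: zero_less_mult_iff)
qed

lemma smoothing_integral:
  assumes f: "f \<in> borel_measurable all_paths" and t: "t \<le> T"
  shows "(\<integral>y. f y \<partial>smoothing S t) = unnorm t f / unnorm t (\<lambda>_. 1)"
proof -
  have m: "f \<in> borel_measurable (chain_law S t)" "(\<lambda>y. \<Prod>u\<le>t. g u (y u)) \<in> borel_measurable (chain_law S t)"
    using path_space_measurable[OF f, of t] path_space_measurable[OF lik_prod_measurable, of t t]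
    by (simp_all cong: measurable_cong_sets add: prob_chain(2))
  show ?thesis
    unfolding smoothing_def smoothing_norm_eq unnorm_def
    using m lik_prod_bounds(1)[OF t] unnorm_1_pos[OF t, unfolded unnorm_def]
    by (subst integral_density) (auto intro!: AE_I2 divide_nonneg_pos)
qed

lemma prob_smoothing:
  assumes t: "t \<le> T" shows "prob_space (smoothing S t)"
proof
  have i: "integrable (chain_law S t) (\<lambda>y. (\<Prod>u\<le>t. g u (y u)) * 1)" by (rule unnorm_integrable[OF _ _ t, where B=1]) auto
  have pos: "smoothing_norm S t > 0" using unnorm_1_pos[OF t] by (simp add: smoothing_norm_eq)
  have "emeasure (smoothing S t) (space (smoothing S t)) =
      (\<integral>\<^sup>+y. ennreal ((\<Prod>u\<le>t. g u (y u)) / smoothing_norm S t) \<partial>chain_law S t)"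
    unfolding smoothing_def using borel_measurable_integrable[OF i] by (subst emeasure_density) (auto intro!: nn_integral_cong)
  also have "\<dots> = ennreal (\<integral>y. (\<Prod>u\<le>t. g u (y u)) / smoothing_norm S t \<partial>chain_law S t)"
    using i lik_prod_bounds(1)[OF t] pos by (intro nn_integral_eq_integral) auto
  also have "\<dots> = 1" using pos by (simp add: smoothing_norm_def)
  finally show "emeasure (smoothing S t) (space (smoothing S t)) = 1" .
qed

lemma sets_smoothing: "sets (smoothing S t) = sets (path_space t)"
  by (simp add: smoothing_def prob_chain)

lemma last_measurable_smoothing: "(\<lambda>x. x t) \<in> smoothing S t \<rightarrow>\<^sub>M borel"
  unfolding measurable_cong_sets[OF sets_smoothing refl] by simp

lemma prob_filter: "t \<le> T \<Longrightarrow> prob_space (filter_law S t)"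
  unfolding filter_law_def by (rule prob_space.prob_space_distr[OF prob_smoothing last_measurable_smoothing])

lemma sets_filter: "sets (filter_law S t) = sets borel"
  by (simp add: filter_law_def)

lemma filter_integral:
  assumes [measurable]: "b \<in> borel_measurable borel" and t: "t \<le> T"
  shows "(\<integral>x. b x \<partial>filter_law S t) = unnorm t (\<lambda>y. b (y t)) / unnorm t (\<lambda>_. 1)"
  unfolding filter_law_def
  by (subst integral_distr[OF last_measurable_smoothing]) (auto simp: smoothing_integral t)

lemma filter_backward_kernels: "backward_kernels m (filter_law S) (Suc T) Cm"
proof (rule backward_kernels.intro)
  show "finite_measure (filter_law S s)" if "s < Suc T" for s
  proof -
    interpret prob_space "filter_law S s" using that by (intro prob_filter) simp
    show ?thesis by unfold_locales
  qed
qed (rule trans_density_measurable trans_density_nonneg trans_le sets_filter)+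

text \<open>The smoothing distribution factorises backwards in time into the last filter and the
  backward kernels of the earlier filters. The induction step is the cancellation in
  \<open>backward_forward_step\<close>, applied with the filters as \<open>\<eta>\<close>; for
  \<open>t = 0\<close> a path is determined by its only coordinate.\<close>

lemma filter_backward_identity:
  assumes f[measurable]: "f \<in> borel_measurable all_paths" and B: "\<And>y. \<bar>f y\<bar> \<le> B" and "t \<le> T"
  shows "(\<integral>x. backward_path m (filter_law S) t f (\<lambda>i\<in>{t}. x) \<partial>filter_law S t) = unnorm t f / unnorm t (\<lambda>_. 1)"
  using assms
proof (induction t arbitrary: f B)
  case (0 f B)
  note [measurable] = 0(1)
  have "unnorm 0 (\<lambda>y. f (\<lambda>i\<in>{0}. y 0)) = unnorm 0 f"
    unfolding unnorm_def
  proof (intro Bochner_Integration.integral_cong refl)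
    fix y assume "y \<in> space (chain_law S 0)"
    then have "(\<lambda>i\<in>{0}. y 0) = y"
      using sets_eq_imp_space_eq[OF prob_chain(2)] by (auto simp: space_PiM PiE_iff extensional_def fun_eq_iff)
    then show "(\<Prod>u\<le>0. g u (y u)) * f (\<lambda>i\<in>{0}. y 0) = (\<Prod>u\<le>0. g u (y u)) * f y" by simp
  qed
  moreover have "(\<integral>x. f (\<lambda>i\<in>{0}. x) \<partial>filter_law S 0) = unnorm 0 (\<lambda>y. f (\<lambda>i\<in>{0}. y 0)) / unnorm 0 (\<lambda>_. 1)"
    by (rule filter_integral[of "\<lambda>x. f (\<lambda>i\<in>{0}. x)"]) auto
  ultimately show ?case by (simp only: backward_path.simps)
next
  case (Suc t f B)
  note [measurable] = Suc.prems(1)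
  interpret bk: backward_kernels m "filter_law S" "Suc T" Cm by (rule filter_backward_kernels)
  have t: "t < Suc T" "t \<le> T" "Suc t \<le> Suc T" using Suc.prems by auto
  define b where "b x = backward_path m (filter_law S) (Suc t) f (\<lambda>i\<in>{Suc t}. x)" for x
  have bm[measurable]: "b \<in> borel_measurable borel"
    unfolding b_def by (rule measurable_compose[OF measurable_singleton_path bk.backward_path_measurable[OF Suc.prems(1) t(3)]])
  have bb: "\<bar>b x\<bar> \<le> B" for x unfolding b_def by (rule bk.backward_path_bound[OF Suc.prems(1,2) t(3)])
  have pos: "unnorm t (\<lambda>_. 1) > 0" by (rule unnorm_1_pos[OF t(2)])
  have "(\<integral>x. b x \<partial>filter_law S (Suc t)) = unnorm (Suc t) (\<lambda>y. b (y (Suc t))) / unnorm (Suc t) (\<lambda>_. 1)"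
    by (rule filter_integral[OF bm Suc.prems(3)])
  also have "unnorm (Suc t) (\<lambda>y. b (y (Suc t))) = unnorm t (forward_step t (\<lambda>y. b (y (Suc t))))"
    by (rule unnorm_Suc[where B=B]) (auto simp: bb Suc.prems)
  also have "\<dots> = unnorm t (\<lambda>y. predict t b (y t))" by (simp add: forward_step_last[abs_def])
  also have "\<dots> = unnorm t (\<lambda>_. 1) * (\<integral>z. predict t b z \<partial>filter_law S t)"
    using pos by (simp add: filter_integral t)
  also have "(\<integral>z. predict t b z \<partial>filter_law S t) =
      (\<integral>z. backward_path m (filter_law S) t (forward_step t f) (\<lambda>i\<in>{t}. z) \<partial>filter_law S t)"
    unfolding b_def[abs_def] by (rule backward_forward_step[OF filter_backward_kernels t(1) Suc.prems(3,1,2)])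
  also have "\<dots> = unnorm t (forward_step t f) / unnorm t (\<lambda>_. 1)"
    by (rule Suc.IH[OF _ forward_step_bound[OF Suc.prems]]) (auto simp: t)
  also have "unnorm t (forward_step t f) = unnorm (Suc t) f" by (rule unnorm_Suc[OF Suc.prems, symmetric])
  finally have "(\<integral>x. b x \<partial>filter_law S (Suc t)) = unnorm (Suc t) f / unnorm (Suc t) (\<lambda>_. 1)"
    using pos by simp
  then show ?case by (simp only: b_def)
qed

text \<open>Iterated forward steps from time \<open>t\<close> to \<open>t + k\<close>: the newest
  coordinate is integrated out first, so the recursion adds its step next to \<open>f\<close>.
  \<open>forward_Suc\<close> gives the decomposition at the other end, which the induction over time
  uses.\<close>

primrec forward :: "nat \<Rightarrow> nat \<Rightarrow> ((nat \<Rightarrow> 'x) \<Rightarrow> real) \<Rightarrow> (nat \<Rightarrow> 'x) \<Rightarrow> real" where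
  "forward t 0 f = f"
| "forward t (Suc k) f = forward t k (forward_step (t + k) f)"

lemma forward_Suc: "forward t (Suc k) f = forward_step t (forward (Suc t) k f)"
  by (induction k arbitrary: f) simp_all

lemma forward_measurable[measurable]:
  "f \<in> borel_measurable all_paths \<Longrightarrow> forward t k f \<in> borel_measurable all_paths"
  by (induction k arbitrary: f) auto

lemma forward_bound:
  assumes "f \<in> borel_measurable all_paths" "\<And>y. \<bar>f y\<bar> \<le> B" "t + k \<le> T"
  shows "\<bar>forward t k f y\<bar> \<le> Cg ^ k * B"
  using assms
proof (induction k arbitrary: f B)
  case (Suc k)
  have "\<bar>forward t k (forward_step (t + k) f) y\<bar> \<le> Cg ^ k * (Cg * B)"
    using Suc.prems by (intro Suc.IH forward_step_bound) auto
  then show ?case by (simp add: mult_ac)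
qed simp

lemma unnorm_forward:
  assumes "f \<in> borel_measurable all_paths" "\<And>y. \<bar>f y\<bar> \<le> B" "t + k \<le> T"
  shows "unnorm t (forward t k f) = unnorm (t + k) f"
  using assms
proof (induction k arbitrary: f B)
  case (Suc k)
  have "unnorm t (forward t k (forward_step (t + k) f)) = unnorm (t + k) (forward_step (t + k) f)"
    using Suc.prems by (intro Suc.IH[where B="Cg * B"] forward_step_bound) auto
  also have "\<dots> = unnorm (Suc (t + k)) f" using Suc.prems by (intro unnorm_Suc[symmetric]) auto
  finally show ?case by simp
qed simp

text \<open>Each forward step absorbs one transition together with its own likelihood, whereas
  \<open>forward_kernel\<close> integrates the full product at once. The function \<open>f\<close>
  lives on all paths and need agree with \<open>h\<close> only on extensional ones.\<close>

lemma forward_kernel_eq: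
  assumes f: "f \<in> borel_measurable all_paths" "\<And>y. \<bar>f y\<bar> \<le> B" "t + k \<le> T"
    and fh: "\<And>y. y \<in> space (path_space (t + k)) \<Longrightarrow> f y = h y" and y: "y \<in> space (path_space t)"
  shows "forward_kernel S t (t + k) y h = forward t k f y"
proof -
  have "forward_kernel S t (t + k) y h = forward_kernel S t (t + k) y f"
    unfolding forward_kernel_def using prob_extend_path(2)[OF y, of k] sets_eq_imp_space_eq[OF prob_extend_path(2)[OF y, of k]] fh
    by (intro Bochner_Integration.integral_cong) auto
  also have "\<dots> = forward t k f y"
    using f
  proof (induction k arbitrary: f B)
    case 0
    then show ?case by (simp add: forward_kernel_def integral_return y path_space_measurable)
  next
    case (Suc k f B)
    note [measurable] = Suc.prems(1)
    let ?P = "\<lambda>k z. \<Prod>u\<in>{t<..t + k}. g u (z u)"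
    have Pm[measurable]: "?P k \<in> borel_measurable all_paths" for k by (intro borel_measurable_prod) measurable
    have Pb: "0 \<le> ?P j z" "?P j z \<le> Cg ^ j" if "t + j \<le> T" for j z
    proof -
      show "0 \<le> ?P j z" by (simp add: prod_nonneg lik_nonneg)
      have "?P j z \<le> (\<Prod>u\<in>{t<..t + j}. Cg)" using that by (intro prod_mono) (auto simp: lik_nonneg intro: lik_le)
      then show "?P j z \<le> Cg ^ j" by simp
    qed
    have b: "\<bar>?P (Suc k) z * f z\<bar> \<le> Cg ^ Suc k * B" for z
      unfolding abs_mult using Pb[of "Suc k" z] Suc.prems C_nonneg by (intro mult_mono) auto
    have "forward_kernel S t (t + Suc k) y f =
        (\<integral>z. (\<integral>w. m (z (t + k)) w * (?P (Suc k) (z(Suc (t + k) := w)) * f (z(Suc (t + k) := w))) \<partial>\<nu>) \<partial>extend_path (trans_kernel S) t k y)"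
      unfolding forward_kernel_def using b
      by (simp only: add_diff_cancel_left', intro integral_extend_path_append[OF _ _ y]) measurable
    also have "\<dots> = (\<integral>z. ?P k z * forward_step (t + k) f z \<partial>extend_path (trans_kernel S) t k y)"
    proof (intro Bochner_Integration.integral_cong refl)
      fix z
      have P: "?P (Suc k) (z(Suc (t + k) := w)) = ?P k z * g (Suc (t + k)) w" for w
      proof -
        have "{t<..t + Suc k} = insert (Suc (t + k)) {t<..t + k}" by auto
        then show ?thesis by (simp add: mult.commute)
      qed
      show "(\<integral>w. m (z (t + k)) w * (?P (Suc k) (z(Suc (t + k) := w)) * f (z(Suc (t + k) := w))) \<partial>\<nu>) =
          ?P k z * forward_step (t + k) f z"
        unfolding P forward_step_def by (simp add: mult.assoc mult.left_commute[of _ "prod _ _"] del: fun_upd_apply)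
    qed
    also have "\<dots> = forward_kernel S t (t + k) y (forward_step (t + k) f)" by (simp add: forward_kernel_def)
    also have "\<dots> = forward t k (forward_step (t + k) f) y"
      using Suc.prems by (intro Suc.IH[where B="Cg * B"] forward_step_bound) auto
    finally show ?case by simp
  qed
  finally show ?thesis .
qed

end

section \<open>One step of the particle filter\<close>

declare One_nat_def [simp del]

lemma le_divide_sqrt:
  fixes x c :: real
  assumes "N * x \<le> c * sqrt N" "N \<ge> 1" shows "x \<le> c / sqrt (real N)"
proof -
  have "sqrt N * (sqrt N * x) = N * x" by (simp flip: mult.assoc)
  then have "sqrt N * (sqrt N * x) \<le> sqrt N * c" using assms(1) by (simp only: mult.commute[of c])
  moreover have "sqrt N > 0" using assms(2) by simp
  ultimately have "sqrt N * x \<le> c" using mult_le_cancel_left_pos by blast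
  with \<open>sqrt N > 0\<close> show ?thesis by (simp add: pos_le_divide_eq mult.commute)
qed

context bounded_smc
begin

lemma weight_measurable:
  assumes "t \<in> {1..T}" shows "(\<lambda>(x, x'). weight S t x x') \<in> borel_measurable (borel \<Otimes>\<^sub>M borel)"
proof -
  note adj_mult_measurable[OF assms, measurable]
  have p: "(\<lambda>x. prop_density S t (fst x) (snd x)) \<in> borel_measurable (borel \<Otimes>\<^sub>M borel)"
    using prop_density_measurable[OF assms] by (simp add: split_beta')
  show ?thesis unfolding weight_def split_beta'
    by (intro borel_measurable_divide borel_measurable_times p) measurable
qed

lemma weight_measurable_comp:
  assumes "t \<in> {1..T}" "f \<in> M \<rightarrow>\<^sub>M borel" "h \<in> M \<rightarrow>\<^sub>M borel"
  shows "(\<lambda>x. weight S t (f x) (h x)) \<in> borel_measurable M"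
  using measurable_compose[OF measurable_Pair[OF assms(2,3)] weight_measurable[OF assms(1)]] by simp

lemma weight_nonneg: "t \<in> {1..T} \<Longrightarrow> weight S t x x' \<ge> 0"
  using adj_mult_pos[of t x] prop_density_nonneg[of t x x']
  by (simp add: weight_def trans_density_nonneg lik_nonneg)

lemma init_weight_measurable[measurable]: "init_weight S \<in> borel_measurable borel"
  unfolding init_weight_def[abs_def] using init_ratio_measurable by measurable

lemma init_weight_nonneg: "init_weight S x \<ge> 0"
  by (simp add: init_weight_def init_ratio_nonneg lik_nonneg)

lemma Cw_nonneg: "Cw \<ge> 0"
  using init_weight_nonneg init_weight_le order_trans by blast

lemma Ca_nonneg: "Suc t \<le> T \<Longrightarrow> Ca \<ge> 0"
  using adj_mult_pos[of "Suc t" undefined] adj_le[of "Suc t" undefined] by simp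

lemma prob_prop: assumes "Suc t \<le> T"
  shows "prob_space (prop_kernel S (Suc t) x)" "sets (prop_kernel S (Suc t) x) = sets borel"
  using measurable_space[OF prop_kernel, of "Suc t" x] assms by (simp_all add: space_prob_algebra)

text \<open>The operator of conditional second moments. Of the two weights in the squared weight,
  one cancels against the proposal density and the adjustment multiplier; what is left is an
  integral against the transition density in which the other weight is bounded by
  \<open>Cw\<close>.\<close>

definition weight_op :: "nat \<Rightarrow> ('x \<Rightarrow> real) \<Rightarrow> 'x \<Rightarrow> real" where
  "weight_op t c z = (\<integral>x. m z x * (weight S (Suc t) z x * (g (Suc t) x * c x)) \<partial>\<nu>)"

text \<open>Where the proposal density is zero the left side is zero, and the support condition on
  the proposal makes \<open>m z x * g (Suc t) x\<close> vanish there too.\<close>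

lemma prop_weight_cancel:
  assumes t: "Suc t \<le> T"
  shows "adj_mult S (Suc t) z * (prop_density S (Suc t) z x * weight S (Suc t) z x) = m z x * g (Suc t) x"
proof (cases "prop_density S (Suc t) z x = 0")
  case True
  then have "m z x * g (Suc t) x = 0"
    using prop_density_pos[of "Suc t" z x] t trans_density_nonneg[of z x] lik_nonneg[of "Suc t" x]
    by (metis One_nat_def Suc_le_mono atLeastAtMost_iff less_irrefl mult_nonneg_nonneg order_le_less zero_le)
  then show ?thesis using True by simp
next
  case False
  then show ?thesis using adj_mult_pos[of "Suc t" z] t by (simp add: weight_def)
qed

lemma prop_integral:
  fixes f :: "'x \<Rightarrow> real"
  assumes t: "Suc t \<le> T" and "f \<in> borel_measurable borel"
  shows "(\<integral>x. f x \<partial>prop_kernel S (Suc t) z) = (\<integral>x. prop_density S (Suc t) z x * f x \<partial>\<nu>)"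
proof -
  have tt: "Suc t \<in> {1..T}" using t by simp
  have "(\<lambda>x. prop_density S (Suc t) z x) \<in> borel_measurable borel"
    using measurable_Pair2[OF prop_density_measurable[OF tt], of z] by simp
  then show ?thesis
    unfolding prop_kernel_eq[OF tt] using assms prop_density_nonneg[OF tt]
    by (subst integral_density) auto
qed

lemma weight_snd_measurable: "Suc t \<le> T \<Longrightarrow> weight S (Suc t) z \<in> borel_measurable borel"
  by (rule weight_measurable_comp) auto

lemma prop_integral_weight:
  assumes t: "Suc t \<le> T" and c[measurable]: "c \<in> borel_measurable borel"
  shows "adj_mult S (Suc t) z * (\<integral>x. weight S (Suc t) z x * c x \<partial>prop_kernel S (Suc t) z) = predict t c z"
    "adj_mult S (Suc t) z * (\<integral>x. (weight S (Suc t) z x)\<^sup>2 * c x \<partial>prop_kernel S (Suc t) z) = weight_op t c z"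
proof -
  note [measurable] = weight_snd_measurable[OF t, of z]
  have "adj_mult S (Suc t) z * (\<integral>x. weight S (Suc t) z x * c x \<partial>prop_kernel S (Suc t) z) =
      (\<integral>x. (adj_mult S (Suc t) z * (prop_density S (Suc t) z x * weight S (Suc t) z x)) * c x \<partial>\<nu>)"
    by (subst prop_integral[OF t]) (simp_all add: mult_ac flip: integral_mult_right_zero)
  then show "adj_mult S (Suc t) z * (\<integral>x. weight S (Suc t) z x * c x \<partial>prop_kernel S (Suc t) z) = predict t c z"
    unfolding prop_weight_cancel[OF t] predict_def by (simp add: mult_ac)
  have "adj_mult S (Suc t) z * (\<integral>x. (weight S (Suc t) z x)\<^sup>2 * c x \<partial>prop_kernel S (Suc t) z) =
      (\<integral>x. (adj_mult S (Suc t) z * (prop_density S (Suc t) z x * weight S (Suc t) z x)) * (weight S (Suc t) z x * c x) \<partial>\<nu>)"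
    by (subst prop_integral[OF t]) (simp_all add: mult_ac power2_eq_square flip: integral_mult_right_zero)
  then show "adj_mult S (Suc t) z * (\<integral>x. (weight S (Suc t) z x)\<^sup>2 * c x \<partial>prop_kernel S (Suc t) z) = weight_op t c z"
    unfolding prop_weight_cancel[OF t] weight_op_def by (simp add: mult_ac)
qed

lemma weight_op_measurable:
  assumes t: "Suc t \<le> T" and c[measurable]: "c \<in> borel_measurable borel"
  shows "weight_op t c \<in> borel_measurable borel"
  unfolding weight_op_def[abs_def]
proof (rule nu.borel_measurable_lebesgue_integral)
  have [measurable]: "(\<lambda>p. weight S (Suc t) (fst p) (snd p)) \<in> borel_measurable (borel \<Otimes>\<^sub>M \<nu>)"
    using t by (intro weight_measurable_comp) auto
  show "(\<lambda>(z, x). m z x * (weight S (Suc t) z x * (g (Suc t) x * c x))) \<in> borel_measurable (borel \<Otimes>\<^sub>M \<nu>)"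
    unfolding split_beta' by measurable
qed

lemma weight_lik_bound:
  assumes "Suc t \<le> T" "\<bar>a\<bar> \<le> B" shows "\<bar>weight S (Suc t) z x * (g (Suc t) x * a)\<bar> \<le> Cw * (Cg * B)"
  unfolding abs_mult[of "weight S (Suc t) z x"]
  using assms weight_nonneg[of "Suc t" z x] weight_le[of "Suc t" z x] Cw_nonneg
  by (intro mult_mono lik_mult_bound) auto

lemma weight_op_bound:
  assumes t: "Suc t \<le> T" and c[measurable]: "c \<in> borel_measurable borel" and "\<And>x. \<bar>c x\<bar> \<le> B"
  shows "\<bar>weight_op t c z\<bar> \<le> Cw * (Cg * B)"
proof -
  note [measurable] = weight_snd_measurable[OF t, of z]
  show ?thesis unfolding weight_op_def by (rule trans_integrable(2)) (auto intro: weight_lik_bound[OF t] assms)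
qed

end

section \<open>The particle system for a fixed number of particles\<close>

locale smc_run = bounded_smc S T Cg Cm Ca Cw + particle_filter S T N \<P> \<xi> I
  for S :: "('x::polish_space, 'y::polish_space) smc_model" and T :: nat
    and Cg Cm Ca Cw :: real and N :: nat and \<P> :: "'w measure"
    and \<xi> :: "nat \<Rightarrow> nat \<Rightarrow> 'w \<Rightarrow> 'x" and I :: "nat \<Rightarrow> nat \<Rightarrow> 'w \<Rightarrow> nat" +
  assumes N_pos: "N \<ge> 1"
begin

abbreviation "w \<equiv> particle_weight S \<xi> I"
abbreviation "hist \<equiv> particle_history S N \<P> \<xi> I"
abbreviation "emp \<equiv> particle_measure S N \<xi> I"

lemma w_bounds: assumes "t \<le> T" shows "0 \<le> w t i \<omega>" "w t i \<omega> \<le> Cw"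
  using assms by (auto simp: particle_weight_def init_weight_nonneg init_weight_le weight_nonneg weight_le)

lemma w_Suc: "w (Suc t) i \<omega> = weight S (Suc t) (\<xi> t (I (Suc t) i \<omega>) \<omega>) (\<xi> (Suc t) i \<omega>)"
  by (simp add: particle_weight_def)

lemma w_measurable:
  assumes "t \<le> T" "i \<in> {1..N}" shows "w t i \<in> borel_measurable \<P>"
proof (cases t)
  case 0
  then show ?thesis using particle_measurable[OF assms] by (simp add: particle_weight_def[abs_def])
next
  case (Suc s)
  have "(\<lambda>\<omega>. \<xi> s (I t i \<omega>) \<omega>) \<in> \<P> \<rightarrow>\<^sub>M borel"
    by (rule measurable_compose_countable'[where I="{1..N}" and f="\<xi> s" and g="I t i"])
       (use assms Suc in \<open>auto intro: particle_measurable ancestor_measurable\<close>)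
  then show ?thesis
    unfolding Suc w_Suc[abs_def] using assms Suc by (intro weight_measurable_comp particle_measurable) auto
qed

lemma history_map_measurable:
  assumes "t \<le> T"
  shows "(\<lambda>\<omega>. \<lambda>(s, i)\<in>{..t} \<times> {1..N}. (\<xi> s i \<omega>, w s i \<omega>)) \<in> \<P> \<rightarrow>\<^sub>M PiM ({..t} \<times> {1..N}) (\<lambda>_. borel \<Otimes>\<^sub>M borel)"
  by (rule measurable_restrict) (use assms in \<open>auto intro!: measurable_Pair particle_measurable w_measurable\<close>)

lemma hist_subalgebra: assumes "t \<le> T" shows "subalgebra \<P> (hist t)"
  unfolding subalgebra_def particle_history_def
  using sets_image_in_sets[OF refl history_map_measurable[OF assms]] by simp

lemma space_hist[simp]: "space (hist t) = space \<P>"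
  by (simp add: particle_history_def)

text \<open>The history is generated by positions and weights, not by ancestor indices. The
  estimators see ancestors only through the weights, so they are adapted to it.\<close>

lemma hist_component:
  assumes "s \<le> t" "t \<le> T" "i \<in> {1..N}"
  shows "(\<lambda>\<omega>. (\<xi> s i \<omega>, w s i \<omega>)) \<in> hist t \<rightarrow>\<^sub>M borel \<Otimes>\<^sub>M borel"
proof -
  have "(\<lambda>\<omega>. \<lambda>(s, i)\<in>{..t} \<times> {1..N}. (\<xi> s i \<omega>, w s i \<omega>)) \<in> hist t \<rightarrow>\<^sub>M PiM ({..t} \<times> {1..N}) (\<lambda>_. borel \<Otimes>\<^sub>M borel)"
    unfolding particle_history_def
    by (rule measurable_vimage_algebra1) (use measurable_space[OF history_map_measurable[OF assms(2)]] in auto)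
  from measurable_compose[OF this measurable_component_singleton[of "(s, i)"]] show ?thesis
    using assms by simp
qed

lemma xi_hist: "s \<le> t \<Longrightarrow> t \<le> T \<Longrightarrow> i \<in> {1..N} \<Longrightarrow> \<xi> s i \<in> hist t \<rightarrow>\<^sub>M borel"
  using measurable_compose[OF hist_component measurable_fst] by simp

lemma w_hist: "s \<le> t \<Longrightarrow> t \<le> T \<Longrightarrow> i \<in> {1..N} \<Longrightarrow> w s i \<in> borel_measurable (hist t)"
  using measurable_compose[OF hist_component measurable_snd] by simp

lemma hist_measurable: "t \<le> T \<Longrightarrow> f \<in> hist t \<rightarrow>\<^sub>M M \<Longrightarrow> f \<in> \<P> \<rightarrow>\<^sub>M M"
  by (rule measurable_from_subalg[OF hist_subalgebra])

text \<open>
  \<open>mass t / N\<close> estimates the ratio of successive normalising constants, so that \<open>acc t * \<Omega>\<^sub>t / N\<close> is the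
  unbiased estimator of the normalising constant, and \<open>gam t b\<close> is the unnormalised filter estimator.
\<close>

definition mass :: "nat \<Rightarrow> 'w \<Rightarrow> real" where
  "mass t \<omega> = (\<Sum>i=1..N. w t i \<omega> * adj_mult S (Suc t) (\<xi> t i \<omega>))"

primrec acc :: "nat \<Rightarrow> 'w \<Rightarrow> real" where
  "acc 0 \<omega> = 1"
| "acc (Suc t) \<omega> = acc t \<omega> * (mass t \<omega> / N)"

definition gam :: "nat \<Rightarrow> ('x \<Rightarrow> real) \<Rightarrow> 'w \<Rightarrow> real" where
  "gam t b \<omega> = acc t \<omega> * ((\<Sum>i=1..N. w t i \<omega> * b (\<xi> t i \<omega>)) / N)"

lemma acc_Suc: "acc (Suc t) \<omega> = gam t (adj_mult S (Suc t)) \<omega>"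
  by (simp add: gam_def mass_def)

lemma average_bound:
  assumes "\<And>i. i \<in> {1..N} \<Longrightarrow> \<bar>a i\<bar> \<le> (B::real)" shows "\<bar>(\<Sum>i=1..N. a i) / N\<bar> \<le> B"
proof -
  have "\<bar>\<Sum>i=1..N. a i\<bar> \<le> (\<Sum>i=1..N. B)" by (rule order_trans[OF sum_abs sum_mono[OF assms]])
  then show ?thesis using N_pos by (simp add: field_simps)
qed

lemma mass_nonneg: "Suc t \<le> T \<Longrightarrow> mass t \<omega> \<ge> 0"
  unfolding mass_def using adj_mult_pos by (intro sum_nonneg mult_nonneg_nonneg w_bounds less_imp_le) auto

lemma acc_bounds: assumes "t \<le> T" shows "0 \<le> acc t \<omega>" "acc t \<omega> \<le> (Cw * Ca) ^ t"
proof -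
  have "0 \<le> acc t \<omega> \<and> acc t \<omega> \<le> (Cw * Ca) ^ t"
    using assms
  proof (induction t)
    case (Suc t)
    have a: "\<bar>adj_mult S (Suc t) x\<bar> \<le> Ca" for x
      using Suc.prems adj_mult_pos[of "Suc t" x] adj_le[of "Suc t" x] by simp
    have "\<bar>mass t \<omega> / N\<bar> \<le> Cw * Ca"
      unfolding mass_def using Suc.prems w_bounds[of t] Cw_nonneg
      by (intro average_bound) (auto simp: abs_mult intro!: mult_mono a)
    moreover have "mass t \<omega> / N \<ge> 0" using Suc.prems mass_nonneg[of t \<omega>] by simp
    ultimately have "0 \<le> mass t \<omega> / N" "mass t \<omega> / N \<le> Cw * Ca" by linarith+
    then show ?case
      unfolding acc.simps power_Suc2 using Suc Ca_nonneg[of t] Cw_nonneg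
      by (intro conjI mult_mono mult_nonneg_nonneg) auto
  qed simp
  then show "0 \<le> acc t \<omega>" "acc t \<omega> \<le> (Cw * Ca) ^ t" by auto
qed

lemma gam_bound:
  assumes "t \<le> T" "\<And>x. \<bar>b x\<bar> \<le> B" shows "\<bar>gam t b \<omega>\<bar> \<le> (Cw * Ca) ^ t * (Cw * B)"
proof -
  have "\<bar>(\<Sum>i=1..N. w t i \<omega> * b (\<xi> t i \<omega>)) / N\<bar> \<le> Cw * B"
    using assms w_bounds Cw_nonneg by (intro average_bound) (auto simp: abs_mult intro!: mult_mono)
  then show ?thesis
    unfolding gam_def abs_mult using acc_bounds[OF assms(1), of \<omega>] by (intro mult_mono) auto
qed

lemma gam_nonneg: "t \<le> T \<Longrightarrow> (\<And>x. b x \<ge> 0) \<Longrightarrow> gam t b \<omega> \<ge> 0"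
  unfolding gam_def by (intro mult_nonneg_nonneg divide_nonneg_nonneg sum_nonneg acc_bounds w_bounds) auto

lemma gam_mono: "t \<le> T \<Longrightarrow> (\<And>x. b x \<le> c x) \<Longrightarrow> gam t b \<omega> \<le> gam t c \<omega>"
  unfolding gam_def by (intro mult_left_mono divide_right_mono sum_mono acc_bounds w_bounds) auto

lemma gam_diff: "gam t (\<lambda>x. b x - a * c x) \<omega> = gam t b \<omega> - a * gam t c \<omega>"
  by (simp add: gam_def right_diff_distrib sum_subtractf diff_divide_distrib sum_distrib_left mult_ac
      sum_divide_distrib)

lemma gam_cmult: "gam t (\<lambda>x. a * c x) \<omega> = a * gam t c \<omega>"
  by (simp add: gam_def sum_distrib_left mult_ac sum_divide_distrib)

lemma abs_gam_le: "t \<le> T \<Longrightarrow> \<bar>gam t b \<omega>\<bar> \<le> gam t (\<lambda>x. \<bar>b x\<bar>) \<omega>"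
  using gam_mono[of t b "\<lambda>x. \<bar>b x\<bar>" \<omega>] gam_mono[of t "\<lambda>x. - b x" "\<lambda>x. \<bar>b x\<bar>" \<omega>] gam_cmult[of t "-1" b \<omega>]
  by (simp add: abs_le_iff)

lemma mass_measurable:
  assumes "t \<le> u" "u \<le> T" "Suc t \<le> T" shows "mass t \<in> borel_measurable (hist u)"
  unfolding mass_def[abs_def]
proof (intro borel_measurable_sum borel_measurable_times)
  fix i assume i: "i \<in> {1..N}"
  show "w t i \<in> borel_measurable (hist u)" using assms i by (intro w_hist) auto
  show "(\<lambda>\<omega>. adj_mult S (Suc t) (\<xi> t i \<omega>)) \<in> borel_measurable (hist u)"
    using assms i by (intro measurable_compose[OF xi_hist adj_mult_measurable]) auto
qed

text \<open>\<open>acc\<close> is predictable: \<open>acc (Suc t)\<close> is built from masses up to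
  time \<open>t\<close>, hence the bound \<open>t \<le> Suc u\<close>. In the conditional law of the
  next generation it is therefore a constant.\<close>

lemma acc_measurable:
  assumes "t \<le> Suc u" "u \<le> T" "t \<le> T" shows "acc t \<in> borel_measurable (hist u)"
  using assms
proof (induction t)
  case 0
  have "acc 0 = (\<lambda>_. 1)" by (simp add: fun_eq_iff)
  then show ?case by simp
next
  case (Suc t)
  have "acc (Suc t) = (\<lambda>\<omega>. acc t \<omega> * (mass t \<omega> / N))" by (simp add: fun_eq_iff)
  then show ?case using Suc mass_measurable[of t u] by simp
qed

lemma gam_measurable:
  assumes b: "(\<lambda>(\<omega>, x). b \<omega> x) \<in> borel_measurable (hist u \<Otimes>\<^sub>M borel)" and t: "t \<le> u" "u \<le> T"
  shows "(\<lambda>\<omega>. gam t (b \<omega>) \<omega>) \<in> borel_measurable (hist u)"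
  unfolding gam_def
proof (intro borel_measurable_times borel_measurable_divide borel_measurable_sum acc_measurable borel_measurable_const)
  fix i assume i: "i \<in> {1..N}"
  show "w t i \<in> borel_measurable (hist u)" using t i by (intro w_hist) auto
  have "(\<lambda>\<omega>. (\<omega>, \<xi> t i \<omega>)) \<in> hist u \<rightarrow>\<^sub>M hist u \<Otimes>\<^sub>M borel"
    using t i by (intro measurable_Pair measurable_ident_sets xi_hist) auto
  from measurable_compose[OF this b] show "(\<lambda>\<omega>. b \<omega> (\<xi> t i \<omega>)) \<in> borel_measurable (hist u)" by simp
qed (use t in auto)

lemma gam_measurable_const:
  assumes [measurable]: "b \<in> borel_measurable borel" and t: "t \<le> u" "u \<le> T"
  shows "gam t b \<in> borel_measurable (hist u)"
  using gam_measurable[of "\<lambda>_. b" u t] t by (simp add: split_beta')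

lemma finite_emp: "finite_measure (emp \<omega> t)" "sets (emp \<omega> t) = sets borel"
proof -
  show "sets (emp \<omega> t) = sets borel" by (simp add: particle_measure_def)
  have "emeasure (point_measure {1..N} (\<lambda>i. ennreal (w t i \<omega> / (\<Sum>j = 1..N. w t j \<omega>)))) {1..N} \<noteq> \<infinity>"
    by (subst emeasure_point_measure_finite) auto
  then have "finite_measure (point_measure {1..N} (\<lambda>i. ennreal (w t i \<omega> / (\<Sum>j = 1..N. w t j \<omega>))))"
    by (intro finite_measureI) (simp add: space_point_measure)
  then show "finite_measure (emp \<omega> t)"
    unfolding particle_measure_def by (rule finite_measure.finite_measure_distr) simp
qed

lemma emp_backward_kernels: "backward_kernels m (emp \<omega>) n Cm"
proof (rule backward_kernels.intro)
qed (rule trans_density_measurable trans_density_nonneg trans_le finite_emp)+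

lemma emp_integral:
  "t \<le> T \<Longrightarrow> b \<in> borel_measurable borel \<Longrightarrow>
    (\<integral>x. b x \<partial>emp \<omega> t) = (\<Sum>i=1..N. w t i \<omega> * b (\<xi> t i \<omega>)) / (\<Sum>i=1..N. w t i \<omega>)"
  by (rule integral_particle_measure) (auto simp: w_bounds)

text \<open>The product form relates the unnormalised and self-normalised estimators without
  dividing by the total weight; if all weights vanish, both sides are zero.\<close>

lemma gam_emp:
  assumes "t \<le> T" "b \<in> borel_measurable borel"
  shows "gam t b \<omega> = gam t (\<lambda>_. 1) \<omega> * (\<integral>x. b x \<partial>emp \<omega> t)"
proof (cases "(\<Sum>i=1..N. w t i \<omega>) = 0")
  case True
  then have "\<And>i. i \<in> {1..N} \<Longrightarrow> w t i \<omega> = 0"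
    using w_bounds[OF assms(1)] by (subst (asm) sum_nonneg_eq_0_iff) auto
  then show ?thesis by (simp add: gam_def)
next
  case False
  then show ?thesis by (simp add: emp_integral[OF assms] gam_def)
qed

definition bwd :: "nat \<Rightarrow> ((nat \<Rightarrow> 'x) \<Rightarrow> real) \<Rightarrow> 'w \<Rightarrow> 'x \<Rightarrow> real" where
  "bwd t f \<omega> x = backward_path m (emp \<omega>) t f (\<lambda>i\<in>{t}. x)"

lemma bwd_measurable_snd: "f \<in> borel_measurable all_paths \<Longrightarrow> bwd t f \<omega> \<in> borel_measurable borel"
  unfolding bwd_def[abs_def]
  by (rule measurable_compose[OF measurable_singleton_path backward_kernels.backward_path_measurable[OF emp_backward_kernels]]) auto

lemma bwd_bound: "f \<in> borel_measurable all_paths \<Longrightarrow> (\<And>y. \<bar>f y\<bar> \<le> B) \<Longrightarrow> \<bar>bwd t f \<omega> x\<bar> \<le> B"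
  unfolding bwd_def by (rule backward_kernels.backward_path_bound[OF emp_backward_kernels]) auto

text \<open>From time \<open>t\<close>, the backward recursion consults only particles at times
  below \<open>t\<close>, so the history at \<open>t - 1\<close> suffices; this is the bound
  \<open>t \<le> Suc u\<close>. Consequently, given the past, the backward function is a fixed test
  function for the new generation.\<close>

lemma backward_path_emp_measurable:
  assumes f: "f \<in> borel_measurable all_paths" and "t \<le> Suc u" "u \<le> T" "t \<le> T"
  shows "(\<lambda>(\<omega>, y). backward_path m (emp \<omega>) t f y) \<in> borel_measurable (hist u \<Otimes>\<^sub>M all_paths)"
  using assms(2-4)
proof (induction t)
  case 0
  then show ?case using f by simp
next
  case (Suc t)
  interpret bk: backward_kernels m "emp \<omega>" "Suc t" Cm for \<omega> by (rule emp_backward_kernels)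
  let ?F = "hist u \<Otimes>\<^sub>M all_paths"
  have IH: "(\<lambda>(\<omega>, y). backward_path m (emp \<omega>) t f y) \<in> borel_measurable ?F" using Suc by simp
  have eq: "backward_path m (emp \<omega>) (Suc t) f y =
      ((\<Sum>i=1..N. w t i \<omega> * (m (\<xi> t i \<omega>) (y (Suc t)) * backward_path m (emp \<omega>) t f (y(t := \<xi> t i \<omega>)))) / (\<Sum>i=1..N. w t i \<omega>)) /
      ((\<Sum>i=1..N. w t i \<omega> * m (\<xi> t i \<omega>) (y (Suc t))) / (\<Sum>i=1..N. w t i \<omega>))" for \<omega> y
  proof -
    have "(\<lambda>z. y(t := z)) \<in> borel \<rightarrow>\<^sub>M all_paths" by measurable
    from measurable_compose[OF this bk.backward_path_measurable[OF f, of t]]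
    have "(\<lambda>z. m z (y (Suc t)) * backward_path m (emp \<omega>) t f (y(t := z))) \<in> borel_measurable borel"
      by (intro borel_measurable_times m_meas) auto
    then show ?thesis using Suc.prems by (simp add: backward_def emp_integral del: fun_upd_apply)
  qed
  have [measurable]: "(\<lambda>p. w t i (fst p)) \<in> borel_measurable ?F" "(\<lambda>p. \<xi> t i (fst p)) \<in> ?F \<rightarrow>\<^sub>M borel"
    if "i \<in> {1..N}" for i
    using that Suc.prems by (auto intro!: measurable_compose[OF measurable_fst] w_hist xi_hist)
  have mi: "(\<lambda>p. m (\<xi> t i (fst p)) (snd p (Suc t))) \<in> borel_measurable ?F"
    and bi: "(\<lambda>p. backward_path m (emp (fst p)) t f ((snd p)(t := \<xi> t i (fst p)))) \<in> borel_measurable ?F"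
    if i: "i \<in> {1..N}" for i
  proof -
    have x: "(\<lambda>p. \<xi> t i (fst p)) \<in> ?F \<rightarrow>\<^sub>M borel" using i Suc.prems by (intro measurable_compose[OF measurable_fst] xi_hist) auto
    show "(\<lambda>p. m (\<xi> t i (fst p)) (snd p (Suc t))) \<in> borel_measurable ?F" by (rule m_meas[OF x]) measurable
    have "(\<lambda>p. (fst p, (snd p)(t := \<xi> t i (fst p)))) \<in> ?F \<rightarrow>\<^sub>M ?F"
      by (intro measurable_Pair measurable_fst measurable_path_update x) measurable
    from measurable_compose[OF this IH]
    show "(\<lambda>p. backward_path m (emp (fst p)) t f ((snd p)(t := \<xi> t i (fst p)))) \<in> borel_measurable ?F" by simp
  qed
  have wi: "(\<lambda>p. w t i (fst p)) \<in> borel_measurable ?F" if "i \<in> {1..N}" for i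
    using that Suc.prems by (intro measurable_compose[OF measurable_fst] w_hist) auto
  show ?case
    unfolding split_beta' eq
    by (intro borel_measurable_divide borel_measurable_sum borel_measurable_times mi bi wi)
qed

lemma bwd_measurable:
  assumes "f \<in> borel_measurable all_paths" "t \<le> Suc u" "u \<le> T" "t \<le> T"
  shows "(\<lambda>(\<omega>, x). bwd t f \<omega> x) \<in> borel_measurable (hist u \<Otimes>\<^sub>M borel)"
proof -
  have "(\<lambda>p. (fst p, \<lambda>i\<in>{t}. snd p)) \<in> hist u \<Otimes>\<^sub>M borel \<rightarrow>\<^sub>M hist u \<Otimes>\<^sub>M all_paths"
    by (intro measurable_Pair measurable_fst measurable_compose[OF measurable_snd measurable_singleton_path])
  from measurable_compose[OF this backward_path_emp_measurable[OF assms]]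
  show ?thesis by (simp add: bwd_def split_beta')
qed

lemma gam_predict_bwd:
  assumes f: "f \<in> borel_measurable all_paths" "\<And>y. \<bar>f y\<bar> \<le> B" and t: "Suc t \<le> T"
  shows "gam t (predict t (bwd (Suc t) f \<omega>)) \<omega> = gam t (bwd t (forward_step t f) \<omega>) \<omega>"
proof -
  have "(\<integral>z. predict t (bwd (Suc t) f \<omega>) z \<partial>emp \<omega> t) = (\<integral>z. bwd t (forward_step t f) \<omega> z \<partial>emp \<omega> t)"
    unfolding bwd_def[abs_def]
    by (rule backward_forward_step[OF emp_backward_kernels _ t f, where n="Suc t"]) simp
  then show ?thesis
    using t f bwd_measurable_snd[OF f(1)] bwd_measurable_snd[OF forward_step_measurable[OF f(1)]]
    by (subst (1 2) gam_emp) auto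
qed

text \<open>For a fixed endpoint \<open>x\<close>, multiplication by the denominator turns the
  backward function into \<open>gam\<close> of a bounded path function one time step earlier, to
  which the law of large numbers applies directly.\<close>

lemma gam_normalised_bwd:
  assumes f: "f \<in> borel_measurable all_paths" "\<And>y. \<bar>f y\<bar> \<le> B" and t: "t \<le> T"
  shows "gam t (\<lambda>z. m z x) \<omega> * bwd (Suc t) f \<omega> x = gam t (bwd t (\<lambda>y. m (y t) x * f (y(Suc t := x))) \<omega>) \<omega>"
proof -
  have f': "(\<lambda>y. m (y t) x * f (y(Suc t := x))) \<in> borel_measurable all_paths" using f(1) by measurable
  have "(\<integral>z. m z x \<partial>emp \<omega> t) * bwd (Suc t) f \<omega> x = (\<integral>z. bwd t (\<lambda>y. m (y t) x * f (y(Suc t := x))) \<omega> z \<partial>emp \<omega> t)"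
    unfolding bwd_def
    by (rule backward_path_normalised(2)[OF emp_backward_kernels _ f, where n="Suc t"]) simp
  then show ?thesis
    using t bwd_measurable_snd[OF f'] by (subst (1 2) gam_emp) auto
qed

lemma ffbs_eq:
  "ffbs S T N \<xi> I f \<omega> = (\<integral>x. bwd T f \<omega> x \<partial>emp \<omega> T)"
  by (simp add: ffbs_def bwd_def)

section \<open>The conditional law of one generation given the past\<close>

abbreviation "index_pos \<equiv> count_space {1..N} \<Otimes>\<^sub>M (borel :: 'x measure)"

definition select_prob :: "nat \<Rightarrow> nat \<Rightarrow> 'w \<Rightarrow> real" where
  "select_prob t j \<omega> = w t j \<omega> * adj_mult S (Suc t) (\<xi> t j \<omega>) / mass t \<omega>"

text \<open>When the selection mass vanishes there is nothing to normalise. A Dirac measure at an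
  arbitrary admissible pair (index 1 exists because \<open>N \<ge> 1\<close>) keeps this a
  probability kernel on the whole space; its value there is masked by the event
  \<open>mass t \<omega> > 0\<close>.\<close>

definition mut_kernel :: "nat \<Rightarrow> 'w \<Rightarrow> (nat \<times> 'x) measure" where
  "mut_kernel t \<omega> = (if mass t \<omega> > 0
    then point_measure {1..N} (\<lambda>j. ennreal (select_prob t j \<omega>)) \<bind>
      (\<lambda>j. distr (prop_kernel S (Suc t) (\<xi> t j \<omega>)) index_pos (Pair j))
    else return index_pos (1, undefined))"

lemma select_prob_sum:
  assumes "Suc t \<le> T" shows "select_prob t j \<omega> \<ge> 0" "mass t \<omega> > 0 \<Longrightarrow> (\<Sum>j=1..N. select_prob t j \<omega>) = 1"
proof -
  show "select_prob t j \<omega> \<ge> 0"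
    unfolding select_prob_def using assms mass_nonneg[OF assms, of \<omega>] w_bounds(1)[of t j \<omega>] adj_mult_pos[of "Suc t" "\<xi> t j \<omega>"]
    by simp
  show "(\<Sum>j=1..N. select_prob t j \<omega>) = 1" if "mass t \<omega> > 0"
    unfolding select_prob_def sum_divide_distrib[symmetric] using that by (simp add: mass_def)
qed

lemma prob_select:
  assumes "Suc t \<le> T" "mass t \<omega> > 0"
  shows "prob_space (point_measure {1..N} (\<lambda>j. ennreal (select_prob t j \<omega>)))"
proof
  show "emeasure (point_measure {1..N} (\<lambda>j. ennreal (select_prob t j \<omega>)))
      (space (point_measure {1..N} (\<lambda>j. ennreal (select_prob t j \<omega>)))) = 1"
    using select_prob_sum[OF assms(1)] assms(2)
    by (simp add: space_point_measure emeasure_point_measure_finite sum_ennreal)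
qed

lemma mut_component_measurable:
  assumes "Suc t \<le> T" "j \<in> {1..N}"
  shows "Pair j \<in> prop_kernel S (Suc t) x \<rightarrow>\<^sub>M index_pos"
    "distr (prop_kernel S (Suc t) x) index_pos (Pair j) \<in> space (prob_algebra index_pos)"
proof -
  show 1: "Pair j \<in> prop_kernel S (Suc t) x \<rightarrow>\<^sub>M index_pos"
    unfolding measurable_cong_sets[OF prob_prop(2)[OF assms(1)] refl] using assms by (intro measurable_Pair1') simp
  show "distr (prop_kernel S (Suc t) x) index_pos (Pair j) \<in> space (prob_algebra index_pos)"
    using prob_space.prob_space_distr[OF prob_prop(1)[OF assms(1)] 1] by (simp add: space_prob_algebra)
qed

lemma mut_bind_measurable:
  assumes "Suc t \<le> T"
  shows "(\<lambda>j. distr (prop_kernel S (Suc t) (\<xi> t j \<omega>)) index_pos (Pair j)) \<in>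
    point_measure {1..N} (\<lambda>j. ennreal (select_prob t j \<omega>)) \<rightarrow>\<^sub>M prob_algebra index_pos"
  unfolding measurable_point_measure_eq1 by (intro Pi_I mut_component_measurable(2)[OF assms])

lemma prob_mut_kernel:
  assumes "Suc t \<le> T" shows "prob_space (mut_kernel t \<omega>)" "sets (mut_kernel t \<omega>) = sets index_pos"
proof -
  have r: "return index_pos (1, undefined) \<in> space (prob_algebra index_pos)"
    using N_pos by (auto simp: space_prob_algebra space_pair_measure intro!: prob_space_return)
  have "mut_kernel t \<omega> \<in> space (prob_algebra index_pos)"
  proof (cases "mass t \<omega> > 0")
    case True
    interpret p: prob_space "point_measure {1..N} (\<lambda>j. ennreal (select_prob t j \<omega>))"
      by (rule prob_select[OF assms True])
    note k = mut_bind_measurable[OF assms, of \<omega>]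
    have "prob_space (point_measure {1..N} (\<lambda>j. ennreal (select_prob t j \<omega>)) \<bind>
      (\<lambda>j. distr (prop_kernel S (Suc t) (\<xi> t j \<omega>)) index_pos (Pair j)))"
      using measurable_space[OF k] by (intro p.prob_space_bind[OF _ measurable_prob_algebraD[OF k]] AE_I2) (simp add: space_prob_algebra)
    then show ?thesis using True sets_bind[OF sets_kernel[OF measurable_prob_algebraD[OF k]] p.not_empty]
      by (simp add: mut_kernel_def space_prob_algebra)
  qed (use r in \<open>simp add: mut_kernel_def\<close>)
  then show "prob_space (mut_kernel t \<omega>)" "sets (mut_kernel t \<omega>) = sets index_pos"
    by (simp_all add: space_prob_algebra)
qed

lemma mut_kernel_emeasure:
  assumes t: "Suc t \<le> T" and pos: "mass t \<omega> > 0" and A: "A \<in> sets index_pos"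
  shows "emeasure (mut_kernel t \<omega>) A =
    (\<Sum>j=1..N. emeasure (prop_kernel S (Suc t) (\<xi> t j \<omega>)) (Pair j -` A) * ennreal (select_prob t j \<omega>))"
proof -
  interpret p: prob_space "point_measure {1..N} (\<lambda>j. ennreal (select_prob t j \<omega>))" by (rule prob_select[OF t pos])
  have "emeasure (mut_kernel t \<omega>) A = (\<integral>\<^sup>+j. emeasure (distr (prop_kernel S (Suc t) (\<xi> t j \<omega>)) index_pos (Pair j)) A
      \<partial>point_measure {1..N} (\<lambda>j. ennreal (select_prob t j \<omega>)))"
    unfolding mut_kernel_def if_P[OF pos]
    by (rule emeasure_bind[OF p.not_empty measurable_prob_algebraD[OF mut_bind_measurable[OF t]] A])
  also have "\<dots> = (\<Sum>j=1..N. emeasure (distr (prop_kernel S (Suc t) (\<xi> t j \<omega>)) index_pos (Pair j)) A * ennreal (select_prob t j \<omega>))"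
    by (subst nn_integral_point_measure_finite) (auto simp: mult.commute)
  also have "\<dots> = (\<Sum>j=1..N. emeasure (prop_kernel S (Suc t) (\<xi> t j \<omega>)) (Pair j -` A) * ennreal (select_prob t j \<omega>))"
  proof (intro sum.cong refl arg_cong2[where f="(*)"])
    fix j assume j: "j \<in> {1..N}"
    have "space (prop_kernel S (Suc t) (\<xi> t j \<omega>)) = UNIV" using sets_eq_imp_space_eq[OF prob_prop(2)[OF t]] by simp
    then show "emeasure (distr (prop_kernel S (Suc t) (\<xi> t j \<omega>)) index_pos (Pair j)) A =
        emeasure (prop_kernel S (Suc t) (\<xi> t j \<omega>)) (Pair j -` A)"
      by (simp add: emeasure_distr[OF mut_component_measurable(1)[OF t j] A])
  qed
  finally show ?thesis .
qed

lemma mut_kernel_integral: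
  fixes f :: "nat \<times> 'x \<Rightarrow> real"
  assumes t: "Suc t \<le> T" and pos: "mass t \<omega> > 0" and f: "f \<in> borel_measurable index_pos" and B: "\<And>x. \<bar>f x\<bar> \<le> B"
  shows "(\<integral>z. f z \<partial>mut_kernel t \<omega>) =
    (\<Sum>j=1..N. select_prob t j \<omega> * (\<integral>x. f (j, x) \<partial>prop_kernel S (Suc t) (\<xi> t j \<omega>)))"
proof -
  interpret p: prob_space "point_measure {1..N} (\<lambda>j. ennreal (select_prob t j \<omega>))" by (rule prob_select[OF t pos])
  note k = mut_bind_measurable[OF t, of \<omega>]
  have "(\<integral>z. f z \<partial>mut_kernel t \<omega>) = (\<integral>j. (\<integral>z. f z \<partial>distr (prop_kernel S (Suc t) (\<xi> t j \<omega>)) index_pos (Pair j))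
      \<partial>point_measure {1..N} (\<lambda>j. ennreal (select_prob t j \<omega>)))"
    unfolding mut_kernel_def if_P[OF pos]
  proof (intro integral_bind[OF f B measurable_prob_algebraD[OF k]])
    show "finite_measure (point_measure {1..N} (\<lambda>j. ennreal (select_prob t j \<omega>)))" by unfold_locales
    show "AE x in point_measure {1..N} (\<lambda>j. ennreal (select_prob t j \<omega>)).
        emeasure (distr (prop_kernel S (Suc t) (\<xi> t x \<omega>)) index_pos (Pair x))
         (space (distr (prop_kernel S (Suc t) (\<xi> t x \<omega>)) index_pos (Pair x))) \<le> ennreal 1"
      using measurable_space[OF k] by (intro AE_I2) (simp add: space_prob_algebra prob_space.emeasure_le_1)
  qed
  also have "\<dots> = (\<Sum>j=1..N. select_prob t j \<omega> * (\<integral>z. f z \<partial>distr (prop_kernel S (Suc t) (\<xi> t j \<omega>)) index_pos (Pair j)))"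
    by (subst lebesgue_integral_point_measure_finite) (auto simp: select_prob_sum[OF t])
  also have "\<dots> = (\<Sum>j=1..N. select_prob t j \<omega> * (\<integral>x. f (j, x) \<partial>prop_kernel S (Suc t) (\<xi> t j \<omega>)))"
    by (intro sum.cong refl arg_cong2[where f="(*)"] integral_distr mut_component_measurable(1)[OF t] f)
  finally show ?thesis .
qed

lemma select_prob_measurable:
  assumes "Suc t \<le> T" "j \<in> {1..N}" shows "select_prob t j \<in> borel_measurable (hist t)"
  unfolding select_prob_def[abs_def]
  using assms
  by (intro borel_measurable_divide borel_measurable_times w_hist mass_measurable
      measurable_compose[OF xi_hist adj_mult_measurable]) auto

lemma mut_kernel_measurable:
  assumes t: "Suc t \<le> T" shows "mut_kernel t \<in> hist t \<rightarrow>\<^sub>M prob_algebra index_pos"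
proof (rule measurable_prob_algebra_generated[where G="sets index_pos" and \<Omega>="space index_pos"])
  show "sets index_pos = sigma_sets (space index_pos) (sets index_pos)" by (rule sets.sigma_sets_eq[symmetric])
  show "Int_stable (sets index_pos)" by (auto intro: Int_stableI)
  show "sets index_pos \<subseteq> Pow (space index_pos)" by (rule sets.space_closed)
  fix A assume A: "A \<in> sets index_pos"
  have "(\<lambda>\<omega>. \<Sum>j=1..N. emeasure (prop_kernel S (Suc t) (\<xi> t j \<omega>)) (Pair j -` A) * ennreal (select_prob t j \<omega>))
      \<in> borel_measurable (hist t)"
  proof (intro borel_measurable_sum borel_measurable_times_ennreal)
    fix j assume j: "j \<in> {1..N}"
    show "(\<lambda>\<omega>. ennreal (select_prob t j \<omega>)) \<in> borel_measurable (hist t)"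
      using select_prob_measurable[OF t j] by simp
    have "(\<lambda>x. emeasure (prop_kernel S (Suc t) x) (Pair j -` A)) \<in> borel_measurable borel"
      using t by (intro measurable_emeasure_kernel[OF measurable_prob_algebraD[OF prop_kernel]] sets_Pair1[OF A]) simp
    from measurable_compose[OF xi_hist this]
    show "(\<lambda>\<omega>. emeasure (prop_kernel S (Suc t) (\<xi> t j \<omega>)) (Pair j -` A)) \<in> borel_measurable (hist t)"
      using t j by simp
  qed
  moreover have "{\<omega> \<in> space (hist t). mass t \<omega> > 0} \<in> sets (hist t)"
    using mass_measurable[of t t] t by (intro borel_measurable_less borel_measurable_const) auto
  ultimately have "(\<lambda>\<omega>. if mass t \<omega> > 0
      then \<Sum>j=1..N. emeasure (prop_kernel S (Suc t) (\<xi> t j \<omega>)) (Pair j -` A) * ennreal (select_prob t j \<omega>)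
      else emeasure (return index_pos (1, undefined)) A) \<in> borel_measurable (hist t)"
    by (intro measurable_If) auto
  also have "(\<lambda>\<omega>. if mass t \<omega> > 0
      then \<Sum>j=1..N. emeasure (prop_kernel S (Suc t) (\<xi> t j \<omega>)) (Pair j -` A) * ennreal (select_prob t j \<omega>)
      else emeasure (return index_pos (1, undefined)) A) = (\<lambda>\<omega>. emeasure (mut_kernel t \<omega>) A)"
  proof (rule ext)
    fix \<omega> show "(if mass t \<omega> > 0
      then \<Sum>j=1..N. emeasure (prop_kernel S (Suc t) (\<xi> t j \<omega>)) (Pair j -` A) * ennreal (select_prob t j \<omega>)
      else emeasure (return index_pos (1, undefined)) A) = emeasure (mut_kernel t \<omega>) A"
      using mut_kernel_emeasure[OF t _ A, of \<omega>] by (cases "mass t \<omega> > 0") (simp_all add: mut_kernel_def)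
  qed
  finally show "(\<lambda>\<omega>. emeasure (mut_kernel t \<omega>) A) \<in> borel_measurable (hist t)" .
qed (rule prob_mut_kernel[OF t])+

lemma mutation_mass_eq:
  assumes t: "Suc t \<le> T" and pos: "mass t \<omega> > 0" and A: "A \<in> sets index_pos"
  shows "measure (mut_kernel t \<omega>) A = mutation_mass S N \<xi> I (Suc t) \<omega> A / mass t \<omega>"
proof -
  interpret k: prob_space "mut_kernel t \<omega>" by (rule prob_mut_kernel[OF t])
  have "measure (mut_kernel t \<omega>) A = (\<integral>z. indicat_real A z \<partial>mut_kernel t \<omega>)"
    using sets.sets_into_space[OF A] sets_eq_imp_space_eq[OF prob_mut_kernel(2)[OF t, of \<omega>]] by (simp add: Int_absorb2)
  also have "\<dots> = (\<Sum>j=1..N. select_prob t j \<omega> * (\<integral>x. indicat_real A (j, x) \<partial>prop_kernel S (Suc t) (\<xi> t j \<omega>)))"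
    using A by (intro mut_kernel_integral[OF t pos, where B=1]) (auto simp: indicator_def)
  also have "\<dots> = (\<Sum>j=1..N. select_prob t j \<omega> * measure (prop_kernel S (Suc t) (\<xi> t j \<omega>)) (Pair j -` A))"
  proof (intro sum.cong refl arg_cong2[where f="(*)"])
    fix j
    have "space (prop_kernel S (Suc t) (\<xi> t j \<omega>)) = UNIV" using sets_eq_imp_space_eq[OF prob_prop(2)[OF t]] by simp
    moreover have "(\<integral>x. indicat_real A (j, x) \<partial>prop_kernel S (Suc t) (\<xi> t j \<omega>)) =
        (\<integral>x. indicat_real (Pair j -` A) x \<partial>prop_kernel S (Suc t) (\<xi> t j \<omega>))"
      by (intro Bochner_Integration.integral_cong) (auto simp: indicator_def)
    ultimately show "(\<integral>x. indicat_real A (j, x) \<partial>prop_kernel S (Suc t) (\<xi> t j \<omega>)) =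
        measure (prop_kernel S (Suc t) (\<xi> t j \<omega>)) (Pair j -` A)" by simp
  qed
  also have "\<dots> = mutation_mass S N \<xi> I (Suc t) \<omega> A / mass t \<omega>"
    by (simp add: mutation_mass_def select_prob_def sum_divide_distrib)
  finally show ?thesis .
qed

lemma mutation_mass_total:
  assumes t: "Suc t \<le> T" shows "mutation_mass S N \<xi> I (Suc t) \<omega> ({1..N} \<times> UNIV) = mass t \<omega>"
proof -
  have "measure (prop_kernel S (Suc t) x) (Pair j -` ({1..N} \<times> UNIV)) = 1" if "j \<in> {1..N}" for x j
  proof -
    interpret p: prob_space "prop_kernel S (Suc t) x" by (rule prob_prop[OF t])
    have "space (prop_kernel S (Suc t) x) = UNIV" using sets_eq_imp_space_eq[OF prob_prop(2)[OF t]] by simp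
    moreover have "Pair j -` ({1..N} \<times> UNIV) = (UNIV :: 'x set)" using that by auto
    ultimately show ?thesis using p.prob_space by simp
  qed
  then show ?thesis by (simp add: mutation_mass_def mass_def)
qed

text \<open>The prescribed conditional expectation holds only where the mass is positive, which is
  an event of the past and serves as \<open>E\<close>. Integrating it against indicators of past
  events inside \<open>E\<close> gives the rectangle identity.\<close>

lemma mutation_cond_iid:
  assumes t: "Suc t \<le> T"
  shows "cond_iid \<P> (hist t) index_pos (mut_kernel t) (\<lambda>i \<omega>. (I (Suc t) i \<omega>, \<xi> (Suc t) i \<omega>)) {1..N}
    {\<omega> \<in> space \<P>. mass t \<omega> > 0}"
proof (intro cond_iid.intro cond_iid_axioms.intro)
  let ?E = "{\<omega> \<in> space \<P>. mass t \<omega> > 0}" and ?Z = "\<lambda>i \<omega>. (I (Suc t) i \<omega>, \<xi> (Suc t) i \<omega>)"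
  show sub: "subalgebra \<P> (hist t)" using t by (intro hist_subalgebra) simp
  show L: "mut_kernel t \<in> hist t \<rightarrow>\<^sub>M prob_algebra index_pos" by (rule mut_kernel_measurable[OF t])
  show Z: "?Z i \<in> \<P> \<rightarrow>\<^sub>M index_pos" if "i \<in> {1..N}" for i
    using that t by (intro measurable_Pair ancestor_measurable particle_measurable) auto
  show E: "?E \<in> sets (hist t)"
    using mass_measurable[of t t] t borel_measurable_less[of "\<lambda>_. 0" "hist t" "mass t"] by simp
  show "finite {1..N}" "{1..N} \<noteq> {}" using N_pos by auto
  show "prob_space \<P>" by unfold_locales
  fix G A assume G: "G \<in> sets (hist t)" and A: "\<And>i. i \<in> {1..N} \<Longrightarrow> A i \<in> sets index_pos"
  interpret F: finite_measure_subalgebra \<P> "hist t" by unfold_locales (rule sub)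
  let ?C = "{\<omega> \<in> space \<P>. \<forall>i\<in>{1..N}. ?Z i \<omega> \<in> A i}"
  have C: "?C \<in> events"
  proof (rule sets.sets_Collect_finite_All)
    show "{\<omega> \<in> space \<P>. ?Z i \<omega> \<in> A i} \<in> events" if "i \<in> {1..N}" for i
      using measurable_sets[OF Z[OF that] A[OF that]] by (simp add: vimage_def Int_def conj_commute)
  qed simp
  have EG: "?E \<inter> G \<in> sets (hist t)" using E G by auto
  then have EG': "?E \<inter> G \<in> events" using sub by (auto simp: subalgebra_def)
  have AE: "AE \<omega> in \<P>. mass t \<omega> > 0 \<longrightarrow>
      real_cond_exp \<P> (hist t) (indicat_real ?C) \<omega> = (\<Prod>i=1..N. measure (mut_kernel t \<omega>) (A i))"
  proof -
    have "AE \<omega> in \<P>. mutation_mass S N \<xi> I (Suc t) \<omega> ({1..N} \<times> UNIV) > 0 \<longrightarrow>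
      real_cond_exp \<P> (hist (Suc t - 1)) (indicat_real ?C) \<omega> =
        (\<Prod>i=1..N. mutation_mass S N \<xi> I (Suc t) \<omega> (A i) / mutation_mass S N \<xi> I (Suc t) \<omega> ({1..N} \<times> UNIV))"
      using t A by (intro mutation) auto
    then show ?thesis
      unfolding mutation_mass_total[OF t] diff_Suc_1
      by eventually_elim (auto simp: mutation_mass_eq[OF t _ A] intro!: prod.cong)
  qed
  have mm: "(\<lambda>\<omega>. measure (mut_kernel t \<omega>) (A i)) \<in> borel_measurable \<P>" if "i \<in> {1..N}" for i
    unfolding measure_def
    by (rule measurable_from_subalg[OF sub borel_measurable_enn2real[OF measurable_emeasure_kernel[OF measurable_prob_algebraD[OF L] A[OF that]]]])
  have int: "integrable \<P> (\<lambda>\<omega>. indicat_real (?E \<inter> G) \<omega> * indicat_real ?C \<omega>)"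
    by (intro integrable_const_bound[where B=1] borel_measurable_times borel_measurable_indicator C EG' AE_I2)
       (simp add: indicator_def)
  have "prob {\<omega> \<in> ?E \<inter> G. \<forall>i\<in>{1..N}. ?Z i \<omega> \<in> A i} = (\<integral>\<omega>. indicat_real (?E \<inter> G) \<omega> * indicat_real ?C \<omega> \<partial>\<P>)"
  proof -
    have "(\<integral>\<omega>. indicat_real (?E \<inter> G) \<omega> * indicat_real ?C \<omega> \<partial>\<P>) = (\<integral>\<omega>. indicat_real (?E \<inter> G \<inter> ?C) \<omega> \<partial>\<P>)"
      by (intro Bochner_Integration.integral_cong) (auto simp: indicator_def)
    also have "\<dots> = prob (?E \<inter> G \<inter> ?C \<inter> space \<P>)" by simp
    also have "?E \<inter> G \<inter> ?C \<inter> space \<P> = ?E \<inter> G \<inter> ?C" by auto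
    also have "?E \<inter> G \<inter> ?C = {\<omega> \<in> ?E \<inter> G. \<forall>i\<in>{1..N}. ?Z i \<omega> \<in> A i}" by auto
    finally show ?thesis by simp
  qed
  also have "\<dots> = (\<integral>\<omega>. indicat_real (?E \<inter> G) \<omega> * real_cond_exp \<P> (hist t) (indicat_real ?C) \<omega> \<partial>\<P>)"
    using C EG by (intro F.real_cond_exp_intg(2)[OF int, symmetric]) auto
  also have "\<dots> = (\<integral>\<omega>. indicat_real (?E \<inter> G) \<omega> * (\<Prod>i=1..N. measure (mut_kernel t \<omega>) (A i)) \<partial>\<P>)"
  proof (rule integral_cong_AE)
    show "(\<lambda>\<omega>. indicat_real (?E \<inter> G) \<omega> * real_cond_exp \<P> (hist t) (indicat_real ?C) \<omega>) \<in> borel_measurable \<P>"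
      using EG' measurable_from_subalg[OF sub borel_measurable_cond_exp] by (intro borel_measurable_times) auto
    show "(\<lambda>\<omega>. indicat_real (?E \<inter> G) \<omega> * (\<Prod>i=1..N. measure (mut_kernel t \<omega>) (A i))) \<in> borel_measurable \<P>"
      using EG' mm by (intro borel_measurable_times borel_measurable_prod) auto
    show "AE \<omega> in \<P>. indicat_real (?E \<inter> G) \<omega> * real_cond_exp \<P> (hist t) (indicat_real ?C) \<omega> =
        indicat_real (?E \<inter> G) \<omega> * (\<Prod>i=1..N. measure (mut_kernel t \<omega>) (A i))"
      using AE by eventually_elim (auto simp: indicator_def)
  qed
  finally show "prob {\<omega> \<in> ?E \<inter> G. \<forall>i\<in>{1..N}. ?Z i \<omega> \<in> A i} =
    (\<integral>\<omega>. indicator (?E \<inter> G) \<omega> * (\<Prod>i\<in>{1..N}. measure (mut_kernel t \<omega>) (A i)) \<partial>\<P>)" .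
qed

text \<open>The multipliers are strictly positive, so zero mass means that every weight is zero.
  Then \<open>gam t\<close> vanishes, and the factor \<open>acc (Suc t)\<close> annihilates whatever
  the unconstrained later generations do.\<close>

lemma mass_zero:
  assumes t: "Suc t \<le> T" and "\<not> mass t \<omega> > 0"
  shows "gam t b \<omega> = 0" "acc (Suc t) \<omega> = 0"
proof -
  have "mass t \<omega> = 0" using assms mass_nonneg[OF t, of \<omega>] by simp
  moreover have "0 \<le> w t i \<omega> * adj_mult S (Suc t) (\<xi> t i \<omega>)" for i
    using t by (intro mult_nonneg_nonneg w_bounds less_imp_le adj_mult_pos) auto
  ultimately have "w t i \<omega> * adj_mult S (Suc t) (\<xi> t i \<omega>) = 0" if "i \<in> {1..N}" for i
    using that sum_nonneg_eq_0_iff[of "{1..N}" "\<lambda>i. w t i \<omega> * adj_mult S (Suc t) (\<xi> t i \<omega>)"]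
    unfolding mass_def by auto
  note z = this
  have "w t i \<omega> = 0" if "i \<in> {1..N}" for i
    using z[OF that] adj_mult_pos[of "Suc t" "\<xi> t i \<omega>"] t by simp
  then show "gam t b \<omega> = 0" by (simp add: gam_def)
  show "acc (Suc t) \<omega> = 0" using \<open>mass t \<omega> = 0\<close> by simp
qed

lemma gam_Suc: "gam (Suc t) b \<omega> = (\<Sum>i=1..N. acc (Suc t) \<omega> * (w (Suc t) i \<omega> * b (\<xi> (Suc t) i \<omega>))) / N"
  by (simp add: gam_def flip: sum_distrib_left del: acc.simps)

section \<open>One selection and mutation step for a test function depending on the past\<close>

context
  fixes b :: "'w \<Rightarrow> 'x \<Rightarrow> real" and B :: real and t :: nat
  assumes b: "(\<lambda>(\<omega>, x). b \<omega> x) \<in> borel_measurable (hist t \<Otimes>\<^sub>M borel)"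
    and B: "\<And>\<omega> x. \<bar>b \<omega> x\<bar> \<le> B" and t: "Suc t \<le> T"
begin

text \<open>The contribution of one offspring to
  \<open>N * gam (Suc t) (b \<omega>) \<omega>\<close>, where \<open>z\<close> pairs the ancestor
  index with the new position. Including the predictable factor \<open>acc (Suc t)\<close> makes the
  sum over offspring an exact multiple of \<open>gam\<close>.\<close>

definition "step_fun \<omega> z = acc (Suc t) \<omega> * (weight S (Suc t) (\<xi> t (fst z) \<omega>) (snd z) * b \<omega> (snd z))"

definition "step_const = (Cw * Ca) ^ Suc t * (Cw * B)"

lemma step_fun_measurable: "(\<lambda>(\<omega>, z). step_fun \<omega> z) \<in> borel_measurable (hist t \<Otimes>\<^sub>M index_pos)"
proof -
  let ?F = "hist t \<Otimes>\<^sub>M index_pos"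
  have "(\<lambda>p. \<xi> t (fst (snd p)) (fst p)) \<in> ?F \<rightarrow>\<^sub>M borel"
  proof (rule measurable_compose_countable'[where I="{1..N}" and f="\<lambda>j p. \<xi> t j (fst p)" and g="\<lambda>p. fst (snd p)"])
    show "(\<lambda>p. \<xi> t j (fst p)) \<in> ?F \<rightarrow>\<^sub>M borel" if "j \<in> {1..N}" for j
      using that t by (intro measurable_compose[OF measurable_fst xi_hist]) auto
  qed auto
  then have 1: "(\<lambda>p. weight S (Suc t) (\<xi> t (fst (snd p)) (fst p)) (snd (snd p))) \<in> borel_measurable ?F"
    using t by (intro weight_measurable_comp) auto
  have "(\<lambda>p. (fst p, snd (snd p))) \<in> ?F \<rightarrow>\<^sub>M hist t \<Otimes>\<^sub>M borel" by measurable
  from measurable_compose[OF this b] have 2: "(\<lambda>p. b (fst p) (snd (snd p))) \<in> borel_measurable ?F" by simp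
  have 3: "(\<lambda>p. acc (Suc t) (fst p)) \<in> borel_measurable ?F"
    using t by (intro measurable_compose[OF measurable_fst acc_measurable]) auto
  show ?thesis unfolding step_fun_def split_beta' by (intro borel_measurable_times 1 2 3)
qed

lemma step_fun_bound: "\<bar>step_fun \<omega> z\<bar> \<le> step_const"
proof -
  have "\<bar>weight S (Suc t) (\<xi> t (fst z) \<omega>) (snd z) * b \<omega> (snd z)\<bar> \<le> Cw * B"
    unfolding abs_mult using t weight_nonneg[of "Suc t"] weight_le[of "Suc t"] Cw_nonneg B by (intro mult_mono) auto
  then show ?thesis
    unfolding step_fun_def step_const_def abs_mult[of "acc _ _"]
    using acc_bounds[OF t, of \<omega>] by (intro mult_mono) (simp_all del: acc.simps)
qed

lemma b_snd: assumes "\<omega> \<in> space \<P>" shows "b \<omega> \<in> borel_measurable borel"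
  using measurable_Pair2[OF b, of \<omega>] assms by simp

interpretation ci: cond_iid \<P> "hist t" index_pos "mut_kernel t" "\<lambda>i \<omega>. (I (Suc t) i \<omega>, \<xi> (Suc t) i \<omega>)" "{1..N}"
  "{\<omega> \<in> space \<P>. mass t \<omega> > 0}"
  by (rule mutation_cond_iid[OF t])

text \<open>The conditional variance of one offspring contribution, written with \<open>gam\<close>
  and \<open>acc\<close> rather than with selection probabilities; in this form it contains no
  division by the mass and equals zero when the mass does.\<close>

definition "step_var \<omega> = acc (Suc t) \<omega> * gam t (weight_op t (\<lambda>x. (b \<omega> x)\<^sup>2)) \<omega> - (gam t (predict t (b \<omega>)) \<omega>)\<^sup>2"

text \<open>The selection probabilities divide by \<open>mass t \<omega>\<close>, and
  \<open>acc (Suc t)\<close> contains \<open>mass t \<omega> / N\<close>. In the first moment the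
  mass cancels completely; in the second one factor \<open>acc (Suc t)\<close> is left over.\<close>

lemma step_cmean:
  assumes w: "\<omega> \<in> space \<P>" and pos: "mass t \<omega> > 0"
  shows "ci.cmean step_fun \<omega> = gam t (predict t (b \<omega>)) \<omega>"
    "(\<integral>z. (step_fun \<omega> z)\<^sup>2 \<partial>mut_kernel t \<omega>) = acc (Suc t) \<omega> * gam t (weight_op t (\<lambda>x. (b \<omega> x)\<^sup>2)) \<omega>"
proof -
  note bm[measurable] = b_snd[OF w]
  have fm: "step_fun \<omega> \<in> borel_measurable index_pos"
    using measurable_Pair2[OF step_fun_measurable, of \<omega>] w by simp
  have "ci.cmean step_fun \<omega> = (\<Sum>j=1..N. select_prob t j \<omega> * (\<integral>x. step_fun \<omega> (j, x) \<partial>prop_kernel S (Suc t) (\<xi> t j \<omega>)))"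
    unfolding ci.cmean_def[OF step_fun_measurable step_fun_bound] by (rule mut_kernel_integral[OF t pos fm step_fun_bound])
  also have "\<dots> = (\<Sum>j=1..N. w t j \<omega> * (acc (Suc t) \<omega> / mass t \<omega>) * predict t (b \<omega>) (\<xi> t j \<omega>))"
    by (intro sum.cong refl) (simp add: step_fun_def select_prob_def prop_integral_weight(1)[OF t bm, symmetric] del: acc.simps)
  also have "\<dots> = gam t (predict t (b \<omega>)) \<omega>"
    using pos by (simp add: gam_def sum_distrib_left mult_ac sum_divide_distrib)
  finally show "ci.cmean step_fun \<omega> = gam t (predict t (b \<omega>)) \<omega>" .
  have fb: "\<bar>(step_fun \<omega> z)\<^sup>2\<bar> \<le> step_const\<^sup>2" for z
    using power_mono[OF step_fun_bound abs_ge_zero, of \<omega> z 2] by simp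
  have "(\<integral>z. (step_fun \<omega> z)\<^sup>2 \<partial>mut_kernel t \<omega>) =
      (\<Sum>j=1..N. select_prob t j \<omega> * (\<integral>x. (step_fun \<omega> (j, x))\<^sup>2 \<partial>prop_kernel S (Suc t) (\<xi> t j \<omega>)))"
    using fm by (intro mut_kernel_integral[OF t pos _ fb]) measurable
  also have "\<dots> = (\<Sum>j=1..N. w t j \<omega> * ((acc (Suc t) \<omega>)\<^sup>2 / mass t \<omega>) * weight_op t (\<lambda>x. (b \<omega> x)\<^sup>2) (\<xi> t j \<omega>))"
    by (intro sum.cong refl) (simp add: step_fun_def select_prob_def power_mult_distrib prop_integral_weight(2)[OF t, symmetric] del: acc.simps)
  also have "\<dots> = acc (Suc t) \<omega> * gam t (weight_op t (\<lambda>x. (b \<omega> x)\<^sup>2)) \<omega>"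
    using pos by (simp add: gam_def sum_distrib_left mult_ac sum_divide_distrib power2_eq_square)
  finally show "(\<integral>z. (step_fun \<omega> z)\<^sup>2 \<partial>mut_kernel t \<omega>) = acc (Suc t) \<omega> * gam t (weight_op t (\<lambda>x. (b \<omega> x)\<^sup>2)) \<omega>" .
qed

lemma step_sum: "(\<Sum>i\<in>{1..N}. step_fun \<omega> (I (Suc t) i \<omega>, \<xi> (Suc t) i \<omega>)) = N * gam (Suc t) (b \<omega>) \<omega>"
  unfolding gam_Suc step_fun_def w_Suc using N_pos by simp

lemma step_centred:
  assumes "\<omega> \<in> space \<P>"
  shows "indicator {\<omega> \<in> space \<P>. mass t \<omega> > 0} \<omega> *
      ((\<Sum>i\<in>{1..N}. step_fun \<omega> (I (Suc t) i \<omega>, \<xi> (Suc t) i \<omega>)) - real (card {1..N}) * ci.cmean step_fun \<omega>) =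
    N * (gam (Suc t) (b \<omega>) \<omega> - gam t (predict t (b \<omega>)) \<omega>)"
proof (cases "mass t \<omega> > 0")
  case True
  then show ?thesis using assms unfolding step_sum by (simp add: step_cmean right_diff_distrib)
next
  case False
  then show ?thesis using mass_zero[OF t False] by (simp add: gam_Suc del: acc.simps)
qed

lemma step_lln:
  "(\<integral>\<omega>. \<bar>gam (Suc t) (b \<omega>) \<omega> - gam t (predict t (b \<omega>)) \<omega>\<bar> \<partial>\<P>) \<le> step_const / sqrt N"
proof -
  have "N * (\<integral>\<omega>. \<bar>gam (Suc t) (b \<omega>) \<omega> - gam t (predict t (b \<omega>)) \<omega>\<bar> \<partial>\<P>) =
      (\<integral>\<omega>. \<bar>N * (gam (Suc t) (b \<omega>) \<omega> - gam t (predict t (b \<omega>)) \<omega>)\<bar> \<partial>\<P>)"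
    by (simp add: abs_mult)
  also have "\<dots> = (\<integral>\<omega>. indicator {\<omega> \<in> space \<P>. mass t \<omega> > 0} \<omega> *
      \<bar>(\<Sum>i\<in>{1..N}. step_fun \<omega> (I (Suc t) i \<omega>, \<xi> (Suc t) i \<omega>)) - real (card {1..N}) * ci.cmean step_fun \<omega>\<bar> \<partial>\<P>)"
    by (intro Bochner_Integration.integral_cong refl, subst step_centred[symmetric]) (auto simp: abs_mult)
  also have "\<dots> \<le> step_const * sqrt (card {1..N})"
    by (rule ci.conditional_lln[OF step_fun_measurable step_fun_bound])
  finally have "N * (\<integral>\<omega>. \<bar>gam (Suc t) (b \<omega>) \<omega> - gam t (predict t (b \<omega>)) \<omega>\<bar> \<partial>\<P>) \<le> step_const * sqrt N" by simp
  then show ?thesis using N_pos by (rule le_divide_sqrt)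
qed

lemma gam_Suc_random_measurable: "(\<lambda>\<omega>. gam (Suc t) (b \<omega>) \<omega>) \<in> borel_measurable \<P>"
proof -
  have "(\<lambda>\<omega>. \<Sum>i\<in>{1..N}. step_fun \<omega> (I (Suc t) i \<omega>, \<xi> (Suc t) i \<omega>)) \<in> borel_measurable \<P>"
    by (rule ci.sum_f_Z_measurable[OF step_fun_measurable step_fun_bound])
  then have "(\<lambda>\<omega>. (\<Sum>i\<in>{1..N}. step_fun \<omega> (I (Suc t) i \<omega>, \<xi> (Suc t) i \<omega>)) / N) \<in> borel_measurable \<P>" by simp
  then show ?thesis using N_pos by (simp add: step_sum)
qed

lemma predict_joint_measurable:
  "(\<lambda>(\<omega>, z). predict t (b \<omega>) z) \<in> borel_measurable (hist t \<Otimes>\<^sub>M borel)"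
  unfolding predict_def split_beta'
proof (rule nu.borel_measurable_lebesgue_integral)
  let ?F = "(hist t \<Otimes>\<^sub>M borel) \<Otimes>\<^sub>M \<nu>"
  have "(\<lambda>p. (fst (fst p), snd p)) \<in> ?F \<rightarrow>\<^sub>M hist t \<Otimes>\<^sub>M borel" by measurable
  from measurable_compose[OF this b] have [measurable]: "(\<lambda>p. b (fst (fst p)) (snd p)) \<in> borel_measurable ?F" by simp
  show "(\<lambda>(p, x). m (snd p) x * (g (Suc t) x * b (fst p) x)) \<in> borel_measurable ?F"
    unfolding split_beta' by measurable
qed

lemma weight_op_joint_measurable:
  "(\<lambda>(\<omega>, z). weight_op t (\<lambda>x. (b \<omega> x)\<^sup>2) z) \<in> borel_measurable (hist t \<Otimes>\<^sub>M borel)"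
  unfolding weight_op_def split_beta'
proof (rule nu.borel_measurable_lebesgue_integral)
  let ?F = "(hist t \<Otimes>\<^sub>M borel) \<Otimes>\<^sub>M \<nu>"
  have "(\<lambda>p. (fst (fst p), snd p)) \<in> ?F \<rightarrow>\<^sub>M hist t \<Otimes>\<^sub>M borel" by measurable
  from measurable_compose[OF this b] have [measurable]: "(\<lambda>p. b (fst (fst p)) (snd p)) \<in> borel_measurable ?F" by simp
  have [measurable]: "(\<lambda>p. weight S (Suc t) (snd (fst p)) (snd p)) \<in> borel_measurable ?F"
    using t by (intro weight_measurable_comp) auto
  show "(\<lambda>(p, x). m (snd p) x * (weight S (Suc t) (snd p) x * (g (Suc t) x * (b (fst p) x)\<^sup>2))) \<in> borel_measurable ?F"
    unfolding split_beta' by measurable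
qed

text \<open>The martingale property in integrated form. An exact equality, not just an error bound,
  is what shows later that a nonnegative deficit has mean zero.\<close>

lemma step_mean:
  "(\<integral>\<omega>. gam (Suc t) (b \<omega>) \<omega> \<partial>\<P>) = (\<integral>\<omega>. gam t (predict t (b \<omega>)) \<omega> \<partial>\<P>)"
proof -
  let ?E = "{\<omega> \<in> space \<P>. mass t \<omega> > 0}"
  note cm = ci.conditional_mean[OF step_fun_measurable step_fun_bound]
  have E: "?E \<in> events" by (rule ci.E_events)
  have f: "(\<lambda>\<omega>. step_fun \<omega> (I (Suc t) i \<omega>, \<xi> (Suc t) i \<omega>)) \<in> borel_measurable \<P>" if i: "i \<in> {1..N}" for i
  proof -
    have "(\<lambda>\<omega>. (\<omega>, (I (Suc t) i \<omega>, \<xi> (Suc t) i \<omega>))) \<in> \<P> \<rightarrow>\<^sub>M hist t \<Otimes>\<^sub>M index_pos"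
      by (rule measurable_Pair[OF ci.F_meas ci.Z[OF i]]) simp
    from measurable_compose[OF this step_fun_measurable] show ?thesis by simp
  qed
  have "integrable \<P> (\<lambda>\<omega>. indicator ?E \<omega> * step_fun \<omega> (I (Suc t) i \<omega>, \<xi> (Suc t) i \<omega>))" if i: "i \<in> {1..N}" for i
    using step_fun_bound order_trans[OF abs_ge_zero step_fun_bound] E f[OF i]
    by (intro integrable_const_bound[where B=step_const] borel_measurable_times borel_measurable_indicator AE_I2)
       (auto simp: indicator_def abs_mult)
  note int = this
  have "(\<integral>\<omega>. gam (Suc t) (b \<omega>) \<omega> \<partial>\<P>) = (\<integral>\<omega>. (\<Sum>i\<in>{1..N}. indicator ?E \<omega> * step_fun \<omega> (I (Suc t) i \<omega>, \<xi> (Suc t) i \<omega>)) / N \<partial>\<P>)"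
  proof (intro Bochner_Integration.integral_cong refl)
    fix \<omega> assume w: "\<omega> \<in> space \<P>"
    show "gam (Suc t) (b \<omega>) \<omega> = (\<Sum>i\<in>{1..N}. indicator ?E \<omega> * step_fun \<omega> (I (Suc t) i \<omega>, \<xi> (Suc t) i \<omega>)) / N"
    proof (cases "mass t \<omega> > 0")
      case True
      then show ?thesis using w N_pos by (simp add: step_sum)
    next
      case False
      then show ?thesis using mass_zero[OF t False] by (simp add: gam_Suc del: acc.simps)
    qed
  qed
  also have "\<dots> = (\<Sum>i\<in>{1..N}. \<integral>\<omega>. indicator ?E \<omega> * step_fun \<omega> (I (Suc t) i \<omega>, \<xi> (Suc t) i \<omega>) \<partial>\<P>) / N"
    by (subst integral_divide_zero, subst Bochner_Integration.integral_sum) (rule int, simp_all)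
  also have "\<dots> = (\<Sum>i\<in>{1..N}. \<integral>\<omega>. indicator ?E \<omega> * ci.cmean step_fun \<omega> \<partial>\<P>) / N"
    by (intro arg_cong2[where f="(/)"] sum.cong refl cm)
  also have "\<dots> = (\<integral>\<omega>. indicator ?E \<omega> * ci.cmean step_fun \<omega> \<partial>\<P>)" using N_pos by simp
  also have "\<dots> = (\<integral>\<omega>. gam t (predict t (b \<omega>)) \<omega> \<partial>\<P>)"
  proof (intro Bochner_Integration.integral_cong refl)
    fix \<omega> assume w: "\<omega> \<in> space \<P>"
    show "indicator ?E \<omega> * ci.cmean step_fun \<omega> = gam t (predict t (b \<omega>)) \<omega>"
      using w step_cmean(1)[OF w] mass_zero(1)[OF t, of \<omega>] by (cases "mass t \<omega> > 0") auto
  qed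
  finally show ?thesis .
qed

lemma step_var_bounds:
  assumes w: "\<omega> \<in> space \<P>" shows "0 \<le> step_var \<omega>"
proof (cases "mass t \<omega> > 0")
  case True
  have "step_var \<omega> = ci.cvar step_fun \<omega>"
    unfolding step_var_def ci.cvar_def[OF step_fun_measurable step_fun_bound] step_cmean[OF w True] ..
  then show ?thesis using ci.cvar_bounds(1)[OF step_fun_measurable step_fun_bound w] by simp
next
  case False
  then show ?thesis using mass_zero[OF t False] by (simp add: step_var_def)
qed

lemma step_var_measurable: "step_var \<in> borel_measurable (hist t)"
  unfolding step_var_def[abs_def]
  using t by (intro borel_measurable_diff borel_measurable_times borel_measurable_power acc_measurable
    gam_measurable predict_joint_measurable weight_op_joint_measurable) auto

text \<open>Off the event of positive mass both the increment and \<open>step_var\<close> are zero,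
  so both integrands reduce to \<open>W\<close>. These equal parts cancel in the difference, and the
  conditional bound on the event extends to the whole space.\<close>

lemma step_clt:
  assumes W: "W \<in> borel_measurable (hist t)" and W1: "\<And>\<omega>. cmod (W \<omega>) \<le> 1"
  shows "cmod ((\<integral>\<omega>. W \<omega> * iexp (u * (sqrt N * (gam (Suc t) (b \<omega>) \<omega> - gam t (predict t (b \<omega>)) \<omega>))) \<partial>\<P>) -
      (\<integral>\<omega>. W \<omega> * exp (- (u\<^sup>2 * step_var \<omega> / 2)) \<partial>\<P>)) \<le> clt_err u step_const N"
proof -
  let ?E = "{\<omega> \<in> space \<P>. mass t \<omega> > 0}"
  let ?D = "\<lambda>\<omega>. gam (Suc t) (b \<omega>) \<omega> - gam t (predict t (b \<omega>)) \<omega>"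
  let ?s = "\<lambda>\<omega>. (\<Sum>i\<in>{1..N}. step_fun \<omega> (I (Suc t) i \<omega>, \<xi> (Suc t) i \<omega>)) - card {1..N} * ci.cmean step_fun \<omega>"
  note [measurable] = ci.F_meas[OF W] ci.F_meas[OF step_var_measurable] gam_Suc_random_measurable ci.E_events
  have [measurable]: "(\<lambda>\<omega>. gam t (predict t (b \<omega>)) \<omega>) \<in> borel_measurable \<P>"
    using t by (intro ci.F_meas gam_measurable predict_joint_measurable) auto
  have Nm: "sqrt N * x = N * x / sqrt N" for x :: real
    using real_div_sqrt[of "real N"] by (metis of_nat_0_le_iff times_divide_eq_left)
  have ie: "indicator ?E \<omega> * (W \<omega> * iexp (u * ?s \<omega> / sqrt (card {1..N}))) =
     indicator ?E \<omega> * (W \<omega> * iexp (u * (sqrt N * ?D \<omega>)))" if w: "\<omega> \<in> space \<P>" for \<omega>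
  proof (cases "\<omega> \<in> ?E")
    case True
    then have "?s \<omega> = N * ?D \<omega>" using step_centred[OF w] by simp
    then show ?thesis unfolding Nm by simp
  qed simp
  have ve: "indicator ?E \<omega> * (W \<omega> * exp (- (u\<^sup>2 * ci.cvar step_fun \<omega> / 2))) =
     indicator ?E \<omega> * (W \<omega> * exp (- (u\<^sup>2 * step_var \<omega> / 2)))" if w: "\<omega> \<in> space \<P>" for \<omega>
    using step_cmean[OF w] by (cases "\<omega> \<in> ?E") (auto simp: step_var_def ci.cvar_def[OF step_fun_measurable step_fun_bound])
  have split: "(\<integral>\<omega>. W \<omega> * G \<omega> \<partial>\<P>) = (\<integral>\<omega>. indicator ?E \<omega> * (W \<omega> * G \<omega>) \<partial>\<P>) + (\<integral>\<omega>. indicator (- ?E) \<omega> * W \<omega> \<partial>\<P>)"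
    if G[measurable]: "G \<in> borel_measurable \<P>" and G1: "\<And>\<omega>. \<omega> \<in> space \<P> \<Longrightarrow> cmod (G \<omega>) \<le> 1" and G0: "\<And>\<omega>. \<omega> \<in> space \<P> \<Longrightarrow> \<omega> \<notin> ?E \<Longrightarrow> G \<omega> = 1" for G
  proof -
    have "integrable \<P> (\<lambda>\<omega>. indicator ?E \<omega> * (W \<omega> * G \<omega>))"
      using W1 G1 by (intro integrable_const_bound[where B=1] AE_I2) (auto simp: norm_mult indicator_def intro!: mult_le_one)
    moreover have "integrable \<P> (\<lambda>\<omega>. indicator (space \<P> - ?E) \<omega> * W \<omega>)"
      using W1 by (intro integrable_const_bound[where B=1] AE_I2) (auto simp: norm_mult indicator_def)
    moreover have "(\<integral>\<omega>. indicator (- ?E) \<omega> * W \<omega> \<partial>\<P>) = (\<integral>\<omega>. indicator (space \<P> - ?E) \<omega> * W \<omega> \<partial>\<P>)"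
      by (intro Bochner_Integration.integral_cong) (auto simp: indicator_def)
    moreover have "(\<integral>\<omega>. W \<omega> * G \<omega> \<partial>\<P>) = (\<integral>\<omega>. indicator ?E \<omega> * (W \<omega> * G \<omega>) + indicator (space \<P> - ?E) \<omega> * W \<omega> \<partial>\<P>)"
      by (intro Bochner_Integration.integral_cong refl) (use G0 in \<open>auto simp: indicator_def\<close>)
    ultimately show ?thesis by simp
  qed
  have "(\<integral>\<omega>. W \<omega> * iexp (u * (sqrt N * ?D \<omega>)) \<partial>\<P>) =
      (\<integral>\<omega>. indicator ?E \<omega> * (W \<omega> * iexp (u * (sqrt N * ?D \<omega>))) \<partial>\<P>) + (\<integral>\<omega>. indicator (- ?E) \<omega> * W \<omega> \<partial>\<P>)"
  proof (rule split)
    fix \<omega> assume "\<omega> \<in> space \<P>" "\<omega> \<notin> ?E"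
    then have "?D \<omega> = 0" using mass_zero[OF t, of \<omega>] by (simp add: gam_Suc del: acc.simps)
    then show "iexp (u * (sqrt N * ?D \<omega>)) = 1" by simp
  qed auto
  also have "(\<integral>\<omega>. indicator ?E \<omega> * (W \<omega> * iexp (u * (sqrt N * ?D \<omega>))) \<partial>\<P>) =
      (\<integral>\<omega>. indicator ?E \<omega> * (W \<omega> * iexp (u * ?s \<omega> / sqrt (card {1..N}))) \<partial>\<P>)"
    by (intro Bochner_Integration.integral_cong refl ie[symmetric])
  finally have 1: "(\<integral>\<omega>. W \<omega> * iexp (u * (sqrt N * ?D \<omega>)) \<partial>\<P>) =
      (\<integral>\<omega>. indicator ?E \<omega> * (W \<omega> * iexp (u * ?s \<omega> / sqrt (card {1..N}))) \<partial>\<P>) + (\<integral>\<omega>. indicator (- ?E) \<omega> * W \<omega> \<partial>\<P>)" .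
  have "(\<integral>\<omega>. W \<omega> * exp (- (u\<^sup>2 * step_var \<omega> / 2)) \<partial>\<P>) =
      (\<integral>\<omega>. indicator ?E \<omega> * (W \<omega> * exp (- (u\<^sup>2 * step_var \<omega> / 2))) \<partial>\<P>) + (\<integral>\<omega>. indicator (- ?E) \<omega> * W \<omega> \<partial>\<P>)"
  proof (rule split)
    fix \<omega> assume w: "\<omega> \<in> space \<P>"
    show "cmod (complex_of_real (exp (- (u\<^sup>2 * step_var \<omega> / 2)))) \<le> 1"
      using step_var_bounds[OF w] by simp
    assume "\<omega> \<notin> ?E"
    then have "step_var \<omega> = 0" using w mass_zero[OF t, of \<omega>] by (simp add: step_var_def del: acc.simps)
    then show "complex_of_real (exp (- (u\<^sup>2 * step_var \<omega> / 2))) = 1" by simp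
  qed measurable
  also have "(\<integral>\<omega>. indicator ?E \<omega> * (W \<omega> * exp (- (u\<^sup>2 * step_var \<omega> / 2))) \<partial>\<P>) =
      (\<integral>\<omega>. indicator ?E \<omega> * (W \<omega> * exp (- (u\<^sup>2 * ci.cvar step_fun \<omega> / 2))) \<partial>\<P>)"
    by (intro Bochner_Integration.integral_cong refl ve[symmetric])
  finally have 2: "(\<integral>\<omega>. W \<omega> * exp (- (u\<^sup>2 * step_var \<omega> / 2)) \<partial>\<P>) =
      (\<integral>\<omega>. indicator ?E \<omega> * (W \<omega> * exp (- (u\<^sup>2 * ci.cvar step_fun \<omega> / 2))) \<partial>\<P>) + (\<integral>\<omega>. indicator (- ?E) \<omega> * W \<omega> \<partial>\<P>)" .
  show ?thesis
    unfolding 1 2 using ci.conditional_clt[OF step_fun_measurable step_fun_bound W W1, of u] by simp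
qed

end

text \<open>The initial generation fits the same scheme with a trivial past, a constant kernel and
  the whole space as event, so the conditional limit theorems apply unchanged.\<close>

lemma init_cond_iid:
  "cond_iid \<P> (sigma (space \<P>) {}) borel (\<lambda>_. init_proposal S) (\<xi> 0) {1..N} (space \<P>)"
proof (intro cond_iid.intro cond_iid_axioms.intro)
  show "prob_space \<P>" by unfold_locales
  show "subalgebra \<P> (sigma (space \<P>) {})" by (auto simp: subalgebra_def sigma_sets_empty_eq)
  show "(\<lambda>_. init_proposal S) \<in> sigma (space \<P>) {} \<rightarrow>\<^sub>M prob_algebra borel"
    using init_proposal by (rule measurable_const)
  show xi: "\<xi> 0 i \<in> \<P> \<rightarrow>\<^sub>M borel" if "i \<in> {1..N}" for i using that by (intro particle_measurable) auto
  show "space \<P> \<in> sets (sigma (space \<P>) {})" by (auto simp: sigma_sets_empty_eq)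
  show "finite {1..N}" "{1..N} \<noteq> {}" using N_pos by auto
  fix G :: "'w set" and A :: "nat \<Rightarrow> 'x set"
  assume "G \<in> sets (sigma (space \<P>) {})" and A: "\<And>i. i \<in> {1..N} \<Longrightarrow> A i \<in> sets borel"
  then consider "G = {}" | "G = space \<P>" by (auto simp: sigma_sets_empty_eq)
  then show "prob {\<omega> \<in> space \<P> \<inter> G. \<forall>i\<in>{1..N}. \<xi> 0 i \<omega> \<in> A i} =
      (\<integral>\<omega>. indicator (space \<P> \<inter> G) \<omega> * (\<Prod>i\<in>{1..N}. measure (init_proposal S) (A i)) \<partial>\<P>)"
  proof cases
    case 2
    have "{\<omega> \<in> space \<P> \<inter> G. \<forall>i\<in>{1..N}. \<xi> 0 i \<omega> \<in> A i} = (\<Inter>i\<in>{1..N}. \<xi> 0 i -` A i \<inter> space \<P>)"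
      using N_pos 2 by auto
    also have "prob \<dots> = (\<Prod>i\<in>{1..N}. prob (\<xi> 0 i -` A i \<inter> space \<P>))"
      using N_pos A by (intro indep_varsD[OF init_indep]) auto
    also have "\<dots> = (\<Prod>i\<in>{1..N}. measure (init_proposal S) (A i))"
      using A xi by (intro prod.cong refl) (simp add: init_distr[symmetric] measure_distr)
    also have "\<dots> = (\<integral>\<omega>. indicator (space \<P> \<inter> G) \<omega> * (\<Prod>i\<in>{1..N}. measure (init_proposal S) (A i)) \<partial>\<P>)"
      using 2 by (simp add: prob_space)
    finally show ?thesis .
  qed simp
qed

context
  fixes b :: "'x \<Rightarrow> real" and B :: real
  assumes b[measurable]: "b \<in> borel_measurable borel" and B: "\<And>x. \<bar>b x\<bar> \<le> B"
begin

interpretation c0: cond_iid \<P> "sigma (space \<P>) {}" borel "\<lambda>_. init_proposal S" "\<xi> 0" "{1..N}" "space \<P>"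
  by (rule init_cond_iid)

lemma init_fun_measurable: "(\<lambda>(\<omega>, x). init_weight S x * b x) \<in> borel_measurable (sigma (space \<P>) {} \<Otimes>\<^sub>M borel)"
  unfolding split_beta' by measurable

lemma init_fun_bound: "\<bar>init_weight S x * b x\<bar> \<le> Cw * B"
  unfolding abs_mult using init_weight_nonneg[of x] init_weight_le[of x] Cw_nonneg B by (intro mult_mono) auto

lemma init_cmean: "c0.cmean (\<lambda>_ x. init_weight S x * b x) \<omega> = unnorm 0 (\<lambda>y. b (y 0))"
proof -
  have "unnorm 0 (\<lambda>y. b (y 0)) = (\<integral>x. init_weight S x * b x \<partial>init_proposal S)"
    using B by (subst unnorm_0[where B=B]) auto
  then show ?thesis by (simp add: c0.cmean_def[OF init_fun_measurable init_fun_bound])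
qed

lemma gam_0: "gam 0 b \<omega> = (\<Sum>i\<in>{1..N}. init_weight S (\<xi> 0 i \<omega>) * b (\<xi> 0 i \<omega>)) / N"
  by (simp add: gam_def particle_weight_def)

lemma init_lln: "(\<integral>\<omega>. \<bar>gam 0 b \<omega> - unnorm 0 (\<lambda>y. b (y 0))\<bar> \<partial>\<P>) \<le> Cw * B / sqrt N"
proof -
  have "N * (\<integral>\<omega>. \<bar>gam 0 b \<omega> - unnorm 0 (\<lambda>y. b (y 0))\<bar> \<partial>\<P>) =
      (\<integral>\<omega>. \<bar>N * (gam 0 b \<omega> - unnorm 0 (\<lambda>y. b (y 0)))\<bar> \<partial>\<P>)"
    by (simp add: abs_mult)
  also have "\<dots> = (\<integral>\<omega>. indicator (space \<P>) \<omega> *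
      \<bar>(\<Sum>i\<in>{1..N}. init_weight S (\<xi> 0 i \<omega>) * b (\<xi> 0 i \<omega>)) - real (card {1..N}) * c0.cmean (\<lambda>_ x. init_weight S x * b x) \<omega>\<bar> \<partial>\<P>)"
    using N_pos by (intro Bochner_Integration.integral_cong refl) (simp add: init_cmean gam_0 right_diff_distrib)
  also have "\<dots> \<le> Cw * B * sqrt (card {1..N})"
    by (rule c0.conditional_lln[OF init_fun_measurable init_fun_bound])
  finally have "N * (\<integral>\<omega>. \<bar>gam 0 b \<omega> - unnorm 0 (\<lambda>y. b (y 0))\<bar> \<partial>\<P>) \<le> Cw * B * sqrt N" by simp
  then show ?thesis using N_pos by (rule le_divide_sqrt)
qed

lemma init_clt:
  "cmod ((\<integral>\<omega>. iexp (u * (sqrt N * (gam 0 b \<omega> - unnorm 0 (\<lambda>y. b (y 0))))) \<partial>\<P>) -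
    exp (- (u\<^sup>2 * ((\<integral>x. (init_weight S x * b x)\<^sup>2 \<partial>init_proposal S) - (unnorm 0 (\<lambda>y. b (y 0)))\<^sup>2) / 2)))
    \<le> clt_err u (Cw * B) N"
proof -
  have Nm: "sqrt N * x = N * x / sqrt N" for x :: real
    using real_div_sqrt[of "real N"] by (metis of_nat_0_le_iff times_divide_eq_left)
  have "(\<integral>\<omega>. iexp (u * (sqrt N * (gam 0 b \<omega> - unnorm 0 (\<lambda>y. b (y 0))))) \<partial>\<P>) =
    (\<integral>\<omega>. indicator (space \<P>) \<omega> * (1 * iexp (u * ((\<Sum>i\<in>{1..N}. init_weight S (\<xi> 0 i \<omega>) * b (\<xi> 0 i \<omega>)) -
      card {1..N} * c0.cmean (\<lambda>_ x. init_weight S x * b x) \<omega>) / sqrt (card {1..N}))) \<partial>\<P>)"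
    using N_pos unfolding Nm
    by (intro Bochner_Integration.integral_cong refl) (simp add: init_cmean gam_0 right_diff_distrib)
  moreover have "(\<integral>\<omega>. indicator (space \<P>) \<omega> * (1 * complex_of_real (exp (- (u\<^sup>2 * c0.cvar (\<lambda>_ x. init_weight S x * b x) \<omega> / 2)))) \<partial>\<P>) =
    (\<integral>\<omega>. complex_of_real (exp (- (u\<^sup>2 * ((\<integral>x. (init_weight S x * b x)\<^sup>2 \<partial>init_proposal S) - (unnorm 0 (\<lambda>y. b (y 0)))\<^sup>2) / 2))) \<partial>\<P>)"
    by (intro Bochner_Integration.integral_cong refl) (simp add: c0.cvar_def[OF init_fun_measurable init_fun_bound] init_cmean)
  ultimately show ?thesis
    using c0.conditional_clt[OF init_fun_measurable init_fun_bound, of "\<lambda>_. 1" u]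
    by (simp add: prob_space)
qed

end

end

section \<open>Convergence lemmas\<close>

text \<open>The dominating functions \<open>K * a n\<close> vary with \<open>n\<close>. They
  converge pointwise and in total mass, hence in mean by Scheffe. Cutting \<open>e n\<close> at the
  fixed function \<open>K * a'\<close> leaves a case of dominated convergence, and what is cut off
  is at most \<open>K * \<bar>a n - a'\<bar>\<close>.\<close>

lemma tendsto_integral_scheffe_dominated:
  fixes e a :: "nat \<Rightarrow> 'a \<Rightarrow> real" and a' :: "'a \<Rightarrow> real"
  assumes e[measurable]: "\<And>n. e n \<in> borel_measurable M" and a: "\<And>n. integrable M (a n)" "integrable M a'"
    and bounds: "\<And>n x. 0 \<le> e n x" "\<And>n x. e n x \<le> K * a n x" "\<And>n x. 0 \<le> a n x" "\<And>x. 0 \<le> a' x" "0 \<le> K"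
    and e0: "\<And>x. (\<lambda>n. e n x) \<longlonglongrightarrow> 0" and aa: "\<And>x. (\<lambda>n. a n x) \<longlonglongrightarrow> a' x"
    and tot: "(\<lambda>n. \<integral>x. a n x \<partial>M) \<longlonglongrightarrow> (\<integral>x. a' x \<partial>M)"
  shows "(\<lambda>n. \<integral>x. e n x \<partial>M) \<longlonglongrightarrow> 0"
proof -
  note [measurable] = borel_measurable_integrable[OF a(1)] borel_measurable_integrable[OF a(2)]
  have "(\<lambda>n. \<integral>\<^sup>+x. norm (a n x) \<partial>M) \<longlonglongrightarrow> (\<integral>\<^sup>+x. norm (a' x) \<partial>M)"
    using tot a bounds by (simp add: nn_integral_eq_integral tendsto_ennrealI)
  then have "limsup (\<lambda>n. \<integral>\<^sup>+x. norm (a n x) \<partial>M) = (\<integral>\<^sup>+x. norm (a' x) \<partial>M)"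
    by (intro lim_imp_Limsup) auto
  then have "(\<lambda>n. \<integral>\<^sup>+x. norm (a n x - a' x) \<partial>M) \<longlonglongrightarrow> 0"
    using a aa by (intro Scheffe_lemma1) auto
  moreover have "(\<integral>\<^sup>+x. norm (a n x - a' x) \<partial>M) = ennreal (\<integral>x. \<bar>a n x - a' x\<bar> \<partial>M)" for n
    using a by (subst nn_integral_eq_integral) auto
  ultimately have "(\<lambda>n. ennreal (\<integral>x. \<bar>a n x - a' x\<bar> \<partial>M)) \<longlonglongrightarrow> ennreal 0" by simp
  then have L1: "(\<lambda>n. \<integral>x. \<bar>a n x - a' x\<bar> \<partial>M) \<longlonglongrightarrow> 0"
    by (rule tendsto_ennrealD) auto
  have mi: "(\<lambda>n. \<integral>x. min (e n x) (K * a' x) \<partial>M) \<longlonglongrightarrow> (\<integral>x. 0 \<partial>M)"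
  proof (rule integral_dominated_convergence[where w="\<lambda>x. K * a' x"])
    show "AE x in M. (\<lambda>n. min (e n x) (K * a' x)) \<longlonglongrightarrow> 0"
    proof (rule AE_I2)
      fix x show "(\<lambda>n. min (e n x) (K * a' x)) \<longlonglongrightarrow> 0"
      proof (rule tendsto_sandwich[OF _ _ tendsto_const e0[of x]])
        show "\<forall>\<^sub>F n in sequentially. 0 \<le> min (e n x) (K * a' x)" by (simp add: bounds)
        show "\<forall>\<^sub>F n in sequentially. min (e n x) (K * a' x) \<le> e n x" by simp
      qed
    qed
    show "AE x in M. norm (min (e n x) (K * a' x)) \<le> K * a' x" for n
      using bounds by (intro AE_I2) (simp add: abs_of_nonneg)
    show "integrable M (\<lambda>x. K * a' x)" using a(2) by simp
  qed measurable
  have min_i: "integrable M (\<lambda>x. min (e n x) (K * a' x))" for n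
  proof (rule Bochner_Integration.integrable_bound[OF integrable_mult_right[OF a(2), of K]])
    show "AE x in M. norm (min (e n x) (K * a' x)) \<le> norm (K * a' x)"
      using bounds by (intro AE_I2) (simp add: abs_of_nonneg)
  qed measurable
  have le: "(\<integral>x. e n x \<partial>M) \<le> (\<integral>x. min (e n x) (K * a' x) \<partial>M) + K * (\<integral>x. \<bar>a n x - a' x\<bar> \<partial>M)" for n
  proof -
    have ei: "integrable M (e n)"
    proof (rule Bochner_Integration.integrable_bound[OF integrable_mult_right[OF a(1), of K n]])
      show "AE x in M. norm (e n x) \<le> norm (K * a n x)"
        using bounds by (intro AE_I2) (simp add: abs_of_nonneg)
    qed measurable
    have "(\<integral>x. e n x \<partial>M) \<le> (\<integral>x. min (e n x) (K * a' x) + K * \<bar>a n x - a' x\<bar> \<partial>M)"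
    proof (rule integral_mono[OF ei])
      show "integrable M (\<lambda>x. min (e n x) (K * a' x) + K * \<bar>a n x - a' x\<bar>)" using min_i a by simp
      fix x
      have "K * a n x \<le> K * a' x + K * \<bar>a n x - a' x\<bar>"
        using bounds(5) mult_left_mono[of "a n x" "a' x + \<bar>a n x - a' x\<bar>" K] by (simp add: distrib_left)
      moreover have "0 \<le> K * \<bar>a n x - a' x\<bar>" using bounds(5) by simp
      ultimately show "e n x \<le> min (e n x) (K * a' x) + K * \<bar>a n x - a' x\<bar>"
        using bounds(2)[of n x] by linarith
    qed
    then show ?thesis using min_i a by simp
  qed
  have lim: "(\<lambda>n. (\<integral>x. min (e n x) (K * a' x) \<partial>M) + K * (\<integral>x. \<bar>a n x - a' x\<bar> \<partial>M)) \<longlonglongrightarrow> 0"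
    using tendsto_add[OF mi tendsto_mult_left[OF L1, of K]] by simp
  show ?thesis
  proof (rule tendsto_sandwich[OF _ _ tendsto_const lim])
    show "\<forall>\<^sub>F n in sequentially. 0 \<le> (\<integral>x. e n x \<partial>M)"
      by (intro always_eventually allI integral_nonneg_AE AE_I2 bounds(1))
    show "\<forall>\<^sub>F n in sequentially. (\<integral>x. e n x \<partial>M) \<le> (\<integral>x. min (e n x) (K * a' x) \<partial>M) + K * (\<integral>x. \<bar>a n x - a' x\<bar> \<partial>M)"
      by (intro always_eventually allI le)
  qed
qed

lemma (in prob_space) L1_triangle:
  assumes [measurable]: "X \<in> borel_measurable M" "Y \<in> borel_measurable M"
    and "\<And>x. x \<in> space M \<Longrightarrow> \<bar>X x\<bar> \<le> K" "\<And>x. x \<in> space M \<Longrightarrow> \<bar>Y x\<bar> \<le> (K'::real)"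
  shows "expectation (\<lambda>x. \<bar>X x - c\<bar>) \<le> expectation (\<lambda>x. \<bar>X x - Y x\<bar>) + expectation (\<lambda>x. \<bar>Y x - c\<bar>)"
proof -
  have [simp]: "integrable M X"
    by (rule integrable_const_bound[where B=K]) (use assms in auto)
  have [simp]: "integrable M Y"
    by (rule integrable_const_bound[where B=K']) (use assms in auto)
  have "expectation (\<lambda>x. \<bar>X x - c\<bar>) \<le> expectation (\<lambda>x. \<bar>X x - Y x\<bar> + \<bar>Y x - c\<bar>)"
    by (rule integral_mono) auto
  then show ?thesis by simp
qed

lemma iexp_diff_le: "cmod (iexp x - iexp y) \<le> \<bar>x - y\<bar>" "cmod (iexp x - iexp y) \<le> 2"
proof -
  have e: "iexp x - iexp y = iexp y * (iexp (x - y) - 1)"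
    by (simp add: algebra_simps exp_diff exp_minus)
  show "cmod (iexp x - iexp y) \<le> \<bar>x - y\<bar>"
    using iexp_approx1[of "x - y" 0] unfolding e by (simp add: norm_mult)
  show "cmod (iexp x - iexp y) \<le> 2"
    using norm_triangle_ineq4[of "iexp x" "iexp y"] by simp
qed

text \<open>A Slutsky argument on characteristic functions. The quotient \<open>Y\<close> of
  \<open>X\<close> by \<open>R\<close> is encoded as \<open>R * Y = X\<close>, because
  \<open>R\<close> may vanish. Where \<open>R\<close> is within \<open>d \<le> r / 2\<close> of
  \<open>r\<close>, the arguments of the exponentials differ by a multiple of
  \<open>d * \<bar>X\<bar>\<close>; elsewhere the trivial bound 2 is at most \<open>2 / d\<close>
  times \<open>\<bar>R - r\<bar>\<close>.\<close>

lemma char_tendsto_divide: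
  fixes P :: "nat \<Rightarrow> 'w measure" and X Y R :: "nat \<Rightarrow> 'w \<Rightarrow> real" and \<psi> :: "real \<Rightarrow> complex"
  assumes P: "\<And>n. prob_space (P n)"
    and m: "\<And>n. X n \<in> borel_measurable (P n)" "\<And>n. Y n \<in> borel_measurable (P n)"
    and Xi: "\<And>n. integrable (P n) (X n)" and Ri: "\<And>n. integrable (P n) (R n)"
    and eq: "\<And>n. AE \<omega> in P n. R n \<omega> * Y n \<omega> = X n \<omega>"
    and C: "\<And>n. (\<integral>\<omega>. \<bar>X n \<omega>\<bar> \<partial>P n) \<le> C"
    and R: "(\<lambda>n. \<integral>\<omega>. \<bar>R n \<omega> - r\<bar> \<partial>P n) \<longlonglongrightarrow> 0" and r: "r > 0"
    and conv: "\<And>u. (\<lambda>n. \<integral>\<omega>. iexp (u * X n \<omega>) \<partial>P n) \<longlonglongrightarrow> \<psi> u"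
  shows "(\<lambda>n. \<integral>\<omega>. iexp (u * Y n \<omega>) \<partial>P n) \<longlonglongrightarrow> \<psi> (u / r)"
proof -
  have main: "cmod ((\<integral>\<omega>. iexp (u * Y n \<omega>) \<partial>P n) - (\<integral>\<omega>. iexp (u / r * X n \<omega>) \<partial>P n)) \<le>
      2 * \<bar>u\<bar> * d / r\<^sup>2 * C + 2 / d * (\<integral>\<omega>. \<bar>R n \<omega> - r\<bar> \<partial>P n)" if d: "0 < d" "d \<le> r / 2" for n d
  proof -
    interpret prob_space "P n" by (rule P)
    note [measurable] = m[of n] borel_measurable_integrable[OF Ri[of n]]
    have i: "integrable (P n) (\<lambda>\<omega>. iexp (u * Y n \<omega>))" "integrable (P n) (\<lambda>\<omega>. iexp (u / r * X n \<omega>))"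
      by (rule integrable_const_bound[where B=1], simp, measurable)+
    have "cmod ((\<integral>\<omega>. iexp (u * Y n \<omega>) \<partial>P n) - (\<integral>\<omega>. iexp (u / r * X n \<omega>) \<partial>P n)) =
        cmod (\<integral>\<omega>. iexp (u * Y n \<omega>) - iexp (u / r * X n \<omega>) \<partial>P n)" using i by simp
    also have "\<dots> \<le> (\<integral>\<omega>. cmod (iexp (u * Y n \<omega>) - iexp (u / r * X n \<omega>)) \<partial>P n)" by (rule integral_norm_bound)
    also have "\<dots> \<le> (\<integral>\<omega>. 2 * \<bar>u\<bar> * d / r\<^sup>2 * \<bar>X n \<omega>\<bar> + 2 / d * \<bar>R n \<omega> - r\<bar> \<partial>P n)"
    proof (rule integral_mono_AE)
      show "integrable (P n) (\<lambda>\<omega>. cmod (iexp (u * Y n \<omega>) - iexp (u / r * X n \<omega>)))" using i by (intro integrable_norm) simp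
      show "integrable (P n) (\<lambda>\<omega>. 2 * \<bar>u\<bar> * d / r\<^sup>2 * \<bar>X n \<omega>\<bar> + 2 / d * \<bar>R n \<omega> - r\<bar>)"
        using Xi Ri by simp
      show "AE \<omega> in P n. cmod (iexp (u * Y n \<omega>) - iexp (u / r * X n \<omega>)) \<le> 2 * \<bar>u\<bar> * d / r\<^sup>2 * \<bar>X n \<omega>\<bar> + 2 / d * \<bar>R n \<omega> - r\<bar>"
        using eq[of n]
      proof eventually_elim
        fix \<omega> assume XY: "R n \<omega> * Y n \<omega> = X n \<omega>"
        show "cmod (iexp (u * Y n \<omega>) - iexp (u / r * X n \<omega>)) \<le> 2 * \<bar>u\<bar> * d / r\<^sup>2 * \<bar>X n \<omega>\<bar> + 2 / d * \<bar>R n \<omega> - r\<bar>"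
        proof (cases "\<bar>R n \<omega> - r\<bar> \<le> d")
          case True
          then have R2: "R n \<omega> \<ge> r / 2" using d by linarith
          then have R0: "R n \<omega> > 0" using r by linarith
          then have Y: "Y n \<omega> = X n \<omega> / R n \<omega>" using XY by (simp add: field_simps)
          have "\<bar>u * Y n \<omega> - u / r * X n \<omega>\<bar> = \<bar>u\<bar> * \<bar>X n \<omega>\<bar> * \<bar>R n \<omega> - r\<bar> / (R n \<omega> * r)"
          proof -
            have "u * Y n \<omega> - u / r * X n \<omega> = u * X n \<omega> * (r - R n \<omega>) / (R n \<omega> * r)"
              unfolding Y using R0 r by (simp add: field_simps)
            then show ?thesis using R0 r by (simp add: abs_mult abs_minus_commute)
          qed
          also have "\<dots> \<le> \<bar>u\<bar> * \<bar>X n \<omega>\<bar> * d / (r / 2 * r)"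
            using True R2 R0 r d by (intro frac_le mult_left_mono mult_right_mono mult_nonneg_nonneg mult_pos_pos) auto
          also have "\<dots> = 2 * \<bar>u\<bar> * d / r\<^sup>2 * \<bar>X n \<omega>\<bar>" using r by (simp add: field_simps power2_eq_square)
          finally have 1: "\<bar>u * Y n \<omega> - u / r * X n \<omega>\<bar> \<le> 2 * \<bar>u\<bar> * d / r\<^sup>2 * \<bar>X n \<omega>\<bar>" .
          have 2: "0 \<le> 2 / d * \<bar>R n \<omega> - r\<bar>" using d by simp
          show ?thesis using order_trans[OF iexp_diff_le(1) 1] 2 by linarith
        next
          case False
          then have 1: "2 \<le> 2 / d * \<bar>R n \<omega> - r\<bar>" using d by (simp add: field_simps)
          have 2: "0 \<le> 2 * \<bar>u\<bar> * d / r\<^sup>2 * \<bar>X n \<omega>\<bar>" using d by simp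
          show ?thesis using order_trans[OF iexp_diff_le(2)[of "u * Y n \<omega>" "u / r * X n \<omega>"] 1] 2 by linarith
        qed
      qed
    qed
    also have "\<dots> = 2 * \<bar>u\<bar> * d / r\<^sup>2 * (\<integral>\<omega>. \<bar>X n \<omega>\<bar> \<partial>P n) + 2 / d * (\<integral>\<omega>. \<bar>R n \<omega> - r\<bar> \<partial>P n)"
      using Xi Ri by simp
    also have "\<dots> \<le> 2 * \<bar>u\<bar> * d / r\<^sup>2 * C + 2 / d * (\<integral>\<omega>. \<bar>R n \<omega> - r\<bar> \<partial>P n)"
      using C[of n] d by (intro add_right_mono mult_left_mono) auto
    finally show ?thesis .
  qed
  have C0: "C \<ge> 0" using order_trans[OF _ C[of 0]] by (simp add: integral_nonneg)
  have "(\<lambda>n. cmod ((\<integral>\<omega>. iexp (u * Y n \<omega>) \<partial>P n) - (\<integral>\<omega>. iexp (u / r * X n \<omega>) \<partial>P n))) \<longlonglongrightarrow> 0"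
  proof (rule LIMSEQ_I)
    fix \<epsilon> :: real assume eps: "0 < \<epsilon>"
    \<comment> \<open>The summand 1 keeps \<open>K\<close> positive. First \<open>d\<close> is fixed
      so that the term with \<open>C\<close> is at most half of \<open>\<epsilon>\<close> for every
      \<open>n\<close>; only then does \<open>n\<close> grow to control the term with
      \<open>2 / d\<close>.\<close>
    define K where "K = 2 * \<bar>u\<bar> / r\<^sup>2 * C + 1"
    have K: "K > 0" unfolding K_def using C0 r by (simp add: add_nonneg_pos)
    define d where "d = min (r / 2) (\<epsilon> / (2 * K))"
    have d: "0 < d" "d \<le> r / 2" "d \<le> \<epsilon> / (2 * K)" using eps K r by (auto simp: d_def)
    have "2 * \<bar>u\<bar> * d / r\<^sup>2 * C = d * (2 * \<bar>u\<bar> / r\<^sup>2 * C)" by simp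
    also have "\<dots> \<le> d * K" unfolding K_def using d by (intro mult_left_mono) auto
    also have "\<dots> \<le> \<epsilon> / (2 * K) * K" using d K by (intro mult_right_mono) auto
    finally have a: "2 * \<bar>u\<bar> * d / r\<^sup>2 * C \<le> \<epsilon> / 2" using K by simp
    obtain n0 where n0: "\<And>n. n \<ge> n0 \<Longrightarrow> norm ((\<integral>\<omega>. \<bar>R n \<omega> - r\<bar> \<partial>P n) - 0) < \<epsilon> * d / 4"
      using LIMSEQ_D[OF R, of "\<epsilon> * d / 4"] eps d by auto
    show "\<exists>no. \<forall>n\<ge>no. norm (cmod ((\<integral>\<omega>. iexp (u * Y n \<omega>) \<partial>P n) - (\<integral>\<omega>. iexp (u / r * X n \<omega>) \<partial>P n)) - 0) < \<epsilon>"
    proof (intro exI allI impI)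
      fix n assume "n \<ge> n0"
      then have "(\<integral>\<omega>. \<bar>R n \<omega> - r\<bar> \<partial>P n) < \<epsilon> * d / 4" using n0[of n] by simp
      then have "2 / d * (\<integral>\<omega>. \<bar>R n \<omega> - r\<bar> \<partial>P n) < 2 / d * (\<epsilon> * d / 4)" using d by (intro mult_strict_left_mono) auto
      then have "2 / d * (\<integral>\<omega>. \<bar>R n \<omega> - r\<bar> \<partial>P n) < \<epsilon> / 2" using d by simp
      then show "norm (cmod ((\<integral>\<omega>. iexp (u * Y n \<omega>) \<partial>P n) - (\<integral>\<omega>. iexp (u / r * X n \<omega>) \<partial>P n)) - 0) < \<epsilon>"
        using main[OF d(1,2), of n] a by simp
    qed
  qed
  then have "(\<lambda>n. (\<integral>\<omega>. iexp (u * Y n \<omega>) \<partial>P n) - (\<integral>\<omega>. iexp (u / r * X n \<omega>) \<partial>P n)) \<longlonglongrightarrow> 0"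
    by (simp add: tendsto_norm_zero_iff)
  from tendsto_add[OF this conv[of "u / r"]] show ?thesis by simp
qed

lemma normal_law_prob: "v \<ge> 0 \<Longrightarrow> real_distribution (normal_law \<mu> v)"
  unfolding real_distribution_def real_distribution_axioms_def normal_law_def
  by (auto intro!: prob_space_return prob_space_normal_density)

text \<open>Variance zero is the Dirac case; otherwise the law is the image of the standard normal
  law under scaling by \<open>sqrt v\<close>.\<close>

lemma char_normal_law:
  assumes "v \<ge> 0" shows "char (normal_law 0 v) u = exp (- (u\<^sup>2 * v / 2))"
proof (cases "v = 0")
  case True
  then show ?thesis by (simp add: normal_law_def char_def integral_return)
next
  case False
  then have v: "sqrt v > 0" using assms by simp
  interpret std: prob_space std_normal_distribution by (rule prob_space_normal_density) simp
  have "distributed std_normal_distribution lborel (\<lambda>x. x) std_normal_density"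
    by (simp add: distributed_def distr_id2)
  from std.normal_density_affine[OF this less_numeral_extra(1), of "sqrt v" 0] v
  have "distributed std_normal_distribution lborel (\<lambda>x. sqrt v * x) (\<lambda>x. ennreal (normal_density 0 (sqrt v) x))"
    by simp
  then have "distr std_normal_distribution lborel (\<lambda>x. sqrt v * x) = normal_law 0 v"
    using False by (simp add: normal_law_def distributed_def)
  moreover have "distr std_normal_distribution lborel (\<lambda>x. sqrt v * x) = distr std_normal_distribution borel (\<lambda>x. sqrt v * x)"
    by (rule distr_cong) auto
  ultimately have eq: "normal_law 0 v = distr std_normal_distribution borel (\<lambda>x. sqrt v * x)" by simp
  have "char (normal_law 0 v) u = (\<integral>x. iexp (u * (sqrt v * x)) \<partial>std_normal_distribution)"
    unfolding char_def eq by (rule integral_distr) auto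
  also have "\<dots> = char std_normal_distribution (u * sqrt v)" by (simp add: char_def mult.assoc)
  finally have "char (normal_law 0 v) u = char std_normal_distribution (u * sqrt v)" .
  then show ?thesis using assms by (simp add: char_std_normal_distribution power_mult_distrib)
qed

section \<open>Integrating particle errors over the endpoint, and the deficit of the backward
  kernels\<close>

context smc_run
begin

lemma gam_trans:
  assumes "k \<in> borel_measurable borel" "\<And>x. \<bar>k x\<bar> \<le> K"
  shows "gam t (\<lambda>z. \<integral>x. m z x * k x \<partial>\<nu>) \<omega> = (\<integral>x. gam t (\<lambda>z. m z x) \<omega> * k x \<partial>\<nu>)"
    "integrable \<nu> (\<lambda>x. gam t (\<lambda>z. m z x) \<omega> * k x)"
proof -
  have e: "gam t (\<lambda>z. m z x) \<omega> * k x = (\<Sum>i=1..N. acc t \<omega> * w t i \<omega> / N * (m (\<xi> t i \<omega>) x * k x))" for x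
    by (simp add: gam_def sum_distrib_left sum_distrib_right sum_divide_distrib mult_ac)
  have i: "integrable \<nu> (\<lambda>x. acc t \<omega> * w t i \<omega> / N * (m (\<xi> t i \<omega>) x * k x))" for i
    by (intro integrable_mult_right trans_integrable(1)[OF assms])
  show "integrable \<nu> (\<lambda>x. gam t (\<lambda>z. m z x) \<omega> * k x)"
    unfolding e by (intro Bochner_Integration.integrable_sum i)
  show "gam t (\<lambda>z. \<integral>x. m z x * k x \<partial>\<nu>) \<omega> = (\<integral>x. gam t (\<lambda>z. m z x) \<omega> * k x \<partial>\<nu>)"
    unfolding e Bochner_Integration.integral_sum[OF i] integral_mult_right_zero
    by (simp add: gam_def sum_distrib_left sum_divide_distrib mult_ac)
qed

lemma gam_trans_measurable:
  assumes t: "t \<le> T"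
  shows "(\<lambda>p. gam t (\<lambda>z. m z (snd p)) (fst p)) \<in> borel_measurable (hist t \<Otimes>\<^sub>M borel)"
  unfolding gam_def
proof (intro borel_measurable_times borel_measurable_divide borel_measurable_sum borel_measurable_const)
  let ?F = "hist t \<Otimes>\<^sub>M (borel :: 'x measure)"
  show "(\<lambda>p. acc t (fst p)) \<in> borel_measurable ?F"
    using t by (intro measurable_compose[OF measurable_fst acc_measurable]) auto
  fix i assume i: "i \<in> {1..N}"
  show "(\<lambda>p. w t i (fst p)) \<in> borel_measurable ?F"
    using t i by (intro measurable_compose[OF measurable_fst w_hist]) auto
  show "(\<lambda>p. m (\<xi> t i (fst p)) (snd p)) \<in> borel_measurable ?F"
    using t i by (intro m_meas measurable_compose[OF measurable_fst xi_hist] measurable_snd) auto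
qed

text \<open>Although \<open>\<nu>\<close> may be infinite, the inner integral is a weighted average
  of integrals against the probability densities \<open>m z\<close>, hence bounded uniformly in
  \<open>\<omega>\<close>; this makes the product integrable.\<close>

lemma gam_trans_fubini:
  assumes k: "(\<lambda>(\<omega>, x). k \<omega> x) \<in> borel_measurable (hist t \<Otimes>\<^sub>M borel)" and K: "\<And>\<omega> x. \<bar>k \<omega> x\<bar> \<le> K" and t: "t \<le> T"
  shows "integrable \<nu> (\<lambda>x. \<integral>\<omega>. gam t (\<lambda>z. m z x) \<omega> * k \<omega> x \<partial>\<P>)"
    "(\<integral>\<omega>. gam t (\<lambda>z. \<integral>x. m z x * k \<omega> x \<partial>\<nu>) \<omega> \<partial>\<P>) = (\<integral>x. (\<integral>\<omega>. gam t (\<lambda>z. m z x) \<omega> * k \<omega> x \<partial>\<P>) \<partial>\<nu>)"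
proof -
  interpret P: pair_sigma_finite \<P> \<nu> ..
  have id: "(\<lambda>p. (fst p, snd p)) \<in> \<P> \<Otimes>\<^sub>M \<nu> \<rightarrow>\<^sub>M hist t \<Otimes>\<^sub>M borel"
    by (intro measurable_Pair measurable_compose[OF measurable_fst] hist_measurable[OF t]) measurable
  have g1: "(\<lambda>p. gam t (\<lambda>z. m z (snd p)) (fst p)) \<in> borel_measurable (\<P> \<Otimes>\<^sub>M \<nu>)"
    using measurable_compose[OF id gam_trans_measurable[OF t]] by simp
  have k1: "(\<lambda>p. k (fst p) (snd p)) \<in> borel_measurable (\<P> \<Otimes>\<^sub>M \<nu>)"
    using measurable_compose[OF id k] by simp
  have ks: "k \<omega> \<in> borel_measurable borel" if "\<omega> \<in> space \<P>" for \<omega>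
    using measurable_Pair2[OF k, of \<omega>] that by simp
  have gn: "gam t (\<lambda>z. m z x) \<omega> \<ge> 0" for x \<omega> by (rule gam_nonneg[OF t trans_density_nonneg])
  have gk: "(\<lambda>(\<omega>, x). gam t (\<lambda>z. m z x) \<omega> * k \<omega> x) \<in> borel_measurable (\<P> \<Otimes>\<^sub>M \<nu>)"
    unfolding split_beta' by (intro borel_measurable_times g1 k1)
  have gkn: "(\<lambda>p. norm (gam t (\<lambda>z. m z (snd p)) (fst p) * k (fst p) (snd p))) \<in> borel_measurable (\<P> \<Otimes>\<^sub>M \<nu>)"
    by (rule measurable_compose[OF borel_measurable_times[OF g1 k1] borel_measurable_norm])
  have K0: "K \<ge> 0" using order_trans[OF abs_ge_zero K] by blast
  have int: "integrable (\<P> \<Otimes>\<^sub>M \<nu>) (\<lambda>(\<omega>, x). gam t (\<lambda>z. m z x) \<omega> * k \<omega> x)"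
  proof (rule P.Fubini_integrable[OF gk])
    have "(\<lambda>\<omega>. \<integral>x. norm (gam t (\<lambda>z. m z x) \<omega> * k \<omega> x) \<partial>\<nu>) \<in> borel_measurable \<P>"
      using gkn by (intro nu.borel_measurable_lebesgue_integral) (simp add: split_beta')
    moreover have "norm (\<integral>x. norm (gam t (\<lambda>z. m z x) \<omega> * k \<omega> x) \<partial>\<nu>) \<le> (Cw * Ca) ^ t * (Cw * K)" if w: "\<omega> \<in> space \<P>" for \<omega>
    proof -
      have ka: "(\<lambda>x. \<bar>k \<omega> x\<bar>) \<in> borel_measurable borel" using ks[OF w] by simp
      have "(\<integral>x. norm (gam t (\<lambda>z. m z x) \<omega> * k \<omega> x) \<partial>\<nu>) = gam t (\<lambda>z. \<integral>x. m z x * \<bar>k \<omega> x\<bar> \<partial>\<nu>) \<omega>"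
        using gn K by (subst gam_trans(1)[OF ka, where K=K]) (auto simp: abs_mult)
      moreover have "\<bar>gam t (\<lambda>z. \<integral>x. m z x * \<bar>k \<omega> x\<bar> \<partial>\<nu>) \<omega>\<bar> \<le> (Cw * Ca) ^ t * (Cw * K)"
        using K by (intro gam_bound[OF t] trans_integrable(2)[OF ka]) auto
      ultimately show ?thesis by simp
    qed
    ultimately show "integrable \<P> (\<lambda>\<omega>. \<integral>x. norm (case (\<omega>, x) of (\<omega>, x) \<Rightarrow> gam t (\<lambda>z. m z x) \<omega> * k \<omega> x) \<partial>\<nu>)"
      by (intro integrable_const_bound[where B="(Cw * Ca) ^ t * (Cw * K)"] AE_I2) auto
    show "AE \<omega> in \<P>. integrable \<nu> (\<lambda>x. case (\<omega>, x) of (\<omega>, x) \<Rightarrow> gam t (\<lambda>z. m z x) \<omega> * k \<omega> x)"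
      using gam_trans(2)[OF ks K] by (intro AE_I2) simp
  qed
  show "integrable \<nu> (\<lambda>x. \<integral>\<omega>. gam t (\<lambda>z. m z x) \<omega> * k \<omega> x \<partial>\<P>)"
    using P.integrable_snd[OF int] by simp
  have "(\<integral>\<omega>. gam t (\<lambda>z. \<integral>x. m z x * k \<omega> x \<partial>\<nu>) \<omega> \<partial>\<P>) = (\<integral>\<omega>. (\<integral>x. gam t (\<lambda>z. m z x) \<omega> * k \<omega> x \<partial>\<nu>) \<partial>\<P>)"
    by (intro Bochner_Integration.integral_cong refl gam_trans(1)[OF ks K])
  then show "(\<integral>\<omega>. gam t (\<lambda>z. \<integral>x. m z x * k \<omega> x \<partial>\<nu>) \<omega> \<partial>\<P>) = (\<integral>x. (\<integral>\<omega>. gam t (\<lambda>z. m z x) \<omega> * k \<omega> x \<partial>\<P>) \<partial>\<nu>)"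
    using P.Fubini_integral[OF int] by simp
qed

text \<open>The squares are reduced to a first-order difference by factoring
  \<open>b^2 - c^2\<close> with \<open>\<bar>b + c\<bar> \<le> 2 * B\<close>; weight and likelihood
  are absorbed into \<open>Cw\<close> and \<open>Cg\<close>, leaving the transition density alone as
  the weight of the error.\<close>

lemma weight_op_diff_bound:
  assumes t: "Suc t \<le> T"
    and b: "b \<in> borel_measurable borel" "\<And>x. \<bar>b x\<bar> \<le> B" and c: "c \<in> borel_measurable borel" "\<And>x. \<bar>c x\<bar> \<le> B"
  shows "\<bar>weight_op t (\<lambda>x. (b x)\<^sup>2) z - weight_op t (\<lambda>x. (c x)\<^sup>2) z\<bar> \<le> Cw * (Cg * (2 * B)) * (\<integral>x. m z x * \<bar>b x - c x\<bar> \<partial>\<nu>)"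
proof -
  note [measurable] = weight_snd_measurable[OF t, of z] b(1) c(1)
  have B0: "B \<ge> 0" using order_trans[OF abs_ge_zero b(2)] by blast
  have sq: "\<bar>(b x)\<^sup>2\<bar> \<le> B\<^sup>2" "\<bar>(c x)\<^sup>2\<bar> \<le> B\<^sup>2" for x
    using b(2)[of x] c(2)[of x] B0 by (simp_all add: abs_le_square_iff[symmetric])
  have i: "integrable \<nu> (\<lambda>x. m z x * (weight S (Suc t) z x * (g (Suc t) x * (b x)\<^sup>2)))"
      "integrable \<nu> (\<lambda>x. m z x * (weight S (Suc t) z x * (g (Suc t) x * (c x)\<^sup>2)))"
    by (rule trans_integrable(1)[OF _ weight_lik_bound[OF t]], measurable, rule sq)+
  have d2: "\<bar>b x - c x\<bar> \<le> 2 * B" for x using b(2)[of x] c(2)[of x] by linarith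
  have d: "\<bar>(b x)\<^sup>2 - (c x)\<^sup>2\<bar> \<le> 2 * B * \<bar>b x - c x\<bar>" for x
  proof -
    have "(b x)\<^sup>2 - (c x)\<^sup>2 = (b x + c x) * (b x - c x)" by (simp add: power2_eq_square algebra_simps)
    moreover have "\<bar>b x + c x\<bar> \<le> 2 * B" using b(2)[of x] c(2)[of x] by linarith
    ultimately show ?thesis by (simp add: abs_mult mult_right_mono)
  qed
  have j: "integrable \<nu> (\<lambda>x. m z x * \<bar>b x - c x\<bar>)" using d2 by (intro trans_integrable(1)[where B="2 * B"]) auto
  have "weight_op t (\<lambda>x. (b x)\<^sup>2) z - weight_op t (\<lambda>x. (c x)\<^sup>2) z =
      (\<integral>x. m z x * (weight S (Suc t) z x * (g (Suc t) x * ((b x)\<^sup>2 - (c x)\<^sup>2))) \<partial>\<nu>)"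
    unfolding weight_op_def using i by (simp add: right_diff_distrib)
  also have "\<bar>\<dots>\<bar> \<le> (\<integral>x. \<bar>m z x * (weight S (Suc t) z x * (g (Suc t) x * ((b x)\<^sup>2 - (c x)\<^sup>2)))\<bar> \<partial>\<nu>)" by (rule integral_abs_bound)
  also have "\<dots> \<le> (\<integral>x. m z x * (Cw * (Cg * (2 * B * \<bar>b x - c x\<bar>))) \<partial>\<nu>)"
  proof (rule integral_mono)
    show "integrable \<nu> (\<lambda>x. \<bar>m z x * (weight S (Suc t) z x * (g (Suc t) x * ((b x)\<^sup>2 - (c x)\<^sup>2)))\<bar>)"
      using i by (intro integrable_abs) (simp add: right_diff_distrib)
    show "integrable \<nu> (\<lambda>x. m z x * (Cw * (Cg * (2 * B * \<bar>b x - c x\<bar>))))"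
      using integrable_mult_right[OF j, of "Cw * (Cg * (2 * B))"] by (simp add: mult_ac)
    fix x
    show "\<bar>m z x * (weight S (Suc t) z x * (g (Suc t) x * ((b x)\<^sup>2 - (c x)\<^sup>2)))\<bar> \<le> m z x * (Cw * (Cg * (2 * B * \<bar>b x - c x\<bar>)))"
      unfolding abs_mult[of "m z x"] abs_of_nonneg[OF trans_density_nonneg]
      by (intro mult_left_mono weight_lik_bound[OF t d] trans_density_nonneg)
  qed
  also have "\<dots> = Cw * (Cg * (2 * B)) * (\<integral>x. m z x * \<bar>b x - c x\<bar> \<partial>\<nu>)"
    by (simp add: mult_ac flip: integral_mult_right_zero)
  finally show ?thesis .
qed

text \<open>After exchanging integrals, the error at the endpoint \<open>x\<close> carries the
  weight \<open>gam t (\<lambda>z. m z x)\<close>, proportional to the denominator of the particle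
  backward kernel at \<open>x\<close>. Endpoints where the kernel degenerates thus contribute
  nothing, and in this weighted form the error is linear and can be controlled.\<close>

lemma gam_weight_op_diff:
  assumes t: "Suc t \<le> T"
    and b: "(\<lambda>(\<omega>, x). b \<omega> x) \<in> borel_measurable (hist t \<Otimes>\<^sub>M borel)" "\<And>\<omega> x. \<bar>b \<omega> x\<bar> \<le> B"
    and c[measurable]: "c \<in> borel_measurable borel" and cB: "\<And>x. \<bar>c x\<bar> \<le> B"
  shows "(\<integral>\<omega>. \<bar>gam t (weight_op t (\<lambda>x. (b \<omega> x)\<^sup>2)) \<omega> - gam t (weight_op t (\<lambda>x. (c x)\<^sup>2)) \<omega>\<bar> \<partial>\<P>) \<le>
    Cw * (Cg * (2 * B)) * (\<integral>x. (\<integral>\<omega>. gam t (\<lambda>z. m z x) \<omega> * \<bar>b \<omega> x - c x\<bar> \<partial>\<P>) \<partial>\<nu>)"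
proof -
  let ?K = "Cw * (Cg * (2 * B))"
  have t': "t \<le> T" using t by simp
  have B0: "B \<ge> 0" using order_trans[OF abs_ge_zero cB] by blast
  have bs: "b \<omega> \<in> borel_measurable borel" if "\<omega> \<in> space \<P>" for \<omega>
    using measurable_Pair2[OF b(1), of \<omega>] that by simp
  have d: "(\<lambda>(\<omega>, x). \<bar>b \<omega> x - c x\<bar>) \<in> borel_measurable (hist t \<Otimes>\<^sub>M borel)"
    using b(1) unfolding split_beta' by measurable
  have d2: "\<bar>\<bar>b \<omega> x - c x\<bar>\<bar> \<le> 2 * B" for \<omega> x using b(2)[of \<omega> x] cB[of x] by linarith
  have le: "\<bar>gam t (weight_op t (\<lambda>x. (b \<omega> x)\<^sup>2)) \<omega> - gam t (weight_op t (\<lambda>x. (c x)\<^sup>2)) \<omega>\<bar> \<le> ?K * gam t (\<lambda>z. \<integral>x. m z x * \<bar>b \<omega> x - c x\<bar> \<partial>\<nu>) \<omega>"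
    if w: "\<omega> \<in> space \<P>" for \<omega>
  proof -
    have "\<bar>gam t (weight_op t (\<lambda>x. (b \<omega> x)\<^sup>2)) \<omega> - gam t (weight_op t (\<lambda>x. (c x)\<^sup>2)) \<omega>\<bar> =
        \<bar>gam t (\<lambda>z. weight_op t (\<lambda>x. (b \<omega> x)\<^sup>2) z - weight_op t (\<lambda>x. (c x)\<^sup>2) z) \<omega>\<bar>"
      using gam_diff[of t "weight_op t (\<lambda>x. (b \<omega> x)\<^sup>2)" 1 "weight_op t (\<lambda>x. (c x)\<^sup>2)" \<omega>] by simp
    also have "\<dots> \<le> gam t (\<lambda>z. \<bar>weight_op t (\<lambda>x. (b \<omega> x)\<^sup>2) z - weight_op t (\<lambda>x. (c x)\<^sup>2) z\<bar>) \<omega>"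
      by (rule abs_gam_le[OF t'])
    also have "\<dots> \<le> gam t (\<lambda>z. ?K * (\<integral>x. m z x * \<bar>b \<omega> x - c x\<bar> \<partial>\<nu>)) \<omega>"
      by (intro gam_mono[OF t'] weight_op_diff_bound[OF t bs[OF w] b(2) c cB])
    finally show ?thesis by (simp add: gam_cmult)
  qed
  have i: "integrable \<P> (\<lambda>\<omega>. gam t (\<lambda>z. \<integral>x. m z x * \<bar>b \<omega> x - c x\<bar> \<partial>\<nu>) \<omega>)"
  proof (rule integrable_const_bound[where B="(Cw * Ca) ^ t * (Cw * (2 * B))"])
    have "(\<lambda>(\<omega>, z). \<integral>x. m z x * \<bar>b \<omega> x - c x\<bar> \<partial>\<nu>) \<in> borel_measurable (hist t \<Otimes>\<^sub>M borel)"
      unfolding split_beta'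
    proof (rule nu.borel_measurable_lebesgue_integral)
      let ?F = "(hist t \<Otimes>\<^sub>M borel) \<Otimes>\<^sub>M \<nu>"
      have "(\<lambda>p. (fst (fst p), snd p)) \<in> ?F \<rightarrow>\<^sub>M hist t \<Otimes>\<^sub>M borel" by measurable
      from measurable_compose[OF this d] have [measurable]: "(\<lambda>p. \<bar>b (fst (fst p)) (snd p) - c (snd p)\<bar>) \<in> borel_measurable ?F" by simp
      show "(\<lambda>(p, x). m (snd p) x * \<bar>b (fst p) x - c x\<bar>) \<in> borel_measurable ?F"
        unfolding split_beta' by measurable
    qed
    then show "(\<lambda>\<omega>. gam t (\<lambda>z. \<integral>x. m z x * \<bar>b \<omega> x - c x\<bar> \<partial>\<nu>) \<omega>) \<in> borel_measurable \<P>"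
      by (intro hist_measurable[OF t'] gam_measurable[where b="\<lambda>\<omega> z. \<integral>x. m z x * \<bar>b \<omega> x - c x\<bar> \<partial>\<nu>"] t') auto
    show "AE \<omega> in \<P>. norm (gam t (\<lambda>z. \<integral>x. m z x * \<bar>b \<omega> x - c x\<bar> \<partial>\<nu>) \<omega>) \<le> (Cw * Ca) ^ t * (Cw * (2 * B))"
    proof (rule AE_I2)
      fix \<omega> assume w: "\<omega> \<in> space \<P>"
      have [measurable]: "b \<omega> \<in> borel_measurable borel" by (rule bs[OF w])
      show "norm (gam t (\<lambda>z. \<integral>x. m z x * \<bar>b \<omega> x - c x\<bar> \<partial>\<nu>) \<omega>) \<le> (Cw * Ca) ^ t * (Cw * (2 * B))"
        unfolding real_norm_def by (intro gam_bound[OF t'] trans_integrable(2) d2) measurable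
    qed
  qed
  have sq: "\<bar>(b \<omega> x)\<^sup>2\<bar> \<le> B\<^sup>2" "\<bar>(c x)\<^sup>2\<bar> \<le> B\<^sup>2" for \<omega> x
    using b(2)[of \<omega> x] cB[of x] B0 by (simp_all add: abs_le_square_iff[symmetric])
  have "(\<integral>\<omega>. \<bar>gam t (weight_op t (\<lambda>x. (b \<omega> x)\<^sup>2)) \<omega> - gam t (weight_op t (\<lambda>x. (c x)\<^sup>2)) \<omega>\<bar> \<partial>\<P>) \<le>
      (\<integral>\<omega>. ?K * gam t (\<lambda>z. \<integral>x. m z x * \<bar>b \<omega> x - c x\<bar> \<partial>\<nu>) \<omega> \<partial>\<P>)"
  proof (rule integral_mono)
    have "(\<lambda>\<omega>. gam t (weight_op t (\<lambda>x. (b \<omega> x)\<^sup>2)) \<omega>) \<in> borel_measurable \<P>"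
      by (intro hist_measurable[OF t'] gam_measurable weight_op_joint_measurable[OF b t] t') auto
    moreover have "gam t (weight_op t (\<lambda>x. (c x)\<^sup>2)) \<in> borel_measurable \<P>"
      by (intro hist_measurable[OF t'] gam_measurable_const weight_op_measurable[OF t] t') auto
    ultimately show "integrable \<P> (\<lambda>\<omega>. \<bar>gam t (weight_op t (\<lambda>x. (b \<omega> x)\<^sup>2)) \<omega> - gam t (weight_op t (\<lambda>x. (c x)\<^sup>2)) \<omega>\<bar>)"
      using le by (intro Bochner_Integration.integrable_bound[OF integrable_mult_right[OF i, of ?K]] AE_I2)
        (auto intro!: order_trans[OF le abs_ge_self])
  qed (use i le in auto)
  then show ?thesis using gam_trans_fubini(2)[OF d d2 t'] by simp
qed

text \<open>A backward kernel with vanishing normalisation gives \<open>0\<close>, so this only holds almost surely.\<close>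

lemma bwd_one: assumes "t \<le> T" shows "AE \<omega> in \<P>. gam t (bwd t (\<lambda>_. 1) \<omega>) \<omega> = gam t (\<lambda>_. 1) \<omega>"
proof -
  \<comment> \<open>The deficit of the backward image of the constant 1. It is nonnegative because
    that image is at most 1, so it suffices to show by induction that its mean is zero.\<close>
  define D where "D t \<omega> = gam t (\<lambda>x. 1 - bwd t (\<lambda>_. 1) \<omega> x) \<omega>" for t \<omega>
  have b1: "\<bar>bwd t (\<lambda>_. 1) \<omega> x\<bar> \<le> 1" for t \<omega> x by (rule bwd_bound) auto
  have D0: "D t \<omega> \<ge> 0" if "t \<le> T" for t \<omega>
    unfolding D_def using b1 by (intro gam_nonneg[OF that]) (simp add: abs_le_iff)
  have Dm: "(\<lambda>(\<omega>, x). 1 - bwd t (\<lambda>_. 1) \<omega> x) \<in> borel_measurable (hist u \<Otimes>\<^sub>M borel)"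
    if "t \<le> Suc u" "u \<le> T" "t \<le> T" for t u
    using bwd_measurable[OF _ that, of "\<lambda>_. 1"] unfolding split_beta' by simp
  have Di: "integrable \<P> (D t)" if "t \<le> T" for t
  proof (rule integrable_const_bound[where B="(Cw * Ca) ^ t * (Cw * 2)"])
    show "D t \<in> borel_measurable \<P>" unfolding D_def[abs_def]
      using that by (intro hist_measurable[OF that] gam_measurable Dm) auto
    have "\<bar>1 - bwd t (\<lambda>_. 1) \<omega> x\<bar> \<le> 2" for \<omega> x using b1[of t \<omega> x] by linarith
    then show "AE \<omega> in \<P>. norm (D t \<omega>) \<le> (Cw * Ca) ^ t * (Cw * 2)"
      unfolding D_def real_norm_def by (intro AE_I2 gam_bound that)
  qed
  have "(\<integral>\<omega>. D t \<omega> \<partial>\<P>) = 0" using assms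
  proof (induction t)
    case 0
    then show ?case by (simp add: D_def bwd_def gam_def)
  next
    case (Suc t)
    then have t: "t \<le> T" "Suc t \<le> T" by auto
    have c2: "\<bar>1 - bwd (Suc t) (\<lambda>_. 1) \<omega> x\<bar> \<le> 2" for \<omega> x using b1[of "Suc t" \<omega> x] by linarith
    have "(\<integral>\<omega>. D (Suc t) \<omega> \<partial>\<P>) = (\<integral>\<omega>. gam t (predict t (\<lambda>x. 1 - bwd (Suc t) (\<lambda>_. 1) \<omega> x)) \<omega> \<partial>\<P>)"
      unfolding D_def by (rule step_mean[OF Dm c2 t(2)]) (use t in auto)
    also have "\<dots> \<le> (\<integral>\<omega>. Cg * D t \<omega> \<partial>\<P>)"
    proof (rule integral_mono)
      \<comment> \<open>The image of 1 at time \<open>Suc t\<close> is pulled back to the image of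
        \<open>forward_step t (\<lambda>_. 1)\<close> at time \<open>t\<close>. That function
        depends on coordinate \<open>t\<close> only, so it comes out as a factor in front of the
        earlier deficit, and being at most \<open>Cg\<close> it gives the inequality.\<close>
      have eq: "gam t (predict t (\<lambda>x. 1 - bwd (Suc t) (\<lambda>_. 1) \<omega> x)) \<omega> = gam t (\<lambda>z. predict t (\<lambda>_. 1) z * (1 - bwd t (\<lambda>_. 1) \<omega> z)) \<omega>" for \<omega>
      proof -
        have bm: "bwd (Suc t) (\<lambda>_. 1) \<omega> \<in> borel_measurable borel" by (rule bwd_measurable_snd) simp
        have i1: "integrable \<nu> (\<lambda>x. m z x * (g (Suc t) x * 1))" for z
          by (rule trans_integrable(1)[OF _ lik_mult_bound[OF t(2), of 1 1]]) auto
        have i2: "integrable \<nu> (\<lambda>x. m z x * (g (Suc t) x * bwd (Suc t) (\<lambda>_. 1) \<omega> x))" for z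
          by (rule trans_integrable(1)[OF _ lik_mult_bound[OF t(2) b1]]) (use bm in measurable)
        have 1: "predict t (\<lambda>x. 1 - bwd (Suc t) (\<lambda>_. 1) \<omega> x) z = predict t (\<lambda>_. 1) z - 1 * predict t (bwd (Suc t) (\<lambda>_. 1) \<omega>) z" for z
          unfolding predict_def using i1[of z] i2[of z] by (simp add: right_diff_distrib)
        have 2: "bwd t (forward_step t (\<lambda>_. 1)) \<omega> z = predict t (\<lambda>_. 1) z * bwd t (\<lambda>_. 1) \<omega> z" for z
        proof -
          have "forward_step t (\<lambda>_. 1) = (\<lambda>y. predict t (\<lambda>_. 1) (y t) * 1)"
            using forward_step_last[of t "\<lambda>_. 1"] by (simp add: fun_eq_iff)
          then show ?thesis unfolding bwd_def
            using backward_path_mult[of t t m "emp \<omega>" "predict t (\<lambda>_. 1)" "\<lambda>_. 1" "\<lambda>i\<in>{t}. z"] by simp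
        qed
        have "gam t (predict t (\<lambda>x. 1 - bwd (Suc t) (\<lambda>_. 1) \<omega> x)) \<omega> =
            gam t (predict t (\<lambda>_. 1)) \<omega> - 1 * gam t (predict t (bwd (Suc t) (\<lambda>_. 1) \<omega>)) \<omega>"
          unfolding 1 gam_diff ..
        also have "gam t (predict t (bwd (Suc t) (\<lambda>_. 1) \<omega>)) \<omega> = gam t (\<lambda>z. predict t (\<lambda>_. 1) z * bwd t (\<lambda>_. 1) \<omega> z) \<omega>"
          by (subst gam_predict_bwd[OF _ _ t(2), where B=1]) (simp_all add: 2[abs_def])
        finally show ?thesis unfolding gam_diff[symmetric] by (simp add: right_diff_distrib)
      qed
      have p: "0 \<le> predict t (\<lambda>_. 1) z" "predict t (\<lambda>_. 1) z \<le> Cg" for z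
        using predict_bound[of "\<lambda>_. 1" 1 t z] t by (auto simp: predict_def trans_density_nonneg lik_nonneg intro!: integral_nonneg)
      show "gam t (predict t (\<lambda>x. 1 - bwd (Suc t) (\<lambda>_. 1) \<omega> x)) \<omega> \<le> Cg * D t \<omega>" for \<omega>
        unfolding eq D_def gam_cmult[symmetric] using b1 p
        by (intro gam_mono[OF t(1)] mult_right_mono) (auto simp: abs_le_iff)
      show "integrable \<P> (\<lambda>\<omega>. Cg * D t \<omega>)" using Di[OF t(1)] by simp
      have "(\<lambda>\<omega>. gam t (predict t (\<lambda>x. 1 - bwd (Suc t) (\<lambda>_. 1) \<omega> x)) \<omega>) \<in> borel_measurable \<P>"
        by (intro hist_measurable[OF t(1)] gam_measurable predict_joint_measurable[OF Dm c2 t(2)]) (use t in auto)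
      moreover have "\<bar>gam t (predict t (\<lambda>x. 1 - bwd (Suc t) (\<lambda>_. 1) \<omega> x)) \<omega>\<bar> \<le> (Cw * Ca) ^ t * (Cw * (Cg * 2))" for \<omega>
        by (intro gam_bound[OF t(1)] predict_bound c2 t(2) borel_measurable_diff bwd_measurable_snd) auto
      ultimately show "integrable \<P> (\<lambda>\<omega>. gam t (predict t (\<lambda>x. 1 - bwd (Suc t) (\<lambda>_. 1) \<omega> x)) \<omega>)"
        by (intro integrable_const_bound[where B="(Cw * Ca) ^ t * (Cw * (Cg * 2))"]) auto
    qed
    also have "\<dots> = 0" using Suc by simp
    finally have "(\<integral>\<omega>. D (Suc t) \<omega> \<partial>\<P>) \<le> 0" .
    moreover have "(\<integral>\<omega>. D (Suc t) \<omega> \<partial>\<P>) \<ge> 0" using D0[OF t(2)] by (simp add: integral_nonneg)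
    ultimately show ?case by simp
  qed
  then have "AE \<omega> in \<P>. D t \<omega> = 0"
    using integral_nonneg_eq_0_iff_AE[OF Di[OF assms]] D0[OF assms] by simp
  then show ?thesis
  proof eventually_elim
    fix \<omega> assume "D t \<omega> = 0"
    then show "gam t (bwd t (\<lambda>_. 1) \<omega>) \<omega> = gam t (\<lambda>_. 1) \<omega>"
      using gam_diff[of t "\<lambda>_. 1" 1 "bwd t (\<lambda>_. 1) \<omega>" \<omega>] unfolding D_def mult_1 by linarith
  qed
qed

end

lemma tendsto_rate:
  fixes x :: "nat \<Rightarrow> real"
  assumes "\<And>n. \<bar>x n\<bar> \<le> C / sqrt (Suc n)" shows "x \<longlonglongrightarrow> 0"
proof -
  have "(\<lambda>n. C / sqrt (Suc n)) \<longlonglongrightarrow> 0"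
    by (intro tendsto_divide_0[OF tendsto_const] filterlim_compose[OF filterlim_at_top_imp_at_infinity[OF sqrt_at_top]]
      filterlim_compose[OF filterlim_real_sequentially] filterlim_Suc)
  then show ?thesis by (rule Lim_null_comparison[rotated]) (use assms in simp)
qed

lemma exp_minus_diff_le:
  fixes a b :: real assumes "0 \<le> a" "0 \<le> b" shows "\<bar>exp (- a) - exp (- b)\<bar> \<le> \<bar>a - b\<bar>"
proof -
  have *: "exp (- x) - exp (- y) \<le> y - x" if "0 \<le> x" "x \<le> y" for x y :: real
  proof -
    have "exp (- x) - exp (- y) = exp (- x) * (1 - exp (- (y - x)))" by (simp add: algebra_simps flip: exp_add)
    moreover have "1 - exp (- (y - x)) \<le> y - x" using exp_ge_add_one_self[of "- (y - x)"] by linarith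
    then have "exp (- x) * (1 - exp (- (y - x))) \<le> 1 * (y - x)" using that by (intro mult_mono) simp_all
    ultimately show ?thesis by simp
  qed
  show ?thesis
  proof (cases "a \<le> b")
    case True
    then show ?thesis using *[of a b] assms by (simp add: abs_of_nonneg)
  next
    case False
    then show ?thesis using *[of b a] assms by (simp add: abs_of_nonpos)
  qed
qed

lemma clt_err_tendsto: "(\<lambda>n. clt_err u B (Suc n)) \<longlonglongrightarrow> 0"
  by (rule tendsto_rate[where C="\<bar>4 / 3 * \<bar>u\<bar> ^ 3 * B ^ 3 + u ^ 4 * B ^ 4 / 8\<bar>"])
     (simp add: clt_err_def abs_divide)

section \<open>The limiting variance\<close>

context bounded_smc
begin

definition bwd_limit :: "nat \<Rightarrow> ((nat \<Rightarrow> 'x) \<Rightarrow> real) \<Rightarrow> 'x \<Rightarrow> real" where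
  "bwd_limit t f x = backward_path m (filter_law S) t f (\<lambda>i\<in>{t}. x)"

lemma bwd_limit_0: "bwd_limit 0 f x = f (\<lambda>i\<in>{0}. x)"
  by (simp add: bwd_limit_def)

lemma bwd_limit_measurable:
  "f \<in> borel_measurable all_paths \<Longrightarrow> t \<le> T \<Longrightarrow> bwd_limit t f \<in> borel_measurable borel"
  unfolding bwd_limit_def[abs_def]
  by (rule measurable_compose[OF measurable_singleton_path backward_kernels.backward_path_measurable[OF filter_backward_kernels]]) auto

lemma bwd_limit_bound:
  "f \<in> borel_measurable all_paths \<Longrightarrow> (\<And>y. \<bar>f y\<bar> \<le> B) \<Longrightarrow> t \<le> T \<Longrightarrow> \<bar>bwd_limit t f x\<bar> \<le> B"
  unfolding bwd_limit_def by (rule backward_kernels.backward_path_bound[OF filter_backward_kernels]) auto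

text \<open>The counterpart of \<open>gam_normalised_bwd\<close> in the limit. Subtracting the two
  compares the backward kernels through linear quantities only.\<close>

lemma unnorm_normalised_bwd_limit:
  assumes f: "f \<in> borel_measurable all_paths" "\<And>y. \<bar>f y\<bar> \<le> B" and t: "Suc t \<le> T"
  shows "unnorm t (\<lambda>y. m (y t) x) * bwd_limit (Suc t) f x = unnorm t (\<lambda>y. m (y t) x * f (y(Suc t := x)))"
proof -
  have t': "t \<le> T" "t < Suc T" using t by auto
  have pos: "unnorm t (\<lambda>_. 1) > 0" by (rule unnorm_1_pos[OF t'(1)])
  have fm: "(\<lambda>y. m (y t) x * f (y(Suc t := x))) \<in> borel_measurable all_paths" using f(1) by measurable
  have fb: "\<bar>m (y t) x * f (y(Suc t := x))\<bar> \<le> Cm * B" for y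
    unfolding abs_mult using trans_le[of "y t" x] trans_density_nonneg[of "y t" x] C_nonneg f(2) by (intro mult_mono) auto
  have "(\<integral>z. m z x \<partial>filter_law S t) = unnorm t (\<lambda>y. m (y t) x) / unnorm t (\<lambda>_. 1)"
    by (rule filter_integral[OF _ t'(1)]) measurable
  then have "unnorm t (\<lambda>y. m (y t) x) * bwd_limit (Suc t) f x =
      unnorm t (\<lambda>_. 1) * ((\<integral>z. m z x \<partial>filter_law S t) * bwd_limit (Suc t) f x)"
    using pos by simp
  also have "(\<integral>z. m z x \<partial>filter_law S t) * bwd_limit (Suc t) f x =
      (\<integral>z. backward_path m (filter_law S) t (\<lambda>y. m (y t) x * f (y(Suc t := x))) (\<lambda>i\<in>{t}. z) \<partial>filter_law S t)"
    unfolding bwd_limit_def by (rule backward_path_normalised(2)[OF filter_backward_kernels t'(2) f])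
  also have "\<dots> = unnorm t (\<lambda>y. m (y t) x * f (y(Suc t := x))) / unnorm t (\<lambda>_. 1)"
    by (rule filter_backward_identity[OF fm fb t'(1)])
  finally show ?thesis using pos by simp
qed

lemma unnorm_0_singleton:
  assumes [measurable]: "f \<in> borel_measurable all_paths" and "\<And>y. \<bar>f y\<bar> \<le> B"
  shows "unnorm 0 (\<lambda>y. f (\<lambda>i\<in>{0}. y 0)) = unnorm 0 f"
proof -
  have "(\<lambda>y. f (\<lambda>i\<in>{0}. y 0)) \<in> borel_measurable (all_paths :: (nat \<Rightarrow> 'x) measure)"
    by (rule measurable_compose[OF measurable_compose[OF _ measurable_singleton_path] assms(1)]) measurable
  moreover have "(\<lambda>i\<in>{0}. (\<lambda>i\<in>{0}. x) 0) = (\<lambda>i\<in>{0}. x)" for x :: 'x and i :: nat by simp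
  ultimately show ?thesis using assms by (simp add: unnorm_0[where B=B])
qed

text \<open>The limit of \<open>step_var\<close> for functions \<open>f\<close> that are centred at
  time \<open>Suc t\<close>: centring makes the squared conditional mean disappear, so only the
  second-moment term is kept.\<close>

definition limit_var :: "nat \<Rightarrow> ((nat \<Rightarrow> 'x) \<Rightarrow> real) \<Rightarrow> real" where
  "limit_var t f = unnorm t (\<lambda>y. adj_mult S (Suc t) (y t)) *
    unnorm t (\<lambda>y. weight_op t (\<lambda>x. (bwd_limit (Suc t) f x)\<^sup>2) (y t))"

lemma weight_op_nonneg: "Suc t \<le> T \<Longrightarrow> (\<And>x. c x \<ge> 0) \<Longrightarrow> weight_op t c z \<ge> 0"
  unfolding weight_op_def using trans_density_nonneg weight_nonneg[of "Suc t"] lik_nonneg[of "Suc t"]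
  by (intro integral_nonneg_AE AE_I2 mult_nonneg_nonneg) auto

lemma limit_var_nonneg: "Suc t \<le> T \<Longrightarrow> limit_var t f \<ge> 0"
  unfolding limit_var_def
  by (intro mult_nonneg_nonneg unnorm_nonneg weight_op_nonneg less_imp_le[OF adj_mult_pos]) auto

text \<open>The variance accumulated by the martingale up to time \<open>t\<close>. As in
  \<open>limit_var\<close>, the initial term is a plain second moment because the function will be
  centred.\<close>

definition asym_var :: "((nat \<Rightarrow> 'x) \<Rightarrow> real) \<Rightarrow> nat \<Rightarrow> real" where
  "asym_var f t = (\<integral>x. (init_weight S x * bwd_limit 0 (forward 0 T f) x)\<^sup>2 \<partial>init_proposal S) +
    (\<Sum>s<t. limit_var s (forward (Suc s) (T - Suc s) f))"

lemma asym_var_nonneg: "t \<le> T \<Longrightarrow> asym_var f t \<ge> 0"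
  unfolding asym_var_def
  by (intro add_nonneg_nonneg sum_nonneg limit_var_nonneg integral_nonneg_AE AE_I2 zero_le_power2) auto

lemma limit_kernel_eq:
  assumes f: "f \<in> borel_measurable all_paths" "\<And>y. \<bar>f y\<bar> \<le> B"
    and fh: "\<And>y. y \<in> space (path_space T) \<Longrightarrow> f y = h y" and t: "t \<le> T"
  shows "limit_kernel S t T x h = bwd_limit t (forward t (T - t) f) x"
  unfolding limit_kernel_def bwd_limit_def
proof (rule backward_path_extensional_cong[where A="{..t}"])
  fix z :: "nat \<Rightarrow> 'x" assume "z \<in> extensional {..t}"
  then have "z \<in> space (path_space t)" by (auto simp: space_PiM PiE_def)
  then show "forward_kernel S t T z h = forward t (T - t) f z"
    using forward_kernel_eq[OF f, of t "T - t" h z] fh t by simp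
qed auto

lemma limit_kernel_mass:
  assumes t: "t \<le> T"
  shows "(\<integral>x. limit_kernel S t T x (\<lambda>_. 1) \<partial>filter_law S t) = unnorm T (\<lambda>_. 1) / unnorm t (\<lambda>_. 1)"
proof -
  have one: "(\<lambda>_. 1) \<in> borel_measurable (all_paths :: (nat \<Rightarrow> 'x) measure)" "\<And>y :: nat \<Rightarrow> 'x. \<bar>1 :: real\<bar> \<le> 1" by auto
  have k: "t + (T - t) \<le> T" using t by simp
  have "(\<integral>x. limit_kernel S t T x (\<lambda>_. 1) \<partial>filter_law S t) = unnorm t (forward t (T - t) (\<lambda>_. 1)) / unnorm t (\<lambda>_. 1)"
    unfolding limit_kernel_eq[OF one refl t] bwd_limit_def
    by (rule filter_backward_identity[OF forward_measurable[OF one(1)] forward_bound[OF one k] t])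
  also have "unnorm t (forward t (T - t) (\<lambda>_. 1)) = unnorm T (\<lambda>_. 1)"
    using unnorm_forward[OF one k] t by simp
  finally show ?thesis .
qed

lemma limit_kernel_init_mass:
  "(\<integral>x. init_weight S x * limit_kernel S 0 T x (\<lambda>_. 1) \<partial>init_proposal S) = unnorm T (\<lambda>_. 1)"
proof -
  have one: "(\<lambda>_. 1) \<in> borel_measurable (all_paths :: (nat \<Rightarrow> 'x) measure)" "\<And>y :: nat \<Rightarrow> 'x. \<bar>1 :: real\<bar> \<le> 1" by auto
  have k: "0 + T \<le> T" by simp
  have "unnorm 0 (forward 0 T (\<lambda>_. 1)) = (\<integral>x. init_weight S x * forward 0 T (\<lambda>_. 1) (\<lambda>i\<in>{0}. x) \<partial>init_proposal S)"
    by (rule unnorm_0[OF forward_measurable[OF one(1)] forward_bound[OF one k]])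
  then show ?thesis
    using unnorm_forward[OF one k] by (simp add: limit_kernel_eq[OF one refl le0] bwd_limit_0)
qed

text \<open>Integrals against the filter at time \<open>t\<close> divide by the normalising constant
  of that time. The two such divisions in each numerator cancel against the square in the
  denominator, which is the squared ratio of the constants at \<open>T\<close> and \<open>t\<close>;
  the common factor 1 over the squared constant at \<open>T\<close> remains in every term, including
  the initial one.\<close>

lemma asymp_variance_eq:
  assumes f: "f \<in> borel_measurable all_paths" "\<And>y. \<bar>f y\<bar> \<le> B"
    and fh: "\<And>y. y \<in> space (path_space T) \<Longrightarrow> f y = h y - (\<integral>z. h z \<partial>smoothing S T)"
  shows "asymp_variance S T h = asym_var f T / (unnorm T (\<lambda>_. 1))\<^sup>2"
proof -
  let ?Z = "\<lambda>t. unnorm t (\<lambda>_. 1)" and ?F = "\<lambda>t. forward t (T - t) f"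
  have G: "centred_kernel S t T x h = bwd_limit t (?F t) x" if "t \<le> T" for t x
    unfolding centred_kernel_def by (rule limit_kernel_eq[OF f fh that])
  have F: "?F t \<in> borel_measurable all_paths" "\<bar>?F t y\<bar> \<le> Cg ^ (T - t) * B" if "t \<le> T" for t y
    using that by (auto intro: forward_measurable[OF f(1)] forward_bound[OF f])
  have summand: "(\<integral>x. upsilon S (Suc t) T x h \<partial>filter_law S t) * (\<integral>x. adj_mult S (Suc t) x \<partial>filter_law S t) /
      (\<integral>x. limit_kernel S t T x (\<lambda>_. 1) \<partial>filter_law S t)\<^sup>2 = limit_var t (?F (Suc t)) / (?Z T)\<^sup>2" if t: "Suc t \<le> T" for t
  proof -
    have t': "t \<le> T" using t by simp
    have c: "(\<lambda>x. (bwd_limit (Suc t) (?F (Suc t)) x)\<^sup>2) \<in> borel_measurable borel"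
      by (rule borel_measurable_power[OF bwd_limit_measurable[OF F(1)[OF t] t]])
    have am: "adj_mult S (Suc t) \<in> borel_measurable borel" using t by (intro adj_mult_measurable) auto
    have "upsilon S (Suc t) T x h = weight_op t (\<lambda>x. (bwd_limit (Suc t) (?F (Suc t)) x)\<^sup>2) x" for x
      unfolding upsilon_def G[OF t] by (rule prop_integral_weight(2)[OF t c])
    then have "(\<integral>x. upsilon S (Suc t) T x h \<partial>filter_law S t) =
        unnorm t (\<lambda>y. weight_op t (\<lambda>x. (bwd_limit (Suc t) (?F (Suc t)) x)\<^sup>2) (y t)) / ?Z t"
      using filter_integral[OF weight_op_measurable[OF t c] t'] by simp
    then show ?thesis
      unfolding limit_kernel_mass[OF t'] filter_integral[OF am t'] limit_var_def
      using unnorm_1_pos[OF t'] unnorm_1_pos[OF order_refl] by (simp add: field_simps power2_eq_square)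
  qed
  have "(\<Sum>t = 1..T. (\<integral>x. upsilon S t T x h \<partial>filter_law S (t - 1)) * (\<integral>x. adj_mult S t x \<partial>filter_law S (t - 1)) /
        (\<integral>x. limit_kernel S (t - 1) T x (\<lambda>_. 1) \<partial>filter_law S (t - 1))\<^sup>2) =
      (\<Sum>t<T. limit_var t (?F (Suc t)) / (?Z T)\<^sup>2)"
    unfolding One_nat_def sum.atLeast1_atMost_eq by (intro sum.cong refl) (use summand in simp)
  then show ?thesis
    unfolding asymp_variance_def asym_var_def limit_kernel_init_mass G[OF le0]
    by (simp add: power_mult_distrib add_divide_distrib sum_divide_distrib)
qed

lemma ffbs_extensional_cong:
  assumes "\<And>z. z \<in> extensional {..T} \<Longrightarrow> f z = h z"
  shows "ffbs S T N \<xi>' I' f \<omega> = ffbs S T N \<xi>' I' h \<omega>"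
  unfolding ffbs_def
  by (intro Bochner_Integration.integral_cong refl backward_path_extensional_cong[where A="{..T}"] assms) auto

end

section \<open>Limit theorems for the particle system\<close>

text \<open>The systems for different \<open>N\<close> carry different probability measures and are
  related only through expectations. Inside, the index \<open>n\<close> stands for
  \<open>Suc n\<close> particles, so that the system exists for every index.\<close>

locale smc_sequence = bounded_smc S T Cg Cm Ca Cw
  for S :: "('x::polish_space, 'y::polish_space) smc_model" and T :: nat and Cg Cm Ca Cw :: real +
  fixes \<P> :: "nat \<Rightarrow> 'w measure" and \<xi> :: "nat \<Rightarrow> nat \<Rightarrow> nat \<Rightarrow> 'w \<Rightarrow> 'x"
    and I :: "nat \<Rightarrow> nat \<Rightarrow> nat \<Rightarrow> 'w \<Rightarrow> nat"
  assumes particles: "N \<ge> 1 \<Longrightarrow> particle_filter S T N (\<P> N) (\<xi> N) (I N)"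
begin

sublocale R: smc_run S T Cg Cm Ca Cw "Suc n" "\<P> (Suc n)" "\<xi> (Suc n)" "I (Suc n)" for n
  by (intro smc_run.intro smc_run_axioms.intro bounded_smc_axioms particles) auto

abbreviation "gam n \<equiv> smc_run.gam S (Suc n) (\<xi> (Suc n)) (I (Suc n))"
abbreviation "bwd n \<equiv> smc_run.bwd S (Suc n) (\<xi> (Suc n)) (I (Suc n))"
abbreviation "acc n \<equiv> smc_run.acc S (Suc n) (\<xi> (Suc n)) (I (Suc n))"
abbreviation "hist n \<equiv> particle_history S (Suc n) (\<P> (Suc n)) (\<xi> (Suc n)) (I (Suc n))"

text \<open>The conditional mean is inserted: the increment around it is of order
  \<open>1 / sqrt (Suc n)\<close> by \<open>step_lln\<close>, and the conditional mean is a
  statistic of the previous time. The function \<open>b\<close> may depend on the past, so the step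
  serves fixed functions and backward functions alike.\<close>

lemma lln_step:
  fixes b :: "'w \<Rightarrow> 'x \<Rightarrow> real"
  assumes b: "(\<lambda>(\<omega>, x). b \<omega> x) \<in> borel_measurable (hist n t \<Otimes>\<^sub>M borel)" and B: "\<And>\<omega> x. \<bar>b \<omega> x\<bar> \<le> B" and t: "Suc t \<le> T"
    and C: "(\<integral>\<omega>. \<bar>gam n t (predict t (b \<omega>)) \<omega> - c\<bar> \<partial>\<P> (Suc n)) \<le> C / sqrt (Suc n)"
  shows "(\<integral>\<omega>. \<bar>gam n (Suc t) (b \<omega>) \<omega> - c\<bar> \<partial>\<P> (Suc n)) \<le> ((Cw * Ca) ^ Suc t * (Cw * B) + C) / sqrt (Suc n)"
proof -
  have "(\<integral>\<omega>. \<bar>gam n (Suc t) (b \<omega>) \<omega> - c\<bar> \<partial>\<P> (Suc n)) \<le>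
      (\<integral>\<omega>. \<bar>gam n (Suc t) (b \<omega>) \<omega> - gam n t (predict t (b \<omega>)) \<omega>\<bar> \<partial>\<P> (Suc n)) +
      (\<integral>\<omega>. \<bar>gam n t (predict t (b \<omega>)) \<omega> - c\<bar> \<partial>\<P> (Suc n))"
  proof (rule R.L1_triangle)
    show "(\<lambda>\<omega>. gam n (Suc t) (b \<omega>) \<omega>) \<in> borel_measurable (\<P> (Suc n))"
      by (rule R.gam_Suc_random_measurable[OF b B t])
    show "(\<lambda>\<omega>. gam n t (predict t (b \<omega>)) \<omega>) \<in> borel_measurable (\<P> (Suc n))"
      using t by (intro R.hist_measurable[where t=t] R.gam_measurable R.predict_joint_measurable[OF b B]) auto
    show "\<bar>gam n (Suc t) (b \<omega>) \<omega>\<bar> \<le> (Cw * Ca) ^ Suc t * (Cw * B)" for \<omega>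
      by (intro R.gam_bound t B)
    fix \<omega> assume w: "\<omega> \<in> space (\<P> (Suc n))"
    have "b \<omega> \<in> borel_measurable borel" using measurable_Pair2[OF b, of \<omega>] w by simp
    then show "\<bar>gam n t (predict t (b \<omega>)) \<omega>\<bar> \<le> (Cw * Ca) ^ t * (Cw * (Cg * B))"
      using t by (intro R.gam_bound predict_bound B) auto
  qed
  also have "\<dots> \<le> (Cw * Ca) ^ Suc t * (Cw * B) / sqrt (Suc n) + C / sqrt (Suc n)"
    using R.step_lln[OF b B t] C unfolding R.step_const_def[OF b B t] by (intro add_mono) auto
  finally show ?thesis by (simp add: add_divide_distrib)
qed

lemma lln_gam:
  assumes "b \<in> borel_measurable borel" "\<And>x. \<bar>b x\<bar> \<le> B" "t \<le> T"
  shows "\<exists>C. \<forall>n. (\<integral>\<omega>. \<bar>gam n t b \<omega> - unnorm t (\<lambda>y. b (y t))\<bar> \<partial>\<P> (Suc n)) \<le> C / sqrt (Suc n)"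
  using assms
proof (induction t arbitrary: b B)
  case 0
  then show ?case using R.init_lln[of b B] by blast
next
  case (Suc t b B)
  note [measurable] = Suc.prems(1)
  obtain C where C: "\<And>n. (\<integral>\<omega>. \<bar>gam n t (predict t b) \<omega> - unnorm t (\<lambda>y. predict t b (y t))\<bar> \<partial>\<P> (Suc n)) \<le> C / sqrt (Suc n)"
    using Suc.IH[of "predict t b" "Cg * B"] predict_bound[OF Suc.prems] Suc.prems(3) by auto
  have U: "unnorm t (\<lambda>y. predict t b (y t)) = unnorm (Suc t) (\<lambda>y. b (y (Suc t)))"
    using unnorm_Suc[of "\<lambda>y. b (y (Suc t))" B t] Suc.prems by (simp add: forward_step_last[abs_def])
  have "(\<integral>\<omega>. \<bar>gam n (Suc t) b \<omega> - unnorm (Suc t) (\<lambda>y. b (y (Suc t)))\<bar> \<partial>\<P> (Suc n)) \<le>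
      ((Cw * Ca) ^ Suc t * (Cw * B) + C) / sqrt (Suc n)" for n
    by (rule lln_step) (use Suc.prems C[of n] U in \<open>auto simp: split_beta'\<close>)
  then show ?case by blast
qed

lemma bwd_0: "bwd n 0 f \<omega> x = f (\<lambda>i\<in>{0}. x)"
  by (simp add: R.bwd_def)

text \<open>Prediction turns the backward image of \<open>f\<close> into that of
  \<open>forward_step t f\<close> one time earlier, so the induction runs over path functions. At no
  stage do the backward kernels themselves have to converge; their convergence is deduced from this
  result.\<close>

lemma lln_bwd:
  assumes "f \<in> borel_measurable all_paths" "\<And>y. \<bar>f y\<bar> \<le> B" "t \<le> T"
  shows "\<exists>C. \<forall>n. (\<integral>\<omega>. \<bar>gam n t (bwd n t f \<omega>) \<omega> - unnorm t f\<bar> \<partial>\<P> (Suc n)) \<le> C / sqrt (Suc n)"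
  using assms
proof (induction t arbitrary: f B)
  case (0 f B)
  have "(\<lambda>x. f (\<lambda>i\<in>{0}. x)) \<in> borel_measurable borel"
    by (rule measurable_compose[OF measurable_singleton_path 0(1)])
  from R.init_lln[OF this 0(2)] show ?case
    unfolding unnorm_0_singleton[OF 0(1,2)] bwd_0[abs_def] by blast
next
  case (Suc t f B)
  note [measurable] = Suc.prems(1)
  obtain C where C: "\<And>n. (\<integral>\<omega>. \<bar>gam n t (bwd n t (forward_step t f) \<omega>) \<omega> - unnorm t (forward_step t f)\<bar> \<partial>\<P> (Suc n)) \<le> C / sqrt (Suc n)"
    using Suc.IH[of "forward_step t f" "Cg * B"] forward_step_bound[OF Suc.prems] Suc.prems(3) by auto
  have "(\<integral>\<omega>. \<bar>gam n (Suc t) (bwd n (Suc t) f \<omega>) \<omega> - unnorm (Suc t) f\<bar> \<partial>\<P> (Suc n)) \<le>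
      ((Cw * Ca) ^ Suc t * (Cw * B) + C) / sqrt (Suc n)" for n
  proof (rule lln_step)
    show "(\<lambda>(\<omega>, x). bwd n (Suc t) f \<omega> x) \<in> borel_measurable (hist n t \<Otimes>\<^sub>M borel)"
      using Suc.prems by (intro R.bwd_measurable) auto
    show "\<bar>bwd n (Suc t) f \<omega> x\<bar> \<le> B" for \<omega> x by (intro R.bwd_bound Suc.prems)
    show "(\<integral>\<omega>. \<bar>gam n t (predict t (bwd n (Suc t) f \<omega>)) \<omega> - unnorm (Suc t) f\<bar> \<partial>\<P> (Suc n)) \<le> C / sqrt (Suc n)"
      using C[of n] by (simp add: R.gam_predict_bwd[OF Suc.prems] unnorm_Suc[OF Suc.prems])
  qed (rule Suc.prems)
  then show ?case by blast
qed

lemma lln_gam_tendsto: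
  assumes "b \<in> borel_measurable borel" "\<And>x. \<bar>b x\<bar> \<le> B" "t \<le> T"
  shows "(\<lambda>n. \<integral>\<omega>. \<bar>gam n t b \<omega> - unnorm t (\<lambda>y. b (y t))\<bar> \<partial>\<P> (Suc n)) \<longlonglongrightarrow> 0"
proof -
  obtain C where "\<And>n. (\<integral>\<omega>. \<bar>gam n t b \<omega> - unnorm t (\<lambda>y. b (y t))\<bar> \<partial>\<P> (Suc n)) \<le> C / sqrt (Suc n)"
    using lln_gam[OF assms] by blast
  then show ?thesis by (intro tendsto_rate) (simp add: integral_nonneg)
qed

lemma lln_bwd_tendsto:
  assumes "f \<in> borel_measurable all_paths" "\<And>y. \<bar>f y\<bar> \<le> B" "t \<le> T"
  shows "(\<lambda>n. \<integral>\<omega>. \<bar>gam n t (bwd n t f \<omega>) \<omega> - unnorm t f\<bar> \<partial>\<P> (Suc n)) \<longlonglongrightarrow> 0"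
proof -
  obtain C where "\<And>n. (\<integral>\<omega>. \<bar>gam n t (bwd n t f \<omega>) \<omega> - unnorm t f\<bar> \<partial>\<P> (Suc n)) \<le> C / sqrt (Suc n)"
    using lln_bwd[OF assms] by blast
  then show ?thesis by (intro tendsto_rate) (simp add: integral_nonneg)
qed

lemma gam_measurable_P:
  "b \<in> borel_measurable borel \<Longrightarrow> t \<le> T \<Longrightarrow> gam n t b \<in> borel_measurable (\<P> (Suc n))"
  by (intro R.hist_measurable[where t=t] R.gam_measurable_const) auto

lemma gam_integrable:
  assumes "b \<in> borel_measurable borel" "\<And>x. \<bar>b x\<bar> \<le> B" "t \<le> T" shows "integrable (\<P> (Suc n)) (gam n t b)"
  by (rule R.integrable_const_bound[where B="(Cw * Ca) ^ t * (Cw * B)"])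
     (use assms in \<open>auto intro!: AE_I2 R.gam_bound gam_measurable_P\<close>)

lemma gam_bwd_measurable:
  assumes "f \<in> borel_measurable all_paths" "t \<le> T"
  shows "(\<lambda>\<omega>. gam n t (bwd n t f \<omega>) \<omega>) \<in> borel_measurable (hist n t)"
  using assms by (intro R.gam_measurable R.bwd_measurable) auto

lemma gam_bwd_measurable_P:
  assumes "f \<in> borel_measurable all_paths" "t \<le> T"
  shows "(\<lambda>\<omega>. gam n t (bwd n t f \<omega>) \<omega>) \<in> borel_measurable (\<P> (Suc n))"
  by (rule R.hist_measurable[OF assms(2) gam_bwd_measurable[OF assms]])

lemma gam_bwd_bound:
  assumes "f \<in> borel_measurable all_paths" "\<And>y. \<bar>f y\<bar> \<le> B" "t \<le> T"
  shows "\<bar>gam n t (bwd n t f \<omega>) \<omega>\<bar> \<le> (Cw * Ca) ^ t * (Cw * B)"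
  by (intro R.gam_bound R.bwd_bound assms)

lemma gam_bwd_integrable:
  assumes "f \<in> borel_measurable all_paths" "\<And>y. \<bar>f y\<bar> \<le> B" "t \<le> T"
  shows "integrable (\<P> (Suc n)) (\<lambda>\<omega>. gam n t (bwd n t f \<omega>) \<omega>)"
  by (rule R.integrable_const_bound[where B="(Cw * Ca) ^ t * (Cw * B)"])
     (use gam_bwd_bound[OF assms] gam_bwd_measurable_P[OF assms(1,3)] in auto)

text \<open>For a fixed endpoint \<open>x\<close>, the product forms of the particle and the
  limiting backward kernel express the weighted error as a difference of two law of large numbers
  errors, one for the numerator and one for the denominator, the latter with the bounded coefficient
  \<open>?c\<close>.\<close>

lemma bwd_error_tendsto:
  assumes f: "f \<in> borel_measurable all_paths" "\<And>y. \<bar>f y\<bar> \<le> B" and t: "Suc t \<le> T"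
  shows "(\<lambda>n. \<integral>\<omega>. gam n t (\<lambda>z. m z x) \<omega> * \<bar>bwd n (Suc t) f \<omega> x - bwd_limit (Suc t) f x\<bar> \<partial>\<P> (Suc n)) \<longlonglongrightarrow> 0"
proof -
  have t': "t \<le> T" using t by simp
  let ?F = "\<lambda>y. m (y t) x * f (y(Suc t := x))" and ?c = "bwd_limit (Suc t) f x"
  have B0: "B \<ge> 0" using order_trans[OF abs_ge_zero f(2)] by blast
  have fm: "?F \<in> borel_measurable all_paths" using f(1) by measurable
  have fb: "\<bar>?F y\<bar> \<le> Cm * B" for y
    unfolding abs_mult using trans_le[of "y t" x] trans_density_nonneg[of "y t" x] C_nonneg f(2) by (intro mult_mono) auto
  have mm: "(\<lambda>z. m z x) \<in> borel_measurable borel" by measurable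
  have mb: "\<bar>m z x\<bar> \<le> Cm" for z using trans_le trans_density_nonneg by simp
  have c: "\<bar>?c\<bar> \<le> B" by (rule bwd_limit_bound[OF f t])
  have le: "gam n t (\<lambda>z. m z x) \<omega> * \<bar>bwd n (Suc t) f \<omega> x - ?c\<bar> \<le>
      \<bar>gam n t (bwd n t ?F \<omega>) \<omega> - unnorm t ?F\<bar> + B * \<bar>gam n t (\<lambda>z. m z x) \<omega> - unnorm t (\<lambda>y. m (y t) x)\<bar>" for n \<omega>
  proof -
    have g: "gam n t (\<lambda>z. m z x) \<omega> \<ge> 0" by (rule R.gam_nonneg[OF t' trans_density_nonneg])
    have "gam n t (\<lambda>z. m z x) \<omega> * \<bar>bwd n (Suc t) f \<omega> x - ?c\<bar> =
        \<bar>gam n t (\<lambda>z. m z x) \<omega> * bwd n (Suc t) f \<omega> x - gam n t (\<lambda>z. m z x) \<omega> * ?c\<bar>"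
      using g by (simp add: abs_mult flip: right_diff_distrib)
    also have "\<dots> = \<bar>(gam n t (bwd n t ?F \<omega>) \<omega> - unnorm t ?F) - ?c * (gam n t (\<lambda>z. m z x) \<omega> - unnorm t (\<lambda>y. m (y t) x))\<bar>"
      unfolding R.gam_normalised_bwd[OF f t'] unnorm_normalised_bwd_limit[OF f t, symmetric]
      by (simp add: algebra_simps)
    also have "\<dots> \<le> \<bar>gam n t (bwd n t ?F \<omega>) \<omega> - unnorm t ?F\<bar> + \<bar>?c\<bar> * \<bar>gam n t (\<lambda>z. m z x) \<omega> - unnorm t (\<lambda>y. m (y t) x)\<bar>"
      by (rule order_trans[OF abs_triangle_ineq4]) (simp add: abs_mult)
    also have "\<dots> \<le> \<bar>gam n t (bwd n t ?F \<omega>) \<omega> - unnorm t ?F\<bar> + B * \<bar>gam n t (\<lambda>z. m z x) \<omega> - unnorm t (\<lambda>y. m (y t) x)\<bar>"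
      by (intro add_left_mono mult_right_mono c) simp
    finally show ?thesis .
  qed
  have lim: "(\<lambda>n. (\<integral>\<omega>. \<bar>gam n t (bwd n t ?F \<omega>) \<omega> - unnorm t ?F\<bar> \<partial>\<P> (Suc n)) +
      B * (\<integral>\<omega>. \<bar>gam n t (\<lambda>z. m z x) \<omega> - unnorm t (\<lambda>y. m (y t) x)\<bar> \<partial>\<P> (Suc n))) \<longlonglongrightarrow> 0"
    using tendsto_add[OF lln_bwd_tendsto[OF fm fb t'] tendsto_mult_left[OF lln_gam_tendsto[OF mm mb t'], of B]] by simp
  have gn: "gam n t (\<lambda>z. m z x) \<omega> \<ge> 0" for n \<omega> by (rule R.gam_nonneg[OF t' trans_density_nonneg])
  show ?thesis
  proof (rule tendsto_sandwich[OF _ _ tendsto_const lim])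
    show "\<forall>\<^sub>F n in sequentially. 0 \<le> (\<integral>\<omega>. gam n t (\<lambda>z. m z x) \<omega> * \<bar>bwd n (Suc t) f \<omega> x - ?c\<bar> \<partial>\<P> (Suc n))"
      by (intro always_eventually allI integral_nonneg_AE AE_I2 mult_nonneg_nonneg gn abs_ge_zero)
    have "(\<integral>\<omega>. gam n t (\<lambda>z. m z x) \<omega> * \<bar>bwd n (Suc t) f \<omega> x - ?c\<bar> \<partial>\<P> (Suc n)) \<le>
        (\<integral>\<omega>. \<bar>gam n t (bwd n t ?F \<omega>) \<omega> - unnorm t ?F\<bar> + B * \<bar>gam n t (\<lambda>z. m z x) \<omega> - unnorm t (\<lambda>y. m (y t) x)\<bar> \<partial>\<P> (Suc n))" for n
    proof (rule integral_mono')
      show "integrable (\<P> (Suc n)) (\<lambda>\<omega>. \<bar>gam n t (bwd n t ?F \<omega>) \<omega> - unnorm t ?F\<bar> + B * \<bar>gam n t (\<lambda>z. m z x) \<omega> - unnorm t (\<lambda>y. m (y t) x)\<bar>)"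
        using gam_bwd_integrable[OF fm fb t', of n] gam_integrable[OF mm mb t', of n] by simp
    qed (rule le, intro add_nonneg_nonneg mult_nonneg_nonneg abs_ge_zero B0)
    then show "\<forall>\<^sub>F n in sequentially. (\<integral>\<omega>. gam n t (\<lambda>z. m z x) \<omega> * \<bar>bwd n (Suc t) f \<omega> x - ?c\<bar> \<partial>\<P> (Suc n)) \<le>
        (\<integral>\<omega>. \<bar>gam n t (bwd n t ?F \<omega>) \<omega> - unnorm t ?F\<bar> \<partial>\<P> (Suc n)) +
        B * (\<integral>\<omega>. \<bar>gam n t (\<lambda>z. m z x) \<omega> - unnorm t (\<lambda>y. m (y t) x)\<bar> \<partial>\<P> (Suc n))"
      using gam_bwd_integrable[OF fm fb t'] gam_integrable[OF mm mb t'] by (intro always_eventually allI) simp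
  qed
qed

text \<open>Pointwise convergence in \<open>x\<close> does not pass to the integral over
  \<open>\<nu>\<close> by a fixed dominating function. The error is dominated instead by
  \<open>2 * B\<close> times the mean of \<open>gam n t (\<lambda>z. m z x)\<close>, whose integral
  over \<open>x\<close> is the mean of \<open>gam n t (\<lambda>_. 1)\<close> because
  \<open>m\<close> is a density; so the total masses of the dominating functions converge as
  well.\<close>

lemma bwd_error_total_tendsto:
  assumes f: "f \<in> borel_measurable all_paths" "\<And>y. \<bar>f y\<bar> \<le> B" and t: "Suc t \<le> T"
  shows "(\<lambda>n. \<integral>x. (\<integral>\<omega>. gam n t (\<lambda>z. m z x) \<omega> * \<bar>bwd n (Suc t) f \<omega> x - bwd_limit (Suc t) f x\<bar> \<partial>\<P> (Suc n)) \<partial>\<nu>) \<longlonglongrightarrow> 0"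
proof (rule tendsto_integral_scheffe_dominated[where K="2 * B" and a="\<lambda>n x. \<integral>\<omega>. gam n t (\<lambda>z. m z x) \<omega> \<partial>\<P> (Suc n)"
      and a'="\<lambda>x. unnorm t (\<lambda>y. m (y t) x)"])
  have t': "t \<le> T" using t by simp
  have B0: "B \<ge> 0" using order_trans[OF abs_ge_zero f(2)] by blast
  let ?c = "bwd_limit (Suc t) f"
  note [measurable] = bwd_limit_measurable[OF f(1) t]
  have mm: "(\<lambda>z. m z x) \<in> borel_measurable borel" for x by measurable
  have mb: "\<bar>m z x\<bar> \<le> Cm" for z x using trans_le trans_density_nonneg by simp
  have gn: "gam n t (\<lambda>z. m z x) \<omega> \<ge> 0" for n x \<omega> by (rule R.gam_nonneg[OF t' trans_density_nonneg])
  have d: "(\<lambda>(\<omega>, x). \<bar>bwd n (Suc t) f \<omega> x - ?c x\<bar>) \<in> borel_measurable (hist n t \<Otimes>\<^sub>M borel)" for n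
  proof -
    have "(\<lambda>p. bwd n (Suc t) f (fst p) (snd p)) \<in> borel_measurable (hist n t \<Otimes>\<^sub>M borel)"
      using R.bwd_measurable[OF f(1) order_refl t' t, of n] by (simp add: split_beta')
    moreover have "(\<lambda>p. ?c (snd p)) \<in> borel_measurable (hist n t \<Otimes>\<^sub>M borel)"
      by (rule measurable_compose[OF measurable_snd bwd_limit_measurable[OF f(1) t]])
    ultimately show ?thesis unfolding split_beta' by (intro borel_measurable_abs borel_measurable_diff)
  qed
  have db: "\<bar>bwd n (Suc t) f \<omega> x - ?c x\<bar> \<le> 2 * B" for n \<omega> x
    using R.bwd_bound[OF f, of n "Suc t" \<omega> x] bwd_limit_bound[OF f t, of x] by linarith
  show "(\<lambda>x. \<integral>\<omega>. gam n t (\<lambda>z. m z x) \<omega> * \<bar>bwd n (Suc t) f \<omega> x - ?c x\<bar> \<partial>\<P> (Suc n)) \<in> borel_measurable \<nu>" for n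
    using R.gam_trans_fubini(1)[OF d _ t', where K="2 * B"] db by (simp add: borel_measurable_integrable)
  have one: "(\<lambda>(\<omega>, x). 1::real) \<in> borel_measurable (hist n t \<Otimes>\<^sub>M borel)" for n by simp
  show "integrable \<nu> (\<lambda>x. \<integral>\<omega>. gam n t (\<lambda>z. m z x) \<omega> \<partial>\<P> (Suc n))" for n
    using R.gam_trans_fubini(1)[OF one _ t', where K=1] by simp
  have tot_n: "(\<integral>x. (\<integral>\<omega>. gam n t (\<lambda>z. m z x) \<omega> \<partial>\<P> (Suc n)) \<partial>\<nu>) = (\<integral>\<omega>. gam n t (\<lambda>_. 1) \<omega> \<partial>\<P> (Suc n))" for n
    using R.gam_trans_fubini(2)[OF one _ t', where K=1] by (simp add: trans_total)
  have flt: "unnorm t (\<lambda>y. m (y t) x) = unnorm t (\<lambda>_. 1) * (\<integral>z. m z x \<partial>filter_law S t)" for x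
    using unnorm_1_pos[OF t'] by (simp add: filter_integral[OF mm t'])
  interpret fl: prob_space "filter_law S t" by (rule prob_filter[OF t'])
  have fub: "integrable (filter_law S t \<Otimes>\<^sub>M \<nu>) (\<lambda>(z, x). m z x * 1)"
    "(\<integral>z. (\<integral>x. m z x * 1 \<partial>\<nu>) \<partial>filter_law S t) = (\<integral>x. (\<integral>z. m z x * 1 \<partial>filter_law S t) \<partial>\<nu>)"
    using trans_fubini[OF _ sets_filter, of t "\<lambda>_ _. 1" 1] fl.finite_measure_axioms by auto
  interpret pr: pair_sigma_finite "filter_law S t" \<nu> ..
  show "integrable \<nu> (\<lambda>x. unnorm t (\<lambda>y. m (y t) x))"
    unfolding flt using pr.integrable_snd[OF fub(1)] by simp
  have "(\<integral>x. unnorm t (\<lambda>y. m (y t) x) \<partial>\<nu>) = unnorm t (\<lambda>_. 1)"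
    unfolding flt using fub(2) by (simp add: trans_total fl.prob_space)
  moreover have conv: "(\<lambda>n. \<integral>\<omega>. gam n t b \<omega> \<partial>\<P> (Suc n)) \<longlonglongrightarrow> unnorm t (\<lambda>y. b (y t))"
    if b: "b \<in> borel_measurable borel" "\<And>x. \<bar>b x\<bar> \<le> C" for b C
  proof -
    have "norm ((\<integral>\<omega>. gam n t b \<omega> \<partial>\<P> (Suc n)) - unnorm t (\<lambda>y. b (y t))) \<le>
        (\<integral>\<omega>. \<bar>gam n t b \<omega> - unnorm t (\<lambda>y. b (y t))\<bar> \<partial>\<P> (Suc n))" for n
      using integral_abs_bound[of "\<P> (Suc n)" "\<lambda>\<omega>. gam n t b \<omega> - unnorm t (\<lambda>y. b (y t))"] gam_integrable[OF b t', of n]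
      by (simp add: R.prob_space)
    then show ?thesis
      by (rule LIM_zero_cancel[OF Lim_null_comparison[OF always_eventually[OF allI] lln_gam_tendsto[OF b t']]])
  qed
  ultimately show "(\<lambda>n. \<integral>x. (\<integral>\<omega>. gam n t (\<lambda>z. m z x) \<omega> \<partial>\<P> (Suc n)) \<partial>\<nu>) \<longlonglongrightarrow> (\<integral>x. unnorm t (\<lambda>y. m (y t) x) \<partial>\<nu>)"
    unfolding tot_n using conv[of "\<lambda>_. 1" 1] by simp
  show "(\<lambda>n. \<integral>\<omega>. gam n t (\<lambda>z. m z x) \<omega> \<partial>\<P> (Suc n)) \<longlonglongrightarrow> unnorm t (\<lambda>y. m (y t) x)" for x
    by (rule conv[OF mm mb])
  show "(\<lambda>n. \<integral>\<omega>. gam n t (\<lambda>z. m z x) \<omega> * \<bar>bwd n (Suc t) f \<omega> x - ?c x\<bar> \<partial>\<P> (Suc n)) \<longlonglongrightarrow> 0" for x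
    by (rule bwd_error_tendsto[OF f t])
  show "0 \<le> (\<integral>\<omega>. gam n t (\<lambda>z. m z x) \<omega> * \<bar>bwd n (Suc t) f \<omega> x - ?c x\<bar> \<partial>\<P> (Suc n))" for n x
    by (intro integral_nonneg_AE AE_I2 mult_nonneg_nonneg gn abs_ge_zero)
  show "0 \<le> (\<integral>\<omega>. gam n t (\<lambda>z. m z x) \<omega> \<partial>\<P> (Suc n))" for n x
    by (intro integral_nonneg_AE AE_I2 gn)
  show "0 \<le> unnorm t (\<lambda>y. m (y t) x)" for x by (intro unnorm_nonneg t' trans_density_nonneg)
  show "0 \<le> 2 * B" using B0 by simp
  show "(\<integral>\<omega>. gam n t (\<lambda>z. m z x) \<omega> * \<bar>bwd n (Suc t) f \<omega> x - ?c x\<bar> \<partial>\<P> (Suc n)) \<le> 2 * B * (\<integral>\<omega>. gam n t (\<lambda>z. m z x) \<omega> \<partial>\<P> (Suc n))" for n x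
  proof -
    have "(\<integral>\<omega>. gam n t (\<lambda>z. m z x) \<omega> * \<bar>bwd n (Suc t) f \<omega> x - ?c x\<bar> \<partial>\<P> (Suc n)) \<le> (\<integral>\<omega>. 2 * B * gam n t (\<lambda>z. m z x) \<omega> \<partial>\<P> (Suc n))"
    proof (rule integral_mono')
      show "integrable (\<P> (Suc n)) (\<lambda>\<omega>. 2 * B * gam n t (\<lambda>z. m z x) \<omega>)" using gam_integrable[OF mm mb t', of n] by simp
      show "gam n t (\<lambda>z. m z x) \<omega> * \<bar>bwd n (Suc t) f \<omega> x - ?c x\<bar> \<le> 2 * B * gam n t (\<lambda>z. m z x) \<omega>" for \<omega>
        using mult_left_mono[OF db gn] by (simp add: mult.commute)
    qed (use B0 in \<open>intro mult_nonneg_nonneg gn, auto\<close>)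
    then show ?thesis by simp
  qed
qed

text \<open>The variance is \<open>A * G - Z^2\<close>. Here \<open>G\<close> is the second moment
  with the particle backward function, compared first with \<open>M\<close>, the same statistic with
  the limiting backward function, and then with its limit \<open>c\<close>; \<open>A\<close> is
  \<open>acc (Suc t)\<close> and tends to \<open>a\<close>. The conditional mean \<open>Z\<close>
  tends to zero by the centring of \<open>f\<close>.\<close>

lemma step_var_tendsto:
  assumes f: "f \<in> borel_measurable all_paths" "\<And>y. \<bar>f y\<bar> \<le> B" and t: "Suc t \<le> T" and f0: "unnorm (Suc t) f = 0"
  shows "(\<lambda>n. \<integral>\<omega>. \<bar>R.step_var n (bwd n (Suc t) f) t \<omega> - limit_var t f\<bar> \<partial>\<P> (Suc n)) \<longlonglongrightarrow> 0"
proof -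
  have t': "t \<le> T" using t by simp
  have B0: "B \<ge> 0" using order_trans[OF abs_ge_zero f(2)] by blast
  let ?bl = "bwd_limit (Suc t) f" and ?b = "\<lambda>n. bwd n (Suc t) f"
  have bl: "?bl \<in> borel_measurable borel" "\<And>x. \<bar>?bl x\<bar> \<le> B"
    by (rule bwd_limit_measurable[OF f(1) t], rule bwd_limit_bound[OF f t])
  have b: "(\<lambda>(\<omega>, x). ?b n \<omega> x) \<in> borel_measurable (hist n t \<Otimes>\<^sub>M borel)" "\<bar>?b n \<omega> x\<bar> \<le> B" for n \<omega> x
    by (rule R.bwd_measurable[OF f(1) order_refl t' t], rule R.bwd_bound[OF f])
  define G where "G n \<omega> = gam n t (weight_op t (\<lambda>x. (?b n \<omega> x)\<^sup>2)) \<omega>" for n \<omega>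
  define M where "M n = gam n t (weight_op t (\<lambda>x. (?bl x)\<^sup>2))" for n
  define A where "A n = gam n t (adj_mult S (Suc t))" for n
  define Z where "Z n \<omega> = gam n t (bwd n t (forward_step t f) \<omega>) \<omega>" for n \<omega>
  define a where "a = unnorm t (\<lambda>y. adj_mult S (Suc t) (y t))"
  define c where "c = unnorm t (\<lambda>y. weight_op t (\<lambda>x. (?bl x)\<^sup>2) (y t))"
  define K where "K = (Cw * Ca) ^ Suc t"
  define K' where "K' = (Cw * Ca) ^ t * (Cw * (Cg * B))"
  have sm: "(\<lambda>x. (?bl x)\<^sup>2) \<in> borel_measurable borel" by (rule borel_measurable_power[OF bl(1)])
  have sb: "\<bar>(?bl x)\<^sup>2\<bar> \<le> B\<^sup>2" for x
    using power_mono[OF bl(2) abs_ge_zero, of x 2] by simp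
  note wm = weight_op_measurable[OF t sm] and wb = weight_op_bound[OF t sm sb]
  have am: "adj_mult S (Suc t) \<in> borel_measurable borel" using t by (intro adj_mult_measurable) auto
  have ab: "\<bar>adj_mult S (Suc t) x\<bar> \<le> Ca" for x using t adj_mult_pos[of "Suc t" x] adj_le[of "Suc t" x] by simp
  have fs: "forward_step t f \<in> borel_measurable all_paths" "\<And>y. \<bar>forward_step t f y\<bar> \<le> Cg * B"
    by (rule forward_step_measurable[OF f(1)], rule forward_step_bound[OF f t])
  have V: "R.step_var n (?b n) t \<omega> = A n \<omega> * G n \<omega> - (Z n \<omega>)\<^sup>2" for n \<omega>
    unfolding R.step_var_def[OF b t] R.acc_Suc R.gam_predict_bwd[OF f t] A_def G_def Z_def ..
  have Ab: "\<bar>A n \<omega>\<bar> \<le> K" for n \<omega>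
    using R.acc_bounds[OF t, of n \<omega>] unfolding R.acc_Suc A_def K_def by linarith
  have Zb: "\<bar>Z n \<omega>\<bar> \<le> K'" for n \<omega> unfolding Z_def K'_def by (rule gam_bwd_bound[OF fs t'])
  have Mi: "integrable (\<P> (Suc n)) (M n)" for n unfolding M_def by (rule gam_integrable[OF wm wb t'])
  have Ai: "integrable (\<P> (Suc n)) (A n)" for n unfolding A_def by (rule gam_integrable[OF am ab t'])
  have Zi: "integrable (\<P> (Suc n)) (Z n)" for n unfolding Z_def[abs_def] by (rule gam_bwd_integrable[OF fs t'])
  have Gm: "G n \<in> borel_measurable (\<P> (Suc n))" for n
    unfolding G_def[abs_def]
    by (rule R.hist_measurable[OF t' R.gam_measurable[OF R.weight_op_joint_measurable[OF b t] order_refl t']])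
  have "\<bar>G n \<omega>\<bar> \<le> (Cw * Ca) ^ t * (Cw * (Cw * (Cg * B\<^sup>2)))" for n \<omega>
    unfolding G_def
    by (intro R.gam_bound[OF t'] weight_op_bound[OF t] borel_measurable_power R.bwd_measurable_snd[OF f(1)])
       (use power_mono[OF b(2) abs_ge_zero, of n \<omega> _ 2] in simp)
  then have Gi: "integrable (\<P> (Suc n)) (G n)" for n
    using Gm by (intro R.integrable_const_bound[where B="(Cw * Ca) ^ t * (Cw * (Cw * (Cg * B\<^sup>2)))"]) auto
  have GM: "(\<lambda>n. \<integral>\<omega>. \<bar>G n \<omega> - M n \<omega>\<bar> \<partial>\<P> (Suc n)) \<longlonglongrightarrow> 0"
  proof (rule tendsto_sandwich[OF _ _ tendsto_const])
    show "(\<lambda>n. Cw * (Cg * (2 * B)) * (\<integral>x. (\<integral>\<omega>. gam n t (\<lambda>z. m z x) \<omega> * \<bar>?b n \<omega> x - ?bl x\<bar> \<partial>\<P> (Suc n)) \<partial>\<nu>)) \<longlonglongrightarrow> 0"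
      using tendsto_mult_left[OF bwd_error_total_tendsto[OF f t], of "Cw * (Cg * (2 * B))"] by simp
    show "\<forall>\<^sub>F n in sequentially. (\<integral>\<omega>. \<bar>G n \<omega> - M n \<omega>\<bar> \<partial>\<P> (Suc n)) \<le>
        Cw * (Cg * (2 * B)) * (\<integral>x. (\<integral>\<omega>. gam n t (\<lambda>z. m z x) \<omega> * \<bar>?b n \<omega> x - ?bl x\<bar> \<partial>\<P> (Suc n)) \<partial>\<nu>)"
      unfolding G_def M_def by (intro always_eventually allI R.gam_weight_op_diff[OF t b bl])
  qed (intro always_eventually allI integral_nonneg_AE AE_I2 abs_ge_zero)
  have Ml: "(\<lambda>n. \<integral>\<omega>. \<bar>M n \<omega> - c\<bar> \<partial>\<P> (Suc n)) \<longlonglongrightarrow> 0"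
    unfolding M_def c_def by (rule lln_gam_tendsto[OF wm wb t'])
  have Al: "(\<lambda>n. \<integral>\<omega>. \<bar>A n \<omega> - a\<bar> \<partial>\<P> (Suc n)) \<longlonglongrightarrow> 0"
    unfolding A_def a_def by (rule lln_gam_tendsto[OF am ab t'])
  have Zl: "(\<lambda>n. \<integral>\<omega>. \<bar>Z n \<omega>\<bar> \<partial>\<P> (Suc n)) \<longlonglongrightarrow> 0"
    using lln_bwd_tendsto[OF fs t'] unfolding Z_def unnorm_Suc[OF f t, symmetric] f0 by simp
  \<comment> \<open>A majorant of the variance error, term by term for the telescoping
    \<open>A (G - M) + A (M - c) + c (A - a) - Z^2\<close>; the bounded factors are replaced by
    their bounds, so only errors of first order are left.\<close>
  define H where "H n \<omega> = K * \<bar>G n \<omega> - M n \<omega>\<bar> + K * \<bar>M n \<omega> - c\<bar> + \<bar>c\<bar> * \<bar>A n \<omega> - a\<bar> + K' * \<bar>Z n \<omega>\<bar>" for n \<omega>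
  have Hi: "integrable (\<P> (Suc n)) (H n)" for n
    unfolding H_def[abs_def]
    by (intro Bochner_Integration.integrable_add integrable_mult_right integrable_abs Bochner_Integration.integrable_diff Gi Mi Ai Zi R.integrable_const)
  have "(\<integral>\<omega>. H n \<omega> \<partial>\<P> (Suc n)) = K * (\<integral>\<omega>. \<bar>G n \<omega> - M n \<omega>\<bar> \<partial>\<P> (Suc n)) + K * (\<integral>\<omega>. \<bar>M n \<omega> - c\<bar> \<partial>\<P> (Suc n)) +
      \<bar>c\<bar> * (\<integral>\<omega>. \<bar>A n \<omega> - a\<bar> \<partial>\<P> (Suc n)) + K' * (\<integral>\<omega>. \<bar>Z n \<omega>\<bar> \<partial>\<P> (Suc n))" for n
    unfolding H_def using Gi[of n] Mi[of n] Ai[of n] Zi[of n] by simp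
  moreover have "(\<lambda>n. K * (\<integral>\<omega>. \<bar>G n \<omega> - M n \<omega>\<bar> \<partial>\<P> (Suc n)) + K * (\<integral>\<omega>. \<bar>M n \<omega> - c\<bar> \<partial>\<P> (Suc n)) +
      \<bar>c\<bar> * (\<integral>\<omega>. \<bar>A n \<omega> - a\<bar> \<partial>\<P> (Suc n)) + K' * (\<integral>\<omega>. \<bar>Z n \<omega>\<bar> \<partial>\<P> (Suc n))) \<longlonglongrightarrow> K * 0 + K * 0 + \<bar>c\<bar> * 0 + K' * 0"
    by (rule tendsto_add[OF tendsto_add[OF tendsto_add]]; rule tendsto_mult_left; fact)
  ultimately have Hl: "(\<lambda>n. \<integral>\<omega>. H n \<omega> \<partial>\<P> (Suc n)) \<longlonglongrightarrow> 0" by simp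
  have le: "\<bar>R.step_var n (?b n) t \<omega> - limit_var t f\<bar> \<le> H n \<omega>" for n \<omega>
  proof -
    have "R.step_var n (?b n) t \<omega> - limit_var t f =
        A n \<omega> * (G n \<omega> - M n \<omega>) + A n \<omega> * (M n \<omega> - c) + c * (A n \<omega> - a) - Z n \<omega> * Z n \<omega>"
      unfolding V limit_var_def a_def[symmetric] c_def[symmetric] by (simp add: algebra_simps power2_eq_square)
    moreover have "\<bar>A n \<omega> * x\<bar> \<le> K * \<bar>x\<bar>" for x
      unfolding abs_mult by (rule mult_right_mono[OF Ab abs_ge_zero])
    moreover have "\<bar>Z n \<omega> * Z n \<omega>\<bar> \<le> K' * \<bar>Z n \<omega>\<bar>"
      unfolding abs_mult by (rule mult_right_mono[OF Zb abs_ge_zero])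
    moreover have "\<bar>c * (A n \<omega> - a)\<bar> \<le> \<bar>c\<bar> * \<bar>A n \<omega> - a\<bar>" by (simp only: abs_mult)
    moreover have "\<bar>p + q + r - s\<bar> \<le> p' + q' + r' + s'"
      if "\<bar>p\<bar> \<le> p'" "\<bar>q\<bar> \<le> q'" "\<bar>r\<bar> \<le> r'" "\<bar>s\<bar> \<le> s'" for p q r s p' q' r' s' :: real
      using that by linarith
    ultimately show ?thesis unfolding H_def by (simp only:)
  qed
  have H0: "0 \<le> H n \<omega>" for n \<omega> using order_trans[OF abs_ge_zero le] .
  show ?thesis
  proof (rule tendsto_sandwich[OF always_eventually[OF allI] always_eventually[OF allI] tendsto_const Hl])
    show "0 \<le> (\<integral>\<omega>. \<bar>R.step_var n (?b n) t \<omega> - limit_var t f\<bar> \<partial>\<P> (Suc n))" for n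
      by (rule integral_nonneg_AE[OF AE_I2[OF abs_ge_zero]])
    show "(\<integral>\<omega>. \<bar>R.step_var n (?b n) t \<omega> - limit_var t f\<bar> \<partial>\<P> (Suc n)) \<le> (\<integral>\<omega>. H n \<omega> \<partial>\<P> (Suc n))" for n
      by (rule integral_mono'[OF Hi le H0])
  qed
qed

text \<open>The exponential of the past is the factor \<open>W\<close> of \<open>step_clt\<close>,
  which replaces the exponential of the increment by a Gaussian factor with random variance. As that
  variance converges in mean and the exponential is Lipschitz on the relevant half-line, a constant
  factor can be pulled out of the expectation.\<close>

lemma clt_step:
  assumes f: "f \<in> borel_measurable all_paths" "\<And>y. \<bar>f y\<bar> \<le> B" and t: "Suc t \<le> T" and f0: "unnorm (Suc t) f = 0"
    and conv: "(\<lambda>n. \<integral>\<omega>. iexp (u * (sqrt (Suc n) * gam n t (bwd n t (forward_step t f) \<omega>) \<omega>)) \<partial>\<P> (Suc n)) \<longlonglongrightarrow> \<psi>"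
  shows "(\<lambda>n. \<integral>\<omega>. iexp (u * (sqrt (Suc n) * gam n (Suc t) (bwd n (Suc t) f \<omega>) \<omega>)) \<partial>\<P> (Suc n))
    \<longlonglongrightarrow> \<psi> * exp (- (u\<^sup>2 * limit_var t f / 2))"
proof -
  have t': "t \<le> T" using t by simp
  let ?b = "\<lambda>n. bwd n (Suc t) f" and ?v = "limit_var t f"
  have b: "(\<lambda>(\<omega>, x). ?b n \<omega> x) \<in> borel_measurable (hist n t \<Otimes>\<^sub>M borel)" "\<bar>?b n \<omega> x\<bar> \<le> B" for n \<omega> x
    by (rule R.bwd_measurable[OF f(1) order_refl t' t], rule R.bwd_bound[OF f])
  define W where "W n \<omega> = iexp (u * (sqrt (Suc n) * gam n t (bwd n t (forward_step t f) \<omega>) \<omega>))" for n \<omega>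
  define V where "V n \<omega> = R.step_var n (?b n) t \<omega>" for n \<omega>
  have Wm: "W n \<in> borel_measurable (hist n t)" for n
  proof -
    have [measurable]: "(\<lambda>\<omega>. gam n t (bwd n t (forward_step t f) \<omega>) \<omega>) \<in> borel_measurable (hist n t)"
      by (rule gam_bwd_measurable[OF forward_step_measurable[OF f(1)] t'])
    show ?thesis unfolding W_def[abs_def] by measurable
  qed
  have W1: "cmod (W n \<omega>) = 1" for n \<omega> unfolding W_def by simp
  have WP[measurable]: "W n \<in> borel_measurable (\<P> (Suc n))" for n by (rule R.hist_measurable[OF t' Wm])
  have VP[measurable]: "V n \<in> borel_measurable (\<P> (Suc n))" for n
    unfolding V_def[abs_def] by (rule R.hist_measurable[OF t' R.step_var_measurable[OF b t]])
  have V0: "0 \<le> V n \<omega>" if "\<omega> \<in> space (\<P> (Suc n))" for n \<omega>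
    unfolding V_def by (rule R.step_var_bounds[OF b t that])
  have v0: "0 \<le> ?v" by (rule limit_var_nonneg[OF t])
  define E where "E n \<omega> = complex_of_real (exp (- (u\<^sup>2 * V n \<omega> / 2)))" for n \<omega>
  define e where "e = complex_of_real (exp (- (u\<^sup>2 * ?v / 2)))"
  have EP[measurable]: "E n \<in> borel_measurable (\<P> (Suc n))" for n unfolding E_def[abs_def] by measurable
  have E1: "cmod (E n \<omega>) \<le> 1" if "\<omega> \<in> space (\<P> (Suc n))" for n \<omega>
    unfolding E_def using V0[OF that] by simp
  \<comment> \<open>The statistic at time \<open>t\<close> built from
    \<open>forward_step t f\<close> is the conditional mean of the one at \<open>Suc t\<close>, so
    the exponent splits into past and increment with no remainder.\<close>
  have eq: "(\<integral>\<omega>. iexp (u * (sqrt (Suc n) * gam n (Suc t) (?b n \<omega>) \<omega>)) \<partial>\<P> (Suc n)) =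
      (\<integral>\<omega>. W n \<omega> * iexp (u * (sqrt (Suc n) * (gam n (Suc t) (?b n \<omega>) \<omega> - gam n t (predict t (?b n \<omega>)) \<omega>))) \<partial>\<P> (Suc n))" for n
    unfolding W_def R.gam_predict_bwd[OF f t]
    by (intro Bochner_Integration.integral_cong refl) (simp add: algebra_simps flip: exp_add)
  have 1: "(\<lambda>n. (\<integral>\<omega>. iexp (u * (sqrt (Suc n) * gam n (Suc t) (?b n \<omega>) \<omega>)) \<partial>\<P> (Suc n)) - (\<integral>\<omega>. W n \<omega> * E n \<omega> \<partial>\<P> (Suc n))) \<longlonglongrightarrow> 0"
  proof (rule Lim_null_comparison[OF always_eventually[OF allI] clt_err_tendsto[of u "(Cw * Ca) ^ Suc t * (Cw * B)"]])
    fix n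
    show "norm ((\<integral>\<omega>. iexp (u * (sqrt (Suc n) * gam n (Suc t) (?b n \<omega>) \<omega>)) \<partial>\<P> (Suc n)) - (\<integral>\<omega>. W n \<omega> * E n \<omega> \<partial>\<P> (Suc n)))
        \<le> clt_err u ((Cw * Ca) ^ Suc t * (Cw * B)) (Suc n)"
      unfolding eq E_def V_def
      using R.step_clt[OF b t Wm eq_refl[OF W1], where u=u] unfolding R.step_const_def[OF b t] .
  qed
  have 2: "(\<lambda>n. (\<integral>\<omega>. W n \<omega> * E n \<omega> \<partial>\<P> (Suc n)) - e * (\<integral>\<omega>. W n \<omega> \<partial>\<P> (Suc n))) \<longlonglongrightarrow> 0"
  proof (rule Lim_null_comparison[OF always_eventually[OF allI]])
    show "(\<lambda>n. u\<^sup>2 / 2 * (\<integral>\<omega>. \<bar>V n \<omega> - ?v\<bar> \<partial>\<P> (Suc n))) \<longlonglongrightarrow> 0"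
      unfolding V_def using tendsto_mult_left[OF step_var_tendsto[OF f t f0], of "u\<^sup>2 / 2"] by simp
    fix n
    have Wi: "integrable (\<P> (Suc n)) (W n)" using W1 by (intro R.integrable_const_bound[where B=1]) auto
    have WEi: "integrable (\<P> (Suc n)) (\<lambda>\<omega>. W n \<omega> * E n \<omega>)"
      using W1 E1 by (intro R.integrable_const_bound[where B=1] AE_I2) (auto simp: norm_mult)
    have Vi: "integrable (\<P> (Suc n)) (\<lambda>\<omega>. u\<^sup>2 / 2 * \<bar>V n \<omega> - ?v\<bar>)"
    proof -
      have "\<bar>V n \<omega>\<bar> \<le> K" if "K = (Cw * Ca) ^ Suc t * ((Cw * Ca) ^ t * (Cw * (Cw * (Cg * B\<^sup>2))))" "\<omega> \<in> space (\<P> (Suc n))" for K \<omega>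
      proof -
        have g: "\<bar>gam n t (weight_op t (\<lambda>x. (?b n \<omega> x)\<^sup>2)) \<omega>\<bar> \<le> (Cw * Ca) ^ t * (Cw * (Cw * (Cg * B\<^sup>2)))"
          by (intro R.gam_bound[OF t'] weight_op_bound[OF t] borel_measurable_power R.bwd_measurable_snd[OF f(1)])
             (use power_mono[OF b(2) abs_ge_zero, of n \<omega> _ 2] in simp)
        have "V n \<omega> \<le> acc n (Suc t) \<omega> * gam n t (weight_op t (\<lambda>x. (?b n \<omega> x)\<^sup>2)) \<omega>"
          unfolding V_def R.step_var_def[OF b t] by simp
        also have "\<dots> \<le> (Cw * Ca) ^ Suc t * ((Cw * Ca) ^ t * (Cw * (Cw * (Cg * B\<^sup>2))))"
          using R.acc_bounds[OF t, of n \<omega>] order_trans[OF abs_ge_self g] order_trans[OF abs_ge_zero g]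
          by (intro order_trans[OF mult_left_mono mult_right_mono]) auto
        finally show ?thesis using V0[OF that(2)] that(1) by simp
      qed
      then have "integrable (\<P> (Suc n)) (V n)"
        by (intro R.integrable_const_bound[OF AE_I2 VP]) auto
      then show ?thesis by simp
    qed
    have "(\<integral>\<omega>. W n \<omega> * E n \<omega> \<partial>\<P> (Suc n)) - e * (\<integral>\<omega>. W n \<omega> \<partial>\<P> (Suc n)) = (\<integral>\<omega>. W n \<omega> * E n \<omega> - e * W n \<omega> \<partial>\<P> (Suc n))"
      using Wi WEi by simp
    also have "norm \<dots> \<le> (\<integral>\<omega>. u\<^sup>2 / 2 * \<bar>V n \<omega> - ?v\<bar> \<partial>\<P> (Suc n))"
    proof (rule order_trans[OF integral_norm_bound integral_mono'[OF Vi]])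
      fix \<omega> assume w: "\<omega> \<in> space (\<P> (Suc n))"
      have "W n \<omega> * E n \<omega> - e * W n \<omega> = W n \<omega> * complex_of_real (exp (- (u\<^sup>2 * V n \<omega> / 2)) - exp (- (u\<^sup>2 * ?v / 2)))"
        unfolding E_def e_def by (simp add: algebra_simps)
      then have "norm (W n \<omega> * E n \<omega> - e * W n \<omega>) = \<bar>exp (- (u\<^sup>2 * V n \<omega> / 2)) - exp (- (u\<^sup>2 * ?v / 2))\<bar>"
        by (simp only: norm_mult W1 norm_of_real mult_1_left)
      also have "\<dots> \<le> \<bar>u\<^sup>2 * V n \<omega> / 2 - u\<^sup>2 * ?v / 2\<bar>"
        by (rule exp_minus_diff_le) (use V0[OF w] v0 in auto)
      also have "\<dots> = u\<^sup>2 / 2 * \<bar>V n \<omega> - ?v\<bar>"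
        by (simp add: abs_mult flip: right_diff_distrib diff_divide_distrib)
      finally show "norm (W n \<omega> * E n \<omega> - e * W n \<omega>) \<le> u\<^sup>2 / 2 * \<bar>V n \<omega> - ?v\<bar>" .
    qed simp
    finally show "norm ((\<integral>\<omega>. W n \<omega> * E n \<omega> \<partial>\<P> (Suc n)) - e * (\<integral>\<omega>. W n \<omega> \<partial>\<P> (Suc n))) \<le> u\<^sup>2 / 2 * (\<integral>\<omega>. \<bar>V n \<omega> - ?v\<bar> \<partial>\<P> (Suc n))"
      by simp
  qed
  have 3: "(\<lambda>n. e * (\<integral>\<omega>. W n \<omega> \<partial>\<P> (Suc n))) \<longlonglongrightarrow> e * \<psi>"
    using conv unfolding W_def[symmetric] by (rule tendsto_mult_left)
  have "(\<lambda>n. \<integral>\<omega>. iexp (u * (sqrt (Suc n) * gam n (Suc t) (?b n \<omega>) \<omega>)) \<partial>\<P> (Suc n)) \<longlonglongrightarrow> 0 + (0 + e * \<psi>)"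
    using tendsto_add[OF 1 tendsto_add[OF 2 3]] by simp
  then show ?thesis unfolding e_def by (simp add: mult.commute)
qed

text \<open>Moving from \<open>t\<close> to \<open>Suc t\<close> undoes one forward step of the test
  function. Every intermediate function remains centred because forward steps preserve
  \<open>unnorm\<close>, and the variances of the successive increments add up.\<close>

lemma unnormalised_clt:
  assumes f: "f \<in> borel_measurable all_paths" "\<And>y. \<bar>f y\<bar> \<le> B" and f0: "unnorm T f = 0" and "t \<le> T"
  shows "(\<lambda>n. \<integral>\<omega>. iexp (u * (sqrt (Suc n) * gam n t (bwd n t (forward t (T - t) f) \<omega>) \<omega>)) \<partial>\<P> (Suc n))
    \<longlonglongrightarrow> exp (- (u\<^sup>2 * asym_var f t / 2))"
  using \<open>t \<le> T\<close>
proof (induction t)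
  case 0
  let ?F = "forward 0 T f"
  have F: "?F \<in> borel_measurable all_paths" "\<And>y. \<bar>?F y\<bar> \<le> Cg ^ T * B"
    by (rule forward_measurable[OF f(1)], rule forward_bound[OF f]) simp
  let ?b = "\<lambda>x. ?F (\<lambda>i\<in>{0}. x)"
  have b: "?b \<in> borel_measurable borel" by (rule measurable_compose[OF measurable_singleton_path F(1)])
  have z: "unnorm 0 (\<lambda>y. ?b (y 0)) = 0"
    unfolding unnorm_0_singleton[OF F] using unnorm_forward[OF f, of 0 T] f0 by simp
  have "(\<lambda>n. (\<integral>\<omega>. iexp (u * (sqrt (Suc n) * gam n 0 ?b \<omega>)) \<partial>\<P> (Suc n)) - complex_of_real (exp (- (u\<^sup>2 * asym_var f 0 / 2)))) \<longlonglongrightarrow> 0"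
  proof (rule Lim_null_comparison[OF always_eventually[OF allI] clt_err_tendsto[of u "Cw * (Cg ^ T * B)"]])
    fix n
    show "norm ((\<integral>\<omega>. iexp (u * (sqrt (Suc n) * gam n 0 ?b \<omega>)) \<partial>\<P> (Suc n)) - complex_of_real (exp (- (u\<^sup>2 * asym_var f 0 / 2))))
        \<le> clt_err u (Cw * (Cg ^ T * B)) (Suc n)"
      using R.init_clt[OF b F(2), of n u] unfolding z asym_var_def by (simp add: bwd_limit_0)
  qed
  then show ?case by (simp only: bwd_0[abs_def] diff_zero) (rule LIM_zero_cancel)
next
  case (Suc t)
  let ?F = "forward (Suc t) (T - Suc t) f"
  have F: "?F \<in> borel_measurable all_paths" "\<And>y. \<bar>?F y\<bar> \<le> Cg ^ (T - Suc t) * B"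
    using Suc.prems by (auto intro: forward_measurable[OF f(1)] forward_bound[OF f])
  have z: "unnorm (Suc t) ?F = 0" using unnorm_forward[OF f, of "Suc t" "T - Suc t"] Suc.prems f0 by simp
  have "T - t = Suc (T - Suc t)" using Suc.prems by simp
  then have s: "forward t (T - t) f = forward_step t ?F" by (simp only: forward_Suc)
  have "(\<lambda>n. \<integral>\<omega>. iexp (u * (sqrt (Suc n) * gam n t (bwd n t (forward_step t ?F) \<omega>) \<omega>)) \<partial>\<P> (Suc n))
      \<longlonglongrightarrow> exp (- (u\<^sup>2 * asym_var f t / 2))"
    using Suc.IH Suc.prems unfolding s by simp
  from clt_step[OF F Suc.prems z this]
  have "(\<lambda>n. \<integral>\<omega>. iexp (u * (sqrt (Suc n) * gam n (Suc t) (bwd n (Suc t) ?F \<omega>) \<omega>)) \<partial>\<P> (Suc n))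
      \<longlonglongrightarrow> complex_of_real (exp (- (u\<^sup>2 * asym_var f t / 2))) * complex_of_real (exp (- (u\<^sup>2 * limit_var t ?F / 2)))" .
  moreover have "complex_of_real (exp (- (u\<^sup>2 * asym_var f t / 2))) * complex_of_real (exp (- (u\<^sup>2 * limit_var t ?F / 2))) =
      complex_of_real (exp (- (u\<^sup>2 * asym_var f (Suc t) / 2)))"
    unfolding of_real_mult[symmetric] exp_add[symmetric] asym_var_def by (simp add: algebra_simps add_divide_distrib)
  ultimately show ?case by (simp only:)
qed

section \<open>From the unnormalised to the self-normalised estimator\<close>

lemma ffbs_measurable:
  assumes f: "f \<in> borel_measurable all_paths"
  shows "ffbs S T (Suc n) (\<xi> (Suc n)) (I (Suc n)) f \<in> borel_measurable (\<P> (Suc n))"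
proof (rule R.hist_measurable[OF order_refl])
  have b: "(\<lambda>(\<omega>, x). bwd n T f \<omega> x) \<in> borel_measurable (hist n T \<Otimes>\<^sub>M borel)"
    by (rule R.bwd_measurable[OF f]) auto
  have "(\<lambda>\<omega>. bwd n T f \<omega> (\<xi> (Suc n) T i \<omega>)) \<in> borel_measurable (hist n T)" if i: "i \<in> {1..Suc n}" for i
    using measurable_compose[OF measurable_Pair[OF measurable_ident_sets[OF refl] R.xi_hist[OF order_refl order_refl i]] b]
    by simp
  then show "ffbs S T (Suc n) (\<xi> (Suc n)) (I (Suc n)) f \<in> borel_measurable (hist n T)"
    unfolding R.ffbs_eq[abs_def] R.emp_integral[OF order_refl R.bwd_measurable_snd[OF f]]
    by (intro borel_measurable_divide borel_measurable_sum borel_measurable_times R.w_hist) auto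
qed

text \<open>The quotient argument is applied with \<open>R = gam n T (\<lambda>_. 1)\<close> and
  with \<open>X\<close> the scaled unnormalised estimator of the centred function. Pulling the
  constant \<open>c\<close> out of the backward kernels relies on \<open>bwd_one\<close>, so the
  relation between numerator and quotient holds almost surely rather than everywhere.\<close>

lemma ffbs_char_tendsto:
  fixes c :: real
  assumes f: "f \<in> borel_measurable all_paths" "\<And>y. \<bar>f y\<bar> \<le> B" and c: "c = unnorm T f / unnorm T (\<lambda>_. 1)"
  shows "(\<lambda>n. \<integral>\<omega>. iexp (u * (sqrt (Suc n) * (ffbs S T (Suc n) (\<xi> (Suc n)) (I (Suc n)) f \<omega> - c))) \<partial>\<P> (Suc n))
    \<longlonglongrightarrow> exp (- ((u / unnorm T (\<lambda>_. 1))\<^sup>2 * asym_var (\<lambda>y. f y - c * 1) T / 2))"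
proof -
  let ?f = "\<lambda>y. f y - c * 1"
  have one: "(\<lambda>_. 1) \<in> borel_measurable (all_paths :: (nat \<Rightarrow> 'x) measure)" "\<And>y :: nat \<Rightarrow> 'x. \<bar>1 :: real\<bar> \<le> 1" by auto
  have F: "?f \<in> borel_measurable all_paths" "\<And>y. \<bar>?f y\<bar> \<le> B + \<bar>c\<bar>"
  proof -
    show "?f \<in> borel_measurable all_paths" using f(1) by simp
    show "\<bar>?f y\<bar> \<le> B + \<bar>c\<bar>" for y using f(2)[of y] by linarith
  qed
  have f0: "unnorm T ?f = 0"
    using unnorm_diff[OF f one order_refl, of c] unnorm_1_pos[OF order_refl] by (simp add: c)
  obtain C where C: "\<And>n. (\<integral>\<omega>. \<bar>gam n T (bwd n T ?f \<omega>) \<omega> - unnorm T ?f\<bar> \<partial>\<P> (Suc n)) \<le> C / sqrt (Suc n)"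
    using lln_bwd[OF F order_refl] by blast
  show ?thesis
  proof (rule char_tendsto_divide)
    show "prob_space (\<P> (Suc n))" for n by (rule R.prob_space_axioms)
    show "(\<lambda>\<omega>. sqrt (Suc n) * gam n T (bwd n T ?f \<omega>) \<omega>) \<in> borel_measurable (\<P> (Suc n))" for n
      by (intro borel_measurable_times borel_measurable_const gam_bwd_measurable_P F(1)) simp
    show "integrable (\<P> (Suc n)) (\<lambda>\<omega>. sqrt (Suc n) * gam n T (bwd n T ?f \<omega>) \<omega>)" for n
      by (intro integrable_mult_right gam_bwd_integrable[OF F]) simp
    show "(\<lambda>\<omega>. sqrt (Suc n) * (ffbs S T (Suc n) (\<xi> (Suc n)) (I (Suc n)) f \<omega> - c)) \<in> borel_measurable (\<P> (Suc n))" for n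
      by (intro borel_measurable_times borel_measurable_diff borel_measurable_const ffbs_measurable[OF f(1)])
    show "integrable (\<P> (Suc n)) (gam n T (\<lambda>_. 1))" for n by (rule gam_integrable[where B=1]) auto
    show "AE \<omega> in \<P> (Suc n). gam n T (\<lambda>_. 1) \<omega> * (sqrt (Suc n) * (ffbs S T (Suc n) (\<xi> (Suc n)) (I (Suc n)) f \<omega> - c)) =
        sqrt (Suc n) * gam n T (bwd n T ?f \<omega>) \<omega>" for n
      using R.bwd_one[OF order_refl, of n]
    proof eventually_elim
      fix \<omega> assume one': "gam n T (bwd n T (\<lambda>_. 1) \<omega>) \<omega> = gam n T (\<lambda>_. 1) \<omega>"
      have d: "bwd n T ?f \<omega> = (\<lambda>x. bwd n T f \<omega> x - c * bwd n T (\<lambda>_. 1) \<omega> x)"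
        unfolding R.bwd_def by (rule ext, rule backward_kernels.backward_path_diff[OF R.emp_backward_kernels f one order_refl])
      have "gam n T (bwd n T ?f \<omega>) \<omega> = gam n T (bwd n T f \<omega>) \<omega> - c * gam n T (\<lambda>_. 1) \<omega>"
        unfolding d R.gam_diff one' ..
      moreover have "gam n T (bwd n T f \<omega>) \<omega> = gam n T (\<lambda>_. 1) \<omega> * ffbs S T (Suc n) (\<xi> (Suc n)) (I (Suc n)) f \<omega>"
        unfolding R.ffbs_eq by (rule R.gam_emp[OF order_refl R.bwd_measurable_snd[OF f(1)]])
      ultimately have G: "gam n T (bwd n T ?f \<omega>) \<omega> =
          gam n T (\<lambda>_. 1) \<omega> * (ffbs S T (Suc n) (\<xi> (Suc n)) (I (Suc n)) f \<omega> - c)"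
        by (simp only: right_diff_distrib mult.commute[of c])
      show "gam n T (\<lambda>_. 1) \<omega> * (sqrt (Suc n) * (ffbs S T (Suc n) (\<xi> (Suc n)) (I (Suc n)) f \<omega> - c)) =
          sqrt (Suc n) * gam n T (bwd n T ?f \<omega>) \<omega>"
        unfolding G by (rule mult.left_commute)
    qed
    \<comment> \<open>The rate in the law of large numbers is exactly what bounds the first absolute
      moment after scaling by \<open>sqrt (Suc n)\<close>.\<close>
    show "(\<integral>\<omega>. \<bar>sqrt (Suc n) * gam n T (bwd n T ?f \<omega>) \<omega>\<bar> \<partial>\<P> (Suc n)) \<le> C" for n
      using C[of n] unfolding f0 abs_mult by (simp add: field_simps)
    show "(\<lambda>n. \<integral>\<omega>. \<bar>gam n T (\<lambda>_. 1) \<omega> - unnorm T (\<lambda>_. 1)\<bar> \<partial>\<P> (Suc n)) \<longlonglongrightarrow> 0"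
      by (rule lln_gam_tendsto[where B=1]) auto
    show "unnorm T (\<lambda>_. 1) > 0" by (rule unnorm_1_pos) simp
    show "(\<lambda>n. \<integral>\<omega>. iexp (v * (sqrt (Suc n) * gam n T (bwd n T ?f \<omega>) \<omega>)) \<partial>\<P> (Suc n))
        \<longlonglongrightarrow> exp (- (v\<^sup>2 * asym_var ?f T / 2))" for v
      using unnormalised_clt[OF F f0 order_refl, of v] by (simp only: diff_self_eq_0 forward.simps)
  qed
qed

theorem ffbs_clt:
  assumes h: "h \<in> borel_measurable (path_space T)" "\<And>x. x \<in> space (path_space T) \<Longrightarrow> \<bar>h x\<bar> \<le> C"
  shows "weak_conv_m
    (\<lambda>N. distr (\<P> N) borel
      (\<lambda>\<omega>. sqrt (real N) * (ffbs S T N (\<xi> N) (I N) h \<omega> - (\<integral>x. h x \<partial>smoothing S T))))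
    (normal_law 0 (asymp_variance S T h))"
proof -
  \<comment> \<open>The function \<open>h\<close> is controlled only on extensional paths; composing
    it with the restriction gives a bounded measurable function on all paths that agrees with it
    there.\<close>
  define f where "f y = h (restrict y {..T})" for y :: "nat \<Rightarrow> 'x"
  define c where "c = (\<integral>x. h x \<partial>smoothing S T)"
  have f: "f \<in> borel_measurable all_paths" "\<And>y. \<bar>f y\<bar> \<le> C"
  proof -
    have "(\<lambda>y. restrict y {..T}) \<in> all_paths \<rightarrow>\<^sub>M (path_space T :: (nat \<Rightarrow> 'x) measure)"
      by (rule measurable_restrict_subset) simp
    from measurable_compose[OF this h(1)] show "f \<in> borel_measurable all_paths" by (simp add: f_def[abs_def])
    show "\<bar>f y\<bar> \<le> C" for y unfolding f_def by (rule h(2)) (auto simp: space_PiM)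
  qed
  have fh: "f y = h y" if "y \<in> extensional {..T}" for y
    using that by (simp add: f_def extensional_restrict)
  have ext: "y \<in> extensional {..T}" if "y \<in> space (path_space T)" for y :: "nat \<Rightarrow> 'x"
    using that by (auto simp: space_PiM PiE_def)
  have "c = (\<integral>y. f y \<partial>smoothing S T)"
  proof -
    have "sets (smoothing S T) = sets (chain_law S T)" by (simp add: smoothing_def)
    also have "\<dots> = sets (path_space T)"
      using chain_law_prob[OF smc_model_axioms, of T] by (simp add: space_prob_algebra)
    finally have "space (smoothing S T) = space (path_space T)" by (rule sets_eq_imp_space_eq)
    then show ?thesis unfolding c_def using fh ext by (intro Bochner_Integration.integral_cong refl) auto
  qed
  then have c: "c = unnorm T f / unnorm T (\<lambda>_. 1)" by (simp add: smoothing_integral[OF f(1) order_refl])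
  have fb: "\<bar>f y - c * 1\<bar> \<le> C + \<bar>c\<bar>" for y using f(2)[of y] by linarith
  have fm: "(\<lambda>y. f y - c * 1) \<in> borel_measurable all_paths" using f(1) by simp
  have var: "asymp_variance S T h = asym_var (\<lambda>y. f y - c * 1) T / (unnorm T (\<lambda>_. 1))\<^sup>2"
    by (rule asymp_variance_eq[OF fm fb]) (use fh ext in \<open>simp add: c_def\<close>)
  have v0: "asymp_variance S T h \<ge> 0" unfolding var using asym_var_nonneg[OF order_refl] by simp
  let ?Y = "\<lambda>N \<omega>. sqrt (real N) * (ffbs S T N (\<xi> N) (I N) h \<omega> - c)"
  have Yf: "?Y (Suc n) = (\<lambda>\<omega>. sqrt (Suc n) * (ffbs S T (Suc n) (\<xi> (Suc n)) (I (Suc n)) f \<omega> - c))" for n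
    by (simp add: ffbs_extensional_cong[of f h, OF fh])
  have Ym: "(\<lambda>\<omega>. sqrt (Suc n) * (ffbs S T (Suc n) (\<xi> (Suc n)) (I (Suc n)) f \<omega> - c)) \<in> borel_measurable (\<P> (Suc n))" for n
    by (intro borel_measurable_times borel_measurable_diff borel_measurable_const ffbs_measurable[OF f(1)])
  have "weak_conv_m (\<lambda>n. distr (\<P> (Suc n)) borel (?Y (Suc n))) (normal_law 0 (asymp_variance S T h))"
  proof (rule levy_continuity)
    show "real_distribution (distr (\<P> (Suc n)) borel (?Y (Suc n)))" for n
      unfolding Yf using Ym by (rule R.real_distribution_distr)
    show "real_distribution (normal_law 0 (asymp_variance S T h))" by (rule normal_law_prob[OF v0])
    fix u
    have "char (distr (\<P> (Suc n)) borel (?Y (Suc n))) u =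
        (\<integral>\<omega>. iexp (u * (sqrt (Suc n) * (ffbs S T (Suc n) (\<xi> (Suc n)) (I (Suc n)) f \<omega> - c))) \<partial>\<P> (Suc n))" for n
      unfolding char_def Yf by (rule integral_distr[OF Ym]) measurable
    moreover have "complex_of_real (exp (- ((u / unnorm T (\<lambda>_. 1))\<^sup>2 * asym_var (\<lambda>y. f y - c * 1) T / 2))) =
        char (normal_law 0 (asymp_variance S T h)) u"
      using char_normal_law[OF v0, of u] by (simp add: var power_divide)
    ultimately show "(\<lambda>n. char (distr (\<P> (Suc n)) borel (?Y (Suc n))) u) \<longlonglongrightarrow> char (normal_law 0 (asymp_variance S T h)) u"
      using ffbs_char_tendsto[OF f c, of u] by (simp only:)
  qed
  \<comment> \<open>Levy continuity was applied to the systems with \<open>Suc n\<close> particles;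
    a limit along \<open>Suc n\<close> is a limit along \<open>N\<close>.\<close>
  then show ?thesis
    unfolding weak_conv_m_def weak_conv_def c_def by (auto intro: LIMSEQ_imp_Suc)
qed

end

theorem theorem8:
  fixes S :: "('x::polish_space, 'y::polish_space) smc_model"
    and T :: nat
    and \<P> :: "nat \<Rightarrow> 'w measure"
    and \<xi> :: "nat \<Rightarrow> nat \<Rightarrow> nat \<Rightarrow> 'w \<Rightarrow> 'x"
    and I :: "nat \<Rightarrow> nat \<Rightarrow> nat \<Rightarrow> 'w \<Rightarrow> nat"
    and h :: "(nat \<Rightarrow> 'x) \<Rightarrow> real"
  assumes model: "smc_model S T"
    and norm_pos: "smoothing_norm S T > 0"
    and particles: "\<And>N. N \<ge> 1 \<Longrightarrow> particle_filter S T N (\<P> N) (\<xi> N) (I N)"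
    and A1: "\<And>t x. t \<le> T \<Longrightarrow> lik S t x > 0"
      "\<exists>C. \<forall>t\<le>T. \<forall>x. lik S t x \<le> C"
    and A2: "\<exists>C. \<forall>t\<in>{1..T}. \<forall>x. adj_mult S t x \<le> C"
      "\<exists>C. (\<forall>x. init_weight S x \<le> C) \<and> (\<forall>t\<in>{1..T}. \<forall>x x'. weight S t x x' \<le> C)"
    and A3: "\<exists>C. \<forall>x x'. trans_density S x x' \<le> C"
      "\<exists>C. \<forall>t\<in>{1..T}. \<forall>x x'. prop_density S t x x' \<le> C"
    and h: "h \<in> borel_measurable (path_space T)"
      "\<exists>C. \<forall>x\<in>space (path_space T). \<bar>h x\<bar> \<le> C"
  shows "weak_conv_m
    (\<lambda>N. distr (\<P> N) borel
      (\<lambda>\<omega>. sqrt (real N) * (ffbs S T N (\<xi> N) (I N) h \<omega> - (\<integral>x. h x \<partial>smoothing S T))))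
    (normal_law 0 (asymp_variance S T h))"
proof -
  obtain Cg where Cg: "\<forall>t\<le>T. \<forall>x. lik S t x \<le> Cg" using A1(2) by blast
  obtain Ca where Ca: "\<forall>t\<in>{1..T}. \<forall>x. adj_mult S t x \<le> Ca" using A2(1) by blast
  obtain Cw where Cw: "\<forall>x. init_weight S x \<le> Cw" "\<forall>t\<in>{1..T}. \<forall>x x'. weight S t x x' \<le> Cw"
    using A2(2) by blast
  obtain Cm where Cm: "\<forall>x x'. trans_density S x x' \<le> Cm" using A3(1) by blast
  obtain C where C: "\<forall>x\<in>space (path_space T). \<bar>h x\<bar> \<le> C" using h(2) by blast
  have "bounded_smc S T Cg Cm Ca Cw"
    by (intro bounded_smc.intro bounded_smc_axioms.intro model norm_pos) (use Cg Ca Cw Cm in auto)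
  then interpret smc_sequence S T Cg Cm Ca Cw \<P> \<xi> I
    by (intro smc_sequence.intro smc_sequence_axioms.intro particles)
  show ?thesis by (rule ffbs_clt[OF h(1)]) (use C in blast)
qed

end
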